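(* Let $X(t)$, $t\ge 0$, be a Lévy process in $\mathbb{R}^d$ starting at the origin and not almost surely identically zero, let $T_1=\inf\{t\ge 0:X(t)\notin B^d\}$ be its first exit time from the centred closed unit ball $B^d$, and let $Z_t$ be the closed convex hull of $\{X(s):0\le s\le t\}$. Assume that $X(T_1)$ lies in the domain of attraction of a strictly $\alpha$-stable random vector $\eta$ in $\mathbb{R}^d$, in the sense that the sum of $n$ i.i.d. copies of $X(T_1)$ scaled by $(n^{1/\alpha}\ell(n))^{-1}$, with a slowly varying function $\ell$, converges in distribution to $\eta$ as $n\to\infty$. Then, as $t\to\infty$, $(t^{1/\alpha}\ell(t))^{-1}Z_t$ converges in distribution to the closed convex hull of $\{Y(s):0\le s\le(\mathbf{E}T_1)^{-1}\}$, where $Y$ is a Lévy process in $\mathbb{R}^d$ such that $Y(1)$ coincides in distribution with $\eta$.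
   Context: Convergence in distribution of random convex bodies is weak convergence in the space $\mathcal{K}_d$ of non-empty compact convex subsets of $\mathbb{R}^d$ with the Hausdorff metric $\rho_H(K,L)=\inf\{r\ge 0:K\subset L+rB^d,\ L\subset K+rB^d\}$. The time $T_1$ is almost surely finite with $\mathbf{E}T_1<\infty$. Lévy processes start at the origin and have right-continuous paths with left limits. *)

theory Defs
  imports "HOL-Probability.Probability"
begin

section \<open>Convex bodies with the Hausdorff metric\<close>

typedef (overloaded) ('a::euclidean_space) convex_body =
  "{K :: 'a set. K \<noteq> {} \<and> compact K \<and> convex K}"
  morphisms body_set Abs_convex_body
  by (rule exI[of _ "{0}"]) auto

lemma body_set_props:
  "body_set K \<noteq> {}" "compact (body_set K)" "convex (body_set K)"
  using body_set[of K] by auto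

definition hausdorff_bounds :: "'a::euclidean_space set \<Rightarrow> 'a set \<Rightarrow> real set" where
  "hausdorff_bounds K L =
     {r. 0 \<le> r \<and> K \<subseteq> L + (*\<^sub>R) r ` cball 0 1 \<and> L \<subseteq> K + (*\<^sub>R) r ` cball 0 1}"

lemma subset_plus_ball_iff:
  fixes K L :: "'a::euclidean_space set"
  assumes "0 \<le> r"
  shows "K \<subseteq> L + (*\<^sub>R) r ` cball 0 1 \<longleftrightarrow> (\<forall>x\<in>K. \<exists>y\<in>L. dist x y \<le> r)"
proof -
  have "(*\<^sub>R) r ` cball (0::'a) 1 = cball 0 r"
  proof (cases "r = 0")
    case True
    have "(0::'a) \<in> cball 0 1" by simp
    then have "(\<lambda>_. 0::'a) ` cball (0::'a) 1 = {0}" by blast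
    with True show ?thesis by simp
  next
    case False
    then show ?thesis using assms cball_scale[of r "0::'a" 1] by simp
  qed
  moreover have "x \<in> L + cball 0 r \<longleftrightarrow> (\<exists>y\<in>L. dist x y \<le> r)" for x
  proof
    assume "x \<in> L + cball 0 r"
    then show "\<exists>y\<in>L. dist x y \<le> r"
      by (auto simp: set_plus_def dist_norm intro!: bexI)
  next
    assume "\<exists>y\<in>L. dist x y \<le> r"
    then obtain y where y: "y \<in> L" "dist x y \<le> r" by blast
    then have "x = y + (x - y)" "x - y \<in> cball 0 r"
      by (auto simp: dist_norm norm_minus_commute)
    with y(1) show "x \<in> L + cball 0 r" by (metis set_plus_intro)
  qed
  ultimately show ?thesis by auto
qed

lemma hausdorff_bounds_iff:
  "r \<in> hausdorff_bounds K L \<longleftrightarrow>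
     0 \<le> r \<and> (\<forall>x\<in>K. \<exists>y\<in>L. dist x y \<le> r) \<and> (\<forall>x\<in>L. \<exists>y\<in>K. dist x y \<le> r)"
  unfolding hausdorff_bounds_def mem_Collect_eq
  by (simp add: subset_plus_ball_iff cong: conj_cong)

lemma hausdorff_bounds_bdd_below: "bdd_below (hausdorff_bounds K L)"
  by (rule bdd_belowI[of _ 0]) (simp add: hausdorff_bounds_iff)

lemma hausdorff_bounds_commute: "hausdorff_bounds K L = hausdorff_bounds L K"
  by (auto simp: hausdorff_bounds_iff)

lemma hausdorff_bounds_nonempty:
  "hausdorff_bounds (body_set K) (body_set L) \<noteq> {}"
proof -
  have "bounded (body_set K \<union> body_set L)"
    by (simp add: body_set_props compact_imp_bounded)
  then obtain e where "\<And>x y. x \<in> body_set K \<union> body_set L \<Longrightarrow> y \<in> body_set K \<union> body_set L \<Longrightarrow> dist x y \<le> e"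
    by (metis bounded_two_points)
  then have "max e 0 \<in> hausdorff_bounds (body_set K) (body_set L)"
    unfolding hausdorff_bounds_iff using body_set_props(1)[of K] body_set_props(1)[of L]
    by (fastforce intro: max.coboundedI1)
  then show ?thesis by blast
qed

lemma hausdorff_bounds_approx:
  assumes "Inf (hausdorff_bounds (body_set K) (body_set L)) < e"
  obtains r where "r \<in> hausdorff_bounds (body_set K) (body_set L)" "r < e"
  using assms cInf_lessD[OF hausdorff_bounds_nonempty] by blast

lemma hausdorff_Inf_0_imp_subset:
  assumes "Inf (hausdorff_bounds (body_set K) (body_set L)) = 0"
  shows "body_set K \<subseteq> body_set L"
proof
  fix x assume x: "x \<in> body_set K"
  have "\<exists>y\<in>body_set L. dist y x < e" if "e > 0" for e
  proof -
    obtain r where "r \<in> hausdorff_bounds (body_set K) (body_set L)" "r < e"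
      using assms \<open>e > 0\<close> hausdorff_bounds_approx[of K L e] by auto
    moreover then obtain y where "y \<in> body_set L" "dist x y \<le> r"
      using x unfolding hausdorff_bounds_iff by blast
    ultimately show ?thesis by (intro bexI[of _ y]) (auto simp: dist_commute)
  qed
  then have "x \<in> closure (body_set L)" by (simp add: closure_approachable)
  then show "x \<in> body_set L"
    using body_set_props(2)[of L] by (simp add: compact_imp_closed closure_closed)
qed

instantiation convex_body :: (euclidean_space) metric_space
begin

definition dist_convex_body :: "'a convex_body \<Rightarrow> 'a convex_body \<Rightarrow> real" where
  "dist_convex_body K L = Inf (hausdorff_bounds (body_set K) (body_set L))"

definition uniformity_convex_body :: "('a convex_body \<times> 'a convex_body) filter" where
  "uniformity_convex_body = (INF e\<in>{0<..}. principal {(x, y). dist x y < e})"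

definition open_convex_body :: "'a convex_body set \<Rightarrow> bool" where
  "open_convex_body U \<longleftrightarrow> (\<forall>x\<in>U. \<forall>\<^sub>F (x', y) in uniformity. x' = x \<longrightarrow> y \<in> U)"

instance
proof
  fix K L M :: "'a convex_body"
  show "dist K L = 0 \<longleftrightarrow> K = L"
  proof
    assume 0: "dist K L = 0"
    then have "body_set K \<subseteq> body_set L"
      by (simp add: dist_convex_body_def hausdorff_Inf_0_imp_subset)
    moreover have "body_set L \<subseteq> body_set K"
      using 0 hausdorff_bounds_commute
      by (metis dist_convex_body_def hausdorff_Inf_0_imp_subset)
    ultimately show "K = L" by (simp add: body_set_inject)
  next
    assume "K = L"
    then have "0 \<in> hausdorff_bounds (body_set K) (body_set L)"
      by (auto simp: hausdorff_bounds_iff)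
    then show "dist K L = 0"
      unfolding dist_convex_body_def
      by (intro cInf_eq_minimum) (auto simp: hausdorff_bounds_iff)
  qed
  show "dist K L \<le> dist K M + dist L M"
  proof (rule field_le_epsilon)
    fix e :: real assume "0 < e"
    obtain r where r: "r \<in> hausdorff_bounds (body_set K) (body_set M)" "r < dist K M + e / 2"
      using \<open>0 < e\<close> hausdorff_bounds_approx[of K M "dist K M + e / 2"]
      by (auto simp: dist_convex_body_def)
    obtain s where s: "s \<in> hausdorff_bounds (body_set L) (body_set M)" "s < dist L M + e / 2"
      using \<open>0 < e\<close> hausdorff_bounds_approx[of L M "dist L M + e / 2"]
      by (auto simp: dist_convex_body_def)
    have half: "\<exists>z\<in>C. dist x z \<le> a + b"
      if h: "a \<in> hausdorff_bounds A B" "b \<in> hausdorff_bounds C B" "x \<in> A"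
      for a b x and A B C :: "'a set"
    proof -
      obtain y where y: "y \<in> B" "dist x y \<le> a"
        using h unfolding hausdorff_bounds_iff by blast
      then obtain z where "z \<in> C" "dist y z \<le> b"
        using h unfolding hausdorff_bounds_iff by blast
      with y dist_triangle[of x z y] show ?thesis by (intro bexI[of _ z]) auto
    qed
    have "r + s \<in> hausdorff_bounds (body_set K) (body_set L)"
      using half[OF r(1) s(1)] half[OF s(1) r(1)] r(1) s(1)
      by (auto simp: hausdorff_bounds_iff add.commute)
    then have "dist K L \<le> r + s"
      unfolding dist_convex_body_def by (rule cInf_lower[OF _ hausdorff_bounds_bdd_below])
    with r(2) s(2) show "dist K L \<le> dist K M + dist L M + e" by simp
  qed
qed (simp_all add: uniformity_convex_body_def open_convex_body_def)

end

(* Meaningful for bounded non-empty A only; the range of a cadlag path on a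
   compact interval is such a set. *)
definition closed_hull :: "'a::euclidean_space set \<Rightarrow> 'a convex_body" where
  "closed_hull A = Abs_convex_body (closure (convex hull A))"

lemma body_set_closed_hull:
  assumes "bounded A" "A \<noteq> {}"
  shows "body_set (closed_hull A) = closure (convex hull A)"
  unfolding closed_hull_def using assms
  by (intro Abs_convex_body_inverse) (auto simp: bounded_convex_hull compact_closure convex_closure)

definition scale_body :: "real \<Rightarrow> 'a::euclidean_space convex_body \<Rightarrow> 'a convex_body" where
  "scale_body c K = Abs_convex_body ((*\<^sub>R) c ` body_set K)"

lemma body_set_scale_body: "body_set (scale_body c K) = (*\<^sub>R) c ` body_set K"
  unfolding scale_body_def using body_set_props[of K]
  by (intro Abs_convex_body_inverse) (auto simp: compact_scaling convex_scaling)

section \<open>Convergence in distribution\<close>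

(* The random elements need not live on one probability space. Measurability is
   part of the notion, since the integrals would be junk without it. *)
definition converges_in_distribution ::
  "('i \<Rightarrow> 'w measure) \<Rightarrow> ('i \<Rightarrow> 'w \<Rightarrow> 'b::metric_space) \<Rightarrow> 'v measure \<Rightarrow> ('v \<Rightarrow> 'b) \<Rightarrow> 'i filter \<Rightarrow> bool"
where
  "converges_in_distribution M \<xi> N \<zeta> F \<longleftrightarrow>
     (\<forall>\<^sub>F i in F. prob_space (M i) \<and> \<xi> i \<in> borel_measurable (M i)) \<and>
     prob_space N \<and> \<zeta> \<in> borel_measurable N \<and>
     (\<forall>f :: 'b \<Rightarrow> real. continuous_on UNIV f \<and> bounded (range f) \<longrightarrow>
        ((\<lambda>i. \<integral>\<omega>. f (\<xi> i \<omega>) \<partial>M i) \<longlongrightarrow> (\<integral>\<omega>. f (\<zeta> \<omega>) \<partial>N)) F)"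

section \<open>Slow variation and strict stability\<close>

definition slowly_varying :: "(real \<Rightarrow> real) \<Rightarrow> bool" where
  "slowly_varying l \<longleftrightarrow>
     (\<exists>a. l \<in> borel_measurable (restrict_space borel {a..}) \<and> (\<forall>x\<ge>a. 0 < l x)) \<and>
     (\<forall>c>0. ((\<lambda>x. l (c * x) / l x) \<longlongrightarrow> 1) at_top)"

definition strictly_stable :: "real \<Rightarrow> 'v measure \<Rightarrow> ('v \<Rightarrow> 'a::euclidean_space) \<Rightarrow> bool" where
  "strictly_stable \<alpha> N \<eta> \<longleftrightarrow>
     0 < \<alpha> \<and> \<alpha> \<le> 2 \<and> prob_space N \<and> \<eta> \<in> borel_measurable N \<and>
     (\<forall>a>0. \<forall>b>0.
        distr (N \<Otimes>\<^sub>M N) borel (\<lambda>(u, v). a powr (1 / \<alpha>) *\<^sub>R \<eta> u + b powr (1 / \<alpha>) *\<^sub>R \<eta> v) =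
        distr N borel (\<lambda>u. (a + b) powr (1 / \<alpha>) *\<^sub>R \<eta> u))"

section \<open>Levy processes\<close>

definition cadlag :: "(real \<Rightarrow> 'a::topological_space) \<Rightarrow> bool" where
  "cadlag x \<longleftrightarrow>
     (\<forall>t\<ge>0. (x \<longlongrightarrow> x t) (at_right t)) \<and> (\<forall>t>0. \<exists>y. (x \<longlongrightarrow> y) (at_left t))"

locale levy_process = prob_space M
  for M :: "'w measure" +
  fixes X :: "real \<Rightarrow> 'w \<Rightarrow> 'a::euclidean_space"
  assumes measurable_X: "0 \<le> t \<Longrightarrow> X t \<in> borel_measurable M"
    and start_origin: "\<omega> \<in> space M \<Longrightarrow> X 0 \<omega> = 0"
    and cadlag_paths: "\<omega> \<in> space M \<Longrightarrow> cadlag (\<lambda>t. X t \<omega>)"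
    and stationary_increments: "0 \<le> s \<Longrightarrow> 0 \<le> t \<Longrightarrow>
      distr M borel (\<lambda>\<omega>. X (s + t) \<omega> - X s \<omega>) = distr M borel (X t)"
    and independent_increments: "0 \<le> \<tau> 0 \<Longrightarrow> incseq \<tau> \<Longrightarrow>
      indep_vars (\<lambda>_. borel) (\<lambda>i \<omega>. X (\<tau> (Suc i)) \<omega> - X (\<tau> i) \<omega>) {..<n::nat}"

(* Infinite on paths that never leave the ball. *)
definition exit_time :: "(real \<Rightarrow> 'w \<Rightarrow> 'a::euclidean_space) \<Rightarrow> 'w \<Rightarrow> ennreal" where
  "exit_time X \<omega> = (INF t\<in>{t. 0 \<le> t \<and> X t \<omega> \<notin> cball 0 1}. ennreal t)"

(* Equals X 0 where the exit time is infinite, as enn2real sends infinity to 0. *)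
definition exit_position :: "(real \<Rightarrow> 'w \<Rightarrow> 'a::euclidean_space) \<Rightarrow> 'w \<Rightarrow> 'a" where
  "exit_position X \<omega> = X (enn2real (exit_time X \<omega>)) \<omega>"

definition mean_exit_time :: "'w measure \<Rightarrow> (real \<Rightarrow> 'w \<Rightarrow> 'a::euclidean_space) \<Rightarrow> real" where
  "mean_exit_time M X = enn2real (\<integral>\<^sup>+\<omega>. exit_time X \<omega> \<partial>M)"

definition path_hull :: "(real \<Rightarrow> 'w \<Rightarrow> 'a::euclidean_space) \<Rightarrow> real \<Rightarrow> 'w \<Rightarrow> 'a convex_body" where
  "path_hull X t \<omega> = closed_hull {X s \<omega> | s. 0 \<le> s \<and> s \<le> t}"

end

theory Submission
  imports Defs
begin

text \<open>Let \<open>T\<^sub>k\<close> be the successive times at which \<open>X\<close> leaves the unit ball around its position at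
  \<open>T\<^bsub>k-1\<^esub>\<close>. By the strong Markov property \<open>X(T\<^sub>k)\<close> is a random walk with steps distributed as
  \<open>X(T\<^sub>1)\<close>, the path \<open>X\<close> stays within distance \<open>1\<close> of this walk, and \<open>T\<^sub>k / k\<close> tends to \<open>E T\<^sub>1\<close>
  in probability.

  The hull of \<open>m\<close> equally spaced positions of the walk, taken up to slightly fewer than \<open>t / E T\<^sub>1\<close>
  steps, is with high probability contained in the hull of the path up to \<open>t\<close>; as \<open>t\<close> and then \<open>m\<close>
  tend to infinity its scaled law tends to that of the limit hull, by independence of the blocks.
  No functional limit theorem is needed for the matching upper bound: by Ottaviani's inequality, with
  slightly more than \<open>t / E T\<^sub>1\<close> steps, the expectation of \<open>1 - exp(- h(u))\<close> for the path hull is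
  asymptotically at most that for the limit hull, where \<open>h\<close> is the support function. Two ordered
  random variables for which these expectations agree in the limit are close in probability, and
  finitely many directions \<open>u\<close> control the Hausdorff distance.

  Strict stability alone determines the law of \<open>Y(r)\<close> from that of \<open>Y(1)\<close>.\<close>

section \<open>Slow variation\<close>

text \<open>The two bounds on the path hull differ in kind. The lower one is a pathwise inclusion.
  For the upper one the walk may exceed its values at block ends, and Ottaviani's inequality
  compares only tails of maxima, up to a factor \<open>1 - \<gamma>\<close> and one direction at a
  time. The expectation of \<open>1 - exp (- h)\<close> is an integral of tails against
  \<open>exp (- x)\<close>, so such a comparison passes to it; and the function is strictly
  increasing on nonnegative values, so a gap between ordered variables that have a moderate smaller
  value costs a fixed amount of expectation. Blocks have length of order \<open>t / m\<close>, and
  the loss inside a block must be negligible against the norming function at \<open>t\<close>,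
  uniformly over all shorter lengths. This needs power-like growth of the norming function, hence
  the uniform convergence theorem for slow variation. The limit in \<open>t\<close> is taken before
  the limit in \<open>m\<close>. Both are bundled into one filter, so that the estimates are
  ordinary eventuality arguments, and \<open>m\<close> disappears at the end because the path hull
  does not depend on it.\<close>

lemma ge_mult_ge_one: "(x0::real) \<le> b * x" if "x0 \<le> x" "1 \<le> b" "0 < x0"
  using that mult_right_mono[of 1 b x] by linarith

text \<open>The uniform convergence theorem for slowly varying functions, in additive form. Along a
  violating sequence, pointwise convergence and continuity of measure make the good shifts of
  \<open>s n\<close> and of \<open>s n + u n\<close> fill most of an interval. After translation of
  the latter by \<open>u n\<close> both sets lie in \<open>{0..2}\<close> and are too large in total
  to be disjoint; a common shift contradicts the violation by the triangle inequality.\<close>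

lemma uniform_convergence_additive:
  fixes h :: "real \<Rightarrow> real"
  assumes [measurable]: "h \<in> borel_measurable borel"
    and lim: "\<And>u. ((\<lambda>s. h (s + u) - h s) \<longlongrightarrow> 0) at_top"
    and "0 < e"
  shows "\<exists>s0. \<forall>s\<ge>s0. \<forall>u\<in>{0..1}. \<bar>h (s + u) - h s\<bar> < e"
proof (rule ccontr)
  assume "\<not> ?thesis"
  then have "\<forall>n. \<exists>s u. real n \<le> s \<and> u \<in> {0..1} \<and> \<bar>h (s + u) - h s\<bar> \<ge> e"
    by (meson not_less)
  then obtain s u where s: "\<And>n. real n \<le> s n" and u: "\<And>n. u n \<in> {0..1}"
    and big: "\<And>n. \<bar>h (s n + u n) - h (s n)\<bar> \<ge> e"
    by metis
  have s_top: "filterlim s at_top sequentially"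
    by (rule filterlim_at_top_mono[OF filterlim_real_sequentially]) (auto simp: s)
  have su_top: "filterlim (\<lambda>n. s n + u n) at_top sequentially"
    by (rule filterlim_at_top_mono[OF s_top]) (use u in auto)
  \<comment> \<open>Three quarters of the length \<open>b\<close>. With \<open>b = 2\<close> for
    \<open>V\<close> and \<open>b = 1\<close> for \<open>W\<close> the sum is \<open>9/4\<close>,
    more than the length of \<open>{0..2}\<close>.\<close>
  have *: "\<exists>N. \<forall>n\<ge>N. b / 2 * 3/2 < measure lebesgue
      {v\<in>{0..b}. \<forall>k\<ge>n. \<bar>h (r k + v) - h (r k)\<bar> < e / 2}"
      (is "\<exists>N. \<forall>n\<ge>N. _ < measure lebesgue (?V n)")
    and **: "\<And>n. {v\<in>{0..b}. \<forall>k\<ge>n. \<bar>h (r k + v) - h (r k)\<bar> < e / 2} \<in> lmeasurable"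
    if r: "filterlim r at_top sequentially" and "b > 0" for r :: "nat \<Rightarrow> real" and b
  proof -
    have meas: "?V n \<in> lmeasurable" for n
    proof (rule bounded_set_imp_lmeasurable)
      show "bounded (?V n)" by (rule bounded_subset[of "{0..b}"]) auto
      have "?V n \<in> sets borel" by measurable
      then show "?V n \<in> sets lebesgue" by auto
    qed
    then show "\<And>n. ?V n \<in> lmeasurable" .
    have un: "(\<Union>n. ?V n) = {0..b}"
    proof (intro equalityI subsetI)
      fix v assume v: "v \<in> {0..b}"
      have "((\<lambda>k. h (r k + v) - h (r k)) \<longlongrightarrow> 0) sequentially"
        using filterlim_compose[OF lim r] by simp
      from tendstoD[OF this, of "e / 2"] \<open>0 < e\<close>
      have "\<forall>\<^sub>F k in sequentially. \<bar>h (r k + v) - h (r k)\<bar> < e / 2"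
        by (simp add: dist_real_def)
      then show "v \<in> (\<Union>n. ?V n)" using v by (auto simp: eventually_sequentially)
    qed auto
    have "(\<Union>n. ?V n) \<in> lmeasurable" unfolding un by simp
    then have "(\<lambda>n. measure lebesgue (?V n)) \<longlonglongrightarrow> measure lebesgue (\<Union>n. ?V n)"
      using meas
      by (intro Lim_measure_incseq) (auto simp del: UN_simps simp: incseq_def dest: fmeasurableD fmeasurableD2)
    moreover have "measure lebesgue {0..b} = b" using \<open>b > 0\<close> by simp
    ultimately have "(\<lambda>n. measure lebesgue (?V n)) \<longlonglongrightarrow> b" using un by simp
    from order_tendstoD(1)[OF this, of "b / 2 * 3/2"] \<open>b > 0\<close>
    show "\<exists>N. \<forall>n\<ge>N. b / 2 * 3/2 < measure lebesgue (?V n)"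
      by (simp add: eventually_sequentially)
  qed
  define V where "V n = {v\<in>{0..2}. \<forall>k\<ge>n. \<bar>h (s k + v) - h (s k)\<bar> < e / 2}" for n
  define W where "W n = {v\<in>{0..1}. \<forall>k\<ge>n. \<bar>h (s k + u k + v) - h (s k + u k)\<bar> < e / 2}" for n
  obtain N1 where N1: "\<And>n. N1 \<le> n \<Longrightarrow> 3/2 < measure lebesgue (V n)"
    using *[OF s_top, of 2] unfolding V_def by auto
  obtain N2 where N2: "\<And>n. N2 \<le> n \<Longrightarrow> 3/4 < measure lebesgue (W n)"
    using *[OF su_top, of 1] unfolding W_def by auto
  define n where "n = max N1 N2"
  have n: "3/2 < measure lebesgue (V n)" "3/4 < measure lebesgue (W n)"
    using N1[of n] N2[of n] by (auto simp: n_def)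
  have mV: "V n \<in> lmeasurable" and mW: "W n \<in> lmeasurable"
    unfolding V_def W_def using **[OF s_top, of 2] **[OF su_top, of 1] by auto
  define W' where "W' = (+) (u n) ` W n"
  have mW': "W' \<in> lmeasurable" "measure lebesgue W' = measure lebesgue (W n)"
    unfolding W'_def using mW by (auto simp: measurable_translation measure_translation)
  have "V n \<inter> W' \<noteq> {}"
  proof
    assume "V n \<inter> W' = {}"
    then have "measure lebesgue (V n) + measure lebesgue W' = measure lebesgue (V n \<union> W')"
      using fmeasurableD[OF mV] fmeasurableD2[OF mV] fmeasurableD[OF mW'(1)] fmeasurableD2[OF mW'(1)]
      by (intro measure_Union[symmetric]) auto
    also have "\<dots> \<le> measure lebesgue {0..2::real}"
    proof (rule measure_mono_fmeasurable)
      show "V n \<union> W' \<subseteq> {0..2}" using u[of n] by (auto simp: V_def W'_def W_def)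
    qed (use fmeasurableD[OF mV] fmeasurableD[OF mW'(1)] in auto)
    finally show False using n mW' by simp
  qed
  then obtain w where w: "w \<in> W n" "u n + w \<in> V n" unfolding W'_def by auto
  then have "\<bar>h (s n + (u n + w)) - h (s n)\<bar> < e / 2" "\<bar>h (s n + u n + w) - h (s n + u n)\<bar> < e / 2"
    unfolding V_def W_def by auto
  then show False using big[of n] by (auto simp: add.assoc abs_if split: if_splits)
qed

lemma slowly_varying_uniform:
  assumes "slowly_varying l" "0 < e"
  shows "\<exists>x0>0. \<forall>x\<ge>x0. 0 < l x \<and> (\<forall>c\<in>{1..2}. \<bar>ln (l (c * x)) - ln (l x)\<bar> < e)"
proof -
  obtain a where meas: "l \<in> borel_measurable (restrict_space borel {a..})" and pos: "\<And>x. x \<ge> a \<Longrightarrow> 0 < l x"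
    and lim: "\<And>c. c > 0 \<Longrightarrow> ((\<lambda>x. l (c * x) / l x) \<longlongrightarrow> 1) at_top"
    using assms(1) unfolding slowly_varying_def by blast
  \<comment> \<open>Logarithmic coordinates turn multiplication by \<open>c\<close> into a shift by
    \<open>ln c\<close>. Below \<open>a\<close> neither measurability nor positivity of
    \<open>l\<close> is assumed, so \<open>l\<close> is replaced by \<open>1\<close> there.\<close>
  define h where "h s = ln (if exp s \<in> {a..} then l (exp s) else 1)" for s
  have "(\<lambda>x. if x \<in> {a..} then l x else 1) \<in> borel_measurable borel"
    using meas by (intro measurable_If_restrict_space_iff[THEN iffD2]) (auto simp: atLeast_def[symmetric])
  then have [measurable]: "h \<in> borel_measurable borel"
    unfolding h_def by measurable
  have "((\<lambda>s. h (s + u) - h s) \<longlongrightarrow> 0) at_top" for u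
  proof -
    have "((\<lambda>s. ln (l (exp u * exp s) / l (exp s))) \<longlongrightarrow> ln 1) at_top"
      by (intro tendsto_ln filterlim_compose[OF lim exp_at_top]) auto
    moreover have "\<forall>\<^sub>F s in at_top. ln (l (exp u * exp s) / l (exp s)) = h (s + u) - h s"
    proof -
      have "\<forall>\<^sub>F s in at_top. exp s \<ge> a" "\<forall>\<^sub>F s in at_top. exp s \<ge> a / exp u"
        using exp_at_top by (auto simp: filterlim_at_top)
      then show ?thesis
      proof eventually_elim
        case (elim s)
        then have "exp (s + u) \<ge> a" by (simp add: exp_add field_simps)
        with elim pos[of "exp s"] pos[of "exp (s + u)"] show ?case
          by (simp add: h_def ln_div exp_add mult.commute)
      qed
    qed
    ultimately show ?thesis by (auto dest: tendsto_cong)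
  qed
  from uniform_convergence_additive[OF \<open>h \<in> borel_measurable borel\<close> this \<open>0 < e\<close>]
  obtain s0 where s0: "\<And>s u. s \<ge> s0 \<Longrightarrow> u \<in> {0..1} \<Longrightarrow> \<bar>h (s + u) - h s\<bar> < e"
    by metis
  show ?thesis
  proof (intro exI[of _ "max (exp s0) \<bar>a\<bar>"] conjI allI impI ballI)
    fix x assume x: "max (exp s0) \<bar>a\<bar> \<le> x"
    then show "0 < l x" by (intro pos) auto
    fix c :: real assume c: "c \<in> {1..2}"
    have x0: "x > 0" using x exp_gt_zero[of s0] by linarith
    have "ln x \<ge> s0" using x x0 by (simp add: ln_ge_iff)
    moreover have "ln c \<in> {0..1}"
      using c ln_le_minus_one[of c] by auto
    ultimately have "\<bar>h (ln x + ln c) - h (ln x)\<bar> < e" by (rule s0)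
    moreover have "a \<le> c * x" using ge_mult_ge_one[of "\<bar>a\<bar>" x c] c x x0
      order_trans[of a x "c * x"] ge_mult_ge_one[of x x c]
      by (auto simp: abs_le_iff)
    moreover have "h (ln x + ln c) = ln (l (c * x))" "h (ln x) = ln (l x)"
      using \<open>a \<le> c * x\<close> x x0 c by (auto simp: h_def exp_add mult.commute)
    ultimately show "\<bar>ln (l (c * x)) - ln (l x)\<bar> < e" by simp
  qed (auto simp: less_max_iff_disj)
qed

lemma slowly_varying_eventually_pos:
  "slowly_varying l \<Longrightarrow> \<forall>\<^sub>F x in at_top. 0 < l x"
  using eventually_ge_at_top unfolding slowly_varying_def by (blast intro: eventually_mono)

text \<open>\<open>k t\<close> and \<open>\<rho> * t\<close> are eventually within a factor 2 of
  each other, so the uniform estimate compares \<open>l\<close> at these two points, with the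
  smaller one as base. Passing from \<open>\<rho> * t\<close> to \<open>t\<close> is the definition
  of slow variation.\<close>

lemma slowly_varying_ratio:
  assumes l: "slowly_varying l" and "0 < \<rho>"
    and k: "((\<lambda>t. k t / t) \<longlongrightarrow> \<rho>) at_top"
  shows "((\<lambda>t. l (k t) / l t) \<longlongrightarrow> 1) at_top"
proof -
  have top: "filterlim (\<lambda>t. \<rho> * t) at_top at_top"
    using \<open>0 < \<rho>\<close> by (simp add: filterlim_tendsto_pos_mult_at_top[OF tendsto_const] filterlim_ident)
  have kt: "\<forall>\<^sub>F t in at_top. \<rho> * t / 2 < k t \<and> \<rho> * t / sqrt 2 < k t \<and> k t < \<rho> * t * sqrt 2 \<and> 0 < t"
  proof -
    have "\<forall>\<^sub>F t in at_top. \<rho> / 2 < k t / t" "\<forall>\<^sub>F t in at_top. \<rho> / sqrt 2 < k t / t"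
         "\<forall>\<^sub>F t in at_top. k t / t < \<rho> * sqrt 2"
      using \<open>0 < \<rho>\<close> order_tendstoD[OF k, of "\<rho> / 2"] order_tendstoD[OF k, of "\<rho> / sqrt 2"]
        order_tendstoD[OF k, of "\<rho> * sqrt 2"] real_sqrt_gt_1_iff[of 2]
      by (simp_all add: divide_less_eq)
    then show ?thesis using eventually_gt_at_top[of 0]
      by eventually_elim (auto simp: field_simps)
  qed
  have "((\<lambda>t. ln (l (k t)) - ln (l (\<rho> * t))) \<longlongrightarrow> 0) at_top"
  proof (rule tendstoI)
    fix e :: real assume "0 < e"
    obtain x0 where x0: "\<And>x c. x \<ge> x0 \<Longrightarrow> c \<in> {1..2} \<Longrightarrow> \<bar>ln (l (c * x)) - ln (l x)\<bar> < e"
      using slowly_varying_uniform[OF l \<open>0 < e\<close>] by blast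
    have s2: "sqrt 2 \<le> (2::real)" by (simp add: real_le_rsqrt sqrt_le_D real_sqrt_le_iff real_le_lsqrt)
    \<comment> \<open>The factor 2 keeps \<open>k t > \<rho> * t / 2\<close> above \<open>x0\<close>
      when \<open>k t\<close> is the smaller of the two points.\<close>
    have "\<forall>\<^sub>F t in at_top. \<rho> * t \<ge> 2 * \<bar>x0\<bar>" using top by (simp add: filterlim_at_top)
    with kt show "\<forall>\<^sub>F t in at_top. dist (ln (l (k t)) - ln (l (\<rho> * t))) 0 < e"
    proof eventually_elim
      case (elim t)
      have p: "\<rho> * t > 0" using elim \<open>0 < \<rho>\<close> by simp
      show ?case
      proof (cases "k t \<ge> \<rho> * t")
        case True
        have "k t < \<rho> * t * 2" using elim p s2 mult_left_mono[OF s2, of "\<rho> * t"] by linarith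
        then have "k t / (\<rho> * t) \<in> {1..2}" using True p by (auto simp: field_simps)
        then have "\<bar>ln (l (k t / (\<rho> * t) * (\<rho> * t))) - ln (l (\<rho> * t))\<bar> < e"
          using elim by (intro x0) auto
        moreover have "k t / (\<rho> * t) * (\<rho> * t) = k t" using p by (metis less_irrefl nonzero_eq_divide_eq)
        ultimately have "\<bar>ln (l (k t)) - ln (l (\<rho> * t))\<bar> < e" by (simp only:)
        then show ?thesis by (simp add: dist_real_def)
      next
        case False
        have "k t > 0" using elim p by linarith
        then have "\<rho> * t / k t \<in> {1..2}" using False elim p by (auto simp: field_simps)
        then have "\<bar>ln (l (\<rho> * t / k t * k t)) - ln (l (k t))\<bar> < e"
          using elim by (intro x0) auto
        moreover have "\<rho> * t / k t * k t = \<rho> * t" using \<open>k t > 0\<close> by simp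
        ultimately have "\<bar>ln (l (\<rho> * t)) - ln (l (k t))\<bar> < e" by (simp only:)
        then show ?thesis by (simp add: dist_real_def abs_minus_commute)
      qed
    qed
  qed
  then have "((\<lambda>t. exp (ln (l (k t)) - ln (l (\<rho> * t)))) \<longlongrightarrow> exp 0) at_top" by (rule tendsto_exp)
  moreover have "((\<lambda>t. l (\<rho> * t) / l t) \<longlongrightarrow> 1) at_top"
    using l \<open>0 < \<rho>\<close> unfolding slowly_varying_def by blast
  ultimately have "((\<lambda>t. exp (ln (l (k t)) - ln (l (\<rho> * t))) * (l (\<rho> * t) / l t)) \<longlongrightarrow> exp 0 * 1) at_top"
    by (rule tendsto_mult)
  moreover have ktop: "filterlim k at_top at_top"
    by (rule filterlim_at_top_mono[of "\<lambda>t. \<rho> * t / 2"])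
       (use kt top \<open>0 < \<rho>\<close> in \<open>auto elim: eventually_mono
          intro!: filterlim_tendsto_pos_mult_at_top[OF tendsto_const, of "\<rho>/2" "\<lambda>t. t", simplified] filterlim_ident\<close>)
  have "\<forall>\<^sub>F t in at_top. exp (ln (l (k t)) - ln (l (\<rho> * t))) * (l (\<rho> * t) / l t) = l (k t) / l t"
    using eventually_compose_filterlim[OF slowly_varying_eventually_pos[OF l] ktop]
      eventually_compose_filterlim[OF slowly_varying_eventually_pos[OF l] top]
      slowly_varying_eventually_pos[OF l]
    by eventually_elim (simp add: exp_diff)
  ultimately show ?thesis by (simp only: tendsto_cong) simp
qed

text \<open>A Potter-type bound. Multiplying the argument by a factor in \<open>{1..2}\<close> costs
  \<open>l\<close> at most a factor \<open>exp e\<close>, while the power gains; repeated doubling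
  gives geometric growth, and one last partial step reaches \<open>t\<close>. The bound makes the
  norming function diverge and makes its values far below \<open>t\<close> small against its value
  at \<open>t\<close>.\<close>

lemma regularly_varying_growth:
  assumes l: "slowly_varying l" and "0 < p"
  defines "c \<equiv> \<lambda>t. t powr p * l t"
  obtains x0 q where "0 < x0" "1 < q"
    "\<And>x. x0 \<le> x \<Longrightarrow> 0 < c x"
    "\<And>x t j. x0 \<le> x \<Longrightarrow> 2 ^ j * x \<le> t \<Longrightarrow> c x * q ^ j \<le> 2 * c t"
proof -
  \<comment> \<open>The first term leaves half of the exponent in each doubling, whence
    \<open>q\<close>; the second limits the loss of the last partial step to a factor 2.\<close>
  define e where "e = min (p * ln 2 / 2) (ln 2)"
  have "0 < e" using \<open>0 < p\<close> by (simp add: e_def)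
  obtain x0 where x0: "x0 > 0" "\<And>x. x \<ge> x0 \<Longrightarrow> 0 < l x"
     "\<And>x c. x \<ge> x0 \<Longrightarrow> c \<in> {1..2} \<Longrightarrow> \<bar>ln (l (c * x)) - ln (l x)\<bar> < e"
    using slowly_varying_uniform[OF l \<open>0 < e\<close>] by blast
  have cpos: "0 < c x" if "x0 \<le> x" for x using that x0 by (simp add: c_def)
  have cexp: "c x = exp (p * ln x + ln (l x))" if "x0 \<le> x" for x
    using that x0(1) x0(2)[OF that] by (simp add: c_def powr_def exp_add)
  define q :: real where "q = exp (p * ln 2 / 2)"
  have "1 < q" using \<open>0 < p\<close> by (simp add: q_def)
  have step: "exp (p * ln b - e) * c x \<le> c (b * x)" if "x0 \<le> x" "b \<in> {1..2}" for x b
  proof -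
    have bx: "x0 \<le> b * x" using that x0(1) by (auto intro: ge_mult_ge_one)
    have "ln (l x) - e \<le> ln (l (b * x))" using x0(3)[OF that] by linarith
    have "exp (p * ln b - e) * c x = exp (p * ln b - e + (p * ln x + ln (l x)))"
      unfolding cexp[OF that(1)] by (simp only: exp_add)
    also have "\<dots> \<le> exp (p * ln (b * x) + ln (l (b * x)))"
      using \<open>ln (l x) - e \<le> ln (l (b * x))\<close> that x0(1) by (simp add: ln_mult algebra_simps)
    also have "\<dots> = c (b * x)" unfolding cexp[OF bx] ..
    finally show ?thesis .
  qed
  have dbl: "q * c x \<le> c (2 * x)" if "x0 \<le> x" for x
  proof -
    have "q \<le> exp (p * ln 2 - e)" unfolding q_def e_def by auto
    then have "q * c x \<le> exp (p * ln 2 - e) * c x" using cpos[OF that] by simp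
    with step[OF that, of 2] show ?thesis by simp
  qed
  have half: "c x \<le> 2 * c (b * x)" if "x0 \<le> x" "b \<in> {1..2}" for x b
  proof -
    have "0 \<le> p * ln b" using that \<open>0 < p\<close> by simp
    then have "exp (- ln 2) \<le> exp (p * ln b - e)" using min.cobounded2[of "p * ln 2 / 2" "ln 2"] unfolding e_def by simp
    then have "c x / 2 \<le> exp (p * ln b - e) * c x" using cpos[OF that(1)] by (simp add: exp_minus field_simps)
    with step[OF that] show ?thesis by simp
  qed
  have pw: "q ^ i * c x \<le> c (2 ^ i * x)" if "x0 \<le> x" for x i
  proof (induction i)
    case (Suc i)
    have "x0 \<le> 2 ^ i * x" using that x0(1) by (auto intro: ge_mult_ge_one)
    from dbl[OF this] Suc mult_left_mono[OF Suc, of q] \<open>1 < q\<close> show ?case by (simp only: power_Suc mult.assoc) linarith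
  qed simp
  show ?thesis
  proof (rule that[OF x0(1) \<open>1 < q\<close> cpos])
    fix x t :: real and j :: nat assume x: "x0 \<le> x" and t: "2 ^ j * x \<le> t"
    have xp: "0 < x" using x x0 by linarith
    obtain i0 where "t / x < 2 ^ i0" using real_arch_pow[of 2 "t / x"] by auto
    \<comment> \<open>\<open>t / x\<close> lies between \<open>2 ^ (i - 1)\<close> and
      \<open>2 ^ i\<close>: there are \<open>i - 1\<close> full doublings, followed by a factor in
      \<open>{1..2}\<close>.\<close>
    define i where "i = (LEAST i. t / x < 2 ^ i)"
    have i: "t / x < 2 ^ i" "\<And>k. k < i \<Longrightarrow> 2 ^ k \<le> t / x"
      unfolding i_def using LeastI[of "\<lambda>i. t / x < 2 ^ i", OF \<open>t / x < 2 ^ i0\<close>] not_less_Least[of _ "\<lambda>i. t / x < 2 ^ i"] by force+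
    have "2 ^ j \<le> t / x" using t xp by (simp add: field_simps)
    then have "(2::real) ^ j < 2 ^ i" using i by linarith
    then have ji: "j < i" by simp
    then obtain i' where i': "i = Suc i'" by (cases i) auto
    have x': "x0 \<le> 2 ^ i' * x" using x x0(1) by (auto intro: ge_mult_ge_one)
    have "2 ^ i' \<le> t / x" using i(2)[of i'] i' by simp
    then have "t / (2 ^ i' * x) \<in> {1..2}" using i(1) i' xp by (auto simp: field_simps)
    from half[OF x' this] have "c (2 ^ i' * x) \<le> 2 * c t" using xp by simp
    moreover have "q ^ j * c x \<le> q ^ i' * c x"
      using ji i' \<open>1 < q\<close> cpos[OF x] by (intro mult_right_mono power_increasing) auto
    ultimately show "c x * q ^ j \<le> 2 * c t" using pw[OF x, of i'] by (simp add: mult.commute)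
  qed auto
qed

section \<open>Lipschitz test functions\<close>

text \<open>These are the Pasch-Hausdorff envelopes of \<open>f\<close>. In the infimum a point at
  distance at least \<open>d\<close> from \<open>x\<close> pays \<open>k * d\<close>, which exceeds
  the oscillation \<open>2 * B\<close> once \<open>k\<close> is large; nearer points are handled by
  continuity at \<open>x\<close>.\<close>

lemma Inf_convolution:
  fixes f :: "'b::metric_space \<Rightarrow> real"
  assumes bd: "\<And>x. \<bar>f x\<bar> \<le> B"
  defines "F \<equiv> \<lambda>k x. INF y. f y + real k * dist x y"
  shows Inf_convolution_le: "F k x \<le> f x"
    and Inf_convolution_bound: "\<bar>F k x\<bar> \<le> B"
    and Inf_convolution_lipschitz: "\<bar>F k x - F k y\<bar> \<le> real k * dist x y"
    and Inf_convolution_tendsto: "isCont f x \<Longrightarrow> (\<lambda>k. F k x) \<longlonglongrightarrow> f x"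
proof -
  have lb: "- B \<le> f y + real k * dist x y" for k x y
    using bd[of y] mult_nonneg_nonneg[of "real k" "dist x y"] zero_le_dist[of x y] of_nat_0_le_iff[of k]
    unfolding abs_le_iff by linarith
  have bdd: "bdd_below (range (\<lambda>y. f y + real k * dist x y))" for k x
    by (rule bdd_belowI[of _ "- B"]) (use lb in auto)
  show le: "F k x \<le> f x" for k x
    unfolding F_def using cINF_lower[OF bdd UNIV_I, of k x x] by simp
  have lF: "- B \<le> F k x" for k x
    unfolding F_def by (rule cINF_greatest) (use lb in auto)
  show bound: "\<bar>F k x\<bar> \<le> B" for k x
    using le[of k x] bd[of x] lF[of k x] by (simp add: abs_le_iff)
  have "F k x \<le> F k y + real k * dist x y" for x y
  proof -
    have "F k x - real k * dist x y \<le> F k y"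
      unfolding F_def
    proof (rule cINF_greatest)
      fix z
      have "(INF y. f y + real k * dist x y) \<le> f z + real k * dist x z"
        by (rule cINF_lower[OF bdd]) auto
      also have "real k * dist x z \<le> real k * dist x y + real k * dist y z"
        using mult_left_mono[OF dist_triangle[of x z y], of "real k"] by (simp add: algebra_simps)
      finally show "(INF y. f y + real k * dist x y) - real k * dist x y \<le> f z + real k * dist y z"
        by simp
    qed auto
    then show ?thesis by simp
  qed
  from this[of x y] this[of y x] show "\<bar>F k x - F k y\<bar> \<le> real k * dist x y"
    by (simp add: dist_commute abs_le_iff)
  assume cont: "isCont f x"
  show "(\<lambda>k. F k x) \<longlonglongrightarrow> f x"
  proof (rule LIMSEQ_I)
    fix e :: real assume "0 < e"
    then obtain d where d: "0 < d" "\<And>y. dist y x < d \<Longrightarrow> \<bar>f y - f x\<bar> < e / 2"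
      using cont[unfolded continuous_at_eps_delta, rule_format, of "e / 2"] by (auto simp: dist_real_def)
    obtain N where N: "real N > 2 * B / d" using reals_Archimedean2 by blast
    show "\<exists>no. \<forall>n\<ge>no. norm (F n x - f x) < e"
    proof (intro exI allI impI)
      fix n assume n: "N \<le> n"
      have "f x - e / 2 \<le> F n x"
        unfolding F_def
      proof (rule cINF_greatest)
        fix y
        show "f x - e / 2 \<le> f y + real n * dist x y"
        proof (cases "dist y x < d")
          case True
          have "0 \<le> real n * dist x y" by simp
          then show ?thesis using d(2)[OF True] unfolding abs_less_iff by linarith
        next
          case False
          have "2 * B < real N * d" using N d(1) by (simp add: field_simps)
          also have "\<dots> \<le> real n * dist x y"
            using n False d(1) by (intro mult_mono) (auto simp: dist_commute)
          finally show ?thesis using bd[of x] bd[of y] \<open>0 < e\<close> unfolding abs_le_iff by linarith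
        qed
      qed auto
      then show "norm (F n x - f x) < e" using le[of n x] \<open>0 < e\<close> by simp
    qed
  qed
qed

text \<open>Lipschitz minorants give the lower bound on the limit for every bounded continuous
  \<open>f\<close>, and the same for \<open>- f\<close> gives the upper bound. The index
  \<open>k\<close> of the minorant is chosen from the limit law alone, by dominated
  convergence.\<close>

lemma converges_in_distributionI_lipschitz:
  fixes \<xi> :: "'i \<Rightarrow> 'w \<Rightarrow> 'b::metric_space"
  assumes ev: "\<forall>\<^sub>F i in F. prob_space (M i) \<and> \<xi> i \<in> borel_measurable (M i)"
    and N: "prob_space N" and \<zeta>[measurable]: "\<zeta> \<in> borel_measurable N"
    and lip: "\<And>(f :: 'b \<Rightarrow> real) B L. (\<And>x. \<bar>f x\<bar> \<le> B) \<Longrightarrow> (\<And>x y. \<bar>f x - f y\<bar> \<le> L * dist x y) \<Longrightarrow>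
      ((\<lambda>i. \<integral>\<omega>. f (\<xi> i \<omega>) \<partial>M i) \<longlongrightarrow> (\<integral>\<omega>. f (\<zeta> \<omega>) \<partial>N)) F"
  shows "converges_in_distribution M \<xi> N \<zeta> F"
proof -
  interpret N: prob_space N by fact
  have half: "\<forall>\<^sub>F i in F. (\<integral>\<omega>. f (\<zeta> \<omega>) \<partial>N) - e < (\<integral>\<omega>. f (\<xi> i \<omega>) \<partial>M i)"
    if cont: "continuous_on UNIV f" and bd: "\<And>x. \<bar>f x\<bar> \<le> B" and "0 < e" for f :: "'b \<Rightarrow> real" and B e
  proof -
    define g where "g k x = (INF y. f y + real k * dist x y)" for k x
    note g = Inf_convolution[where f = f, OF bd, folded g_def]
    have [measurable]: "f \<in> borel_measurable borel" using cont by (rule borel_measurable_continuous_onI)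
    have [measurable]: "g k \<in> borel_measurable borel" for k
    proof (rule borel_measurable_continuous_onI)
      have "(real k)-lipschitz_on UNIV (g k)"
        by (rule lipschitz_onI) (use g(3)[of k] in \<open>auto simp: dist_real_def\<close>)
      then show "continuous_on UNIV (g k)" by (rule lipschitz_on_continuous_on)
    qed
    have "(\<lambda>k. \<integral>\<omega>. g k (\<zeta> \<omega>) \<partial>N) \<longlonglongrightarrow> (\<integral>\<omega>. f (\<zeta> \<omega>) \<partial>N)"
    proof (rule integral_dominated_convergence[where w = "\<lambda>_. B"])
      show "AE x in N. (\<lambda>i. g i (\<zeta> x)) \<longlonglongrightarrow> f (\<zeta> x)"
        using g(4) cont by (simp add: continuous_on_eq_continuous_at)
    qed (use g(2) in auto)
    then obtain k where k: "(\<integral>\<omega>. f (\<zeta> \<omega>) \<partial>N) - e / 2 < (\<integral>\<omega>. g k (\<zeta> \<omega>) \<partial>N)"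
      using order_tendstoD(1)[of _ _ sequentially "(\<integral>\<omega>. f (\<zeta> \<omega>) \<partial>N) - e / 2"] \<open>0 < e\<close>
      by (metis (no_types, lifting) diff_less_eq eventually_sequentially half_gt_zero less_add_same_cancel1 order_refl)
    have "((\<lambda>i. \<integral>\<omega>. g k (\<xi> i \<omega>) \<partial>M i) \<longlongrightarrow> (\<integral>\<omega>. g k (\<zeta> \<omega>) \<partial>N)) F"
      by (rule lip[OF g(2) g(3)])
    then have "\<forall>\<^sub>F i in F. (\<integral>\<omega>. g k (\<zeta> \<omega>) \<partial>N) - e / 2 < (\<integral>\<omega>. g k (\<xi> i \<omega>) \<partial>M i)"
      by (rule order_tendstoD(1)) (use \<open>0 < e\<close> in simp)
    with ev show ?thesis
    proof eventually_elim
      case (elim i)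
      interpret Mi: prob_space "M i" using elim by simp
      have [measurable]: "\<xi> i \<in> borel_measurable (M i)" using elim by simp
      have "(\<integral>\<omega>. g k (\<xi> i \<omega>) \<partial>M i) \<le> (\<integral>\<omega>. f (\<xi> i \<omega>) \<partial>M i)"
        by (intro integral_mono Mi.integrable_const_bound[where B = B]) (use g(1,2) bd in auto)
      then show ?case using k elim by linarith
    qed
  qed
  show ?thesis
    unfolding converges_in_distribution_def
  proof (intro conjI allI impI ev N \<zeta>)
    fix f :: "'b \<Rightarrow> real" assume f: "continuous_on UNIV f \<and> bounded (range f)"
    then obtain B where B: "\<And>x. \<bar>f x\<bar> \<le> B" by (auto simp: bounded_iff)
    show "((\<lambda>i. \<integral>\<omega>. f (\<xi> i \<omega>) \<partial>M i) \<longlongrightarrow> (\<integral>\<omega>. f (\<zeta> \<omega>) \<partial>N)) F"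
    proof (rule tendstoI)
      fix e :: real assume "0 < e"
      have "\<forall>\<^sub>F i in F. (\<integral>\<omega>. f (\<zeta> \<omega>) \<partial>N) - e < (\<integral>\<omega>. f (\<xi> i \<omega>) \<partial>M i)"
        using f B \<open>0 < e\<close> by (intro half) auto
      moreover have "\<forall>\<^sub>F i in F. (\<integral>\<omega>. - f (\<zeta> \<omega>) \<partial>N) - e < (\<integral>\<omega>. - f (\<xi> i \<omega>) \<partial>M i)"
        using f B \<open>0 < e\<close> by (intro half[of "\<lambda>x. - f x" B]) (auto intro: continuous_intros)
      ultimately show "\<forall>\<^sub>F i in F. dist (\<integral>\<omega>. f (\<xi> i \<omega>) \<partial>M i) (\<integral>\<omega>. f (\<zeta> \<omega>) \<partial>N) < e"
        by eventually_elim (simp add: dist_real_def abs_less_iff)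
    qed
  qed
qed

section \<open>Hulls and support functions\<close>

lemma dist_body_le:
  assumes "0 \<le> r" "\<And>x. x \<in> body_set K \<Longrightarrow> \<exists>y\<in>body_set L. dist x y \<le> r"
    "\<And>x. x \<in> body_set L \<Longrightarrow> \<exists>y\<in>body_set K. dist x y \<le> r"
  shows "dist K L \<le> r"
  unfolding dist_convex_body_def
  by (rule cInf_lower[OF _ hausdorff_bounds_bdd_below]) (use assms in \<open>auto simp: hausdorff_bounds_iff\<close>)

lemma dist_body_attained:
  assumes "x \<in> body_set K"
  shows "\<exists>y\<in>body_set L. dist x y \<le> dist K L"
proof -
  obtain y where y: "y \<in> body_set L" "\<And>z. z \<in> body_set L \<Longrightarrow> dist x y \<le> dist x z"
    using continuous_attains_inf[OF body_set_props(2,1)[of L], of "dist x"] by (auto simp: continuous_on_dist)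
  have "dist x y \<le> dist K L"
  proof (rule field_le_epsilon)
    fix e :: real assume "0 < e"
    obtain r where r: "r \<in> hausdorff_bounds (body_set K) (body_set L)" "r < dist K L + e"
      using \<open>0 < e\<close> hausdorff_bounds_approx[of K L "dist K L + e"] by (auto simp: dist_convex_body_def)
    then obtain z where "z \<in> body_set L" "dist x z \<le> r"
      using assms by (auto simp: hausdorff_bounds_iff)
    then show "dist x y \<le> dist K L + e" using y(2)[of z] r(2) by linarith
  qed
  with y(1) show ?thesis by blast
qed

lemma closed_hull_superset:
  assumes "bounded A" "A \<noteq> {}"
  shows "A \<subseteq> body_set (closed_hull A)"
  using assms by (simp add: body_set_closed_hull) (meson closure_subset hull_subset order_trans)

lemma closed_hull_minimal:
  assumes "bounded A" "A \<noteq> {}" "A \<subseteq> C" "closed C" "convex C"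
  shows "body_set (closed_hull A) \<subseteq> C"
  using assms by (simp add: body_set_closed_hull closure_minimal hull_minimal)

lemma closed_hull_mono:
  assumes "A \<subseteq> B" "bounded B" "A \<noteq> {}"
  shows "body_set (closed_hull A) \<subseteq> body_set (closed_hull B)"
  using assms bounded_subset[of B A] closed_hull_superset[of B] body_set_props[of "closed_hull B"]
  by (intro closed_hull_minimal) (auto simp: compact_imp_closed)

text \<open>The closed \<open>r\<close>-neighbourhood of \<open>L\<close>, written as a Minkowski
  sum with a ball, is compact and convex, so it contains the hull of \<open>A\<close> as soon as it
  contains \<open>A\<close>.\<close>

lemma closed_hull_within:
  fixes A :: "'a::euclidean_space set"
  assumes "bounded A" "A \<noteq> {}" and r: "\<And>a. a \<in> A \<Longrightarrow> \<exists>b\<in>body_set L. dist a b \<le> r"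
    and x: "x \<in> body_set (closed_hull A)"
  shows "\<exists>b\<in>body_set L. dist x b \<le> r"
proof -
  let ?C = "{y + z |y z. y \<in> body_set L \<and> z \<in> cball 0 r}"
  have C: "x \<in> ?C \<longleftrightarrow> (\<exists>b\<in>body_set L. dist x b \<le> r)" for x
  proof
    assume "\<exists>b\<in>body_set L. dist x b \<le> r"
    then obtain b where "b \<in> body_set L" "dist x b \<le> r" by blast
    then show "x \<in> ?C" by (intro CollectI exI[of _ b] exI[of _ "x - b"]) (auto simp: dist_norm norm_minus_commute)
  next
    assume "x \<in> ?C"
    then obtain b z where "x = b + z" "b \<in> body_set L" "norm z \<le> r" by auto
    then show "\<exists>b\<in>body_set L. dist x b \<le> r" by (intro bexI[of _ b]) (auto simp: dist_norm)
  qed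
  have "compact ?C" using body_set_props(2)[of L] by (intro compact_sums) auto
  moreover have "convex ?C"
  proof -
    have "?C = (\<Union>y\<in>body_set L. \<Union>z\<in>cball 0 r. {y + z})" by blast
    then show ?thesis
      using convex_sums[OF body_set_props(3)[of L] convex_cball[of 0 r]] by (simp only:)
  qed
  moreover have "A \<subseteq> ?C" by (intro subsetI C[THEN iffD2] r)
  ultimately have "body_set (closed_hull A) \<subseteq> ?C"
    using assms(1,2) by (intro closed_hull_minimal) (auto simp: compact_imp_closed)
  from C[THEN iffD1, OF subsetD[OF this x]] show ?thesis .
qed

lemma dist_closed_hull_le:
  fixes A B :: "'a::euclidean_space set"
  assumes "bounded A" "A \<noteq> {}" "bounded B" "B \<noteq> {}" "0 \<le> r"
    and "\<And>a. a \<in> A \<Longrightarrow> \<exists>b\<in>body_set (closed_hull B). dist a b \<le> r"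
    and "\<And>b. b \<in> B \<Longrightarrow> \<exists>a\<in>body_set (closed_hull A). dist b a \<le> r"
  shows "dist (closed_hull A) (closed_hull B) \<le> r"
  using assms closed_hull_within[of A "closed_hull B" r] closed_hull_within[of B "closed_hull A" r]
  by (intro dist_body_le) auto

lemma scale_body_closed_hull:
  assumes "bounded A" "A \<noteq> {}"
  shows "scale_body c (closed_hull A) = closed_hull ((*\<^sub>R) c ` A)"
proof -
  have "body_set (scale_body c (closed_hull A)) = body_set (closed_hull ((*\<^sub>R) c ` A))"
    using assms bounded_scaling[OF assms(1), of c]
    by (simp add: body_set_scale_body body_set_closed_hull convex_hull_scaling closure_scaleR)
  then show ?thesis by (simp add: body_set_inject)
qed

section \<open>Support functions and the Hausdorff distance\<close>

definition support_fun :: "'a::euclidean_space \<Rightarrow> 'a convex_body \<Rightarrow> real" where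
  "support_fun u K = Sup ((\<bullet>) u ` body_set K)"

lemma support_fun_attained: "\<exists>x\<in>body_set K. support_fun u K = u \<bullet> x"
  and support_fun_upper: "x \<in> body_set K \<Longrightarrow> u \<bullet> x \<le> support_fun u K"
proof -
  obtain z where z: "z \<in> body_set K" "\<And>y. y \<in> body_set K \<Longrightarrow> u \<bullet> y \<le> u \<bullet> z"
    using continuous_attains_sup[OF body_set_props(2,1)[of K], of "(\<bullet>) u"] by (auto simp: continuous_on_inner)
  then have "support_fun u K = u \<bullet> z"
    unfolding support_fun_def by (intro cSup_eq_maximum) auto
  with z show "\<exists>x\<in>body_set K. support_fun u K = u \<bullet> x" "x \<in> body_set K \<Longrightarrow> u \<bullet> x \<le> support_fun u K"
    by auto
qed

lemma support_fun_le: "(\<And>x. x \<in> body_set K \<Longrightarrow> u \<bullet> x \<le> c) \<Longrightarrow> support_fun u K \<le> c"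
  using support_fun_attained[of K u] by auto

lemma support_fun_mono: "body_set K \<subseteq> body_set L \<Longrightarrow> support_fun u K \<le> support_fun u L"
  by (rule support_fun_le) (auto intro: support_fun_upper)

lemma support_fun_lipschitz: "\<bar>support_fun u K - support_fun u L\<bar> \<le> norm u * dist K L"
proof -
  have "support_fun u K \<le> support_fun u L + norm u * dist K L" for K L
  proof (rule support_fun_le)
    fix x assume "x \<in> body_set K"
    then obtain y where y: "y \<in> body_set L" "dist x y \<le> dist K L" using dist_body_attained by blast
    have "u \<bullet> x = u \<bullet> y + u \<bullet> (x - y)" by (simp add: inner_diff_right)
    also have "u \<bullet> (x - y) \<le> norm u * dist K L"
      using norm_cauchy_schwarz[of u "x - y"] mult_left_mono[OF y(2), of "norm u"]
      by (simp add: dist_norm)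
    finally show "u \<bullet> x \<le> support_fun u L + norm u * dist K L"
      using support_fun_upper[OF y(1), of u] by linarith
  qed
  from this[of K L] this[of L K] show ?thesis by (simp add: dist_commute abs_le_iff)
qed

lemma support_fun_closed_hull_le:
  assumes "bounded A" "A \<noteq> {}" "\<And>a. a \<in> A \<Longrightarrow> u \<bullet> a \<le> c"
  shows "support_fun u (closed_hull A) \<le> c"
proof (rule support_fun_le)
  have "body_set (closed_hull A) \<subseteq> {x. u \<bullet> x \<le> c}"
    using assms by (intro closed_hull_minimal) (auto simp: closed_halfspace_le convex_halfspace_le)
  then show "x \<in> body_set (closed_hull A) \<Longrightarrow> u \<bullet> x \<le> c" for x by auto
qed

text \<open>If \<open>a\<close> is the point of \<open>A\<close> nearest to \<open>h\<close>, the
  unit vector \<open>v\<close> from \<open>a\<close> to \<open>h\<close> is an outer normal of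
  \<open>A\<close> at \<open>a\<close>, so the distance is the height of \<open>h\<close> above
  \<open>A\<close> in direction \<open>v\<close>. Replacing \<open>v\<close> by a net direction
  \<open>u\<close> changes the inner products with \<open>h\<close> and with a maximiser of
  \<open>u\<close> over \<open>A\<close> by at most \<open>\<delta> * R\<close> each.\<close>

lemma dist_body_le_support:
  assumes sub: "body_set A \<subseteq> body_set H" and "0 \<le> \<theta>"
    and net: "\<And>v. norm v = 1 \<Longrightarrow> \<exists>u\<in>D. norm (v - u) \<le> \<delta>"
    and supp: "\<And>u. u \<in> D \<Longrightarrow> support_fun u H \<le> support_fun u A + \<theta>"
    and R: "\<And>x. x \<in> body_set H \<Longrightarrow> norm x \<le> R" and "0 \<le> \<delta>"
  shows "dist A H \<le> \<theta> + 2 * \<delta> * R"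
proof (rule dist_body_le)
  obtain h where "h \<in> body_set H" using body_set_props(1)[of H] by blast
  from R[OF this] have "0 \<le> R" using norm_ge_zero order_trans by blast
  then show r0: "0 \<le> \<theta> + 2 * \<delta> * R" using \<open>0 \<le> \<theta>\<close> \<open>0 \<le> \<delta>\<close> by simp
  show "\<exists>y\<in>body_set H. dist x y \<le> \<theta> + 2 * \<delta> * R" if "x \<in> body_set A" for x
    using that sub r0 by (intro bexI[of _ x]) auto
  fix h assume h: "h \<in> body_set H"
  define a where "a = closest_point (body_set A) h"
  have cl: "closed (body_set A)" using body_set_props(2) by (rule compact_imp_closed)
  have a: "a \<in> body_set A" unfolding a_def using cl body_set_props(1) by (rule closest_point_in_set)
  have dot: "(h - a) \<bullet> (x - a) \<le> 0" if "x \<in> body_set A" for x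
    unfolding a_def by (rule closest_point_dot[OF body_set_props(3) cl that])
  show "\<exists>y\<in>body_set A. dist h y \<le> \<theta> + 2 * \<delta> * R"
  proof (rule bexI[OF _ a], cases "h = a")
    case False
    define v where "v = (h - a) /\<^sub>R norm (h - a)"
    have "norm v = 1" using False by (simp add: v_def)
    then obtain u where u: "u \<in> D" "norm (v - u) \<le> \<delta>" using net by blast
    have close: "\<bar>v \<bullet> x - u \<bullet> x\<bar> \<le> \<delta> * R" if "x \<in> body_set H" for x
    proof -
      have "\<bar>(v - u) \<bullet> x\<bar> \<le> norm (v - u) * norm x" by (rule Cauchy_Schwarz_ineq2)
      also have "\<dots> \<le> \<delta> * R" using u(2) R[OF that] by (intro mult_mono) (auto intro: \<open>0 \<le> \<delta>\<close>)
      finally show ?thesis by (simp add: inner_diff_left)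
    qed
    \<comment> \<open>\<open>x\<close> is maximal on \<open>A\<close> in the net direction
      \<open>u\<close>, while \<open>a\<close> is maximal in direction \<open>v\<close>; the link
      between them is \<open>v \<bullet> x \<le> v \<bullet> a\<close>.\<close>
    obtain x where x: "x \<in> body_set A" "support_fun u A = u \<bullet> x" using support_fun_attained by blast
    have "v \<bullet> x \<le> v \<bullet> a"
      using dot[OF x(1)] by (simp add: v_def inner_diff_right mult_left_mono)
    moreover have "dist h a = v \<bullet> h - v \<bullet> a"
    proof -
      have "v \<bullet> h - v \<bullet> a = inverse (norm (h - a)) * ((h - a) \<bullet> (h - a))"
        by (simp only: v_def inner_diff_right inner_scaleR_left right_diff_distrib)
      also have "\<dots> = norm (h - a)" using False by (simp add: dot_square_norm power2_eq_square)
      finally show ?thesis by (simp add: dist_norm)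
    qed
    ultimately show "dist h a \<le> \<theta> + 2 * \<delta> * R"
      using close[OF h] close[of x] x sub supp[OF u(1)] support_fun_upper[OF h, of u] by (auto simp: abs_le_iff)
  qed (use r0 in auto)
qed

lemma norm_le_support:
  fixes x :: "'a::euclidean_space"
  assumes "\<And>b. b \<in> Basis \<Longrightarrow> support_fun b H \<le> R \<and> support_fun (- b) H \<le> R" "x \<in> body_set H"
  shows "norm x \<le> real DIM('a) * R"
proof -
  have "\<bar>x \<bullet> b\<bar> \<le> R" if "b \<in> Basis" for b
    using assms(1)[OF that] support_fun_upper[OF assms(2), of b] support_fun_upper[OF assms(2), of "- b"]
    by (auto simp: abs_le_iff inner_commute)
  then have "(\<Sum>b\<in>Basis. \<bar>x \<bullet> b\<bar>) \<le> real DIM('a) * R" by (intro sum_bounded_above) auto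
  then show ?thesis using norm_le_l1[of x] by linarith
qed

text \<open>The signed basis vectors are added to the net so that control of the support function on
  \<open>D\<close> also bounds the body itself, through \<open>norm_le_support\<close>.\<close>

lemma finite_sphere_net:
  fixes \<delta> :: real
  assumes "0 < \<delta>"
  obtains D :: "'a::euclidean_space set" where "finite D" "\<And>b. b \<in> Basis \<Longrightarrow> b \<in> D \<and> - b \<in> D"
    "\<And>u. u \<in> D \<Longrightarrow> norm u = 1" "\<And>v. norm v = 1 \<Longrightarrow> \<exists>u\<in>D. norm (v - u) \<le> \<delta>"
proof -
  obtain K where K: "finite K" "K \<subseteq> sphere (0::'a) 1" "sphere 0 1 \<subseteq> (\<Union>x\<in>K. ball x \<delta>)"
    using compactE_image[of "sphere (0::'a) 1" "sphere 0 1" "\<lambda>x. ball x \<delta>"] assms by (metis (no_types, lifting) UN_I centre_in_ball compact_sphere open_ball subsetI)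
  show ?thesis
  proof (rule that[of "K \<union> Basis \<union> uminus ` Basis"])
    fix v :: 'a assume "norm v = 1"
    then have "v \<in> (\<Union>x\<in>K. ball x \<delta>)" by (intro subsetD[OF K(3)]) simp
    then show "\<exists>u\<in>K \<union> Basis \<union> uminus ` Basis. norm (v - u) \<le> \<delta>"
      by (force simp: dist_norm norm_minus_commute)
  qed (use K in auto)
qed

section \<open>Hulls of walks and of cadlag paths\<close>

definition walk_hull :: "nat \<Rightarrow> (nat \<Rightarrow> 'a::euclidean_space) \<Rightarrow> 'a convex_body" where
  "walk_hull m x = closed_hull ((\<lambda>j. \<Sum>i<j. x i) ` {..m})"

text \<open>Partial sums differ by at most the sum of the differences of the steps. The hull takes
  steps rather than positions as its argument so that independent increments enter as independent
  coordinates.\<close>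

lemma dist_walk_hull_le: "dist (walk_hull m x) (walk_hull m y) \<le> (\<Sum>i<m. dist (x i) (y i))"
proof -
  have d: "dist (\<Sum>i<j. x i) (\<Sum>i<j. y i) \<le> (\<Sum>i<m. dist (x i) (y i))" if "j \<le> m" for x y :: "nat \<Rightarrow> 'a" and j
  proof -
    have "dist (\<Sum>i<j. x i) (\<Sum>i<j. y i) \<le> (\<Sum>i<j. dist (x i) (y i))"
      by (simp add: dist_norm sum_subtractf[symmetric] norm_sum)
    also have "\<dots> \<le> (\<Sum>i<m. dist (x i) (y i))" using that by (intro sum_mono2) auto
    finally show ?thesis .
  qed
  have f: "bounded ((\<lambda>j. \<Sum>i<j. x i) ` {..m})" "(\<lambda>j. \<Sum>i<j. x i) ` {..m} \<noteq> {}" for x :: "nat \<Rightarrow> 'a"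
    by (auto intro: finite_imp_bounded)
  have e: "\<exists>b\<in>body_set (closed_hull ((\<lambda>j. \<Sum>i<j. y i) ` {..m})). dist a b \<le> (\<Sum>i<m. dist (x i) (y i))"
    if "a \<in> (\<lambda>j. \<Sum>i<j. x i) ` {..m}" for a and x y :: "nat \<Rightarrow> 'a"
    using that d[of _ x y] closed_hull_superset[OF f[of y]] by blast
  show ?thesis
    unfolding walk_hull_def
    using e[of _ x y] e[of _ y x] by (intro dist_closed_hull_le f sum_nonneg) (auto simp: dist_commute)
qed

text \<open>Only the first \<open>m\<close> coordinates enter, so the Lipschitz bound gives
  continuity for the product topology on \<open>nat \<Rightarrow> 'a\<close>. Measurability of all
  walk hulls rests on this.\<close>

lemma continuous_walk_hull: "continuous_on UNIV (walk_hull m)"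
proof (rule continuous_at_imp_continuous_on, intro ballI)
  fix x :: "nat \<Rightarrow> 'a"
  have "((\<lambda>y. \<Sum>i<m. dist (y i) (x i)) \<longlongrightarrow> (\<Sum>i<m. dist (x i) (x i))) (at x)"
  proof (intro tendsto_intros)
    fix i
    have "continuous_on UNIV (\<lambda>y :: nat \<Rightarrow> 'a. y i)" by (rule continuous_on_product_coordinates)
    then show "((\<lambda>y. y i) \<longlongrightarrow> x i) (at x)" by (simp add: continuous_on_def)
  qed
  then have "((\<lambda>y. \<Sum>i<m. dist (y i) (x i)) \<longlongrightarrow> 0) (at x)" by simp
  then have "((\<lambda>y. dist (walk_hull m y) (walk_hull m x)) \<longlongrightarrow> 0) (at x)"
    by (rule Lim_null_comparison[rotated]) (simp add: dist_walk_hull_le)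
  then show "isCont (walk_hull m) x" unfolding isCont_def by (rule tendsto_dist_iff[THEN iffD2])
qed

lemma measurable_walk_hull[measurable (raw)]:
  assumes [measurable]: "\<And>i. f i \<in> borel_measurable M"
  shows "(\<lambda>\<omega>. walk_hull m (\<lambda>i. f i \<omega>)) \<in> borel_measurable M"
proof -
  have "(\<lambda>\<omega> i. f i \<omega>) \<in> borel_measurable M"
    by (rule measurable_coordinatewise_then_product) simp
  then show ?thesis
    by (rule measurable_compose[OF _ borel_measurable_continuous_onI[OF continuous_walk_hull]])
qed

lemma body_set_walk_hull:
  "j \<le> m \<Longrightarrow> (\<Sum>i<j. x i) \<in> body_set (walk_hull m x)"
  unfolding walk_hull_def
  by (rule subsetD[OF closed_hull_superset]) (auto intro: finite_imp_bounded)

lemma support_fun_walk_hull: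
  "support_fun u (walk_hull m x) = Max ((\<lambda>j. u \<bullet> (\<Sum>i<j. x i)) ` {..m})"
proof (rule antisym)
  show "support_fun u (walk_hull m x) \<le> Max ((\<lambda>j. u \<bullet> (\<Sum>i<j. x i)) ` {..m})"
    unfolding walk_hull_def by (rule support_fun_closed_hull_le) (auto intro: finite_imp_bounded)
  show "Max ((\<lambda>j. u \<bullet> (\<Sum>i<j. x i)) ` {..m}) \<le> support_fun u (walk_hull m x)"
    by (auto intro!: support_fun_upper body_set_walk_hull)
qed

text \<open>One-sided limits bound the path near every time, and finitely many such neighbourhoods
  cover \<open>{0..t}\<close>.\<close>

lemma bounded_cadlag:
  fixes x :: "real \<Rightarrow> 'a::metric_space"
  assumes "cadlag x"
  shows "bounded {x s |s. 0 \<le> s \<and> s \<le> t}"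
proof -
  \<comment> \<open>The intersection with \<open>{0..}\<close> is there because
    \<open>cadlag\<close> says nothing about negative times.\<close>
  have ex: "\<exists>e>0. bounded (x ` ({s - e<..<s + e} \<inter> {0..}))" if "0 \<le> s" for s
  proof -
    have "(x \<longlongrightarrow> x s) (at_right s)" using assms that unfolding cadlag_def by blast
    from tendstoD[OF this, of 1] obtain b where b: "b > s" "\<And>y. s < y \<Longrightarrow> y < b \<Longrightarrow> dist (x y) (x s) < 1"
      unfolding eventually_at_right_field by auto
    have "\<exists>c<s. bounded (x ` ({c<..<s} \<inter> {0..}))"
    proof (cases "s = 0")
      case True
      then have "{-1<..<s} \<inter> {0..} = {}" by auto
      then show ?thesis using True by (intro exI[of _ "-1"]) simp
    next
      case False
      then have "0 < s" using that by simp
      then obtain l where "(x \<longlongrightarrow> l) (at_left s)" using assms unfolding cadlag_def by blast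
      from tendstoD[OF this, of 1] obtain c where c: "c < s" "\<And>y. c < y \<Longrightarrow> y < s \<Longrightarrow> dist (x y) l < 1"
        unfolding eventually_at_left_field by auto
      then have "x ` ({c<..<s} \<inter> {0..}) \<subseteq> ball l 1" by (auto simp: dist_commute)
      then show ?thesis using c(1) by (intro exI[of _ c] conjI bounded_subset[OF bounded_ball])
    qed
    then obtain c where c: "c < s" "bounded (x ` ({c<..<s} \<inter> {0..}))" by blast
    define e where "e = min (s - c) (b - s)"
    have sub: "x ` ({s - e<..<s + e} \<inter> {0..}) \<subseteq> x ` ({c<..<s} \<inter> {0..}) \<union> {x s} \<union> ball (x s) 1"
    proof (intro subsetI)
      fix z assume "z \<in> x ` ({s - e<..<s + e} \<inter> {0..})"
      then obtain y where y: "z = x y" "y > s - e" "y < s + e" "y \<ge> 0" by auto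
      consider "y < s" | "y = s" | "s < y" by linarith
      then show "z \<in> x ` ({c<..<s} \<inter> {0..}) \<union> {x s} \<union> ball (x s) 1"
        using y b(2)[of y] by cases (auto simp: e_def dist_commute)
    qed
    have "0 < e" using b(1) c(1) by (simp add: e_def)
    have bd: "bounded (x ` ({c<..<s} \<inter> {0..}) \<union> {x s} \<union> ball (x s) 1)" using c(2) by simp
    show ?thesis by (intro exI[of _ e] conjI \<open>0 < e\<close> bounded_subset[OF bd sub])
  qed
  then obtain e where e: "\<And>s. 0 \<le> s \<Longrightarrow> 0 < e s \<and> bounded (x ` ({s - e s<..<s + e s} \<inter> {0..}))" by metis
  have "compact {0..t}" by simp
  then obtain K where K: "K \<subseteq> {0..t}" "finite K" "{0..t} \<subseteq> (\<Union>s\<in>K. {s - e s<..<s + e s})"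
  proof (rule compactE_image[of "{0..t}" "{0..t}" "\<lambda>s. {s - e s<..<s + e s}"])
    show "{0..t} \<subseteq> (\<Union>s\<in>{0..t}. {s - e s<..<s + e s})" using e by force
  qed auto
  have "{x s |s. 0 \<le> s \<and> s \<le> t} \<subseteq> (\<Union>s\<in>K. x ` ({s - e s<..<s + e s} \<inter> {0..}))"
  proof
    fix z assume "z \<in> {x s |s. 0 \<le> s \<and> s \<le> t}"
    then obtain s where s: "z = x s" "0 \<le> s" "s \<le> t" by blast
    then obtain k where "k \<in> K" "s \<in> {k - e k<..<k + e k}" using subsetD[OF K(3), of s] by auto
    then show "z \<in> (\<Union>s\<in>K. x ` ({s - e s<..<s + e s} \<inter> {0..}))" using s by blast
  qed
  moreover have "bounded (\<Union>s\<in>K. x ` ({s - e s<..<s + e s} \<inter> {0..}))"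
    using K e by (intro bounded_UN) auto
  ultimately show ?thesis by (rule bounded_subset[rotated])
qed

lemma bounded_image_finite_cover:
  fixes x :: "'b \<Rightarrow> 'a::euclidean_space"
  assumes "bounded (x ` I)" "0 < e"
  shows "\<exists>K\<subseteq>I. finite K \<and> x ` I \<subseteq> (\<Union>s\<in>K. ball (x s) e)"
proof -
  have c: "compact (closure (x ` I))" using assms(1) by (simp add: compact_closure)
  have sub: "closure (x ` I) \<subseteq> (\<Union>s\<in>I. ball (x s) e)"
    using \<open>0 < e\<close> by (fastforce simp: closure_approachable)
  obtain K where "K \<subseteq> I" "finite K" "closure (x ` I) \<subseteq> (\<Union>s\<in>K. ball (x s) e)"
    using compactE_image[OF c open_ball sub] by metis
  then show ?thesis using closure_subset[of "x ` I"] by (metis order_trans)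
qed

text \<open>The range is bounded, so the path values at finitely many times form a net of it. These
  times are fixed before \<open>m\<close>, and by right continuity the path value at the next grid
  time is close to the value at each of them once the mesh is fine.\<close>

lemma grid_hull_tendsto:
  fixes x :: "real \<Rightarrow> 'a::euclidean_space"
  assumes x: "cadlag x" and "0 \<le> r"
  shows "(\<lambda>m. closed_hull ((\<lambda>j. x (real j * (r / real m))) ` {..m})) \<longlonglongrightarrow> closed_hull {x s |s. 0 \<le> s \<and> s \<le> r}"
    (is "?K \<longlonglongrightarrow> closed_hull ?A")
proof (rule metric_LIMSEQ_I)
  fix e :: real assume "0 < e"
  have bdA: "bounded ?A" using x by (rule bounded_cadlag)
  have neA: "?A \<noteq> {}" using \<open>0 \<le> r\<close> by auto
  have A_image: "?A = x ` {0..r}" by auto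
  obtain K where K: "K \<subseteq> {0..r}" "finite K" "?A \<subseteq> (\<Union>s\<in>K. ball (x s) (e / 4))"
    using bounded_image_finite_cover[of x "{0..r}" "e / 4"] bdA \<open>0 < e\<close> unfolding A_image by auto
  have pt: "\<forall>\<^sub>F m in sequentially. \<exists>j\<le>m. dist (x s) (x (real j * (r / real m))) < e / 4" if s: "s \<in> {0..r}" for s
  proof -
    have "(x \<longlongrightarrow> x s) (at_right s)" using x s unfolding cadlag_def by auto
    from tendstoD[OF this, of "e / 4"] \<open>0 < e\<close>
    obtain b where b: "b > s" "\<And>y. s < y \<Longrightarrow> y < b \<Longrightarrow> dist (x y) (x s) < e / 4"
      unfolding eventually_at_right_field by auto
    have "(\<lambda>m. r / real m) \<longlonglongrightarrow> 0" by (rule lim_const_over_n)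
    then have "\<forall>\<^sub>F m in sequentially. r / real m < b - s" using b(1) by (intro order_tendstoD) auto
    then show ?thesis using eventually_gt_at_top[of 0]
    proof eventually_elim
      case (elim m)
      show ?case
      proof (cases "r = 0")
        case True
        then show ?thesis using s \<open>0 < e\<close> by (intro exI[of _ 0]) auto
      next
        case False
        then have "r > 0" using \<open>0 \<le> r\<close> by simp
        \<comment> \<open>Rounding up selects the first grid time not before \<open>s\<close>; it
          does not pass \<open>r\<close> because \<open>r\<close> is itself a grid time.\<close>
        define j where "j = nat \<lceil>s * real m / r\<rceil>"
        have "s * real m / r \<le> real m" using s \<open>r > 0\<close> elim by (simp add: field_simps mult_right_mono)
        then have jm: "j \<le> m" unfolding j_def by (simp add: ceiling_le_iff nat_le_iff)
        have j: "s * real m / r \<le> real j" "real j < s * real m / r + 1"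
          unfolding j_def using s \<open>r > 0\<close> ceiling_correct[of "s * real m / r"] by (auto simp: of_nat_nat)
        have "s \<le> real j * (r / real m)" "real j * (r / real m) < s + r / real m"
          using j \<open>r > 0\<close> elim by (auto simp: field_simps)
        then have "s = real j * (r / real m) \<or> (s < real j * (r / real m) \<and> real j * (r / real m) < b)"
          using elim by linarith
        then show ?thesis using jm b(2)[of "real j * (r / real m)"] \<open>0 < e\<close>
          by (intro exI[of _ j]) (auto simp: dist_commute)
      qed
    qed
  qed
  have "\<forall>\<^sub>F m in sequentially. \<forall>s\<in>K. \<exists>j\<le>m. dist (x s) (x (real j * (r / real m))) < e / 4"
    using K pt by (intro eventually_ball_finite) auto
  then have "\<forall>\<^sub>F m in sequentially. dist (?K m) (closed_hull ?A) < e"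
    using eventually_gt_at_top[of 0]
  proof eventually_elim
    case (elim m)
    let ?G = "(\<lambda>j. x (real j * (r / real m))) ` {..m}"
    have G: "bounded ?G" "?G \<noteq> {}" by (auto intro: finite_imp_bounded)
    have "?G \<subseteq> ?A"
    proof (intro image_subsetI)
      fix j assume "j \<in> {..m}"
      then have "real j * (r / real m) \<le> r" using \<open>0 \<le> r\<close> elim by (simp add: field_simps mult_left_mono)
      then show "x (real j * (r / real m)) \<in> ?A"
        using \<open>0 \<le> r\<close> by (intro CollectI exI[of _ "real j * (r / real m)"]) auto
    qed
    then have GA: "?G \<subseteq> body_set (closed_hull ?A)" using closed_hull_superset[OF bdA neA] by blast
    have "dist (?K m) (closed_hull ?A) \<le> e / 2"
    proof (rule dist_closed_hull_le[OF G bdA neA])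
      show "\<exists>b\<in>body_set (closed_hull ?A). dist a b \<le> e / 2" if "a \<in> ?G" for a
        using subsetD[OF GA that] \<open>0 < e\<close> by (intro bexI[of _ a]) auto
      show "\<exists>a\<in>body_set (closed_hull ?G). dist b a \<le> e / 2" if "b \<in> ?A" for b
      proof -
        obtain s where s: "s \<in> K" "dist (x s) b < e / 4" using K(3) \<open>b \<in> ?A\<close> by force
        then obtain j where j: "j \<le> m" "dist (x s) (x (real j * (r / real m))) < e / 4" using elim by blast
        have "x (real j * (r / real m)) \<in> body_set (closed_hull ?G)"
          using j(1) closed_hull_superset[OF G] by blast
        moreover have "dist b (x (real j * (r / real m))) \<le> e / 2"
          using s(2) j(2) dist_triangle3[of b "x (real j * (r / real m))" "x s"] by linarith
        ultimately show ?thesis by blast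
      qed
    qed (use \<open>0 < e\<close> in simp)
    then show ?case using \<open>0 < e\<close> by linarith
  qed
  then show "\<exists>no. \<forall>n\<ge>no. dist (?K n) (closed_hull ?A) < e" unfolding eventually_sequentially .
qed

lemma walk_hull_increments:
  "walk_hull m (\<lambda>i. x (Suc i) - x i) = closed_hull ((\<lambda>j. x j - x 0) ` {..m})"
  unfolding walk_hull_def by (simp add: sum_lessThan_telescope)

lemma walk_hull_grid_tendsto:
  fixes x :: "real \<Rightarrow> 'a::euclidean_space"
  assumes "cadlag x" "0 \<le> r" "x 0 = 0"
  shows "(\<lambda>m. walk_hull m (\<lambda>i. x (real (Suc i) * (r / real m)) - x (real i * (r / real m))))
    \<longlonglongrightarrow> closed_hull {x s |s. 0 \<le> s \<and> s \<le> r}"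
proof -
  have "walk_hull m (\<lambda>i. x (real (Suc i) * (r / real m)) - x (real i * (r / real m)))
     = closed_hull ((\<lambda>j. x (real j * (r / real m))) ` {..m})" for m
    using walk_hull_increments[of m "\<lambda>i. x (real i * (r / real m))"] assms(3) by simp
  then show ?thesis using grid_hull_tendsto[OF assms(1,2)] by simp
qed

lemma scale_body_walk_hull: "scale_body c (walk_hull m x) = walk_hull m (\<lambda>i. c *\<^sub>R x i)"
  unfolding walk_hull_def
  by (subst scale_body_closed_hull) (auto intro: finite_imp_bounded simp: image_image scaleR_sum_right)

lemma scale_body_tendsto:
  assumes c: "c \<longlonglongrightarrow> 1" and K: "K \<longlonglongrightarrow> L"
  shows "(\<lambda>m. scale_body (c m) (K m)) \<longlonglongrightarrow> L"
proof -
  obtain R where R: "\<And>y. y \<in> body_set L \<Longrightarrow> norm y \<le> R" "0 \<le> R"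
    using compact_imp_bounded[OF body_set_props(2)[of L]] by (metis bounded_pos less_imp_le)
  have le: "dist (scale_body (c m) (K m)) L \<le> \<bar>c m\<bar> * dist (K m) L + \<bar>c m - 1\<bar> * R" for m
  proof -
    have *: "dist (c m *\<^sub>R x) y \<le> \<bar>c m\<bar> * dist (K m) L + \<bar>c m - 1\<bar> * R"
      if "y \<in> body_set L" "dist x y \<le> dist (K m) L" for x y
    proof -
      have "c m *\<^sub>R x - y = c m *\<^sub>R (x - y) + (c m - 1) *\<^sub>R y" by (simp add: algebra_simps)
      then have "dist (c m *\<^sub>R x) y \<le> \<bar>c m\<bar> * dist x y + \<bar>c m - 1\<bar> * norm y"
        unfolding dist_norm by (metis norm_scaleR norm_triangle_ineq)
      also have "\<dots> \<le> \<bar>c m\<bar> * dist (K m) L + \<bar>c m - 1\<bar> * R"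
        using that R by (intro add_mono mult_left_mono) auto
      finally show ?thesis .
    qed
    show ?thesis
    proof (rule dist_body_le)
      show "0 \<le> \<bar>c m\<bar> * dist (K m) L + \<bar>c m - 1\<bar> * R" using R(2) by simp
      show "\<exists>y\<in>body_set L. dist x y \<le> \<bar>c m\<bar> * dist (K m) L + \<bar>c m - 1\<bar> * R"
        if "x \<in> body_set (scale_body (c m) (K m))" for x
        using that * dist_body_attained[of _ "K m" L] unfolding body_set_scale_body by blast
      show "\<exists>y\<in>body_set (scale_body (c m) (K m)). dist x y \<le> \<bar>c m\<bar> * dist (K m) L + \<bar>c m - 1\<bar> * R"
        if x: "x \<in> body_set L" for x
      proof -
        obtain y where "y \<in> body_set (K m)" "dist x y \<le> dist L (K m)" using dist_body_attained[OF x] by blast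
        with *[OF x, of y] show ?thesis unfolding body_set_scale_body
          by (intro bexI[of _ "c m *\<^sub>R y"]) (auto simp: dist_commute)
      qed
    qed
  qed
  have "(\<lambda>m. \<bar>c m\<bar> * dist (K m) L + \<bar>c m - 1\<bar> * R) \<longlonglongrightarrow> \<bar>1\<bar> * 0 + \<bar>1 - 1\<bar> * R"
    by (intro tendsto_intros c K[THEN tendsto_dist_iff[THEN iffD1]])
  then have z: "(\<lambda>m. \<bar>c m\<bar> * dist (K m) L + \<bar>c m - 1\<bar> * R) \<longlonglongrightarrow> 0" by (simp only: diff_self abs_zero mult_zero_right mult_zero_left add_0_right)
  have "(\<lambda>m. dist (scale_body (c m) (K m)) L) \<longlonglongrightarrow> 0"
    by (rule tendsto_sandwich[OF always_eventually always_eventually tendsto_const z]) (simp_all add: le)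
  then show ?thesis by (rule tendsto_dist_iff[THEN iffD2])
qed

section \<open>Joint convergence of independent vectors\<close>

lemma one_minus_prod_le:
  fixes s :: "'i \<Rightarrow> real"
  assumes "finite I" "\<And>i. i \<in> I \<Longrightarrow> 0 \<le> s i \<and> s i \<le> 1"
  shows "1 - (\<Prod>i\<in>I. s i) \<le> (\<Sum>i\<in>I. 1 - s i)"
  using assms
proof (induction I rule: finite_induct)
  case (insert i I)
  have p: "0 \<le> (\<Prod>i\<in>I. s i)" "(\<Prod>i\<in>I. s i) \<le> 1" using insert by (auto intro!: prod_nonneg prod_le_1)
  have "1 - s i * (\<Prod>i\<in>I. s i) = (1 - s i) * (\<Prod>i\<in>I. s i) + (1 - (\<Prod>i\<in>I. s i))" by (simp add: algebra_simps)
  also have "\<dots> \<le> (1 - s i) + (\<Sum>i\<in>I. 1 - s i)"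
    using insert p mult_left_le[of "\<Prod>i\<in>I. s i" "1 - s i"] by (intro add_mono) auto
  finally show ?case using insert by simp
qed simp

text \<open>A continuous stand-in for the indicator of large norms: it vanishes up to norm
  \<open>R\<close> and equals \<open>1\<close> from norm \<open>R + 1\<close> on. Being bounded and
  continuous, it lets weak convergence carry tightness from the limit to the prelimit.\<close>

definition cutoff :: "real \<Rightarrow> 'a::real_normed_vector \<Rightarrow> real" where
  "cutoff R x = min 1 (max 0 (norm x - R))"

lemma cutoff_bounds: "0 \<le> cutoff R x" "cutoff R x \<le> 1"
  by (auto simp: cutoff_def)

lemma continuous_cutoff: "continuous_on UNIV (cutoff R)"
  unfolding cutoff_def by (intro continuous_intros)

lemma measurable_cutoff[measurable]: "cutoff R \<in> borel_measurable borel"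
  by (rule borel_measurable_continuous_onI[OF continuous_cutoff])

lemma cutoff_tendsto: "(\<lambda>n. cutoff (real n) x) \<longlonglongrightarrow> 0"
proof (rule tendsto_eventually)
  obtain k where k: "norm x \<le> real k" using real_arch_simple by blast
  show "\<forall>\<^sub>F n in sequentially. cutoff (real n) x = 0"
    using eventually_ge_at_top[of k] by eventually_elim (use k in \<open>auto simp: cutoff_def\<close>)
qed

lemma (in prob_space) cutoff_integral_small:
  fixes \<zeta> :: "nat \<Rightarrow> 'a \<Rightarrow> 'b::euclidean_space"
  assumes [measurable]: "\<And>j. j < m \<Longrightarrow> \<zeta> j \<in> borel_measurable M" and "0 < e"
  obtains n where "(\<Sum>j<m. \<integral>\<omega>. cutoff (real n) (\<zeta> j \<omega>) \<partial>M) < e"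
proof -
  have "(\<lambda>n. \<Sum>j<m. \<integral>\<omega>. cutoff (real n) (\<zeta> j \<omega>) \<partial>M) \<longlonglongrightarrow> (\<Sum>j<m. \<integral>\<omega>. 0 \<partial>M)"
  proof (intro tendsto_sum integral_dominated_convergence[where w = "\<lambda>_. 1"])
    fix j n assume "j \<in> {..<m}"
    then have [measurable]: "\<zeta> j \<in> borel_measurable M" by auto
    show "(\<lambda>\<omega>. cutoff (real n) (\<zeta> j \<omega>)) \<in> borel_measurable M" by measurable
  qed (auto simp: cutoff_tendsto cutoff_bounds)
  then have "\<forall>\<^sub>F n in sequentially. (\<Sum>j<m. \<integral>\<omega>. cutoff (real n) (\<zeta> j \<omega>) \<partial>M) < e"
    using \<open>0 < e\<close> by (intro order_tendstoD(2)) auto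
  then show ?thesis using that eventually_happens'[OF sequentially_bot] by blast
qed

text \<open>Tent functions around a finite \<open>d\<close>-net of the ball of radius
  \<open>R + 1\<close>, normalised by their sum. On that ball some tent has height at least
  \<open>d\<close>, so bounding the divisor below by \<open>d\<close> leaves the total equal to one
  there and keeps the quotients continuous elsewhere; outside that ball \<open>cutoff R\<close> is
  already \<open>1\<close>.\<close>

lemma partition_of_unity_ball:
  fixes R d :: real
  assumes "0 < d"
  obtains K :: "'a::euclidean_space set" and \<phi> :: "'a \<Rightarrow> 'a \<Rightarrow> real" where "finite K"
    "\<And>a. continuous_on UNIV (\<phi> a)" "\<And>a x. 0 \<le> \<phi> a x" "\<And>x. (\<Sum>a\<in>K. \<phi> a x) \<le> 1"
    "\<And>x. 1 - (\<Sum>a\<in>K. \<phi> a x) \<le> cutoff R x" "\<And>a x. \<phi> a x \<noteq> 0 \<Longrightarrow> dist x a \<le> 2 * d"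
proof -
  have "compact (cball (0::'a) (R + 1))" by simp
  moreover have "cball 0 (R + 1) \<subseteq> (\<Union>x\<in>cball (0::'a) (R + 1). ball x d)" using assms by force
  ultimately obtain K where K: "finite K" "cball (0::'a) (R + 1) \<subseteq> (\<Union>x\<in>K. ball x d)"
    by (rule compactE_image[where f = "\<lambda>x. ball x d", OF _ open_ball])
  define p where "p a x = max 0 (2 * d - dist x a)" for a x :: 'a
  define q where "q x = max d (\<Sum>a\<in>K. p a x)" for x
  have q0: "0 < q x" for x using assms by (simp add: q_def less_max_iff_disj)
  show ?thesis
  proof (rule that[of K "\<lambda>a x. p a x / q x"])
    have cp: "continuous_on UNIV (p a)" for a unfolding p_def by (intro continuous_intros)
    then have "continuous_on UNIV q" unfolding q_def by (intro continuous_intros)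
    then show "continuous_on UNIV (\<lambda>x. p a x / q x)" for a
      using cp q0 by (intro continuous_on_divide) (auto simp: less_imp_neq[symmetric])
    show "0 \<le> p a x / q x" for a x using q0[of x] by (simp add: p_def)
    have s: "(\<Sum>a\<in>K. p a x / q x) = (\<Sum>a\<in>K. p a x) / q x" for x by (simp add: sum_divide_distrib)
    show le: "(\<Sum>a\<in>K. p a x / q x) \<le> 1" for x
      unfolding s using q0[of x] by (simp add: q_def)
    show "1 - (\<Sum>a\<in>K. p a x / q x) \<le> cutoff R x" for x
    proof (cases "norm x \<le> R + 1")
      case True
      then obtain a where a: "a \<in> K" "dist a x < d" using K(2) by (force simp: subset_eq)
      have "d \<le> p a x" using a by (simp add: p_def dist_commute)
      also have "\<dots> \<le> (\<Sum>a\<in>K. p a x)"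
        using a(1) K(1) by (intro member_le_sum) (auto simp: p_def)
      finally have "q x = (\<Sum>a\<in>K. p a x)" by (simp add: q_def)
      then show ?thesis unfolding s using q0[of x] by (simp add: cutoff_bounds)
    next
      case False
      have "0 \<le> (\<Sum>a\<in>K. p a x / q x)" using q0[of x] by (intro sum_nonneg) (auto simp: p_def)
      moreover have "cutoff R x = 1" using False by (simp add: cutoff_def)
      ultimately show ?thesis by linarith
    qed
    show "dist x a \<le> 2 * d" if "p a x / q x \<noteq> 0" for a x
    proof -
      have "p a x \<noteq> 0" using that by auto
      then show ?thesis by (auto simp: p_def max_def split: if_splits)
    qed
  qed (rule K(1))
qed

text \<open>A partition of unity in each coordinate replaces \<open>\<Phi>\<close> by a finite sum
  of products of functions of one coordinate. Independence factorises the integrals of these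
  products, and the factors converge by convergence of the marginals. The replacement error is
  uniformly small up to \<open>cutoff\<close> terms, which pass to the limit as well.\<close>

lemma joint_convergence_independent:
  fixes \<xi> :: "'i \<Rightarrow> nat \<Rightarrow> 'w \<Rightarrow> 'a::euclidean_space" and \<Phi> :: "(nat \<Rightarrow> 'a) \<Rightarrow> real"
  assumes M: "prob_space M" and N: "prob_space N"
    and ind\<xi>: "\<And>i. prob_space.indep_vars M (\<lambda>_. borel) (\<xi> i) {..<m}"
    and ind\<zeta>: "prob_space.indep_vars N (\<lambda>_. borel) \<zeta> {..<m}"
    and conv: "\<And>j (f :: 'a \<Rightarrow> real). j < m \<Longrightarrow> continuous_on UNIV f \<Longrightarrow> (\<And>x. \<bar>f x\<bar> \<le> 1) \<Longrightarrow>
       ((\<lambda>i. \<integral>\<omega>. f (\<xi> i j \<omega>) \<partial>M) \<longlongrightarrow> (\<integral>\<omega>. f (\<zeta> j \<omega>) \<partial>N)) F"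
    and meas\<xi>: "\<And>i. (\<lambda>\<omega>. \<Phi> (\<lambda>j. \<xi> i j \<omega>)) \<in> borel_measurable M"
    and meas\<zeta>: "(\<lambda>\<omega>. \<Phi> (\<lambda>j. \<zeta> j \<omega>)) \<in> borel_measurable N"
    and B: "\<And>x. \<bar>\<Phi> x\<bar> \<le> B" and L: "\<And>x y. \<bar>\<Phi> x - \<Phi> y\<bar> \<le> L * (\<Sum>j<m. dist (x j) (y j))" "0 \<le> L"
  shows "((\<lambda>i. \<integral>\<omega>. \<Phi> (\<lambda>j. \<xi> i j \<omega>) \<partial>M) \<longlongrightarrow> (\<integral>\<omega>. \<Phi> (\<lambda>j. \<zeta> j \<omega>) \<partial>N)) F"
proof (rule tendstoI)
  fix e :: real assume "0 < e"
  interpret N: prob_space N by fact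
  have B0: "0 \<le> B" using B[of undefined] by linarith
  have m\<zeta>[measurable]: "\<zeta> j \<in> borel_measurable N" if "j < m" for j
    using ind\<zeta> that unfolding N.indep_vars_def by auto
  have "0 < e / (8 * (B + 1))" using \<open>0 < e\<close> B0 by simp
  then obtain n where n: "(\<Sum>j<m. \<integral>\<omega>. cutoff (real n) (\<zeta> j \<omega>) \<partial>N) < e / (8 * (B + 1))"
    using N.cutoff_integral_small[of m \<zeta>] m\<zeta> by metis
  \<comment> \<open>A chosen net point differs from the argument by at most \<open>2 * d\<close> in
    each of the \<open>m\<close> coordinates, so \<open>\<Phi>\<close> changes by at most
    \<open>e / 8\<close>. The added \<open>1\<close> covers the case
    \<open>L * real m = 0\<close>.\<close>
  define d where "d = e / (16 * (L * real m + 1))"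
  have "0 < d" using \<open>0 < e\<close> L(2) by (simp add: d_def add_nonneg_pos)
  have Ld: "L * (real m * (2 * d)) \<le> e / 8"
  proof -
    have pos: "L * real m + 1 > 0" using L(2) by (simp add: add_nonneg_pos)
    have "L * (real m * (2 * d)) \<le> (L * real m + 1) * (2 * d)" using \<open>0 < d\<close> by (simp add: algebra_simps)
    also have "\<dots> = e / 8" using pos by (simp only: d_def) (simp add: divide_eq_eq mult.commute)
    finally show ?thesis .
  qed
  obtain K :: "'a set" and \<phi> where K: "finite K"
    and \<phi>: "\<And>a. continuous_on UNIV (\<phi> a)" "\<And>a x. 0 \<le> \<phi> a x" "\<And>x. (\<Sum>a\<in>K. \<phi> a x) \<le> 1"
    "\<And>x. 1 - (\<Sum>a\<in>K. \<phi> a x) \<le> cutoff (real n) x" "\<And>a x. \<phi> a x \<noteq> 0 \<Longrightarrow> dist x a \<le> 2 * d"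
    using partition_of_unity_ball[OF \<open>0 < d\<close>, of "real n"] by metis
  have [measurable]: "\<phi> a \<in> borel_measurable borel" for a by (rule borel_measurable_continuous_onI[OF \<phi>(1)])
  have \<phi>1: "\<bar>\<phi> a x\<bar> \<le> 1" if "a \<in> K" for a x
  proof -
    have "\<phi> a x \<le> (\<Sum>a\<in>K. \<phi> a x)" using that K \<phi>(2) by (intro member_le_sum) auto
    then show ?thesis using \<phi>(2)[of a x] \<phi>(3)[of x] by simp
  qed
  \<comment> \<open>A choice of net points is itself an argument of \<open>\<Phi>\<close>. It is
    \<open>undefined\<close> from index \<open>m\<close> on, where the Lipschitz bound does not
    look.\<close>
  define H where "H = PiE {..<m} (\<lambda>_. K)"
  have finH: "finite H" unfolding H_def using K by (intro finite_PiE) auto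
  define \<Psi> where "\<Psi> x = (\<Sum>h\<in>H. \<Phi> h * (\<Prod>j<m. \<phi> (h j) (x j)))" for x :: "nat \<Rightarrow> 'a"
  have approx: "\<bar>\<Phi> x - \<Psi> x\<bar> \<le> e / 8 + B * (\<Sum>j<m. cutoff (real n) (x j))" for x
  proof -
    define P where "P = (\<Prod>j<m. \<Sum>a\<in>K. \<phi> a (x j))"
    have P: "(\<Sum>h\<in>H. \<Prod>j<m. \<phi> (h j) (x j)) = P"
      unfolding P_def H_def using K by (subst prod_sum_PiE) auto
    have P01: "0 \<le> P" "P \<le> 1"
      unfolding P_def using \<phi>(2,3) by (auto intro!: prod_nonneg prod_le_1 sum_nonneg)
    have "1 - P \<le> (\<Sum>j<m. 1 - (\<Sum>a\<in>K. \<phi> a (x j)))"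
      unfolding P_def using \<phi>(2,3) by (intro one_minus_prod_le) (auto intro!: sum_nonneg)
    also have "\<dots> \<le> (\<Sum>j<m. cutoff (real n) (x j))" using \<phi>(4) by (intro sum_mono) auto
    finally have P1: "1 - P \<le> (\<Sum>j<m. cutoff (real n) (x j))" .
    have "\<Phi> x - \<Psi> x = (\<Sum>h\<in>H. (\<Phi> x - \<Phi> h) * (\<Prod>j<m. \<phi> (h j) (x j))) + \<Phi> x * (1 - P)"
    proof -
      have "(\<Sum>h\<in>H. (\<Phi> x - \<Phi> h) * (\<Prod>j<m. \<phi> (h j) (x j))) = \<Phi> x * P - \<Psi> x"
        unfolding P[symmetric] \<Psi>_def by (simp only: left_diff_distrib sum_subtractf sum_distrib_left)
      then show ?thesis by (simp add: right_diff_distrib)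
    qed
    then have "\<bar>\<Phi> x - \<Psi> x\<bar> \<le> \<bar>\<Sum>h\<in>H. (\<Phi> x - \<Phi> h) * (\<Prod>j<m. \<phi> (h j) (x j))\<bar> + \<bar>\<Phi> x * (1 - P)\<bar>"
      by (simp only: abs_triangle_ineq)
    also have "\<bar>\<Phi> x * (1 - P)\<bar> \<le> B * (\<Sum>j<m. cutoff (real n) (x j))"
      unfolding abs_mult using B B0 P01 P1 by (intro mult_mono) auto
    also have "\<bar>\<Sum>h\<in>H. (\<Phi> x - \<Phi> h) * (\<Prod>j<m. \<phi> (h j) (x j))\<bar> \<le> (\<Sum>h\<in>H. e / 8 * (\<Prod>j<m. \<phi> (h j) (x j)))"
    proof (rule order_trans[OF sum_abs sum_mono])
      fix h assume "h \<in> H"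
      have nn: "0 \<le> (\<Prod>j<m. \<phi> (h j) (x j))" using \<phi>(2) by (intro prod_nonneg) auto
      show "\<bar>(\<Phi> x - \<Phi> h) * (\<Prod>j<m. \<phi> (h j) (x j))\<bar> \<le> e / 8 * (\<Prod>j<m. \<phi> (h j) (x j))"
      proof (cases "(\<Prod>j<m. \<phi> (h j) (x j)) = 0")
        case False
        then have "\<phi> (h j) (x j) \<noteq> 0" if "j < m" for j using that by auto
        then have "(\<Sum>j<m. dist (x j) (h j)) \<le> (\<Sum>j<m. 2 * d)" by (intro sum_mono \<phi>(5)) auto
        then have "L * (\<Sum>j<m. dist (x j) (h j)) \<le> L * (real m * (2 * d))"
          using L(2) by (intro mult_left_mono) auto
        with L(1)[of x h] Ld have "\<bar>\<Phi> x - \<Phi> h\<bar> \<le> e / 8" by linarith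
        then have "\<bar>\<Phi> x - \<Phi> h\<bar> * (\<Prod>j<m. \<phi> (h j) (x j)) \<le> e / 8 * (\<Prod>j<m. \<phi> (h j) (x j))"
          using nn by (rule mult_right_mono)
        then show ?thesis using nn by (simp add: abs_mult)
      next
        case True
        show ?thesis unfolding True by simp
      qed
    qed
    also have "(\<Sum>h\<in>H. e / 8 * (\<Prod>j<m. \<phi> (h j) (x j))) \<le> e / 8"
      unfolding sum_distrib_left[symmetric] P using P01 \<open>0 < e\<close> by simp
    finally show ?thesis by simp
  qed
  \<comment> \<open>Stated for an arbitrary probability space and family because it serves both the
    prelimit on \<open>M\<close> and the limit on \<open>N\<close>.\<close>
  have integral: "\<bar>(\<integral>\<omega>. \<Phi> (\<lambda>j. Z j \<omega>) \<partial>P) - (\<Sum>h\<in>H. \<Phi> h * (\<Prod>j<m. \<integral>\<omega>. \<phi> (h j) (Z j \<omega>) \<partial>P))\<bar>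
      \<le> e / 8 + B * (\<Sum>j<m. \<integral>\<omega>. cutoff (real n) (Z j \<omega>) \<partial>P)"
    if P: "prob_space P" and ind: "prob_space.indep_vars P (\<lambda>_. borel) Z {..<m}"
      and [measurable]: "(\<lambda>\<omega>. \<Phi> (\<lambda>j. Z j \<omega>)) \<in> borel_measurable P" for P :: "'z measure" and Z
  proof -
    interpret P: prob_space P by fact
    have mZ[measurable]: "Z j \<in> borel_measurable P" if "j < m" for j
      using ind that unfolding P.indep_vars_def by auto
    have i\<phi>: "integrable P (\<lambda>\<omega>. \<phi> a (Z j \<omega>))" if "a \<in> K" "j < m" for a j
      using that \<phi>1[OF that(1)] by (intro P.integrable_const_bound[where B = 1]) auto
    have ic: "integrable P (\<lambda>\<omega>. cutoff (real n) (Z j \<omega>))" if "j < m" for j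
      using that by (intro P.integrable_const_bound[where B = 1]) (auto simp: cutoff_bounds)
    have iprod: "integrable P (\<lambda>\<omega>. \<Prod>j<m. \<phi> (h j) (Z j \<omega>))"
       and eprod: "(\<integral>\<omega>. (\<Prod>j<m. \<phi> (h j) (Z j \<omega>)) \<partial>P) = (\<Prod>j<m. \<integral>\<omega>. \<phi> (h j) (Z j \<omega>) \<partial>P)" if "h \<in> H" for h
    proof -
      have "P.indep_vars (\<lambda>_. borel) (\<lambda>j \<omega>. \<phi> (h j) (Z j \<omega>)) {..<m}"
        using ind by (rule P.indep_vars_compose2) simp
      moreover have "integrable P (\<lambda>\<omega>. \<phi> (h j) (Z j \<omega>))" if "j \<in> {..<m}" for j
        using that \<open>h \<in> H\<close> by (intro i\<phi>) (auto simp: H_def)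
      ultimately show "integrable P (\<lambda>\<omega>. \<Prod>j<m. \<phi> (h j) (Z j \<omega>))"
         "(\<integral>\<omega>. (\<Prod>j<m. \<phi> (h j) (Z j \<omega>)) \<partial>P) = (\<Prod>j<m. \<integral>\<omega>. \<phi> (h j) (Z j \<omega>) \<partial>P)"
        by (intro P.indep_vars_integrable P.indep_vars_lebesgue_integral; simp)+
    qed
    have i\<Psi>: "integrable P (\<lambda>\<omega>. \<Psi> (\<lambda>j. Z j \<omega>))"
      unfolding \<Psi>_def using iprod by (intro Bochner_Integration.integrable_sum integrable_mult_right) auto
    have e\<Psi>: "(\<integral>\<omega>. \<Psi> (\<lambda>j. Z j \<omega>) \<partial>P) = (\<Sum>h\<in>H. \<Phi> h * (\<Prod>j<m. \<integral>\<omega>. \<phi> (h j) (Z j \<omega>) \<partial>P))"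
      unfolding \<Psi>_def using iprod eprod by (subst Bochner_Integration.integral_sum) auto
    have i\<Phi>: "integrable P (\<lambda>\<omega>. \<Phi> (\<lambda>j. Z j \<omega>))"
      using B by (intro P.integrable_const_bound[where B = B]) auto
    have "\<bar>(\<integral>\<omega>. \<Phi> (\<lambda>j. Z j \<omega>) \<partial>P) - (\<integral>\<omega>. \<Psi> (\<lambda>j. Z j \<omega>) \<partial>P)\<bar>
        = \<bar>\<integral>\<omega>. \<Phi> (\<lambda>j. Z j \<omega>) - \<Psi> (\<lambda>j. Z j \<omega>) \<partial>P\<bar>"
      using i\<Phi> i\<Psi> by simp
    also have "\<dots> \<le> (\<integral>\<omega>. \<bar>\<Phi> (\<lambda>j. Z j \<omega>) - \<Psi> (\<lambda>j. Z j \<omega>)\<bar> \<partial>P)" by (rule integral_abs_bound)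
    also have "\<dots> \<le> (\<integral>\<omega>. e / 8 + B * (\<Sum>j<m. cutoff (real n) (Z j \<omega>)) \<partial>P)"
      using i\<Phi> i\<Psi> ic approx
      by (intro integral_mono integrable_abs Bochner_Integration.integrable_diff Bochner_Integration.integrable_add
            integrable_mult_right Bochner_Integration.integrable_sum) auto
    also have "\<dots> = e / 8 + B * (\<Sum>j<m. \<integral>\<omega>. cutoff (real n) (Z j \<omega>) \<partial>P)"
      using ic by (subst Bochner_Integration.integral_add)
        (auto simp: Bochner_Integration.integral_sum P.prob_space intro!: integrable_mult_right Bochner_Integration.integrable_sum)
    finally show ?thesis unfolding e\<Psi> .
  qed
  have t1: "((\<lambda>i. \<Sum>h\<in>H. \<Phi> h * (\<Prod>j<m. \<integral>\<omega>. \<phi> (h j) (\<xi> i j \<omega>) \<partial>M)) \<longlongrightarrow>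
     (\<Sum>h\<in>H. \<Phi> h * (\<Prod>j<m. \<integral>\<omega>. \<phi> (h j) (\<zeta> j \<omega>) \<partial>N))) F"
  proof (intro tendsto_sum tendsto_mult tendsto_const tendsto_prod)
    fix h j assume "h \<in> H" "j \<in> {..<m}"
    then have hK: "h j \<in> K" and jm: "j < m" by (auto simp: H_def)
    show "((\<lambda>i. \<integral>\<omega>. \<phi> (h j) (\<xi> i j \<omega>) \<partial>M) \<longlongrightarrow> (\<integral>\<omega>. \<phi> (h j) (\<zeta> j \<omega>) \<partial>N)) F"
      by (rule conv[of j "\<phi> (h j)", OF jm \<phi>(1) \<phi>1[OF hK]])
  qed
  have t2: "((\<lambda>i. B * (\<Sum>j<m. \<integral>\<omega>. cutoff (real n) (\<xi> i j \<omega>) \<partial>M)) \<longlongrightarrow>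
     B * (\<Sum>j<m. \<integral>\<omega>. cutoff (real n) (\<zeta> j \<omega>) \<partial>N)) F"
  proof (intro tendsto_mult tendsto_const tendsto_sum)
    fix j assume "j \<in> {..<m}"
    then have jm: "j < m" by simp
    show "((\<lambda>i. \<integral>\<omega>. cutoff (real n) (\<xi> i j \<omega>) \<partial>M) \<longlongrightarrow> (\<integral>\<omega>. cutoff (real n) (\<zeta> j \<omega>) \<partial>N)) F"
      by (rule conv[of j "cutoff (real n)", OF jm continuous_cutoff]) (simp add: cutoff_bounds)
  qed
  have B8: "B * (\<Sum>j<m. \<integral>\<omega>. cutoff (real n) (\<zeta> j \<omega>) \<partial>N) < e / 4"
  proof -
    have "B * (\<Sum>j<m. \<integral>\<omega>. cutoff (real n) (\<zeta> j \<omega>) \<partial>N) \<le> B * (e / (8 * (B + 1)))"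
      using n B0 by (intro mult_left_mono) auto
    also have "\<dots> < e / 4" using B0 \<open>0 < e\<close> by (simp add: field_simps add_strict_increasing)
    finally show ?thesis .
  qed
  have "\<forall>\<^sub>F i in F. B * (\<Sum>j<m. \<integral>\<omega>. cutoff (real n) (\<xi> i j \<omega>) \<partial>M) < e / 4"
    using order_tendstoD(2)[OF t2 B8] .
  moreover have "\<forall>\<^sub>F i in F. dist (\<Sum>h\<in>H. \<Phi> h * (\<Prod>j<m. \<integral>\<omega>. \<phi> (h j) (\<xi> i j \<omega>) \<partial>M))
     (\<Sum>h\<in>H. \<Phi> h * (\<Prod>j<m. \<integral>\<omega>. \<phi> (h j) (\<zeta> j \<omega>) \<partial>N)) < e / 4"
    using tendstoD[OF t1, of "e / 4"] \<open>0 < e\<close> by simp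
  ultimately show "\<forall>\<^sub>F i in F. dist (\<integral>\<omega>. \<Phi> (\<lambda>j. \<xi> i j \<omega>) \<partial>M) (\<integral>\<omega>. \<Phi> (\<lambda>j. \<zeta> j \<omega>) \<partial>N) < e"
  proof eventually_elim
    case (elim i)
    from integral[OF M ind\<xi> meas\<xi>, of i] integral[OF N ind\<zeta> meas\<zeta>] elim B8
    show ?case unfolding dist_real_def abs_le_iff abs_less_iff by linarith
  qed
qed

section \<open>Characteristic functions\<close>

lemma open_indicator_approx:
  fixes U :: "'b::metric_space set"
  assumes "open U"
  obtains \<phi> :: "nat \<Rightarrow> 'b \<Rightarrow> real" where "\<And>n. continuous_on UNIV (\<phi> n)"
    "\<And>n x. 0 \<le> \<phi> n x \<and> \<phi> n x \<le> 1" "\<And>x. (\<lambda>n. \<phi> n x) \<longlonglongrightarrow> indicator U x"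
proof (cases "U = UNIV")
  \<comment> \<open>Treated separately because \<open>infdist\<close> to the empty complement is
    \<open>0\<close> by convention.\<close>
  case True
  then show ?thesis by (intro that[of "\<lambda>_ _. 1"]) auto
next
  case False
  show ?thesis
  proof (rule that[of "\<lambda>n x. min 1 (real n * infdist x (- U))"])
    show "continuous_on UNIV (\<lambda>x. min 1 (real n * infdist x (- U)))" for n
      by (intro continuous_intros)
    show "0 \<le> min 1 (real n * infdist x (- U)) \<and> min 1 (real n * infdist x (- U)) \<le> 1" for n x
      by (simp add: infdist_nonneg)
    show "(\<lambda>n. min 1 (real n * infdist x (- U))) \<longlonglongrightarrow> indicator U x" for x
    proof (cases "x \<in> U")
      case True
      have "infdist x (- U) \<noteq> 0"
        using in_closed_iff_infdist_zero[of "- U" x] True False assms by (auto simp: closed_Compl)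
      then have pos: "0 < infdist x (- U)" using infdist_nonneg[of x "- U"] by linarith
      obtain k where k: "1 / infdist x (- U) \<le> real k" using real_arch_simple by blast
      have "\<forall>\<^sub>F n in sequentially. min 1 (real n * infdist x (- U)) = 1"
        using eventually_ge_at_top[of k]
      proof eventually_elim
        case (elim n)
        have "1 / infdist x (- U) \<le> real n" using k elim by linarith
        then show ?case using pos by (simp add: field_simps)
      qed
      then show ?thesis using True by (simp add: tendsto_eventually)
    next
      case False
      then show ?thesis by simp
    qed
  qed
qed

lemma distr_eqI_bounded_continuous:
  fixes U :: "'v \<Rightarrow> 'b::metric_space" and V :: "'w \<Rightarrow> 'b"
  assumes P: "prob_space P" and Q: "prob_space Q"
    and [measurable]: "U \<in> borel_measurable P" "V \<in> borel_measurable Q"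
    and eq: "\<And>f. continuous_on UNIV f \<Longrightarrow> (\<And>x. 0 \<le> f x \<and> f x \<le> (1::real)) \<Longrightarrow>
      (\<integral>\<omega>. f (U \<omega>) \<partial>P) = (\<integral>\<omega>. f (V \<omega>) \<partial>Q)"
  shows "distr P borel U = distr Q borel V"
proof (rule measure_eqI_generator_eq[where E = "{S. open S}" and \<Omega> = UNIV and A = "\<lambda>_. UNIV"])
  interpret P: prob_space P by fact
  interpret Q: prob_space Q by fact
  interpret PU: prob_space "distr P borel U" by (rule P.prob_space_distr) simp
  interpret QV: prob_space "distr Q borel V" by (rule Q.prob_space_distr) simp
  show "Int_stable {S::'b set. open S}" by (auto simp: Int_stable_def)
  show "emeasure (distr P borel U) UNIV \<noteq> \<infinity>" by simp
  fix S :: "'b set" assume "S \<in> {S. open S}"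
  then have "open S" by simp
  then have [measurable]: "S \<in> sets borel" by simp
  obtain \<phi> :: "nat \<Rightarrow> 'b \<Rightarrow> real" where \<phi>: "\<And>n. continuous_on UNIV (\<phi> n)"
    "\<And>n x. 0 \<le> \<phi> n x \<and> \<phi> n x \<le> 1" "\<And>x. (\<lambda>n. \<phi> n x) \<longlonglongrightarrow> indicator S x"
    using open_indicator_approx[OF \<open>open S\<close>] by metis
  have [measurable]: "\<phi> n \<in> borel_measurable borel" for n by (rule borel_measurable_continuous_onI[OF \<phi>(1)])
  have "(\<lambda>n. \<integral>\<omega>. \<phi> n (U \<omega>) \<partial>P) \<longlonglongrightarrow> (\<integral>\<omega>. indicator S (U \<omega>) \<partial>P)"
    using \<phi> by (intro integral_dominated_convergence[where w = "\<lambda>_. 1"]) auto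
  moreover have "(\<lambda>n. \<integral>\<omega>. \<phi> n (V \<omega>) \<partial>Q) \<longlonglongrightarrow> (\<integral>\<omega>. indicator S (V \<omega>) \<partial>Q)"
    using \<phi> by (intro integral_dominated_convergence[where w = "\<lambda>_. 1"]) auto
  moreover have "(\<integral>\<omega>. \<phi> n (U \<omega>) \<partial>P) = (\<integral>\<omega>. \<phi> n (V \<omega>) \<partial>Q)" for n
    by (rule eq[OF \<phi>(1,2)])
  ultimately have "(\<integral>\<omega>. indicator S (U \<omega>) \<partial>P) = (\<integral>\<omega>. indicator S (V \<omega>) \<partial>Q :: real)"
    using LIMSEQ_unique by simp
  moreover have "measure (distr P borel U) S = (\<integral>\<omega>. indicator S (U \<omega>) \<partial>P)"
    using integral_distr[of U P borel "indicator S :: 'b \<Rightarrow> real"] by simp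
  moreover have "measure (distr Q borel V) S = (\<integral>\<omega>. indicator S (V \<omega>) \<partial>Q)"
    using integral_distr[of V Q borel "indicator S :: 'b \<Rightarrow> real"] by simp
  ultimately have "measure (distr P borel U) S = measure (distr Q borel V) S" by simp
  then show "emeasure (distr P borel U) S = emeasure (distr Q borel V) S"
    by (simp add: PU.emeasure_eq_measure QV.emeasure_eq_measure)
qed (auto simp: borel_def)

section \<open>Uniqueness of laws through trigonometric polynomials\<close>

inductive trig_poly :: "('a::real_inner \<Rightarrow> real) \<Rightarrow> bool" where
  cos: "trig_poly (\<lambda>x. cos (u \<bullet> x))"
| sin: "trig_poly (\<lambda>x. sin (u \<bullet> x))"
| add: "trig_poly f \<Longrightarrow> trig_poly g \<Longrightarrow> trig_poly (\<lambda>x. f x + g x)"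
| cmult: "trig_poly f \<Longrightarrow> trig_poly (\<lambda>x. c * f x)"

lemma trig_poly_diff: "trig_poly f \<Longrightarrow> trig_poly g \<Longrightarrow> trig_poly (\<lambda>x. f x - g x)"
  using trig_poly.add[OF _ trig_poly.cmult[of g "-1"], of f] by simp

lemma trig_poly_mult_cos: "trig_poly f \<Longrightarrow> trig_poly (\<lambda>x. cos (v \<bullet> x) * f x)"
proof (induction f rule: trig_poly.induct)
  case (cos u)
  have "(\<lambda>x. cos (v \<bullet> x) * cos (u \<bullet> x)) = (\<lambda>x. 1/2 * (cos ((v - u) \<bullet> x) + cos ((v + u) \<bullet> x)))"
    by (simp add: cos_times_cos inner_add_left inner_diff_left)
  then show ?case by (simp only: trig_poly.intros)
next
  case (sin u)
  have "(\<lambda>x. cos (v \<bullet> x) * sin (u \<bullet> x)) = (\<lambda>x. 1/2 * (sin ((v + u) \<bullet> x) - sin ((v - u) \<bullet> x)))"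
    by (simp add: cos_times_sin inner_add_left inner_diff_left)
  then show ?case by (simp only: trig_poly.intros trig_poly_diff)
next
  case (add f g)
  then show ?case by (simp only: distrib_left trig_poly.add)
next
  case (cmult f c)
  from trig_poly.cmult[OF cmult.IH, of c] show ?case by (simp only: mult.left_commute)
qed

lemma trig_poly_mult_sin: "trig_poly f \<Longrightarrow> trig_poly (\<lambda>x. sin (v \<bullet> x) * f x)"
proof (induction f rule: trig_poly.induct)
  case (cos u)
  have "(\<lambda>x. sin (v \<bullet> x) * cos (u \<bullet> x)) = (\<lambda>x. 1/2 * (sin ((v + u) \<bullet> x) + sin ((v - u) \<bullet> x)))"
    by (simp add: sin_times_cos inner_add_left inner_diff_left)
  then show ?case by (simp only: trig_poly.intros)
next
  case (sin u)
  have "(\<lambda>x. sin (v \<bullet> x) * sin (u \<bullet> x)) = (\<lambda>x. 1/2 * (cos ((v - u) \<bullet> x) - cos ((v + u) \<bullet> x)))"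
    by (simp add: sin_times_sin inner_add_left inner_diff_left)
  then show ?case by (simp only: trig_poly.intros trig_poly_diff)
next
  case (add f g)
  then show ?case by (simp only: distrib_left trig_poly.add)
next
  case (cmult f c)
  from trig_poly.cmult[OF cmult.IH, of c] show ?case by (simp only: mult.left_commute)
qed

text \<open>The product-to-sum formulas make trigonometric polynomials an algebra. Products are kept
  out of the introduction rules so that equality of integrals can be proved by induction over rules
  that are all linear.\<close>

lemma trig_poly_mult: "trig_poly f \<Longrightarrow> trig_poly g \<Longrightarrow> trig_poly (\<lambda>x. f x * g x)"
proof (induction f rule: trig_poly.induct)
  case (add f1 f2)
  then show ?case by (simp only: distrib_right trig_poly.add)
next
  case (cmult f c)
  from trig_poly.cmult[OF cmult.IH, of c] cmult.prems show ?case by (simp only: mult.assoc)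
qed (simp_all add: trig_poly_mult_cos trig_poly_mult_sin)

lemma trig_poly_const: "trig_poly (\<lambda>x. c)"
  using trig_poly.cmult[OF trig_poly.cos[of 0], of c] by simp

lemma trig_poly_sum:
  assumes "finite S" "\<And>b. b \<in> S \<Longrightarrow> trig_poly (f b)"
  shows "trig_poly (\<lambda>x. \<Sum>b\<in>S. f b x)"
  using assms by (induction S rule: finite_induct) (auto simp: trig_poly_const intro: trig_poly.add)

text \<open>The map \<open>box_map n\<close> has bounded range and tends to the identity, while polynomials of it are
  trigonometric polynomials; so the Stone-Weierstrass theorem needs only compact sets.\<close>

definition box_map :: "nat \<Rightarrow> 'a::euclidean_space \<Rightarrow> 'a" where
  "box_map n x = (\<Sum>b\<in>Basis. (real n * sin (x \<bullet> b / real n)) *\<^sub>R b)"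

lemma trig_poly_polynomial_box_map:
  "real_polynomial_function p \<Longrightarrow> trig_poly (\<lambda>x. p (box_map n x))"
proof (induction p rule: real_polynomial_function.induct)
  case (linear f)
  then interpret bounded_linear f .
  have "f (box_map n x) = (\<Sum>b\<in>Basis. (real n * f b) * sin ((b /\<^sub>R real n) \<bullet> x))" for x
    unfolding box_map_def by (simp add: sum scaleR inner_commute divide_inverse mult_ac)
  then show ?case by (simp only:) (intro trig_poly_sum trig_poly.cmult trig_poly.sin finite_Basis)
qed (auto intro: trig_poly_const trig_poly_mult trig_poly.add)

lemma box_map_in_cbox: "box_map n x \<in> cbox (- (\<Sum>b\<in>Basis. real n *\<^sub>R b)) (\<Sum>b\<in>Basis. real n *\<^sub>R b)"
proof -
  have "\<bar>real n * sin y\<bar> \<le> real n" for y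
    unfolding abs_mult using mult_left_le[of "\<bar>sin y\<bar>" "real n"] by (simp add: abs_sin_le_one)
  then show ?thesis
    unfolding box_map_def mem_box by (auto simp: inner_sum_left_Basis inner_sum_left inner_Basis abs_le_iff if_distrib cong: if_cong) (smt (verit) minus_le_iff)
qed

lemma continuous_box_map: "continuous_on UNIV (box_map n)"
proof (cases "n = 0")
  case False
  then show ?thesis unfolding box_map_def by (intro continuous_intros) auto
qed (simp add: box_map_def)

lemma box_map_tendsto: "(\<lambda>n. box_map n x) \<longlonglongrightarrow> x"
proof -
  have "(\<lambda>n. real n * sin (y / real n)) \<longlonglongrightarrow> y" for y :: real
  proof (cases "y = 0")
    case False
    have "((\<lambda>z. sin z / z) \<longlongrightarrow> 1) (at (0::real))"
      using DERIV_sin[of 0] by (simp add: has_field_derivative_iff)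
    moreover have "filterlim (\<lambda>n. y / real n) (at 0) sequentially"
      using False unfolding filterlim_at
      by (auto intro: lim_const_over_n eventually_mono[OF eventually_gt_at_top[of 0]])
    ultimately have "(\<lambda>n. sin (y / real n) / (y / real n)) \<longlonglongrightarrow> 1" by (rule filterlim_compose)
    then have "(\<lambda>n. y * (sin (y / real n) / (y / real n))) \<longlonglongrightarrow> y * 1" by (intro tendsto_intros)
    then show ?thesis using False by (simp add: field_simps)
  qed simp
  then have "(\<lambda>n. box_map n x) \<longlonglongrightarrow> (\<Sum>b\<in>Basis. (x \<bullet> b) *\<^sub>R b)"
    unfolding box_map_def by (intro tendsto_sum tendsto_scaleR tendsto_const)
  then show ?thesis by (simp add: euclidean_representation)
qed

text \<open>After composition with \<open>box_map n\<close> only the values of \<open>f\<close> on a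
  compact box matter. There Stone-Weierstrass approximates \<open>f\<close> uniformly by a
  polynomial, which becomes a trigonometric polynomial in the original variable. Then
  \<open>n\<close> tends to infinity by dominated convergence.\<close>

lemma distr_eqI_cos_sin:
  fixes U :: "'v \<Rightarrow> 'a::euclidean_space" and V :: "'w \<Rightarrow> 'a"
  assumes P: "prob_space P" and Q: "prob_space Q"
    and [measurable]: "U \<in> borel_measurable P" "V \<in> borel_measurable Q"
    and c: "\<And>u. (\<integral>\<omega>. cos (u \<bullet> U \<omega>) \<partial>P) = (\<integral>\<omega>. cos (u \<bullet> V \<omega>) \<partial>Q)"
    and s: "\<And>u. (\<integral>\<omega>. sin (u \<bullet> U \<omega>) \<partial>P) = (\<integral>\<omega>. sin (u \<bullet> V \<omega>) \<partial>Q)"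
  shows "distr P borel U = distr Q borel V"
proof (rule distr_eqI_bounded_continuous[OF P Q])
  interpret P: prob_space P by fact
  interpret Q: prob_space Q by fact
  have trig: "integrable P (\<lambda>\<omega>. f (U \<omega>)) \<and> integrable Q (\<lambda>\<omega>. f (V \<omega>)) \<and>
     (\<integral>\<omega>. f (U \<omega>) \<partial>P) = (\<integral>\<omega>. f (V \<omega>) \<partial>Q)" if "trig_poly f" for f
    using that
  proof (induction f rule: trig_poly.induct)
    case (cos u)
    show ?case using c by (auto intro!: P.integrable_const_bound[where B = 1] Q.integrable_const_bound[where B = 1])
  next
    case (sin u)
    show ?case using s by (auto intro!: P.integrable_const_bound[where B = 1] Q.integrable_const_bound[where B = 1])
  qed auto
  fix f :: "'a \<Rightarrow> real" assume f: "continuous_on UNIV f" "\<And>x. 0 \<le> f x \<and> f x \<le> 1"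
  have [measurable]: "f \<in> borel_measurable borel" "box_map n \<in> borel_measurable borel" for n
    by (rule borel_measurable_continuous_onI, fact f continuous_box_map)+
  have box: "(\<integral>\<omega>. f (box_map n (U \<omega>)) \<partial>P) = (\<integral>\<omega>. f (box_map n (V \<omega>)) \<partial>Q)" for n
  proof -
    have "\<bar>(\<integral>\<omega>. f (box_map n (U \<omega>)) \<partial>P) - (\<integral>\<omega>. f (box_map n (V \<omega>)) \<partial>Q)\<bar> \<le> 0 + e" if "0 < e" for e
    proof -
      define S where "S = cbox (- (\<Sum>b\<in>Basis. real n *\<^sub>R b)) (\<Sum>b\<in>Basis. real n *\<^sub>R b :: 'a)"
      have "compact S" "continuous_on S f"
        using f(1) by (auto simp: S_def intro: continuous_on_subset)
      then obtain p where p: "real_polynomial_function p" "\<And>x. x \<in> S \<Longrightarrow> \<bar>f x - p x\<bar> < e / 2"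
        using Stone_Weierstrass_real_polynomial_function[of S f "e / 2"] \<open>0 < e\<close> by (metis half_gt_zero)
      note t = trig[OF trig_poly_polynomial_box_map[OF p(1), of n]]
      have pf: "\<bar>f (box_map n x) - p (box_map n x)\<bar> \<le> e / 2" for x
        using p(2)[of "box_map n x"] box_map_in_cbox[of n x] unfolding S_def by simp
      have iP: "integrable P (\<lambda>\<omega>. f (box_map n (U \<omega>)))" and iQ: "integrable Q (\<lambda>\<omega>. f (box_map n (V \<omega>)))"
        using f(2) by (auto intro!: P.integrable_const_bound[where B = 1] Q.integrable_const_bound[where B = 1])
      have "\<bar>\<integral>\<omega>. f (box_map n (U \<omega>)) - p (box_map n (U \<omega>)) \<partial>P\<bar> \<le> (\<integral>\<omega>. e / 2 \<partial>P)"
        using iP t pf by (intro order_trans[OF integral_abs_bound] integral_mono) auto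
      moreover have "\<bar>\<integral>\<omega>. f (box_map n (V \<omega>)) - p (box_map n (V \<omega>)) \<partial>Q\<bar> \<le> (\<integral>\<omega>. e / 2 \<partial>Q)"
        using iQ t pf by (intro order_trans[OF integral_abs_bound] integral_mono) auto
      ultimately show ?thesis
        using iP iQ t by (simp add: P.prob_space Q.prob_space) (auto simp: abs_if split: if_splits)
    qed
    then have "\<bar>(\<integral>\<omega>. f (box_map n (U \<omega>)) \<partial>P) - (\<integral>\<omega>. f (box_map n (V \<omega>)) \<partial>Q)\<bar> \<le> 0"
      by (rule field_le_epsilon)
    then show ?thesis by simp
  qed
  have lim: "(\<lambda>n. f (box_map n x)) \<longlonglongrightarrow> f x" for x
    using f(1) by (intro isCont_tendsto_compose[OF _ box_map_tendsto]) (simp add: continuous_on_eq_continuous_at)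
  have "(\<lambda>n. \<integral>\<omega>. f (box_map n (U \<omega>)) \<partial>P) \<longlonglongrightarrow> (\<integral>\<omega>. f (U \<omega>) \<partial>P)"
    using f(2) lim by (intro integral_dominated_convergence[where w = "\<lambda>_. 1"]) auto
  moreover have "(\<lambda>n. \<integral>\<omega>. f (box_map n (V \<omega>)) \<partial>Q) \<longlonglongrightarrow> (\<integral>\<omega>. f (V \<omega>) \<partial>Q)"
    using f(2) lim by (intro integral_dominated_convergence[where w = "\<lambda>_. 1"]) auto
  ultimately show "(\<integral>\<omega>. f (U \<omega>) \<partial>P) = (\<integral>\<omega>. f (V \<omega>) \<partial>Q)"
    unfolding box by (rule LIMSEQ_unique)
qed fact+

definition char_fun :: "'v measure \<Rightarrow> ('v \<Rightarrow> 'a::euclidean_space) \<Rightarrow> 'a \<Rightarrow> complex" where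
  "char_fun P U u = (\<integral>\<omega>. cis (u \<bullet> U \<omega>) \<partial>P)"

lemma measurable_cis[measurable]: "cis \<in> borel_measurable borel"
  by (intro borel_measurable_continuous_onI continuous_on_cis continuous_on_id)

lemma (in prob_space) integrable_cis:
  "V \<in> borel_measurable M \<Longrightarrow> integrable M (\<lambda>\<omega>. cis (V \<omega>))"
  by (rule integrable_const_bound[where B = 1]) auto

lemma char_fun_distr_cong:
  assumes "U \<in> borel_measurable P" "V \<in> borel_measurable Q" "distr P borel U = distr Q borel V"
  shows "char_fun P U u = char_fun Q V u"
proof -
  have "char_fun P U u = (\<integral>x. cis (u \<bullet> x) \<partial>distr P borel U)"
    unfolding char_fun_def using assms(1) by (subst integral_distr) auto
  also have "\<dots> = char_fun Q V u"
    unfolding char_fun_def assms(3) using assms(2) by (subst integral_distr) auto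
  finally show ?thesis .
qed

lemma distr_eqI_char_fun:
  fixes U :: "'v \<Rightarrow> 'a::euclidean_space" and V :: "'w \<Rightarrow> 'a"
  assumes P: "prob_space P" and Q: "prob_space Q"
    and [measurable]: "U \<in> borel_measurable P" "V \<in> borel_measurable Q"
    and eq: "\<And>u. char_fun P U u = char_fun Q V u"
  shows "distr P borel U = distr Q borel V"
proof (rule distr_eqI_cos_sin[OF P Q])
  interpret P: prob_space P by fact
  interpret Q: prob_space Q by fact
  fix u
  have "integrable P (\<lambda>\<omega>. cis (u \<bullet> U \<omega>))" "integrable Q (\<lambda>\<omega>. cis (u \<bullet> V \<omega>))"
    by (intro P.integrable_cis Q.integrable_cis; measurable)+
  then have "Re (char_fun P U u) = (\<integral>\<omega>. cos (u \<bullet> U \<omega>) \<partial>P)" "Re (char_fun Q V u) = (\<integral>\<omega>. cos (u \<bullet> V \<omega>) \<partial>Q)"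
     "Im (char_fun P U u) = (\<integral>\<omega>. sin (u \<bullet> U \<omega>) \<partial>P)" "Im (char_fun Q V u) = (\<integral>\<omega>. sin (u \<bullet> V \<omega>) \<partial>Q)"
    unfolding char_fun_def by (simp_all flip: integral_Re integral_Im)
  with eq[of u] show "(\<integral>\<omega>. cos (u \<bullet> U \<omega>) \<partial>P) = (\<integral>\<omega>. cos (u \<bullet> V \<omega>) \<partial>Q)"
     "(\<integral>\<omega>. sin (u \<bullet> U \<omega>) \<partial>P) = (\<integral>\<omega>. sin (u \<bullet> V \<omega>) \<partial>Q)" by auto
qed fact+

lemma char_fun_tendsto:
  assumes "prob_space P" "\<And>n. U n \<in> borel_measurable P" "V \<in> borel_measurable P"
    and "\<And>\<omega>. \<omega> \<in> space P \<Longrightarrow> (\<lambda>n. U n \<omega>) \<longlonglongrightarrow> V \<omega>"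
  shows "(\<lambda>n. char_fun P (U n) u) \<longlonglongrightarrow> char_fun P V u"
proof -
  interpret prob_space P by fact
  note [measurable] = assms(2,3)
  show ?thesis
    unfolding char_fun_def
  proof (rule integral_dominated_convergence[where w = "\<lambda>_. 1"])
    show "AE x in P. (\<lambda>i. cis (u \<bullet> U i x)) \<longlonglongrightarrow> cis (u \<bullet> V x)"
      using assms(4) by (auto intro!: AE_I2 tendsto_intros tendsto_cis)
  qed auto
qed

lemma continuous_char_fun:
  fixes U :: "'v \<Rightarrow> 'a::euclidean_space"
  assumes "prob_space P" and [measurable]: "U \<in> borel_measurable P"
  shows "continuous_on UNIV (char_fun P U)"
proof (rule continuous_at_imp_continuous_on, intro ballI, rule continuous_at_sequentiallyI)
  interpret prob_space P by fact
  fix u :: 'a and x :: "nat \<Rightarrow> 'a" assume x: "x \<longlonglongrightarrow> u"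
  have "(\<lambda>n. cis (x n \<bullet> U \<omega>)) \<longlonglongrightarrow> cis (u \<bullet> U \<omega>)" for \<omega>
    using x by (auto intro!: tendsto_intros tendsto_cis)
  then show "(\<lambda>n. char_fun P U (x n)) \<longlonglongrightarrow> char_fun P U u"
    unfolding char_fun_def
    by (intro integral_dominated_convergence[where w = "\<lambda>_. 1"]) auto
qed

section \<open>Marginal laws of Levy processes\<close>

context levy_process
begin

lemma indep_increment_pair:
  assumes "0 \<le> s" "0 \<le> t"
  shows "char_fun M (X (s + t)) u = char_fun M (X s) u * char_fun M (X t) u"
proof -
  \<comment> \<open>Increments are indexed by an infinite increasing sequence of times, so
    \<open>0, s, s + t\<close> is continued by a constant.\<close>
  define \<tau> where "\<tau> i = (if i = 0 then 0 else if i = Suc 0 then s else s + t)" for i :: nat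
  have "incseq \<tau>" unfolding incseq_def \<tau>_def using assms by auto
  then have "indep_vars (\<lambda>_. borel) (\<lambda>i \<omega>. X (\<tau> (Suc i)) \<omega> - X (\<tau> i) \<omega>) {..<2}"
    by (rule independent_increments[rotated]) (simp add: \<tau>_def)
  then have "indep_vars (\<lambda>_. borel) (\<lambda>i \<omega>. cis (u \<bullet> (X (\<tau> (Suc i)) \<omega> - X (\<tau> i) \<omega>))) {..<2}"
    by (rule indep_vars_compose2) simp
  moreover have [measurable]: "X r \<in> borel_measurable M" if "0 \<le> r" for r using measurable_X that .
  have m: "(\<lambda>\<omega>. X (s + t) \<omega> - X s \<omega>) \<in> borel_measurable M" "X s \<in> borel_measurable M"
    "X (s + t) \<in> borel_measurable M" "X t \<in> borel_measurable M" "X 0 \<in> borel_measurable M"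
    using assms by simp_all
  have "integrable M (\<lambda>\<omega>. cis (u \<bullet> (X (\<tau> (Suc i)) \<omega> - X (\<tau> i) \<omega>)))" for i
  proof (rule integrable_cis)
    have "0 \<le> \<tau> i" "0 \<le> \<tau> (Suc i)" using assms by (auto simp: \<tau>_def)
    then have [measurable]: "X (\<tau> i) \<in> borel_measurable M" "X (\<tau> (Suc i)) \<in> borel_measurable M" by simp_all
    show "(\<lambda>\<omega>. u \<bullet> (X (\<tau> (Suc i)) \<omega> - X (\<tau> i) \<omega>)) \<in> borel_measurable M" by measurable
  qed
  ultimately have "(\<integral>\<omega>. (\<Prod>i<2. cis (u \<bullet> (X (\<tau> (Suc i)) \<omega> - X (\<tau> i) \<omega>))) \<partial>M) =
     (\<Prod>i<2. \<integral>\<omega>. cis (u \<bullet> (X (\<tau> (Suc i)) \<omega> - X (\<tau> i) \<omega>)) \<partial>M)"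
    by (intro indep_vars_lebesgue_integral) auto
  also have "(\<integral>\<omega>. (\<Prod>i<2. cis (u \<bullet> (X (\<tau> (Suc i)) \<omega> - X (\<tau> i) \<omega>))) \<partial>M) = char_fun M (X (s + t)) u"
    unfolding char_fun_def
    by (intro Bochner_Integration.integral_cong)
       (auto simp: numeral_2_eq_2 \<tau>_def start_origin cis_mult inner_diff_right)
  also have "(\<Prod>i<2. \<integral>\<omega>. cis (u \<bullet> (X (\<tau> (Suc i)) \<omega> - X (\<tau> i) \<omega>)) \<partial>M)
     = char_fun M (\<lambda>\<omega>. X s \<omega> - X 0 \<omega>) u * char_fun M (\<lambda>\<omega>. X (s + t) \<omega> - X s \<omega>) u"
    unfolding char_fun_def by (simp add: numeral_2_eq_2 \<tau>_def)
  also have "char_fun M (\<lambda>\<omega>. X s \<omega> - X 0 \<omega>) u = char_fun M (X s) u"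
    unfolding char_fun_def by (intro Bochner_Integration.integral_cong) (auto simp: start_origin)
  also have "char_fun M (\<lambda>\<omega>. X (s + t) \<omega> - X s \<omega>) u = char_fun M (X t) u"
    using m stationary_increments[OF assms] by (intro char_fun_distr_cong) auto
  finally show ?thesis .
qed

lemma char_fun_power:
  assumes "0 \<le> r"
  shows "char_fun M (X (real k * r)) u = char_fun M (X r) u ^ k"
proof (induction k)
  case 0
  have "char_fun M (X 0) u = (\<integral>\<omega>. 1 \<partial>M)"
    unfolding char_fun_def by (intro Bochner_Integration.integral_cong) (auto simp: start_origin)
  then show ?case by (simp add: prob_space)
next
  case (Suc k)
  have "real (Suc k) * r = r + real k * r" by (simp add: algebra_simps)
  then show ?case using Suc indep_increment_pair[of r "real k * r" u] assms by simp
qed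

lemma paths_right_continuous:
  assumes "\<omega> \<in> space M" "0 \<le> r" "r_seq \<longlonglongrightarrow> r" "\<And>n. r \<le> r_seq n"
  shows "(\<lambda>n. X (r_seq n) \<omega>) \<longlonglongrightarrow> X r \<omega>"
proof -
  have "((\<lambda>t. X t \<omega>) \<longlongrightarrow> X r \<omega>) (at_right r)"
    using cadlag_paths[OF assms(1)] assms(2) unfolding cadlag_def by blast
  then have "((\<lambda>t. X t \<omega>) \<longlongrightarrow> X r \<omega>) (at r within {r..})"
    by (simp add: at_within_Ici_at_right)
  then have "continuous (at r within {r..}) (\<lambda>t. X t \<omega>)" by (simp add: continuous_within)
  then show ?thesis using assms(3,4)
    by (intro continuous_within_tendsto_compose'[of r "{r..}" "\<lambda>t. X t \<omega>" r_seq]) auto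
qed

lemma char_fun_right_continuous:
  assumes "0 \<le> r" "r_seq \<longlonglongrightarrow> r" "\<And>n. r \<le> r_seq n"
  shows "(\<lambda>n. char_fun M (X (r_seq n)) u) \<longlonglongrightarrow> char_fun M (X r) u"
proof (rule char_fun_tendsto[OF prob_space_axioms])
  show "X (r_seq n) \<in> borel_measurable M" for n using assms(1) assms(3)[of n] by (intro measurable_X) linarith
  show "X r \<in> borel_measurable M" using assms(1) by (rule measurable_X)
qed (rule paths_right_continuous[OF _ assms])

end

text \<open>Fubini turns the identity of laws into a functional equation for the characteristic
  function along the ray through \<open>u\<close>: a product for a sum of the parameters
  \<open>a\<close> and \<open>b\<close>.\<close>

lemma strictly_stable_char_fun:
  fixes \<eta> :: "'v \<Rightarrow> 'a::euclidean_space"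
  assumes "strictly_stable \<alpha> N \<eta>" "0 < a" "0 < b"
  shows "char_fun N \<eta> (a powr (1 / \<alpha>) *\<^sub>R u) * char_fun N \<eta> (b powr (1 / \<alpha>) *\<^sub>R u)
    = char_fun N \<eta> ((a + b) powr (1 / \<alpha>) *\<^sub>R u)"
proof -
  from assms have [measurable]: "\<eta> \<in> borel_measurable N" and N: "prob_space N"
    and eq: "distr (N \<Otimes>\<^sub>M N) borel (\<lambda>(u, v). a powr (1 / \<alpha>) *\<^sub>R \<eta> u + b powr (1 / \<alpha>) *\<^sub>R \<eta> v) =
        distr N borel (\<lambda>u. (a + b) powr (1 / \<alpha>) *\<^sub>R \<eta> u)"
    unfolding strictly_stable_def by auto
  interpret N: prob_space N by fact
  interpret NN: pair_prob_space N N ..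
  define A B where "A = a powr (1 / \<alpha>)" and "B = b powr (1 / \<alpha>)"
  have "char_fun N \<eta> ((a + b) powr (1 / \<alpha>) *\<^sub>R u) = char_fun N (\<lambda>v. (a + b) powr (1 / \<alpha>) *\<^sub>R \<eta> v) u"
    by (simp add: char_fun_def)
  also have "\<dots> = char_fun (N \<Otimes>\<^sub>M N) (\<lambda>(v, w). A *\<^sub>R \<eta> v + B *\<^sub>R \<eta> w) u"
    unfolding A_def B_def by (intro char_fun_distr_cong eq[symmetric]) measurable
  also have "\<dots> = (\<integral>v. (\<integral>w. cis (u \<bullet> (A *\<^sub>R \<eta> v + B *\<^sub>R \<eta> w)) \<partial>N) \<partial>N)"
    unfolding char_fun_def
    by (subst NN.integral_fst'[symmetric]) (auto intro!: NN.integrable_const_bound[where B = 1])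
  also have "\<dots> = (\<integral>v. (\<integral>w. cis ((A *\<^sub>R u) \<bullet> \<eta> v) * cis ((B *\<^sub>R u) \<bullet> \<eta> w) \<partial>N) \<partial>N)"
    by (simp add: cis_mult inner_add_right)
  also have "\<dots> = char_fun N \<eta> (A *\<^sub>R u) * char_fun N \<eta> (B *\<^sub>R u)"
    unfolding char_fun_def by simp
  finally show ?thesis unfolding A_def B_def ..
qed

text \<open>A Levy process and the scaled stable law have characteristic functions with the same
  \<open>n\<close>-th power at time \<open>1/n\<close>; continuity in the argument and connectedness identify the roots.\<close>

lemma levy_strictly_stable_marginal:
  fixes \<eta> :: "'v \<Rightarrow> 'a::euclidean_space" and Y :: "real \<Rightarrow> 'u \<Rightarrow> 'a"
  assumes Y: "levy_process M' Y" and st: "strictly_stable \<alpha> N \<eta>"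
    and law: "distr M' borel (Y 1) = distr N borel \<eta>" and "0 < r"
  shows "distr M' borel (Y r) = distr N borel (\<lambda>v. r powr (1 / \<alpha>) *\<^sub>R \<eta> v)"
proof -
  interpret Y: levy_process M' Y by fact
  from st have [measurable]: "\<eta> \<in> borel_measurable N" and N: "prob_space N" and "0 < \<alpha>"
    unfolding strictly_stable_def by auto
  interpret N: prob_space N by fact
  define \<phi> where "\<phi> r u = char_fun M' (Y r) u" for r u
  define \<psi> where "\<psi> r u = char_fun N \<eta> (r powr (1 / \<alpha>) *\<^sub>R u)" for r u
  have one: "\<phi> 1 u = \<psi> 1 u" for u
    unfolding \<phi>_def \<psi>_def using law Y.measurable_X by (auto intro!: char_fun_distr_cong)
  have \<psi>_pow: "\<psi> (real (Suc k) * s) u = \<psi> s u ^ Suc k" if "0 < s" for k s u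
  proof (induction k)
    case (Suc k)
    have "real (Suc (Suc k)) * s = s + real (Suc k) * s" by (simp add: algebra_simps)
    then have "\<psi> (real (Suc (Suc k)) * s) u = \<psi> s u * \<psi> (real (Suc k) * s) u"
      unfolding \<psi>_def using that by (simp add: strictly_stable_char_fun[OF st] add_pos_pos)
    then show ?case by (simp only: Suc power_Suc)
  qed simp
  have \<phi>_pow: "\<phi> (real k * s) u = \<phi> s u ^ k" if "0 \<le> s" for k s u
    unfolding \<phi>_def using that by (rule Y.char_fun_power)
  \<comment> \<open>\<open>\<phi> 1 u\<close> is a power of
    \<open>\<phi> (1 / real (Suc n)) u\<close>, which for large \<open>n\<close> is close to
    \<open>\<phi> 0 u = 1\<close> by right continuity.\<close>
  have nz1: "\<phi> 1 u \<noteq> 0" for u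
  proof -
    have "(\<lambda>n. \<phi> (1 / real (Suc n)) u) \<longlonglongrightarrow> \<phi> 0 u"
      unfolding \<phi>_def by (intro Y.char_fun_right_continuous LIMSEQ_Suc lim_1_over_n) auto
    moreover have "\<phi> 0 u = 1" using \<phi>_pow[of 0 0 u] by simp
    ultimately have "\<forall>\<^sub>F n in sequentially. dist (\<phi> (1 / real (Suc n)) u) 1 < 1" by (intro tendstoD) auto
    then obtain n where "dist (\<phi> (1 / real (Suc n)) u) 1 < 1"
      using eventually_happens'[OF sequentially_bot] by blast
    then have "\<phi> (1 / real (Suc n)) u \<noteq> 0" by auto
    moreover have "\<phi> 1 u = \<phi> (1 / real (Suc n)) u ^ Suc n"
      using \<phi>_pow[of "1 / real (Suc n)" "Suc n" u] by (simp del: power_Suc)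
    ultimately show ?thesis by simp
  qed
  have root: "\<phi> (1 / real (Suc n)) u = \<psi> (1 / real (Suc n)) u" for n u
  proof -
    define s where "s = 1 / real (Suc n)"
    have s: "0 < s" "real (Suc n) * s = 1" by (simp_all add: s_def)
    have pw: "\<phi> s u ^ Suc n = \<phi> 1 u" "\<psi> s u ^ Suc n = \<phi> 1 u" for u
      using \<phi>_pow[of s "Suc n" u] \<psi>_pow[OF s(1), of n u] s one by (auto simp del: power_Suc)
    have nz: "\<phi> s u \<noteq> 0" "\<psi> s u \<noteq> 0" for u
      using pw[of u] nz1[of u] by auto
    define q where "q u = \<phi> s u / \<psi> s u" for u
    have c\<phi>: "continuous_on UNIV (\<phi> s)"
      unfolding \<phi>_def using s(1) by (intro continuous_char_fun Y.prob_space_axioms Y.measurable_X) simp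
    have c\<psi>: "continuous_on UNIV (\<psi> s)"
      unfolding \<psi>_def
      by (rule continuous_on_compose2[OF continuous_char_fun[OF N]]) (auto intro!: continuous_intros)
    have "continuous_on UNIV q"
      unfolding q_def using c\<phi> c\<psi> nz by (intro continuous_on_divide) auto
    moreover have "finite (q ` UNIV)"
    proof (rule finite_subset)
      show "q ` UNIV \<subseteq> {z. z ^ Suc n = 1}"
        using pw nz1 by (auto simp: q_def power_divide simp del: power_Suc)
      show "finite {z::complex. z ^ Suc n = 1}" by (rule finite_roots_unity) simp
    qed
    ultimately have "q constant_on UNIV"
      by (intro continuous_finite_range_constant) auto
    then have "q u = q 0" unfolding constant_on_def by auto
    moreover have "q 0 = 1" by (simp add: q_def \<phi>_def \<psi>_def char_fun_def Y.prob_space N.prob_space)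
    ultimately show ?thesis using nz[of u] by (simp add: q_def s_def)
  qed
  have rat: "\<phi> (real (Suc k) * (1 / real (Suc n))) u = \<psi> (real (Suc k) * (1 / real (Suc n))) u" for k n u
    using \<phi>_pow[of "1 / real (Suc n)" "Suc k" u] \<psi>_pow[of "1 / real (Suc n)" k u] root[of n u] by simp
  have "\<phi> r u = \<psi> r u" for u
  proof -
    \<comment> \<open>Rational approximations from above, since the paths are only right continuous;
      they have the form covered by \<open>rat\<close>.\<close>
    define r' where "r' n = real (Suc (nat \<lfloor>r * real (Suc n)\<rfloor>)) * (1 / real (Suc n))" for n
    have fl: "r * real (Suc n) < real (Suc (nat \<lfloor>r * real (Suc n)\<rfloor>))"
       "real (Suc (nat \<lfloor>r * real (Suc n)\<rfloor>)) \<le> r * real (Suc n) + 1" for n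
    proof -
      have "0 \<le> r * real (Suc n)" using \<open>0 < r\<close> by simp
      then show "r * real (Suc n) < real (Suc (nat \<lfloor>r * real (Suc n)\<rfloor>))"
       "real (Suc (nat \<lfloor>r * real (Suc n)\<rfloor>)) \<le> r * real (Suc n) + 1" by linarith+
    qed
    have ge: "r \<le> r' n" for n using fl(1)[of n] by (simp add: r'_def field_simps del: of_nat_Suc)
    have le: "r' n \<le> r + 1 / real (Suc n)" for n
      using fl(2)[of n] by (simp add: r'_def field_simps del: of_nat_Suc)
    have "(\<lambda>n. r + 1 / real (Suc n)) \<longlonglongrightarrow> r + 0"
      by (intro tendsto_intros LIMSEQ_Suc lim_1_over_n)
    then have r': "r' \<longlonglongrightarrow> r"
      using ge le by (intro tendsto_sandwich[of "\<lambda>_. r" r' sequentially "\<lambda>n. r + 1 / real (Suc n)"]) auto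
    have t1: "(\<lambda>n. \<phi> (r' n) u) \<longlonglongrightarrow> \<phi> r u"
      unfolding \<phi>_def using ge r' \<open>0 < r\<close> by (intro Y.char_fun_right_continuous) auto
    have t2: "(\<lambda>n. \<psi> (r' n) u) \<longlonglongrightarrow> \<psi> r u"
      unfolding \<psi>_def
    proof (rule isCont_tendsto_compose[where g = "char_fun N \<eta>"])
      show "isCont (char_fun N \<eta>) (r powr (1 / \<alpha>) *\<^sub>R u)"
        using continuous_char_fun[OF N, of \<eta>] by (simp add: continuous_on_eq_continuous_at)
      show "(\<lambda>n. r' n powr (1 / \<alpha>) *\<^sub>R u) \<longlonglongrightarrow> r powr (1 / \<alpha>) *\<^sub>R u"
        using r' \<open>0 < r\<close> by (intro tendsto_intros) auto
    qed
    have "\<phi> (r' n) u = \<psi> (r' n) u" for n unfolding r'_def by (rule rat)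
    with t1 have "(\<lambda>n. \<psi> (r' n) u) \<longlonglongrightarrow> \<phi> r u" by simp
    from LIMSEQ_unique[OF this t2] show ?thesis .
  qed
  then show ?thesis
    using \<open>0 < r\<close> by (intro distr_eqI_char_fun Y.prob_space_axioms N Y.measurable_X)
      (auto simp: \<phi>_def \<psi>_def char_fun_def)
qed

section \<open>First exit of a cadlag path\<close>

lemma cadlag_tendsto:
  assumes "cadlag x" "0 \<le> r" "(s \<longlongrightarrow> r) F" "\<forall>\<^sub>F i in F. r \<le> s i"
  shows "((\<lambda>i. x (s i)) \<longlongrightarrow> x r) F"
proof -
  have "(x \<longlongrightarrow> x r) (at_right r)" using assms(1,2) unfolding cadlag_def by blast
  then have "(x \<longlongrightarrow> x r) (at r within {r..})" by (simp add: at_within_Ici_at_right)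
  then have "continuous (at r within {r..}) x" by (simp add: continuous_within)
  then show ?thesis using assms(3,4)
    by (intro continuous_within_tendsto_compose[of r "{r..}" x s]) auto
qed

lemma cadlag_shift:
  fixes x :: "real \<Rightarrow> 'a::real_normed_vector"
  assumes "cadlag x" "0 \<le> r"
  shows "cadlag (\<lambda>s. x (r + s) - c)"
  unfolding cadlag_def
proof (intro conjI allI impI)
  fix t :: real assume "0 \<le> t"
  have "((\<lambda>s. x (r + s)) \<longlongrightarrow> x (r + t)) (at_right t)"
    using assms \<open>0 \<le> t\<close>
    by (intro cadlag_tendsto[OF assms(1)] tendsto_intros) (auto simp: eventually_at_right_less intro: eventually_mono[OF eventually_at_right_less])
  then show "((\<lambda>s. x (r + s) - c) \<longlongrightarrow> x (r + t) - c) (at_right t)" by (intro tendsto_intros)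
next
  fix t :: real assume "0 < t"
  then obtain y where y: "(x \<longlongrightarrow> y) (at_left (r + t))"
    using assms unfolding cadlag_def by (metis add_nonneg_pos)
  have "filterlim (\<lambda>s. r + s) (at_left (r + t)) (at_left t)"
    unfolding filterlim_at by (intro conjI tendsto_intros) (simp add: eventually_at_filter)
  from filterlim_compose[OF y this] have "((\<lambda>s. x (r + s)) \<longlongrightarrow> y) (at_left t)" .
  then have "((\<lambda>s. x (r + s) - c) \<longlongrightarrow> y - c) (at_left t)" by (intro tendsto_intros)
  then show "\<exists>y. ((\<lambda>s. x (r + s) - c) \<longlongrightarrow> y) (at_left t)" by blast
qed

text \<open>The exit time is read off the dyadic times only, so that it makes sense on the product space
  of all paths; \<open>lim\<close> is only meaningful on cadlag paths that leave the ball.\<close>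

definition exits :: "(real \<Rightarrow> 'a::euclidean_space) \<Rightarrow> bool" where
  "exits x \<longleftrightarrow> (\<exists>n k. 1 < norm (x (real k / 2 ^ n)))"

definition first_idx :: "nat \<Rightarrow> (real \<Rightarrow> 'a::euclidean_space) \<Rightarrow> nat" where
  "first_idx n x = (LEAST k. 1 < norm (x (real k / 2 ^ n)))"

definition grid_time :: "nat \<Rightarrow> (real \<Rightarrow> 'a::euclidean_space) \<Rightarrow> real" where
  "grid_time n x = real (first_idx n x) / 2 ^ n"

definition hit_time :: "(real \<Rightarrow> 'a::euclidean_space) \<Rightarrow> real" where
  "hit_time x = (if exits x then lim (\<lambda>n. grid_time n x) else 0)"

definition hit_pos :: "(real \<Rightarrow> 'a::euclidean_space) \<Rightarrow> 'a" where
  "hit_pos x = (if exits x then lim (\<lambda>n. x (grid_time n x)) else x 0)"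

text \<open>The value for a path without exit agrees with the default \<open>hit_time x = 0\<close>,
  so that \<open>post_path_eq\<close> needs no assumption that the path exits.\<close>

definition post_path :: "(real \<Rightarrow> 'a::euclidean_space) \<Rightarrow> real \<Rightarrow> 'a" where
  "post_path x s = (if exits x then lim (\<lambda>n. x (grid_time n x + s) - x (grid_time n x)) else x s - x 0)"

lemma grid_time_nonneg: "0 \<le> grid_time n x"
  by (simp add: grid_time_def)

text \<open>All these functionals read the path at nonnegative times only. Restricting a path to
  \<open>{0..}\<close>, as membership in the product space demands, therefore does not change
  them.\<close>

lemma path_cong:
  assumes "\<And>t. 0 \<le> t \<Longrightarrow> x t = y t"
  shows "exits x = exits y" "first_idx n x = first_idx n y" "grid_time n x = grid_time n y"
    "hit_time x = hit_time y" "hit_pos x = hit_pos y" "0 \<le> s \<Longrightarrow> post_path x s = post_path y s"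
proof -
  show e: "exits x = exits y" by (simp add: exits_def assms)
  show "first_idx n x = first_idx n y" for n by (simp add: first_idx_def assms)
  then show g: "grid_time n x = grid_time n y" for n by (simp add: grid_time_def)
  show "hit_time x = hit_time y" by (simp add: hit_time_def e g)
  show "hit_pos x = hit_pos y" by (simp add: hit_pos_def e g assms grid_time_nonneg)
  show "0 \<le> s \<Longrightarrow> post_path x s = post_path y s"
    by (simp add: post_path_def e g assms grid_time_nonneg)
qed

locale cadlag_path =
  fixes x :: "real \<Rightarrow> 'a::euclidean_space"
  assumes cadlag: "cadlag x" and start: "x 0 = 0"
begin

lemma right_cont: "0 \<le> r \<Longrightarrow> (s \<longlongrightarrow> r) F \<Longrightarrow> \<forall>\<^sub>F i in F. r \<le> s i \<Longrightarrow> ((\<lambda>i. x (s i)) \<longlongrightarrow> x r) F"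
  using cadlag by (rule cadlag_tendsto)

lemma outside_persists:
  assumes "0 \<le> t" "1 < norm (x t)"
  obtains b where "t < b" "\<And>s. t \<le> s \<Longrightarrow> s < b \<Longrightarrow> 1 < norm (x s)"
proof -
  have "(x \<longlongrightarrow> x t) (at_right t)" using cadlag assms unfolding cadlag_def by blast
  then have "((\<lambda>s. norm (x s)) \<longlongrightarrow> norm (x t)) (at_right t)" by (rule tendsto_norm)
  then have "\<forall>\<^sub>F s in at_right t. 1 < norm (x s)" using assms(2) by (rule order_tendstoD)
  then obtain b where "t < b" "\<And>s. t < s \<Longrightarrow> s < b \<Longrightarrow> 1 < norm (x s)"
    unfolding eventually_at_right_field by auto
  then show ?thesis using that[of b] assms(2) by (metis order_le_less)
qed

definition "out = {t. 0 \<le> t \<and> 1 < norm (x t)}"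
definition "\<tau> = Inf out"

lemma bdd_out: "bdd_below out"
  by (rule bdd_belowI[of _ 0]) (simp add: out_def)

text \<open>By right continuity a path outside the closed ball stays outside for a while, and every
  such time interval contains dyadic times of all sufficiently fine levels. This is why dyadic times
  detect the exit.\<close>

lemma dyadic_out:
  assumes "t \<in> out" "t < c"
  shows "\<forall>\<^sub>F n in sequentially. \<exists>k. real k / 2 ^ n \<in> out \<and> real k / 2 ^ n < c"
proof -
  obtain b where b: "t < b" "\<And>s. t \<le> s \<Longrightarrow> s < b \<Longrightarrow> 1 < norm (x s)"
    using outside_persists[of t] assms unfolding out_def by auto
  define d where "d = min (b - t) (c - t)"
  have "0 < d" using b assms by (simp add: d_def)
  have "(\<lambda>n. inverse (2 ^ n)) \<longlonglongrightarrow> (0::real)" by (rule LIMSEQ_inverse_realpow_zero) simp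
  then have "\<forall>\<^sub>F n in sequentially. inverse (2 ^ n) < d" using \<open>0 < d\<close> by (rule order_tendstoD)
  then show ?thesis
  proof eventually_elim
    case (elim n)
    \<comment> \<open>Rounding down and adding one gives the first dyadic time of level
      \<open>n\<close> strictly after \<open>t\<close>.\<close>
    define k where "k = Suc (nat \<lfloor>t * 2 ^ n\<rfloor>)"
    have "0 \<le> t * 2 ^ n" using assms by (simp add: out_def)
    then have k: "t * 2 ^ n < real k" "real k \<le> t * 2 ^ n + 1" unfolding k_def by linarith+
    then have kk: "t < real k / 2 ^ n" "real k / 2 ^ n \<le> t + inverse (2 ^ n)"
      by (auto simp: field_simps)
    then have "real k / 2 ^ n < b" "real k / 2 ^ n < c" using elim by (auto simp: d_def)
    moreover have "0 \<le> t" using assms by (simp add: out_def)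
    ultimately show ?case using kk b(2)[of "real k / 2 ^ n"] by (intro exI[of _ k]) (auto simp: out_def)
  qed
qed

lemma exits_iff: "exits x \<longleftrightarrow> out \<noteq> {}"
proof
  assume "exits x"
  then obtain n k where "1 < norm (x (real k / 2 ^ n))" unfolding exits_def by blast
  then have "real k / 2 ^ n \<in> out" by (simp add: out_def)
  then show "out \<noteq> {}" by blast
next
  assume "out \<noteq> {}"
  then obtain t where "t \<in> out" by blast
  from dyadic_out[OF this, of "t + 1"]
  have "\<forall>\<^sub>F n in sequentially. \<exists>k. real k / 2 ^ n \<in> out \<and> real k / 2 ^ n < t + 1" by simp
  then obtain n k where "real k / 2 ^ n \<in> out" using eventually_happens'[OF sequentially_bot] by blast
  then show "exits x" unfolding exits_def out_def by blast
qed

lemma before_exit: "0 \<le> s \<Longrightarrow> s < \<tau> \<Longrightarrow> norm (x s) \<le> 1"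
  using cInf_lower[OF _ bdd_out, of s] unfolding \<tau>_def out_def by force

lemma tau_nonneg: "exits x \<Longrightarrow> 0 \<le> \<tau>"
  unfolding \<tau>_def exits_iff by (rule cInf_greatest) (auto simp: out_def)

lemma tau_pos: assumes "exits x" shows "0 < \<tau>"
proof -
  have "(x \<longlongrightarrow> x 0) (at_right 0)" using cadlag unfolding cadlag_def by blast
  then have "((\<lambda>s. norm (x s)) \<longlongrightarrow> norm (x 0)) (at_right 0)" by (rule tendsto_norm)
  then have "\<forall>\<^sub>F s in at_right 0. norm (x s) < 1" by (rule order_tendstoD) (simp add: start)
  then obtain b where b: "0 < b" "\<And>s. 0 < s \<Longrightarrow> s < b \<Longrightarrow> norm (x s) < 1"
    unfolding eventually_at_right_field by auto
  have "b \<le> t" if "t \<in> out" for t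
  proof (rule ccontr)
    assume "\<not> b \<le> t"
    then show False using that b(2)[of t] start by (cases "t = 0") (auto simp: out_def)
  qed
  then have "b \<le> \<tau>" unfolding \<tau>_def using assms exits_iff by (intro cInf_greatest) auto
  with b(1) show ?thesis by simp
qed

text \<open>Once level \<open>n\<close> sees the exit, the grid time belongs to \<open>out\<close>
  and so is not below its infimum; by \<open>dyadic_out\<close> it falls below every
  \<open>c > \<tau>\<close>. The approach from the right is what right continuity of the path can
  use.\<close>

lemma grid_time_limit:
  assumes "exits x"
  shows "\<forall>\<^sub>F n in sequentially. grid_time n x \<in> out"
    and "\<forall>\<^sub>F n in sequentially. \<tau> \<le> grid_time n x"
    and "(\<lambda>n. grid_time n x) \<longlonglongrightarrow> \<tau>"
proof -
  have ne: "out \<noteq> {}" using assms exits_iff by simp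
  have *: "\<forall>\<^sub>F n in sequentially. grid_time n x \<in> out \<and> grid_time n x < c" if c: "\<tau> < c" for c
  proof -
    obtain t where "t \<in> out" "t < c" using cInf_lessD[OF ne, of c] c unfolding \<tau>_def by blast
    from dyadic_out[OF this] show ?thesis
    proof eventually_elim
      case (elim n)
      then obtain k where k: "1 < norm (x (real k / 2 ^ n))" "real k / 2 ^ n < c" unfolding out_def by blast
      have "1 < norm (x (real (first_idx n x) / 2 ^ n))" "first_idx n x \<le> k"
        unfolding first_idx_def using k(1) by (rule LeastI, intro Least_le)
      moreover have "real (first_idx n x) / 2 ^ n \<le> real k / 2 ^ n"
        using \<open>first_idx n x \<le> k\<close> by (intro divide_right_mono) auto
      ultimately show ?case using k(2) unfolding grid_time_def out_def by auto
    qed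
  qed
  show o: "\<forall>\<^sub>F n in sequentially. grid_time n x \<in> out"
    using *[of "\<tau> + 1"] by (auto elim: eventually_mono)
  show le: "\<forall>\<^sub>F n in sequentially. \<tau> \<le> grid_time n x"
    using o by eventually_elim (auto simp: \<tau>_def intro: cInf_lower bdd_out)
  show "(\<lambda>n. grid_time n x) \<longlonglongrightarrow> \<tau>"
  proof (rule order_tendstoI)
    fix a assume "a < \<tau>"
    with le show "\<forall>\<^sub>F n in sequentially. a < grid_time n x" by (auto elim: eventually_mono)
  next
    fix a assume "\<tau> < a"
    from *[OF this] show "\<forall>\<^sub>F n in sequentially. grid_time n x < a" by (auto elim: eventually_mono)
  qed
qed

lemma path_limit:
  assumes "exits x" "0 \<le> s"
  shows "(\<lambda>n. x (grid_time n x + s)) \<longlonglongrightarrow> x (\<tau> + s)"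
proof (rule right_cont)
  show "0 \<le> \<tau> + s" using tau_nonneg[OF assms(1)] assms(2) by simp
  show "(\<lambda>n. grid_time n x + s) \<longlonglongrightarrow> \<tau> + s" by (intro tendsto_intros grid_time_limit(3) assms)
  show "\<forall>\<^sub>F n in sequentially. \<tau> + s \<le> grid_time n x + s" using grid_time_limit(2)[OF assms(1)] by simp
qed

lemma hit_time_eq: "hit_time x = (if exits x then \<tau> else 0)"
  using grid_time_limit(3) by (auto simp: hit_time_def limI)

lemma hit_time_nonneg: "0 \<le> hit_time x"
  using tau_nonneg by (simp add: hit_time_eq)

lemma hit_pos_eq: "hit_pos x = x (hit_time x)"
  using path_limit[of 0] by (auto simp: hit_pos_def hit_time_eq limI)

lemma post_path_eq:
  assumes "0 \<le> s" shows "post_path x s = x (hit_time x + s) - x (hit_time x)"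
proof (cases "exits x")
  case True
  have "(\<lambda>n. x (grid_time n x + s) - x (grid_time n x + 0)) \<longlonglongrightarrow> x (\<tau> + s) - x (\<tau> + 0)"
    using True assms by (intro tendsto_diff path_limit) auto
  then show ?thesis using True by (simp add: post_path_def hit_time_eq limI)
qed (simp add: post_path_def hit_time_eq)

lemma before_hit_time: "0 \<le> s \<Longrightarrow> s < hit_time x \<Longrightarrow> norm (x s) \<le> 1"
  using before_exit by (simp add: hit_time_eq split: if_splits)

lemma exit_time_eq:
  "exit_time (\<lambda>t _. x t) \<omega> = (if exits x then ennreal (hit_time x) else \<infinity>)"
proof -
  have out: "{t. 0 \<le> t \<and> x t \<notin> cball 0 1} = out" by (auto simp: out_def)
  show ?thesis
  proof (cases "exits x")
    case True
    then have ne: "out \<noteq> {}" using exits_iff by simp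
    have "(INF t\<in>out. ennreal t) = ennreal \<tau>"
    proof (rule antisym)
      show "ennreal \<tau> \<le> (INF t\<in>out. ennreal t)"
        by (intro INF_greatest ennreal_leI) (auto simp: \<tau>_def intro: cInf_lower bdd_out)
      show "(INF t\<in>out. ennreal t) \<le> ennreal \<tau>"
      proof (rule ennreal_le_epsilon)
        fix e :: real assume "0 < e"
        then obtain t where t: "t \<in> out" "t < \<tau> + e" using cInf_lessD[OF ne, of "\<tau> + e"] unfolding \<tau>_def by auto
        have "(INF t\<in>out. ennreal t) \<le> ennreal t" using t(1) by (rule INF_lower)
        also have "\<dots> \<le> ennreal (\<tau> + e)" using t(2) by (intro ennreal_leI) simp
        also have "\<dots> = ennreal \<tau> + ennreal e" using tau_nonneg[OF True] \<open>0 < e\<close> by (intro ennreal_plus) auto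
        finally show "(INF t\<in>out. ennreal t) \<le> ennreal \<tau> + ennreal e" .
      qed
    qed
    then show ?thesis using True unfolding exit_time_def out hit_time_eq by simp
  next
    case False
    then have "out = {}" using exits_iff by simp
    then show ?thesis using False unfolding exit_time_def out by simp
  qed
qed

end

lemma cadlag_path_post:
  assumes "cadlag_path x"
  shows "cadlag_path (\<lambda>s. x (hit_time x + s) - x (hit_time x))"
proof -
  interpret cadlag_path x by fact
  show ?thesis using cadlag_shift[OF cadlag hit_time_nonneg, of "x (hit_time x)"] by unfold_locales auto
qed

abbreviation path_space :: "(real \<Rightarrow> 'a::euclidean_space) measure" where
  "path_space \<equiv> PiM {0..} (\<lambda>_. borel)"

section \<open>Measurability of the exit functionals\<close>

context
  fixes M0 :: "'w measure" and X :: "'w \<Rightarrow> real \<Rightarrow> 'a::euclidean_space"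
  assumes X[measurable]: "\<And>t. 0 \<le> t \<Longrightarrow> (\<lambda>\<omega>. X \<omega> t) \<in> borel_measurable M0"
begin

lemma measurable_first_idx[measurable]: "(\<lambda>\<omega>. first_idx n (X \<omega>)) \<in> measurable M0 (count_space UNIV)"
  unfolding first_idx_def by measurable

lemma measurable_exits[measurable]: "Measurable.pred M0 (\<lambda>\<omega>. exits (X \<omega>))"
  unfolding exits_def by measurable

lemma measurable_grid_time[measurable]: "(\<lambda>\<omega>. grid_time n (X \<omega>)) \<in> borel_measurable M0"
  unfolding grid_time_def by measurable

text \<open>The random time takes countably many values, so evaluation at it is measurable although
  nothing is assumed about the paths jointly in time.\<close>

lemma measurable_at_grid_time:
  assumes "0 \<le> s" shows "(\<lambda>\<omega>. X \<omega> (grid_time n (X \<omega>) + s)) \<in> borel_measurable M0"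
  unfolding grid_time_def
  by (rule measurable_compose_countable[OF _ measurable_first_idx]) (use assms in simp)

lemma measurable_hit_time[measurable]: "(\<lambda>\<omega>. hit_time (X \<omega>)) \<in> borel_measurable M0"
  unfolding hit_time_def by measurable

lemma measurable_hit_pos[measurable]: "(\<lambda>\<omega>. hit_pos (X \<omega>)) \<in> borel_measurable M0"
proof -
  have [measurable]: "(\<lambda>\<omega>. X \<omega> (grid_time n (X \<omega>))) \<in> borel_measurable M0" for n
    using measurable_at_grid_time[of 0 n] by simp
  show ?thesis unfolding hit_pos_def by measurable
qed

lemma measurable_post_path[measurable]:
  assumes "0 \<le> s" shows "(\<lambda>\<omega>. post_path (X \<omega>) s) \<in> borel_measurable M0"
proof -
  have [measurable]: "(\<lambda>\<omega>. X \<omega> (grid_time n (X \<omega>))) \<in> borel_measurable M0"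
    "(\<lambda>\<omega>. X \<omega> (grid_time n (X \<omega>) + s)) \<in> borel_measurable M0" for n
    using measurable_at_grid_time[of 0 n] measurable_at_grid_time[OF assms, of n] by simp_all
  have [measurable]: "(\<lambda>\<omega>. X \<omega> s) \<in> borel_measurable M0" "(\<lambda>\<omega>. X \<omega> 0) \<in> borel_measurable M0"
    using assms by simp_all
  show ?thesis unfolding post_path_def by measurable
qed

end

text \<open>Cut down to \<open>{0..}\<close> so as to be a point of \<open>path_space\<close> again,
  ready for iteration.\<close>

definition post :: "(real \<Rightarrow> 'a::euclidean_space) \<Rightarrow> real \<Rightarrow> 'a" where
  "post x = restrict (post_path x) {0..}"

lemma measurable_path_space_functionals[measurable]:
  "hit_time \<in> borel_measurable path_space" "hit_pos \<in> borel_measurable path_space"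
  "post \<in> measurable path_space path_space"
proof -
  have c: "(\<lambda>x. x t) \<in> borel_measurable path_space" if "0 \<le> t" for t
    using that by (intro measurable_component_singleton) simp
  show "hit_time \<in> borel_measurable path_space" "hit_pos \<in> borel_measurable path_space"
    using measurable_hit_time[OF c] measurable_hit_pos[OF c] by simp_all
  show "post \<in> measurable path_space path_space"
    unfolding post_def by (intro measurable_restrict measurable_post_path c) auto
qed

section \<open>The strong Markov property at the exit time\<close>

text \<open>Indicators of open sets are bounded limits of continuous functions, and preimages of
  open sets form an intersection-stable generator. This form of the criterion survives the limit
  over grids in the strong Markov property, where only continuous functionals converge.\<close>

lemma (in prob_space) indep_varsI_bounded_continuous:
  fixes U :: "'i \<Rightarrow> 'a \<Rightarrow> 'b::metric_space"
  assumes I: "finite I" and U[measurable]: "\<And>i. i \<in> I \<Longrightarrow> U i \<in> borel_measurable M"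
    and eq: "\<And>f. (\<And>i. i \<in> I \<Longrightarrow> continuous_on UNIV (f i)) \<Longrightarrow> (\<And>i x. 0 \<le> f i x \<and> f i x \<le> (1::real)) \<Longrightarrow>
      (\<integral>\<omega>. (\<Prod>i\<in>I. f i (U i \<omega>)) \<partial>M) = (\<Prod>i\<in>I. \<integral>\<omega>. f i (U i \<omega>) \<partial>M)"
  shows "indep_vars (\<lambda>_. borel) U I"
proof -
  let ?E = "\<lambda>i. {U i -` A \<inter> space M |A. open A}"
  have "indep_sets ?E I"
  proof (rule indep_setsI)
    show "?E i \<subseteq> events" if "i \<in> I" for i
      using measurable_sets[OF U[OF that]] by (auto simp: borel_open)
    fix A J assume J: "J \<noteq> {}" "J \<subseteq> I" "finite J" and A: "\<forall>j\<in>J. A j \<in> ?E j"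
    then have "\<forall>j\<in>J. \<exists>S. open S \<and> A j = U j -` S \<inter> space M" by blast
    then obtain S where S: "\<And>j. j \<in> J \<Longrightarrow> open (S j)" "\<And>j. j \<in> J \<Longrightarrow> A j = U j -` S j \<inter> space M" by metis
    \<comment> \<open>Indices outside \<open>J\<close> receive the constant \<open>1\<close>, so the
      product formula over all of \<open>I\<close> yields the one for the subfamily.\<close>
    have "\<exists>\<phi>. (\<forall>n. continuous_on UNIV (\<phi> n)) \<and> (\<forall>n x. 0 \<le> \<phi> n x \<and> \<phi> n x \<le> (1::real)) \<and>
        (\<forall>x. (\<lambda>n. \<phi> n x) \<longlonglongrightarrow> (if j \<in> J then indicator (S j) x else 1))" for j
    proof (cases "j \<in> J")
      case True
      from open_indicator_approx[OF S(1)[OF True]] obtain \<phi> :: "nat \<Rightarrow> 'b \<Rightarrow> real" where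
        "\<And>n. continuous_on UNIV (\<phi> n)" "\<And>n x. 0 \<le> \<phi> n x \<and> \<phi> n x \<le> 1"
        "\<And>x. (\<lambda>n. \<phi> n x) \<longlonglongrightarrow> indicator (S j) x" by metis
      with True show ?thesis by (intro exI[of _ \<phi>]) auto
    next
      case False
      then show ?thesis by (intro exI[of _ "\<lambda>_ _. 1"]) auto
    qed
    then obtain \<phi> where \<phi>: "\<And>j n. continuous_on UNIV (\<phi> j n)"
      "\<And>j n x. 0 \<le> \<phi> j n x \<and> \<phi> j n x \<le> (1::real)"
      "\<And>j x. (\<lambda>n. \<phi> j n x) \<longlonglongrightarrow> (if j \<in> J then indicator (S j) x else 1)" by metis
    define g where "g j x = (if j \<in> J then indicator (S j) x else 1 :: real)" for j x
    have [measurable]: "\<phi> j n \<in> borel_measurable borel" for j n by (rule borel_measurable_continuous_onI[OF \<phi>(1)])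
    have [measurable]: "g j \<in> borel_measurable borel" for j
    proof (cases "j \<in> J")
      case True
      then have "S j \<in> sets borel" using S(1) by simp
      then show ?thesis unfolding g_def using True by simp
    qed (simp add: g_def[abs_def])
    have lim1: "(\<lambda>n. \<integral>\<omega>. (\<Prod>i\<in>I. \<phi> i n (U i \<omega>)) \<partial>M) \<longlonglongrightarrow> (\<integral>\<omega>. (\<Prod>i\<in>I. g i (U i \<omega>)) \<partial>M)"
    proof (rule integral_dominated_convergence[where w = "\<lambda>_. 1"])
      show "AE x in M. (\<lambda>n. \<Prod>i\<in>I. \<phi> i n (U i x)) \<longlonglongrightarrow> (\<Prod>i\<in>I. g i (U i x))"
        using \<phi>(3) unfolding g_def by (intro AE_I2 tendsto_prod) auto
      show "AE x in M. norm (\<Prod>i\<in>I. \<phi> i n (U i x)) \<le> 1" for n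
        using \<phi>(2) by (auto simp: abs_prod intro!: AE_I2 prod_le_1)
    qed auto
    have lim2: "(\<lambda>n. \<Prod>i\<in>I. \<integral>\<omega>. \<phi> i n (U i \<omega>) \<partial>M) \<longlonglongrightarrow> (\<Prod>i\<in>I. \<integral>\<omega>. g i (U i \<omega>) \<partial>M)"
    proof (intro tendsto_prod integral_dominated_convergence[where w = "\<lambda>_. 1"])
      fix i n assume i: "i \<in> I"
      then have [measurable]: "U i \<in> borel_measurable M" by (rule U)
      show "(\<lambda>x. g i (U i x)) \<in> borel_measurable M" "(\<lambda>x. \<phi> i n (U i x)) \<in> borel_measurable M" by measurable
      show "AE x in M. (\<lambda>n. \<phi> i n (U i x)) \<longlonglongrightarrow> g i (U i x)" using \<phi>(3) by (simp add: g_def)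
      show "AE x in M. norm (\<phi> i n (U i x)) \<le> 1" using \<phi>(2) by auto
    qed auto
    have "(\<integral>\<omega>. (\<Prod>i\<in>I. \<phi> i n (U i \<omega>)) \<partial>M) = (\<Prod>i\<in>I. \<integral>\<omega>. \<phi> i n (U i \<omega>) \<partial>M)" for n
      by (rule eq) (use \<phi> in auto)
    with lim1 have "(\<lambda>n. \<Prod>i\<in>I. \<integral>\<omega>. \<phi> i n (U i \<omega>) \<partial>M) \<longlonglongrightarrow> (\<integral>\<omega>. (\<Prod>i\<in>I. g i (U i \<omega>)) \<partial>M)" by simp
    from LIMSEQ_unique[OF this lim2]
    have e: "(\<integral>\<omega>. (\<Prod>i\<in>I. g i (U i \<omega>)) \<partial>M) = (\<Prod>i\<in>I. \<integral>\<omega>. g i (U i \<omega>) \<partial>M)" .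
    have A_ev: "A j \<in> events" if "j \<in> J" for j
      using measurable_sets[OF U, of j "S j"] S that J(2) by (auto simp: borel_open)
    have "(\<Prod>i\<in>I. \<integral>\<omega>. g i (U i \<omega>) \<partial>M) = (\<Prod>i\<in>J. \<integral>\<omega>. g i (U i \<omega>) \<partial>M)"
      using I J(2) by (intro prod.mono_neutral_right) (auto simp: g_def prob_space)
    also have "\<dots> = (\<Prod>i\<in>J. prob (A i))"
    proof (intro prod.cong refl)
      fix i assume "i \<in> J"
      have "(\<integral>\<omega>. g i (U i \<omega>) \<partial>M) = (\<integral>\<omega>. indicator (A i) \<omega> \<partial>M)"
        using S(2)[OF \<open>i \<in> J\<close>] \<open>i \<in> J\<close>
        by (intro Bochner_Integration.integral_cong) (auto simp: g_def indicator_def)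
      also have "\<dots> = prob (A i)" using A_ev[OF \<open>i \<in> J\<close>] by simp
      finally show "(\<integral>\<omega>. g i (U i \<omega>) \<partial>M) = prob (A i)" .
    qed
    finally have r: "(\<Prod>i\<in>I. \<integral>\<omega>. g i (U i \<omega>) \<partial>M) = (\<Prod>i\<in>J. prob (A i))" .
    have "(\<integral>\<omega>. (\<Prod>i\<in>I. g i (U i \<omega>)) \<partial>M) = (\<integral>\<omega>. indicator (\<Inter>j\<in>J. A j) \<omega> \<partial>M)"
    proof (intro Bochner_Integration.integral_cong refl)
      fix \<omega> assume \<omega>: "\<omega> \<in> space M"
      have "(\<Prod>i\<in>I. g i (U i \<omega>)) = (\<Prod>i\<in>J. g i (U i \<omega>))"
        using I J(2) by (intro prod.mono_neutral_right) (auto simp: g_def)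
      also have "\<dots> = (\<Prod>i\<in>J. indicator (A i) \<omega>)"
        using S(2) \<omega> by (intro prod.cong) (auto simp: g_def indicator_def)
      also have "\<dots> = indicator (\<Inter>j\<in>J. A j) \<omega>"
        using J(3) by (cases "\<forall>j\<in>J. \<omega> \<in> A j") (auto simp: indicator_def intro!: prod_zero prod.neutral)
      finally show "(\<Prod>i\<in>I. g i (U i \<omega>)) = indicator (\<Inter>j\<in>J. A j) \<omega>" .
    qed
    also have "\<dots> = prob (\<Inter>j\<in>J. A j)"
    proof -
      have "(\<Inter>j\<in>J. A j) \<in> events" using J A_ev by (intro sets.finite_INT) auto
      then show ?thesis by simp
    qed
    finally show "prob (\<Inter>j\<in>J. A j) = (\<Prod>j\<in>J. prob (A j))" using e r by simp
  qed
  then have "indep_sets (\<lambda>i. sigma_sets (space M) (?E i)) I"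
  proof (rule indep_sets_sigma)
    fix i
    show "Int_stable (?E i)"
      unfolding Int_stable_def
    proof (intro ballI)
      fix a b assume "a \<in> ?E i" "b \<in> ?E i"
      then obtain A B where "a = U i -` A \<inter> space M" "open A" "b = U i -` B \<inter> space M" "open B" by auto
      then show "a \<inter> b \<in> ?E i" by (intro CollectI exI[of _ "A \<inter> B"]) auto
    qed
  qed
  moreover have "sigma_sets (space M) (?E i) = {U i -` A \<inter> space M |A. A \<in> sets borel}" for i
  proof -
    have "{U i -` A \<inter> space M |A. A \<in> sigma_sets UNIV {S. open S}} = sigma_sets (space M) {U i -` A \<inter> space M |A. A \<in> {S. open S}}"
      by (rule sigma_sets_vimage_commute) simp
    then show ?thesis by (simp add: borel_def)
  qed
  ultimately show ?thesis unfolding indep_vars_def2 using U by simp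
qed

context levy_process
begin

lemma cadlag_path: "\<omega> \<in> space M \<Longrightarrow> cadlag_path (\<lambda>t. X t \<omega>)"
  using cadlag_paths start_origin by (simp add: cadlag_path_def)

text \<open>The grid walk stops at step \<open>k\<close> on an event determined by the increments before time \<open>k / 2^n\<close>,
  which are independent of the increments afterwards.\<close>

lemma grid_stopping_factor:
  fixes f :: "nat \<Rightarrow> real \<times> 'a \<Rightarrow> real" and s :: "nat \<Rightarrow> real"
  assumes s: "incseq s" "0 \<le> s 0"
    and f: "\<And>i. f i \<in> borel_measurable borel" "\<And>i x. 0 \<le> f i x \<and> f i x \<le> 1"
  defines "E \<equiv> \<lambda>n k \<omega>. 1 < norm (X (real k / 2 ^ n) \<omega>) \<and> (\<forall>j<k. norm (X (real j / 2 ^ n) \<omega>) \<le> 1)"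
  shows "(\<integral>\<omega>. of_bool (E n k \<omega>) * f 0 (real k / 2 ^ n, X (real k / 2 ^ n) \<omega>) *
      (\<Prod>i<p. f (Suc i) (0, X (real k / 2 ^ n + s (Suc i)) \<omega> - X (real k / 2 ^ n + s i) \<omega>)) \<partial>M) =
    (\<integral>\<omega>. of_bool (E n k \<omega>) * f 0 (real k / 2 ^ n, X (real k / 2 ^ n) \<omega>) \<partial>M) *
      (\<Prod>i<p. \<integral>\<omega>. f (Suc i) (0, X (s (Suc i) - s i) \<omega>) \<partial>M)"
proof -
  define h :: real where "h = 1 / 2 ^ n"
  have h: "0 < h" "real j / 2 ^ n = real j * h" for j by (simp_all add: h_def)
  have snn: "0 \<le> s i" for i using s by (meson incseq_def le0 order_trans)
  \<comment> \<open>The grid times up to step \<open>k\<close>, followed by the times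
    \<open>s\<close> counted from there. The increments before index \<open>k\<close> determine the
    stopping event.\<close>
  define \<tau> where "\<tau> j = (if j \<le> k then real j * h else real k * h + s (j - Suc k))" for j
  have "incseq \<tau>"
  proof (rule incseq_SucI)
    fix j
    consider "Suc j \<le> k" | "j = k" | "k < j" by linarith
    then show "\<tau> j \<le> \<tau> (Suc j)"
    proof cases
      case 3
      then have "Suc j - Suc k = Suc (j - Suc k)" by simp
      with 3 show ?thesis using s(1) incseq_SucD[OF s(1)] by (simp add: \<tau>_def)
    qed (use h snn in \<open>auto simp: \<tau>_def algebra_simps\<close>)
  qed
  define D where "D j \<omega> = X (\<tau> (Suc j)) \<omega> - X (\<tau> j) \<omega>" for j \<omega>
  have \<tau>nn: "0 \<le> \<tau> j" for j using h snn by (simp add: \<tau>_def)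
  have indD: "indep_vars (\<lambda>_. borel) D {..<k + Suc p}"
    unfolding D_def[abs_def] by (rule independent_increments[OF \<tau>nn \<open>incseq \<tau>\<close>])
  have X_sum: "X (real j * h) \<omega> = (\<Sum>l<j. D l \<omega>)" if "\<omega> \<in> space M" "j \<le> k" for j \<omega>
  proof -
    have "(\<Sum>l<j. D l \<omega>) = X (\<tau> j) \<omega> - X (\<tau> 0) \<omega>" unfolding D_def by (rule sum_lessThan_telescope)
    then show ?thesis using that start_origin by (simp add: \<tau>_def)
  qed
  have D_after: "D (k + Suc i) \<omega> = X (real k * h + s (Suc i)) \<omega> - X (real k * h + s i) \<omega>" for i \<omega>
    by (simp add: D_def \<tau>_def)
  \<comment> \<open>The index \<open>k\<close> is skipped: \<open>D k\<close> spans the time from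
    \<open>real k * h\<close> to \<open>real k * h + s 0\<close>, and the increments of
    \<open>s\<close> start with \<open>D (k + 1)\<close>.\<close>
  define K where "K i = (if i = 0 then {..<k} else {k + i})" for i :: nat
  define G where "G y = of_bool (1 < norm (\<Sum>l<k. y l) \<and> (\<forall>j<k. norm (\<Sum>l<j. y l) \<le> 1)) * f 0 (real k * h, \<Sum>l<k. y l)"
    for y :: "nat \<Rightarrow> 'a"
  define H where "H i = (if i = 0 then G else (\<lambda>y. f i (0, y (k + i))))" for i
  have "indep_vars (\<lambda>j. PiM (K j) (\<lambda>_. borel)) (\<lambda>j \<omega>. restrict (\<lambda>i. D i \<omega>) (K j)) {..p}"
    by (rule indep_vars_restrict[OF indD]) (auto simp: K_def disjoint_family_on_def)
  then have "indep_vars (\<lambda>_. borel) (\<lambda>j \<omega>. H j (restrict (\<lambda>i. D i \<omega>) (K j))) {..p}"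
  proof (rule indep_vars_compose2)
    fix i
    note f(1)[measurable]
    show "H i \<in> borel_measurable (PiM (K i) (\<lambda>_. borel))"
    proof (cases "i = 0")
      case True
      have [measurable]: "(\<lambda>y. y l) \<in> borel_measurable (PiM {..<k} (\<lambda>_. borel))" if "l < k" for l
        using that by (intro measurable_component_singleton) simp
      have [measurable]: "(\<lambda>y. \<Sum>l<j. y l) \<in> borel_measurable (PiM {..<k} (\<lambda>_. borel :: 'a measure))" if "j \<le> k" for j
        using that by (intro borel_measurable_sum) simp
      have [measurable]: "(\<lambda>y. \<Sum>l<k. y l) \<in> borel_measurable (PiM {..<k} (\<lambda>_. borel :: 'a measure))" by measurable
      have [measurable]: "Measurable.pred (PiM {..<k} (\<lambda>_. borel :: 'a measure)) (\<lambda>y. \<forall>j\<in>{..<k}. norm (\<Sum>l<j. y l) \<le> 1)"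
        by (intro pred_intros_finite) auto
      have "G = (\<lambda>y. of_bool (1 < norm (\<Sum>l<k. y l) \<and> (\<forall>j\<in>{..<k}. norm (\<Sum>l<j. y l) \<le> 1)) * f 0 (real k * h, \<Sum>l<k. y l))"
        by (intro ext) (auto simp: G_def)
      also have "\<dots> \<in> borel_measurable (PiM {..<k} (\<lambda>_. borel))" by measurable
      finally show ?thesis using True by (simp add: H_def K_def)
    next
      case False
      have [measurable]: "(\<lambda>y. y (k + i)) \<in> borel_measurable (PiM {k + i} (\<lambda>_. borel))"
        by (intro measurable_component_singleton) simp
      show ?thesis using False by (simp add: H_def K_def)
    qed
  qed
  moreover have H01: "0 \<le> H i y \<and> H i y \<le> 1" for i y
    using f(2) by (auto simp: H_def G_def)
  moreover have "integrable M (\<lambda>\<omega>. H j (restrict (\<lambda>i. D i \<omega>) (K j)))" if "j \<in> {..p}" for j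
    using calculation that H01 by (intro integrable_const_bound[where B = 1]) (auto simp: indep_vars_def)
  ultimately have "(\<integral>\<omega>. (\<Prod>j\<le>p. H j (restrict (\<lambda>i. D i \<omega>) (K j))) \<partial>M)
     = (\<Prod>j\<le>p. \<integral>\<omega>. H j (restrict (\<lambda>i. D i \<omega>) (K j)) \<partial>M)"
    by (intro indep_vars_lebesgue_integral) auto
  then have eq: "(\<integral>\<omega>. H 0 (restrict (\<lambda>i. D i \<omega>) (K 0)) * (\<Prod>j<p. H (Suc j) (restrict (\<lambda>i. D i \<omega>) (K (Suc j)))) \<partial>M)
     = (\<integral>\<omega>. H 0 (restrict (\<lambda>i. D i \<omega>) (K 0)) \<partial>M) * (\<Prod>j<p. \<integral>\<omega>. H (Suc j) (restrict (\<lambda>i. D i \<omega>) (K (Suc j))) \<partial>M)"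
    by (simp only: prod.atMost_shift)
  have H0: "H 0 (restrict (\<lambda>i. D i \<omega>) (K 0)) = of_bool (E n k \<omega>) * f 0 (real k / 2 ^ n, X (real k / 2 ^ n) \<omega>)"
    if "\<omega> \<in> space M" for \<omega>
  proof -
    have *: "(\<Sum>l<j. D l \<omega>) = X (real j * h) \<omega>" if "j \<le> k" for j
      using X_sum[OF \<open>\<omega> \<in> space M\<close> that] by simp
    show ?thesis
      unfolding H_def K_def E_def h(2) by (simp add: G_def * less_imp_le)
  qed
  have HS: "H (Suc j) (restrict (\<lambda>i. D i \<omega>) (K (Suc j))) =
      f (Suc j) (0, X (real k / 2 ^ n + s (Suc j)) \<omega> - X (real k / 2 ^ n + s j) \<omega>)" for j \<omega>
    unfolding H_def K_def h(2) using D_after[of j \<omega>] by simp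
  have stat: "(\<integral>\<omega>. f (Suc j) (0, X (real k / 2 ^ n + s (Suc j)) \<omega> - X (real k / 2 ^ n + s j) \<omega>) \<partial>M)
     = (\<integral>\<omega>. f (Suc j) (0, X (s (Suc j) - s j) \<omega>) \<partial>M)" for j
  proof -
    define a where "a = real k / 2 ^ n + s j"
    have a: "0 \<le> a" "0 \<le> s (Suc j) - s j" using snn[of j] incseq_SucD[OF s(1), of j] by (auto simp: a_def)
    have b: "real k / 2 ^ n + s (Suc j) = a + (s (Suc j) - s j)" by (simp add: a_def)
    note f(1)[measurable]
    have [measurable]: "X a \<in> borel_measurable M" "X (a + (s (Suc j) - s j)) \<in> borel_measurable M"
      "X (s (Suc j) - s j) \<in> borel_measurable M" using a by (intro measurable_X; simp)+
    have "(\<integral>\<omega>. f (Suc j) (0, X (a + (s (Suc j) - s j)) \<omega> - X a \<omega>) \<partial>M)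
       = (\<integral>x. f (Suc j) (0, x) \<partial>distr M borel (\<lambda>\<omega>. X (a + (s (Suc j) - s j)) \<omega> - X a \<omega>))"
      by (subst integral_distr) auto
    also have "\<dots> = (\<integral>\<omega>. f (Suc j) (0, X (s (Suc j) - s j) \<omega>) \<partial>M)"
      unfolding stationary_increments[OF a] by (subst integral_distr) auto
    finally show ?thesis unfolding b by (simp add: a_def)
  qed
  have "(\<integral>\<omega>. of_bool (E n k \<omega>) * f 0 (real k / 2 ^ n, X (real k / 2 ^ n) \<omega>) *
      (\<Prod>i<p. f (Suc i) (0, X (real k / 2 ^ n + s (Suc i)) \<omega> - X (real k / 2 ^ n + s i) \<omega>)) \<partial>M)
    = (\<integral>\<omega>. H 0 (restrict (\<lambda>i. D i \<omega>) (K 0)) * (\<Prod>j<p. H (Suc j) (restrict (\<lambda>i. D i \<omega>) (K (Suc j)))) \<partial>M)"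
    by (intro Bochner_Integration.integral_cong refl) (simp add: H0 HS)
  also have "\<dots> = (\<integral>\<omega>. H 0 (restrict (\<lambda>i. D i \<omega>) (K 0)) \<partial>M) *
      (\<Prod>j<p. \<integral>\<omega>. H (Suc j) (restrict (\<lambda>i. D i \<omega>) (K (Suc j))) \<partial>M)" by (rule eq)
  also have "(\<integral>\<omega>. H 0 (restrict (\<lambda>i. D i \<omega>) (K 0)) \<partial>M)
      = (\<integral>\<omega>. of_bool (E n k \<omega>) * f 0 (real k / 2 ^ n, X (real k / 2 ^ n) \<omega>) \<partial>M)"
    using H0 by (intro Bochner_Integration.integral_cong refl)
  also have "(\<Prod>j<p. \<integral>\<omega>. H (Suc j) (restrict (\<lambda>i. D i \<omega>) (K (Suc j))) \<partial>M)
      = (\<Prod>i<p. \<integral>\<omega>. f (Suc i) (0, X (s (Suc i) - s i) \<omega>) \<partial>M)"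
    unfolding HS stat ..
  finally show ?thesis .
qed

abbreviation path :: "'w \<Rightarrow> real \<Rightarrow> 'a" where "path \<omega> \<equiv> \<lambda>t. X t \<omega>"

text \<open>Summing \<open>grid_stopping_factor\<close> over \<open>k\<close> gives the
  factorisation at the grid exit time, because the second factor depends neither on \<open>k\<close>
  nor on \<open>n\<close>. The grid exit times decrease to the exit time closely enough for right
  continuity, so bounded convergence carries the identity to the limit; continuity of the
  \<open>f i\<close> is needed exactly here.\<close>

lemma strong_markov_continuous:
  fixes f :: "nat \<Rightarrow> real \<times> 'a \<Rightarrow> real" and s :: "nat \<Rightarrow> real"
  assumes ex: "AE \<omega> in M. exits (path \<omega>)" and s: "incseq s" "0 \<le> s 0"
    and f: "\<And>i. continuous_on UNIV (f i)" "\<And>i x. 0 \<le> f i x \<and> f i x \<le> 1"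
  shows "(\<integral>\<omega>. f 0 (hit_time (path \<omega>), hit_pos (path \<omega>)) *
      (\<Prod>i<p. f (Suc i) (0, post_path (path \<omega>) (s (Suc i)) - post_path (path \<omega>) (s i))) \<partial>M) =
    (\<integral>\<omega>. f 0 (hit_time (path \<omega>), hit_pos (path \<omega>)) \<partial>M) *
      (\<Prod>i<p. \<integral>\<omega>. f (Suc i) (0, X (s (Suc i) - s i) \<omega>) \<partial>M)"
proof -
  have snn: "0 \<le> s i" for i using s by (meson incseq_def le0 order_trans)
  have [measurable]: "f i \<in> borel_measurable borel" for i by (rule borel_measurable_continuous_onI[OF f(1)])
  have X[measurable]: "X t \<in> borel_measurable M" if "0 \<le> t" for t using that by (rule measurable_X)
  define E where "E n k \<omega> \<longleftrightarrow> 1 < norm (X (real k / 2 ^ n) \<omega>) \<and> (\<forall>j<k. norm (X (real j / 2 ^ n) \<omega>) \<le> 1)" for n k \<omega>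
  have E_iff: "E n k \<omega> \<longleftrightarrow> 1 < norm (X (real k / 2 ^ n) \<omega>) \<and> first_idx n (path \<omega>) = k" for n k \<omega>
  proof
    assume "E n k \<omega>"
    then show "1 < norm (X (real k / 2 ^ n) \<omega>) \<and> first_idx n (path \<omega>) = k"
      unfolding E_def first_idx_def by (auto intro!: Least_equality simp: not_less[symmetric])
  next
    assume "1 < norm (X (real k / 2 ^ n) \<omega>) \<and> first_idx n (path \<omega>) = k"
    then show "E n k \<omega>" unfolding E_def first_idx_def by (auto dest: not_less_Least simp: not_less)
  qed
  have [measurable]: "Measurable.pred M (E n k)" for n k unfolding E_def[abs_def] by measurable
  define Q where "Q t \<omega> = f 0 (t, X t \<omega>) * (\<Prod>i<p. f (Suc i) (0, X (t + s (Suc i)) \<omega> - X (t + s i) \<omega>))" for t \<omega>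
  define Q0 where "Q0 t \<omega> = f 0 (t, X t \<omega>)" for t \<omega>
  define C where "C = (\<Prod>i<p. \<integral>\<omega>. f (Suc i) (0, X (s (Suc i) - s i) \<omega>) \<partial>M)"
  have [measurable]: "Q t \<in> borel_measurable M" "Q0 t \<in> borel_measurable M" if "0 \<le> t" for t
    unfolding Q_def[abs_def] Q0_def[abs_def] using that snn by (auto intro!: borel_measurable_times borel_measurable_prod)
  have Q01: "0 \<le> Q t \<omega> \<and> Q t \<omega> \<le> 1" "0 \<le> Q0 t \<omega> \<and> Q0 t \<omega> \<le> 1" for t \<omega>
  proof -
    have "0 \<le> (\<Prod>i<p. f (Suc i) (0, X (t + s (Suc i)) \<omega> - X (t + s i) \<omega>))"
      "(\<Prod>i<p. f (Suc i) (0, X (t + s (Suc i)) \<omega> - X (t + s i) \<omega>)) \<le> 1"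
      using f(2) by (auto intro!: prod_nonneg prod_le_1)
    then show "0 \<le> Q t \<omega> \<and> Q t \<omega> \<le> 1" unfolding Q_def using f(2) by (auto intro: mult_le_one)
    show "0 \<le> Q0 t \<omega> \<and> Q0 t \<omega> \<le> 1" unfolding Q0_def using f(2) by auto
  qed
  \<comment> \<open>At most one \<open>k\<close> contributes, the index of the first grid exit. The
    cut at \<open>4 ^ n\<close> keeps the sum finite and still reaches all grid times below
    \<open>2 ^ n\<close>, hence eventually the exit time.\<close>
  have sums: "(\<Sum>k<4 ^ n. of_bool (E n k \<omega>) * R (real k / 2 ^ n) \<omega>)
     = (if 1 < norm (X (grid_time n (path \<omega>)) \<omega>) \<and> first_idx n (path \<omega>) < 4 ^ n then R (grid_time n (path \<omega>)) \<omega> else 0)"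
    for n \<omega> and R :: "real \<Rightarrow> 'w \<Rightarrow> real"
  proof -
    have "(\<Sum>k<4 ^ n. of_bool (E n k \<omega>) * R (real k / 2 ^ n) \<omega>)
      = (\<Sum>k<4 ^ n. if first_idx n (path \<omega>) = k then (if 1 < norm (X (real k / 2 ^ n) \<omega>) then R (real k / 2 ^ n) \<omega> else 0) else 0)"
      by (intro sum.cong) (auto simp: E_iff)
    also have "\<dots> = (if first_idx n (path \<omega>) < 4 ^ n then (if 1 < norm (X (real (first_idx n (path \<omega>)) / 2 ^ n) \<omega>)
       then R (real (first_idx n (path \<omega>)) / 2 ^ n) \<omega> else 0) else 0)"
      by (subst sum.delta') auto
    finally show ?thesis by (simp add: grid_time_def)
  qed
  have ev: "\<forall>\<^sub>F n in sequentially. 1 < norm (X (grid_time n (path \<omega>)) \<omega>) \<and> first_idx n (path \<omega>) < 4 ^ n"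
    if "\<omega> \<in> space M" "exits (path \<omega>)" for \<omega>
  proof -
    interpret cadlag_path "path \<omega>" using that by (intro cadlag_path)
    obtain N where N: "hit_time (path \<omega>) + 1 < real N" using reals_Archimedean2 by blast
    have "\<forall>\<^sub>F n in sequentially. grid_time n (path \<omega>) < \<tau> + 1"
      using grid_time_limit(3)[OF that(2)] by (rule order_tendstoD) simp
    then show ?thesis using grid_time_limit(1)[OF that(2)] eventually_ge_at_top[of N]
    proof eventually_elim
      case (elim n)
      have "grid_time n (path \<omega>) < real n" using elim N that(2) by (simp add: hit_time_eq)
      also have "real n < 2 ^ n" by (rule of_nat_less_two_power)
      finally have "real (first_idx n (path \<omega>)) < 2 ^ n * 2 ^ n" by (simp add: grid_time_def field_simps)
      also have "\<dots> = real (4 ^ n)" by (simp add: power_mult_distrib[symmetric])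
      finally have "first_idx n (path \<omega>) < 4 ^ n" by (simp only: of_nat_less_iff)
      then show ?case using elim by (auto simp: out_def)
    qed
  qed
  have ptw: "(\<lambda>n. \<Sum>k<4 ^ n. of_bool (E n k \<omega>) * R (real k / 2 ^ n) \<omega>) \<longlonglongrightarrow> L"
    if "\<omega> \<in> space M" "exits (path \<omega>)" "(\<lambda>n. R (grid_time n (path \<omega>)) \<omega>) \<longlonglongrightarrow> L" for \<omega> L and R :: "real \<Rightarrow> 'w \<Rightarrow> real"
  proof (rule Lim_transform_eventually[OF that(3)])
    show "\<forall>\<^sub>F n in sequentially. R (grid_time n (path \<omega>)) \<omega> = (\<Sum>k<4 ^ n. of_bool (E n k \<omega>) * R (real k / 2 ^ n) \<omega>)"
      using ev[OF that(1,2)] by eventually_elim (simp add: sums)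
  qed
  have lim0: "(\<lambda>n. f i (a n)) \<longlonglongrightarrow> f i b" if "a \<longlonglongrightarrow> b" for a b i
  proof (rule isCont_tendsto_compose[where g = "f i", OF _ that])
    show "isCont (f i) b" using f(1)[of i] continuous_on_eq_continuous_at[OF open_UNIV, of "f i"] by blast
  qed
  have limQ: "(\<lambda>n. Q (grid_time n (path \<omega>)) \<omega>) \<longlonglongrightarrow> f 0 (hit_time (path \<omega>), hit_pos (path \<omega>)) *
      (\<Prod>i<p. f (Suc i) (0, post_path (path \<omega>) (s (Suc i)) - post_path (path \<omega>) (s i)))"
    and limQ0: "(\<lambda>n. Q0 (grid_time n (path \<omega>)) \<omega>) \<longlonglongrightarrow> f 0 (hit_time (path \<omega>), hit_pos (path \<omega>))"
    if \<omega>: "\<omega> \<in> space M" "exits (path \<omega>)" for \<omega>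
  proof -
    interpret cadlag_path "path \<omega>" using \<omega> by (intro cadlag_path)
    have 0: "(\<lambda>n. f 0 (grid_time n (path \<omega>), X (grid_time n (path \<omega>)) \<omega>)) \<longlonglongrightarrow> f 0 (hit_time (path \<omega>), hit_pos (path \<omega>))"
      using grid_time_limit(3)[OF \<omega>(2)] path_limit[OF \<omega>(2), of 0] \<omega>(2)
      by (intro lim0 tendsto_Pair) (simp_all add: hit_time_eq hit_pos_eq)
    then show "(\<lambda>n. Q0 (grid_time n (path \<omega>)) \<omega>) \<longlonglongrightarrow> f 0 (hit_time (path \<omega>), hit_pos (path \<omega>))"
      unfolding Q0_def .
    have post: "post_path (path \<omega>) (s (Suc i)) - post_path (path \<omega>) (s i) = X (\<tau> + s (Suc i)) \<omega> - X (\<tau> + s i) \<omega>" for i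
      using snn \<omega>(2) by (simp add: post_path_eq hit_time_eq)
    show "(\<lambda>n. Q (grid_time n (path \<omega>)) \<omega>) \<longlonglongrightarrow> f 0 (hit_time (path \<omega>), hit_pos (path \<omega>)) *
      (\<Prod>i<p. f (Suc i) (0, post_path (path \<omega>) (s (Suc i)) - post_path (path \<omega>) (s i)))"
      unfolding Q_def post
      by (intro tendsto_mult 0 tendsto_prod lim0 tendsto_Pair tendsto_const tendsto_diff path_limit \<omega> snn)
  qed
  have bound: "\<bar>\<Sum>k<4 ^ n. of_bool (E n k \<omega>) * R (real k / 2 ^ n) \<omega>\<bar> \<le> 1"
    if "\<And>t \<omega>. 0 \<le> R t \<omega> \<and> R t \<omega> \<le> 1" for n \<omega> and R :: "real \<Rightarrow> 'w \<Rightarrow> real"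
    unfolding sums using that by auto
  have hm[measurable]: "(\<lambda>\<omega>. hit_time (path \<omega>)) \<in> borel_measurable M" "(\<lambda>\<omega>. hit_pos (path \<omega>)) \<in> borel_measurable M"
     "\<And>s. 0 \<le> s \<Longrightarrow> (\<lambda>\<omega>. post_path (path \<omega>) s) \<in> borel_measurable M"
    by (intro measurable_hit_time measurable_hit_pos measurable_post_path X; simp)+
  have mS: "(\<lambda>\<omega>. \<Sum>k<4 ^ n. of_bool (E n k \<omega>) * R (real k / 2 ^ n) \<omega>) \<in> borel_measurable M"
    if "\<And>t. 0 \<le> t \<Longrightarrow> R t \<in> borel_measurable M" for n and R :: "real \<Rightarrow> 'w \<Rightarrow> real"
  proof (intro borel_measurable_sum borel_measurable_times)
    show "(\<lambda>\<omega>. of_bool (E n k \<omega>)) \<in> borel_measurable M" for k by measurable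
    show "R (real k / 2 ^ n) \<in> borel_measurable M" for k by (rule that) simp
  qed
  have "(\<lambda>n. \<integral>\<omega>. (\<Sum>k<4 ^ n. of_bool (E n k \<omega>) * Q (real k / 2 ^ n) \<omega>) \<partial>M) \<longlonglongrightarrow>
    (\<integral>\<omega>. f 0 (hit_time (path \<omega>), hit_pos (path \<omega>)) *
      (\<Prod>i<p. f (Suc i) (0, post_path (path \<omega>) (s (Suc i)) - post_path (path \<omega>) (s i))) \<partial>M)"
  proof (rule integral_dominated_convergence[where w = "\<lambda>_. 1"])
    show "(\<lambda>\<omega>. f 0 (hit_time (path \<omega>), hit_pos (path \<omega>)) *
      (\<Prod>i<p. f (Suc i) (0, post_path (path \<omega>) (s (Suc i)) - post_path (path \<omega>) (s i)))) \<in> borel_measurable M"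
      using snn by (auto intro!: borel_measurable_times borel_measurable_prod)
    show "AE \<omega> in M. (\<lambda>n. \<Sum>k<4 ^ n. of_bool (E n k \<omega>) * Q (real k / 2 ^ n) \<omega>) \<longlonglongrightarrow>
      f 0 (hit_time (path \<omega>), hit_pos (path \<omega>)) *
      (\<Prod>i<p. f (Suc i) (0, post_path (path \<omega>) (s (Suc i)) - post_path (path \<omega>) (s i)))"
      using ex AE_space by eventually_elim (intro ptw limQ)
    show "AE \<omega> in M. norm (\<Sum>k<4 ^ n. of_bool (E n k \<omega>) * Q (real k / 2 ^ n) \<omega>) \<le> 1" for n
      using bound[of Q n] Q01(1) by (intro AE_I2) simp
    show "(\<lambda>\<omega>. \<Sum>k<4 ^ n. of_bool (E n k \<omega>) * Q (real k / 2 ^ n) \<omega>) \<in> borel_measurable M" for n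
      by (rule mS) measurable
  qed auto
  moreover have "(\<lambda>n. \<integral>\<omega>. (\<Sum>k<4 ^ n. of_bool (E n k \<omega>) * Q0 (real k / 2 ^ n) \<omega>) \<partial>M) \<longlonglongrightarrow>
    (\<integral>\<omega>. f 0 (hit_time (path \<omega>), hit_pos (path \<omega>)) \<partial>M)"
  proof (rule integral_dominated_convergence[where w = "\<lambda>_. 1"])
    show "AE \<omega> in M. (\<lambda>n. \<Sum>k<4 ^ n. of_bool (E n k \<omega>) * Q0 (real k / 2 ^ n) \<omega>) \<longlonglongrightarrow>
      f 0 (hit_time (path \<omega>), hit_pos (path \<omega>))"
      using ex AE_space by eventually_elim (intro ptw limQ0)
    show "AE \<omega> in M. norm (\<Sum>k<4 ^ n. of_bool (E n k \<omega>) * Q0 (real k / 2 ^ n) \<omega>) \<le> 1" for n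
      using bound[of Q0 n] Q01(2) by (intro AE_I2) simp
    show "(\<lambda>\<omega>. \<Sum>k<4 ^ n. of_bool (E n k \<omega>) * Q0 (real k / 2 ^ n) \<omega>) \<in> borel_measurable M" for n
      by (rule mS) measurable
  qed auto
  moreover have "(\<integral>\<omega>. (\<Sum>k<4 ^ n. of_bool (E n k \<omega>) * Q (real k / 2 ^ n) \<omega>) \<partial>M) =
      (\<integral>\<omega>. (\<Sum>k<4 ^ n. of_bool (E n k \<omega>) * Q0 (real k / 2 ^ n) \<omega>) \<partial>M) * C" for n
  proof -
    have iQ: "integrable M (\<lambda>\<omega>. of_bool (E n k \<omega>) * Q (real k / 2 ^ n) \<omega>)"
      "integrable M (\<lambda>\<omega>. of_bool (E n k \<omega>) * Q0 (real k / 2 ^ n) \<omega>)" for k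
      using Q01 by (auto intro!: integrable_const_bound[where B = 1] simp: abs_mult split: split_of_bool)
    have e: "(\<integral>\<omega>. of_bool (E n k \<omega>) * Q (real k / 2 ^ n) \<omega> \<partial>M) = (\<integral>\<omega>. of_bool (E n k \<omega>) * Q0 (real k / 2 ^ n) \<omega> \<partial>M) * C" for k
      using grid_stopping_factor[OF s, where f = f and n = n and k = k and p = p] f(2)
      unfolding E_def Q_def Q0_def C_def by (simp add: mult.assoc)
    have "(\<integral>\<omega>. (\<Sum>k<4 ^ n. of_bool (E n k \<omega>) * Q (real k / 2 ^ n) \<omega>) \<partial>M)
      = (\<Sum>k<4 ^ n. \<integral>\<omega>. of_bool (E n k \<omega>) * Q (real k / 2 ^ n) \<omega> \<partial>M)"
      by (rule Bochner_Integration.integral_sum) (rule iQ)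
    also have "\<dots> = (\<Sum>k<4 ^ n. \<integral>\<omega>. of_bool (E n k \<omega>) * Q0 (real k / 2 ^ n) \<omega> \<partial>M) * C"
      unfolding e sum_distrib_right ..
    also have "(\<Sum>k<4 ^ n. \<integral>\<omega>. of_bool (E n k \<omega>) * Q0 (real k / 2 ^ n) \<omega> \<partial>M)
      = (\<integral>\<omega>. (\<Sum>k<4 ^ n. of_bool (E n k \<omega>) * Q0 (real k / 2 ^ n) \<omega>) \<partial>M)"
      by (rule Bochner_Integration.integral_sum[symmetric]) (rule iQ)
    finally show ?thesis .
  qed
  ultimately show ?thesis
    unfolding C_def[symmetric] by (simp only:) (rule LIMSEQ_unique, assumption, intro tendsto_mult tendsto_const)
qed

end

lemma prod_atMost_shift: "(\<Prod>i\<le>p. g i) = g 0 * (\<Prod>i<p. g (Suc i))" for g :: "nat \<Rightarrow> real"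
  by (rule prod.atMost_shift)

text \<open>Prepares a cylinder for \<open>independent_increments\<close>: the times are listed in
  increasing order from \<open>0\<close>, with the last one repeated for ever.\<close>

lemma finite_nonneg_enumeration:
  fixes J :: "real set"
  assumes "finite J" "J \<subseteq> {0..}"
  obtains s :: "nat \<Rightarrow> real" and p idx where "incseq s" "s 0 = 0"
    "\<And>j. j \<in> J \<Longrightarrow> idx j \<le> p \<and> s (idx j) = j"
proof -
  have "\<exists>s p. incseq s \<and> s 0 = 0 \<and> J \<subseteq> s ` {..p::nat} \<and> range s \<subseteq> insert 0 J"
    using assms
  proof (induction J rule: finite_linorder_max_induct)
    case empty
    show ?case by (intro exI[of _ "\<lambda>_. 0"]) (auto simp: incseq_def)
  next
    case (insert b A)
    then obtain s p where s: "incseq s" "s 0 = 0" "A \<subseteq> s ` {..p::nat}" "range s \<subseteq> insert 0 A" by auto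
    have sb: "s i \<le> b" for i
    proof -
      have "s i \<in> insert 0 A" using s(4) by blast
      then show ?thesis using insert(2,4) by force
    qed
    define s' where "s' i = (if i \<le> p then s i else b)" for i
    have "incseq s'" using s(1) sb by (auto simp: incseq_def s'_def)
    moreover have "s' 0 = 0" using s(2) by (simp add: s'_def)
    moreover have "insert b A \<subseteq> s' ` {..Suc p}"
    proof
      fix x assume "x \<in> insert b A"
      then consider "x = b" | "x \<in> A" by blast
      then show "x \<in> s' ` {..Suc p}"
      proof cases
        case 1
        then show ?thesis by (intro image_eqI[of _ _ "Suc p"]) (auto simp: s'_def)
      next
        case 2
        then obtain i where "i \<le> p" "x = s i" using s(3) by auto
        then show ?thesis by (intro image_eqI[of _ _ i]) (auto simp: s'_def)
      qed
    qed
    moreover have "range s' \<subseteq> insert 0 (insert b A)" using s(4) by (auto simp: s'_def)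
    ultimately show ?case by blast
  qed
  then obtain s p where s: "incseq s" "s 0 = 0" "J \<subseteq> s ` {..p::nat}" by blast
  have "\<forall>j\<in>J. \<exists>i\<le>p. s i = j" using s(3) by auto
  then obtain idx where "\<And>j. j \<in> J \<Longrightarrow> idx j \<le> p \<and> s (idx j) = j" by metis
  with s that show ?thesis by blast
qed

context levy_process
begin

abbreviation post_process :: "real \<Rightarrow> 'w \<Rightarrow> 'a" where
  "post_process t \<omega> \<equiv> post_path (path \<omega>) t"

lemma measurable_hit[measurable]:
  "(\<lambda>\<omega>. hit_time (path \<omega>)) \<in> borel_measurable M" "(\<lambda>\<omega>. hit_pos (path \<omega>)) \<in> borel_measurable M"
  by (intro measurable_hit_time measurable_hit_pos measurable_X; simp)+

lemma measurable_post_process[measurable]: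
  "0 \<le> s \<Longrightarrow> post_process s \<in> borel_measurable M"
  by (intro measurable_post_path measurable_X)

lemma post_process_increment_law:
  assumes ex: "AE \<omega> in M. exits (path \<omega>)" and "0 \<le> s" "s \<le> t"
  shows "distr M borel (\<lambda>\<omega>. post_process t \<omega> - post_process s \<omega>) = distr M borel (X (t - s))"
proof (rule distr_eqI_bounded_continuous[OF prob_space_axioms prob_space_axioms])
  fix f :: "'a \<Rightarrow> real" assume f: "continuous_on UNIV f" "\<And>x. 0 \<le> f x \<and> f x \<le> 1"
  define u where "u i = (if i = 0 then s else t)" for i :: nat
  \<comment> \<open>The constant \<open>1\<close> in place \<open>0\<close> discards the exit pair,
    so the factorisation reduces to the law of a single increment.\<close>
  define g :: "nat \<Rightarrow> real \<times> 'a \<Rightarrow> real" where "g i = (if i = 0 then (\<lambda>_. 1) else f \<circ> snd)" for i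
  have "(\<integral>\<omega>. g 0 (hit_time (path \<omega>), hit_pos (path \<omega>)) *
      (\<Prod>i<1. g (Suc i) (0, post_process (u (Suc i)) \<omega> - post_process (u i) \<omega>)) \<partial>M) =
    (\<integral>\<omega>. g 0 (hit_time (path \<omega>), hit_pos (path \<omega>)) \<partial>M) *
      (\<Prod>i<1. \<integral>\<omega>. g (Suc i) (0, X (u (Suc i) - u i) \<omega>) \<partial>M)"
  proof (rule strong_markov_continuous[OF ex])
    show "incseq u" using assms by (auto simp: incseq_def u_def)
    have "continuous_on UNIV (\<lambda>x::real \<times> 'a. f (snd x))"
      by (rule continuous_on_compose2[OF f(1)]) (auto intro: continuous_intros)
    then show "continuous_on UNIV (g i)" for i by (simp add: g_def comp_def)
  qed (use assms f in \<open>auto simp: g_def u_def\<close>)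
  then show "(\<integral>\<omega>. f (post_process t \<omega> - post_process s \<omega>) \<partial>M) = (\<integral>\<omega>. f (X (t - s) \<omega>) \<partial>M)"
    by (simp add: g_def u_def prob_space)
qed (use assms measurable_X in auto)

text \<open>A dummy first component \<open>0\<close> gives the increments the type of the exit pair,
  so that all of them form one independent family.\<close>

lemma strong_markov_indep:
  assumes ex: "AE \<omega> in M. exits (path \<omega>)" and s: "incseq s" "0 \<le> s 0"
  defines "U \<equiv> \<lambda>i \<omega>. if i = 0 then (hit_time (path \<omega>), hit_pos (path \<omega>))
      else (0, post_process (s i) \<omega> - post_process (s (i - 1)) \<omega>)"
  shows "indep_vars (\<lambda>_. borel) U {..p}"
proof (rule indep_varsI_bounded_continuous)
  have snn: "0 \<le> s i" for i using s by (meson incseq_def le0 order_trans)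
  show mU: "U i \<in> borel_measurable M" for i
    unfolding U_def using snn by (cases "i = 0") simp_all
  fix f :: "nat \<Rightarrow> real \<times> 'a \<Rightarrow> real"
  assume f0: "\<And>i. i \<in> {..p} \<Longrightarrow> continuous_on UNIV (f i)" and f1: "\<And>i x. 0 \<le> f i x \<and> f i x \<le> 1"
  define f' where "f' i = (if i \<le> p then f i else (\<lambda>_. 0))" for i
  have f: "\<And>i. continuous_on UNIV (f' i)" "\<And>i x. 0 \<le> f' i x \<and> f' i x \<le> 1"
    using f0 f1 by (auto simp: f'_def)
  have [measurable]: "f' i \<in> borel_measurable borel" for i by (rule borel_measurable_continuous_onI[OF f(1)])
  have "(\<integral>\<omega>. (\<Prod>i\<in>{..p}. f i (U i \<omega>)) \<partial>M) = (\<integral>\<omega>. (\<Prod>i\<le>p. f' i (U i \<omega>)) \<partial>M)"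
    by (intro Bochner_Integration.integral_cong prod.cong refl) (simp add: f'_def)
  also have "\<dots> = (\<integral>\<omega>. f' 0 (hit_time (path \<omega>), hit_pos (path \<omega>)) *
      (\<Prod>i<p. f' (Suc i) (0, post_process (s (Suc i)) \<omega> - post_process (s i) \<omega>)) \<partial>M)"
    unfolding prod_atMost_shift by (simp add: U_def)
  also have "\<dots> = (\<integral>\<omega>. f' 0 (hit_time (path \<omega>), hit_pos (path \<omega>)) \<partial>M) *
      (\<Prod>i<p. \<integral>\<omega>. f' (Suc i) (0, X (s (Suc i) - s i) \<omega>) \<partial>M)"
    by (rule strong_markov_continuous[OF ex s f])
  also have "(\<Prod>i<p. \<integral>\<omega>. f' (Suc i) (0, X (s (Suc i) - s i) \<omega>) \<partial>M) = (\<Prod>i<p. \<integral>\<omega>. f' (Suc i) (U (Suc i) \<omega>) \<partial>M)"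
  proof (intro prod.cong refl)
    fix i
    have le: "s i \<le> s (Suc i)" using incseq_SucD[OF s(1)] .
    have [measurable]: "X (s (Suc i) - s i) \<in> borel_measurable M" using le by (intro measurable_X) simp
    have [measurable]: "post_process (s i) \<in> borel_measurable M" "post_process (s (Suc i)) \<in> borel_measurable M"
      using snn by simp_all
    have "(\<integral>\<omega>. f' (Suc i) (0, X (s (Suc i) - s i) \<omega>) \<partial>M) = (\<integral>x. f' (Suc i) (0, x) \<partial>distr M borel (X (s (Suc i) - s i)))"
      by (subst integral_distr) auto
    also have "\<dots> = (\<integral>\<omega>. f' (Suc i) (0, post_process (s (Suc i)) \<omega> - post_process (s i) \<omega>) \<partial>M)"
      unfolding post_process_increment_law[OF ex snn le, symmetric] by (subst integral_distr) auto
    finally show "(\<integral>\<omega>. f' (Suc i) (0, X (s (Suc i) - s i) \<omega>) \<partial>M) = (\<integral>\<omega>. f' (Suc i) (U (Suc i) \<omega>) \<partial>M)"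
      by (simp add: U_def)
  qed
  also have "(\<integral>\<omega>. f' 0 (hit_time (path \<omega>), hit_pos (path \<omega>)) \<partial>M) = (\<integral>\<omega>. f' 0 (U 0 \<omega>) \<partial>M)" by (simp add: U_def)
  also have "(\<integral>\<omega>. f' 0 (U 0 \<omega>) \<partial>M) * (\<Prod>i<p. \<integral>\<omega>. f' (Suc i) (U (Suc i) \<omega>) \<partial>M) = (\<Prod>i\<in>{..p}. \<integral>\<omega>. f' i (U i \<omega>) \<partial>M)"
    by (simp only: prod_atMost_shift)
  also have "\<dots> = (\<Prod>i\<in>{..p}. \<integral>\<omega>. f i (U i \<omega>) \<partial>M)"
    by (intro prod.cong refl) (simp add: f'_def)
  finally show "(\<integral>\<omega>. (\<Prod>i\<in>{..p}. f i (U i \<omega>)) \<partial>M) = (\<Prod>i\<in>{..p}. \<integral>\<omega>. f i (U i \<omega>) \<partial>M)" .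
qed simp

text \<open>Finitely many values of the process after the exit are partial sums of its increments.
  These are independent of the exit pair and have jointly the law of the corresponding increments of
  \<open>X\<close>.\<close>

lemma strong_markov_cylinder:
  assumes ex: "AE \<omega> in M. exits (path \<omega>)" and J: "finite J" "J \<subseteq> {0..}"
    and A[measurable]: "A \<in> sets (borel :: (real \<times> 'a) measure)" and B: "\<And>j. j \<in> J \<Longrightarrow> B j \<in> sets (borel :: 'a measure)"
  shows "prob {\<omega>\<in>space M. (hit_time (path \<omega>), hit_pos (path \<omega>)) \<in> A \<and> (\<forall>j\<in>J. post_process j \<omega> \<in> B j)} =
    prob {\<omega>\<in>space M. (hit_time (path \<omega>), hit_pos (path \<omega>)) \<in> A} * prob {\<omega>\<in>space M. \<forall>j\<in>J. X j \<omega> \<in> B j}"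
proof -
  obtain s :: "nat \<Rightarrow> real" and p idx where s: "incseq s" "s 0 = 0"
    and idx: "\<And>j. j \<in> J \<Longrightarrow> idx j \<le> p \<and> s (idx j) = j"
    using finite_nonneg_enumeration[OF J] by metis
  have snn: "0 \<le> s i" for i using s by (metis incseq_def le0)
  define U where "U i \<omega> = (if i = 0 then (hit_time (path \<omega>), hit_pos (path \<omega>))
      else (0, post_process (s i) \<omega> - post_process (s (i - 1)) \<omega>))" for i \<omega>
  have indU: "indep_vars (\<lambda>_. borel) U {..p}"
    unfolding U_def[abs_def] using strong_markov_indep[OF ex s(1)] s(2) by simp
  have post0: "post_process 0 \<omega> = 0" if "\<omega> \<in> space M" for \<omega>
    using cadlag_path.post_path_eq[OF cadlag_path[OF that], of 0] by simp
  have post_sum: "(\<Sum>l<i. snd (U (Suc l) \<omega>)) = post_process (s i) \<omega>" if "\<omega> \<in> space M" for i \<omega>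
    using sum_lessThan_telescope[of "\<lambda>l. post_process (s l) \<omega>" i] post0[OF that] s(2) by (simp add: U_def)
  have X_sum: "(\<Sum>l<i. X (s (Suc l)) \<omega> - X (s l) \<omega>) = X (s i) \<omega>" if "\<omega> \<in> space M" for i \<omega>
    using sum_lessThan_telescope[of "\<lambda>l. X (s l) \<omega>" i] start_origin[OF that] s(2) by simp
  \<comment> \<open>The cylinder in increment coordinates. The same set \<open>C\<close> serves the
    process after the exit, through \<open>R'\<close>, and \<open>X\<close> itself, through
    \<open>R\<close>.\<close>
  define C where "C = {y \<in> space (PiM {..<p} (\<lambda>_. borel :: 'a measure)). \<forall>j\<in>J. (\<Sum>l<idx j. y l) \<in> B j}"
  have C: "C \<in> sets (PiM {..<p} (\<lambda>_. borel))"
    unfolding C_def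
  proof (intro sets.sets_Collect_finite_All J(1))
    fix j assume j: "j \<in> J"
    have "(\<lambda>y. \<Sum>l<idx j. y l) \<in> borel_measurable (PiM {..<p} (\<lambda>_. borel :: 'a measure))"
      using idx[OF j] by (intro borel_measurable_sum measurable_component_singleton) auto
    then show "{y \<in> space (PiM {..<p} (\<lambda>_. borel :: 'a measure)). (\<Sum>l<idx j. y l) \<in> B j} \<in> sets (PiM {..<p} (\<lambda>_. borel))"
      using measurable_sets[OF _ B[OF j]] by (simp add: vimage_def Int_def conj_commute[of _ "_ \<in> B j"])
  qed
  define R' where "R' \<omega> = (\<lambda>l\<in>{..<p}. snd (U (Suc l) \<omega>))" for \<omega>
  define R where "R \<omega> = (\<lambda>l\<in>{..<p}. X (s (Suc l)) \<omega> - X (s l) \<omega>)" for \<omega>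
  have mU: "U i \<in> borel_measurable M" for i
    unfolding U_def[abs_def] using snn by (cases "i = 0") simp_all
  have mX: "(\<lambda>\<omega>. X (s (Suc l)) \<omega> - X (s l) \<omega>) \<in> borel_measurable M" for l
    using snn measurable_X by auto
  have mS: "(\<lambda>\<omega>. snd (U i \<omega>)) \<in> borel_measurable M" for i
    by (rule measurable_compose[OF mU borel_measurable_continuous_onI[OF continuous_on_snd[OF continuous_on_id]]])
  have mR': "R' \<in> measurable M (PiM {..<p} (\<lambda>_. borel))"
    unfolding R'_def[abs_def] using mS by (intro measurable_restrict)
  have mR: "R \<in> measurable M (PiM {..<p} (\<lambda>_. borel))"
    unfolding R_def[abs_def] using mX by (intro measurable_restrict)
  have law: "distr M (PiM {..<p} (\<lambda>_. borel)) R' = distr M (PiM {..<p} (\<lambda>_. borel)) R"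
  proof (cases "p = 0")
    case True
    have "R' = R" unfolding R'_def R_def using True by (intro ext) (simp add: restrict_def)
    then show ?thesis by simp
  next
    case False
    then have ne: "{..<p} \<noteq> {}" by auto
    have "indep_vars (\<lambda>_. borel) (\<lambda>l \<omega>. U (Suc l) \<omega>) {..<p}"
    proof -
      have "indep_vars (\<lambda>j. PiM {Suc j} (\<lambda>_. borel)) (\<lambda>j \<omega>. restrict (\<lambda>i. U i \<omega>) {Suc j}) {..<p}"
        by (rule indep_vars_restrict[OF indU]) (auto simp: disjoint_family_on_def)
      then have "indep_vars (\<lambda>_. borel) (\<lambda>j \<omega>. (restrict (\<lambda>i. U i \<omega>) {Suc j}) (Suc j)) {..<p}"
        by (rule indep_vars_compose2) (auto intro: measurable_component_singleton)
      then show ?thesis by simp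
    qed
    then have i': "indep_vars (\<lambda>_. borel) (\<lambda>l \<omega>. snd (U (Suc l) \<omega>)) {..<p}"
      by (rule indep_vars_compose2) (rule borel_measurable_continuous_onI[OF continuous_on_snd[OF continuous_on_id]])
    have i: "indep_vars (\<lambda>_. borel) (\<lambda>l \<omega>. X (s (Suc l)) \<omega> - X (s l) \<omega>) {..<p}"
      using s by (intro independent_increments) auto
    have "distr M (PiM {..<p} (\<lambda>_. borel)) R' = PiM {..<p} (\<lambda>l. distr M borel (\<lambda>\<omega>. snd (U (Suc l) \<omega>)))"
      unfolding R'_def using i' mS by (subst (asm) indep_vars_iff_distr_eq_PiM'[OF ne]) auto
    also have "\<dots> = PiM {..<p} (\<lambda>l. distr M borel (\<lambda>\<omega>. X (s (Suc l)) \<omega> - X (s l) \<omega>))"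
    proof (intro PiM_cong refl)
      fix l
      have le: "s l \<le> s (Suc l)" using incseq_SucD[OF s(1)] .
      have "distr M borel (\<lambda>\<omega>. snd (U (Suc l) \<omega>)) = distr M borel (X (s (Suc l) - s l))"
        using post_process_increment_law[OF ex snn le] by (simp add: U_def)
      also have "\<dots> = distr M borel (\<lambda>\<omega>. X (s (Suc l)) \<omega> - X (s l) \<omega>)"
        using stationary_increments[of "s l" "s (Suc l) - s l"] snn le by simp
      finally show "distr M borel (\<lambda>\<omega>. snd (U (Suc l) \<omega>)) = distr M borel (\<lambda>\<omega>. X (s (Suc l)) \<omega> - X (s l) \<omega>)" .
    qed
    also have "\<dots> = distr M (PiM {..<p} (\<lambda>_. borel)) R"
      unfolding R_def using i mX by (subst (asm) indep_vars_iff_distr_eq_PiM'[OF ne]) auto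
    finally show ?thesis .
  qed
  have evR': "{\<omega>\<in>space M. \<forall>j\<in>J. post_process j \<omega> \<in> B j} = R' -` C \<inter> space M"
  proof (intro set_eqI)
    fix \<omega>
    have "(\<Sum>l<idx j. R' \<omega> l) = post_process j \<omega>" if "\<omega> \<in> space M" "j \<in> J" for j
      using post_sum[OF that(1), of "idx j"] idx[OF that(2)] by (simp add: R'_def)
    then show "\<omega> \<in> {\<omega>\<in>space M. \<forall>j\<in>J. post_process j \<omega> \<in> B j} \<longleftrightarrow> \<omega> \<in> R' -` C \<inter> space M"
      using measurable_space[OF mR', of \<omega>] by (auto simp: C_def)
  qed
  have evR: "{\<omega>\<in>space M. \<forall>j\<in>J. X j \<omega> \<in> B j} = R -` C \<inter> space M"
  proof (intro set_eqI)
    fix \<omega>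
    have "(\<Sum>l<idx j. R \<omega> l) = X j \<omega>" if "\<omega> \<in> space M" "j \<in> J" for j
      using X_sum[OF that(1), of "idx j"] idx[OF that(2)] by (simp add: R_def)
    then show "\<omega> \<in> {\<omega>\<in>space M. \<forall>j\<in>J. X j \<omega> \<in> B j} \<longleftrightarrow> \<omega> \<in> R -` C \<inter> space M"
      using measurable_space[OF mR, of \<omega>] by (auto simp: C_def)
  qed
  have same: "prob (R' -` C \<inter> space M) = prob (R -` C \<inter> space M)"
    using arg_cong[OF law, of "\<lambda>\<mu>. measure \<mu> C"] C mR mR' by (simp add: measure_distr)
  \<comment> \<open>Groups the independent family into two: the exit pair at index \<open>0\<close>,
    and all increments.\<close>
  define K where "K j = (if j = 0 then {0} else {Suc 0..p})" for j :: nat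
  define W where "W j \<omega> = restrict (\<lambda>i. U i \<omega>) (K j)" for j \<omega>
  have indW: "indep_vars (\<lambda>j. PiM (K j) (\<lambda>_. borel)) W {..<2}"
    unfolding W_def[abs_def] by (rule indep_vars_restrict[OF indU]) (auto simp: K_def disjoint_family_on_def)
  define H where "H j = (if j = 0 then (\<lambda>y. y 0) -` A \<inter> space (PiM {0} (\<lambda>_. borel))
     else (\<lambda>y. \<lambda>l\<in>{..<p}. snd (y (Suc l))) -` C \<inter> space (PiM {Suc 0..p} (\<lambda>_. borel :: (real \<times> 'a) measure)))" for j :: nat
  have "H j \<in> sets (PiM (K j) (\<lambda>_. borel))" for j
  proof (cases "j = 0")
    case True
    have "(\<lambda>y. y 0) \<in> borel_measurable (PiM {0::nat} (\<lambda>_. borel :: (real \<times> 'a) measure))"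
      by (intro measurable_component_singleton) simp
    then show ?thesis using True A by (simp add: H_def K_def measurable_sets)
  next
    case False
    have "(\<lambda>y. \<lambda>l\<in>{..<p}. snd (y (Suc l))) \<in> measurable (PiM {Suc 0..p} (\<lambda>_. borel :: (real \<times> 'a) measure)) (PiM {..<p} (\<lambda>_. borel))"
    proof (intro measurable_restrict)
      fix l assume "l \<in> {..<p}"
      then have "(\<lambda>y. y (Suc l)) \<in> borel_measurable (PiM {Suc 0..p} (\<lambda>_. borel :: (real \<times> 'a) measure))"
        by (intro measurable_component_singleton) auto
      then show "(\<lambda>y. snd (y (Suc l))) \<in> borel_measurable (PiM {Suc 0..p} (\<lambda>_. borel :: (real \<times> 'a) measure))"
        by (rule measurable_compose) (rule borel_measurable_continuous_onI[OF continuous_on_snd[OF continuous_on_id]])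
    qed
    from measurable_sets[OF this C] show ?thesis using False by (simp add: H_def K_def)
  qed
  then have "prob (\<Inter>j\<in>{..<2}. W j -` H j \<inter> space M) = (\<Prod>j\<in>{..<2}. prob (W j -` H j \<inter> space M))"
    by (intro indep_varsD[OF indW]) (auto simp: set_eq_iff intro: zero_less_numeral)
  then have prod: "prob ((W 0 -` H 0 \<inter> space M) \<inter> (W 1 -` H 1 \<inter> space M)) = prob (W 0 -` H 0 \<inter> space M) * prob (W 1 -` H 1 \<inter> space M)"
    by (simp add: numeral_2_eq_2 lessThan_Suc Int_commute mult.commute)
  have W0: "W 0 -` H 0 \<inter> space M = {\<omega>\<in>space M. (hit_time (path \<omega>), hit_pos (path \<omega>)) \<in> A}"
  proof -
    have "W 0 \<omega> 0 = (hit_time (path \<omega>), hit_pos (path \<omega>))" for \<omega> by (simp add: W_def K_def U_def)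
    moreover have "W 0 \<omega> \<in> space (PiM {0} (\<lambda>_. borel))" for \<omega> by (simp add: W_def K_def space_PiM)
    ultimately show ?thesis by (simp add: H_def vimage_def Int_def conj_commute)
  qed
  have W1: "W 1 -` H 1 \<inter> space M = R' -` C \<inter> space M"
  proof -
    have "(\<lambda>l\<in>{..<p}. snd (W 1 \<omega> (Suc l))) = R' \<omega>" for \<omega>
      unfolding R'_def by (intro restrict_ext) (simp add: W_def K_def)
    moreover have "W 1 \<omega> \<in> space (PiM {Suc 0..p} (\<lambda>_. borel))" for \<omega>
      by (simp add: W_def K_def space_PiM)
    ultimately show ?thesis by (simp add: H_def vimage_def Int_def conj_commute)
  qed
  have "{\<omega>\<in>space M. (hit_time (path \<omega>), hit_pos (path \<omega>)) \<in> A \<and> (\<forall>j\<in>J. post_process j \<omega> \<in> B j)}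
     = (W 0 -` H 0 \<inter> space M) \<inter> (W 1 -` H 1 \<inter> space M)"
    unfolding W0 W1 evR'[symmetric] by auto
  then show ?thesis unfolding evR using prod same W0 W1 by simp
qed

definition rpath :: "'w \<Rightarrow> real \<Rightarrow> 'a" where "rpath \<omega> = restrict (path \<omega>) {0..}"

lemma measurable_rpath[measurable]: "rpath \<in> measurable M path_space"
  unfolding rpath_def[abs_def] by (intro measurable_restrict measurable_X) simp

lemma rpath_functionals:
  "hit_time (rpath \<omega>) = hit_time (path \<omega>)" "hit_pos (rpath \<omega>) = hit_pos (path \<omega>)"
  "post (rpath \<omega>) = restrict (\<lambda>s. post_process s \<omega>) {0..}"
proof -
  have e: "rpath \<omega> t = X t \<omega>" if "0 \<le> t" for t using that by (simp add: rpath_def)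
  show "hit_time (rpath \<omega>) = hit_time (path \<omega>)" "hit_pos (rpath \<omega>) = hit_pos (path \<omega>)"
    by (rule path_cong; rule e; assumption)+
  show "post (rpath \<omega>) = restrict (\<lambda>s. post_process s \<omega>) {0..}"
    unfolding post_def by (intro restrict_ext path_cong(6)) (auto simp: e)
qed

text \<open>Both sides are finite measures in \<open>B\<close>: the law of the path after the exit
  restricted to the event \<open>EA\<close>, and the law of the path itself weighted by the
  probability of \<open>EA\<close>. They agree on cylinders, hence on the product sigma-algebra.
  Events of the whole future are needed because later exits depend on infinitely many times.\<close>

lemma strong_markov:
  assumes ex: "AE \<omega> in M. exits (path \<omega>)"
    and A[measurable]: "A \<in> sets (borel :: (real \<times> 'a) measure)" and B[measurable]: "B \<in> sets path_space"
  shows "prob {\<omega>\<in>space M. (hit_time (rpath \<omega>), hit_pos (rpath \<omega>)) \<in> A \<and> post (rpath \<omega>) \<in> B} =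
    prob {\<omega>\<in>space M. (hit_time (rpath \<omega>), hit_pos (rpath \<omega>)) \<in> A} * prob {\<omega>\<in>space M. rpath \<omega> \<in> B}"
proof -
  define EA where "EA = {\<omega>\<in>space M. (hit_time (rpath \<omega>), hit_pos (rpath \<omega>)) \<in> A}"
  have [measurable]: "EA \<in> events" unfolding EA_def by measurable
  have mpost[measurable]: "(\<lambda>\<omega>. post (rpath \<omega>)) \<in> measurable M path_space" by measurable
  define \<mu>1 where "\<mu>1 = distr (density M (indicator EA)) path_space (\<lambda>\<omega>. post (rpath \<omega>))"
  define \<mu>2 where "\<mu>2 = scale_measure (emeasure M EA) (distr M path_space rpath)"
  have mu1: "emeasure \<mu>1 S = emeasure M (EA \<inter> ((\<lambda>\<omega>. post (rpath \<omega>)) -` S \<inter> space M))" if [measurable]: "S \<in> sets path_space" for S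
  proof -
    define S' where "S' = (\<lambda>\<omega>. post (rpath \<omega>)) -` S \<inter> space M"
    have [measurable]: "S' \<in> events" unfolding S'_def using mpost that by (rule measurable_sets)
    have "emeasure \<mu>1 S = emeasure (density M (indicator EA)) S'"
      unfolding \<mu>1_def S'_def using mpost that by (subst emeasure_distr) auto
    also have "\<dots> = (\<integral>\<^sup>+\<omega>. indicator EA \<omega> * indicator S' \<omega> \<partial>M)" by (rule emeasure_density) auto
    also have "\<dots> = (\<integral>\<^sup>+\<omega>. indicator (EA \<inter> S') \<omega> \<partial>M)" by (intro nn_integral_cong) (auto split: split_indicator)
    also have "\<dots> = emeasure M (EA \<inter> S')" by (rule nn_integral_indicator) measurable
    finally show ?thesis by (simp add: S'_def)
  qed
  have mu2: "emeasure \<mu>2 S = emeasure M EA * emeasure M (rpath -` S \<inter> space M)" if "S \<in> sets path_space" for S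
    unfolding \<mu>2_def using that by (simp add: emeasure_distr)
  have "\<mu>1 = \<mu>2"
  proof (rule measure_eqI_PiM_infinite[where I = "{0..}" and M = "\<lambda>_. borel"])
    show "sets \<mu>1 = sets path_space" "sets \<mu>2 = sets path_space" by (simp_all add: \<mu>1_def \<mu>2_def)
    show "finite_measure \<mu>1"
    proof
      have "emeasure \<mu>1 (space \<mu>1) = emeasure M (EA \<inter> ((\<lambda>\<omega>. post (rpath \<omega>)) -` space path_space \<inter> space M))"
        using mu1[of "space path_space"] by (simp add: \<mu>1_def)
      then show "emeasure \<mu>1 (space \<mu>1) \<noteq> \<infinity>" by simp
    qed
    fix S J assume J: "finite J" "J \<subseteq> {0::real..}" and S: "\<And>i. i \<in> J \<Longrightarrow> S i \<in> sets (borel :: 'a measure)"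
    let ?C = "prod_emb {0..} (\<lambda>_. borel) J (Pi\<^sub>E J S)"
    have C: "?C \<in> sets path_space" using J S by (intro sets_PiM_I) auto
    have c1: "EA \<inter> ((\<lambda>\<omega>. post (rpath \<omega>)) -` ?C \<inter> space M)
       = {\<omega>\<in>space M. (hit_time (path \<omega>), hit_pos (path \<omega>)) \<in> A \<and> (\<forall>j\<in>J. post_process j \<omega> \<in> S j)}"
      using J(2) by (auto simp: prod_emb_def EA_def rpath_functionals PiE_iff subset_eq extensional_def restrict_def)
    have c2: "rpath -` ?C \<inter> space M = {\<omega>\<in>space M. \<forall>j\<in>J. X j \<omega> \<in> S j}"
      using J(2) by (auto simp: prod_emb_def rpath_def PiE_iff subset_eq extensional_def restrict_def)
    have c3: "EA = {\<omega>\<in>space M. (hit_time (path \<omega>), hit_pos (path \<omega>)) \<in> A}"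
      by (simp add: EA_def rpath_functionals)
    show "emeasure \<mu>1 ?C = emeasure \<mu>2 ?C"
      unfolding mu1[OF C] mu2[OF C] c1 c2 unfolding c3 emeasure_eq_measure
      using strong_markov_cylinder[OF ex J A S] by (simp add: ennreal_mult')
  qed
  then have "emeasure M (EA \<inter> ((\<lambda>\<omega>. post (rpath \<omega>)) -` B \<inter> space M)) = emeasure M EA * emeasure M (rpath -` B \<inter> space M)"
    using mu1[OF B] mu2[OF B] by simp
  then have "prob (EA \<inter> ((\<lambda>\<omega>. post (rpath \<omega>)) -` B \<inter> space M)) = prob EA * prob (rpath -` B \<inter> space M)"
    by (simp add: emeasure_eq_measure ennreal_mult'[symmetric])
  moreover have "EA \<inter> ((\<lambda>\<omega>. post (rpath \<omega>)) -` B \<inter> space M) = {\<omega>\<in>space M. (hit_time (rpath \<omega>), hit_pos (rpath \<omega>)) \<in> A \<and> post (rpath \<omega>) \<in> B}"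
    by (auto simp: EA_def)
  moreover have "rpath -` B \<inter> space M = {\<omega>\<in>space M. rpath \<omega> \<in> B}" by auto
  ultimately show ?thesis by (simp add: EA_def)
qed

section \<open>The sequence of successive exits\<close>

definition renewal :: "nat \<Rightarrow> 'w \<Rightarrow> real \<times> 'a" where
  "renewal k \<omega> = (hit_time ((post ^^ k) (rpath \<omega>)), hit_pos ((post ^^ k) (rpath \<omega>)))"

lemma measurable_post_funpow: "(post ^^ k) \<in> measurable path_space path_space"
  by (induction k) (auto intro: measurable_comp)

lemma measurable_renewal[measurable]: "renewal k \<in> borel_measurable M"
proof -
  have "(\<lambda>\<omega>. (post ^^ k) (rpath \<omega>)) \<in> measurable M path_space"
    by (rule measurable_compose[OF measurable_rpath measurable_post_funpow])
  from measurable_compose[OF this measurable_path_space_functionals(1)]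
    measurable_compose[OF this measurable_path_space_functionals(2)]
  show ?thesis unfolding renewal_def[abs_def] by (rule borel_measurable_Pair)
qed

text \<open>The strong Markov property is applied with \<open>B\<close> the event that the later
  renewals, computed from the path after the first exit, lie in their sets. The induction ranges
  over all sequences \<open>A\<close> because what remains is \<open>A\<close> shifted by
  one.\<close>

lemma renewal_product:
  assumes ex: "AE \<omega> in M. exits (path \<omega>)"
    and A: "\<And>k. A k \<in> sets (borel :: (real \<times> 'a) measure)"
  shows "prob {\<omega>\<in>space M. \<forall>k<n. renewal k \<omega> \<in> A k} = (\<Prod>k<n. prob {\<omega>\<in>space M. renewal 0 \<omega> \<in> A k})"
  using A
proof (induction n arbitrary: A)
  case 0
  then show ?case by (simp add: prob_space)
next
  case (Suc n)
  note [measurable] = Suc.prems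
  define B where "B = {y\<in>space path_space. \<forall>k<n. (hit_time ((post ^^ k) y), hit_pos ((post ^^ k) y)) \<in> A (Suc k)}"
  have "(\<lambda>y. (hit_time ((post ^^ k) y), hit_pos ((post ^^ k) y))) \<in> borel_measurable path_space" for k
    using measurable_compose[OF measurable_post_funpow measurable_path_space_functionals(1)]
      measurable_compose[OF measurable_post_funpow measurable_path_space_functionals(2)]
    by (rule borel_measurable_Pair)
  note [measurable] = this
  have [measurable]: "B \<in> sets path_space" unfolding B_def by measurable
  have all_Suc: "(\<forall>k<Suc n. P k) \<longleftrightarrow> P 0 \<and> (\<forall>k<n. P (Suc k))" for P :: "nat \<Rightarrow> bool"
    by (metis less_Suc_eq_0_disj)
  have "{\<omega>\<in>space M. \<forall>k<Suc n. renewal k \<omega> \<in> A k} =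
     {\<omega>\<in>space M. (hit_time (rpath \<omega>), hit_pos (rpath \<omega>)) \<in> A 0 \<and> post (rpath \<omega>) \<in> B}"
    using measurable_space[OF measurable_compose[OF measurable_rpath measurable_path_space_functionals(3)]]
    unfolding all_Suc by (auto simp: renewal_def B_def funpow_Suc_right simp del: funpow.simps)
  then have "prob {\<omega>\<in>space M. \<forall>k<Suc n. renewal k \<omega> \<in> A k} =
     prob {\<omega>\<in>space M. renewal 0 \<omega> \<in> A 0} * prob {\<omega>\<in>space M. rpath \<omega> \<in> B}"
    using strong_markov[OF ex, of "A 0" B] Suc.prems by (simp add: renewal_def)
  also have "{\<omega>\<in>space M. rpath \<omega> \<in> B} = {\<omega>\<in>space M. \<forall>k<n. renewal k \<omega> \<in> A (Suc k)}"
    using measurable_space[OF measurable_rpath] by (auto simp: B_def renewal_def)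
  also have "prob \<dots> = (\<Prod>k<n. prob {\<omega>\<in>space M. renewal 0 \<omega> \<in> A (Suc k)})"
    using Suc.prems by (intro Suc.IH) auto
  finally show ?case by (simp only: prod.lessThan_Suc_shift)
qed

lemma renewal_event:
  assumes ex: "AE \<omega> in M. exits (path \<omega>)" and S: "S \<in> sets (borel :: (real \<times> 'a) measure)"
  shows "prob {\<omega>\<in>space M. renewal k \<omega> \<in> S} = prob {\<omega>\<in>space M. renewal 0 \<omega> \<in> S}"
proof -
  define A where "A i = (if i = k then S else UNIV)" for i
  have "{\<omega>\<in>space M. \<forall>i<Suc k. renewal i \<omega> \<in> A i} = {\<omega>\<in>space M. renewal k \<omega> \<in> S}"
    by (auto simp: A_def split: if_splits)
  then have "prob {\<omega>\<in>space M. renewal k \<omega> \<in> S} = (\<Prod>i<Suc k. prob {\<omega>\<in>space M. renewal 0 \<omega> \<in> A i})"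
    using renewal_product[OF ex, of A "Suc k"] S by (simp add: A_def)
  also have "\<dots> = prob {\<omega>\<in>space M. renewal 0 \<omega> \<in> S}"
    by (subst prod.mono_neutral_right[of "{..<Suc k}" "{k}"]) (auto simp: A_def prob_space)
  finally show ?thesis .
qed

lemma renewal_law:
  assumes ex: "AE \<omega> in M. exits (path \<omega>)"
  shows "distr M borel (renewal k) = distr M borel (renewal 0)"
proof (rule measure_eqI)
  fix S assume "S \<in> sets (distr M borel (renewal k))"
  then have S: "S \<in> sets borel" by simp
  have e: "renewal i -` S \<inter> space M = {\<omega>\<in>space M. renewal i \<omega> \<in> S}" for i by auto
  show "emeasure (distr M borel (renewal k)) S = emeasure (distr M borel (renewal 0)) S"
    using S renewal_event[OF ex S, of k] by (simp add: emeasure_distr e emeasure_eq_measure)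
qed simp

lemma renewal_indep:
  assumes ex: "AE \<omega> in M. exits (path \<omega>)"
  shows "indep_vars (\<lambda>_. borel) renewal UNIV"
  unfolding indep_vars_def2
proof (intro conjI ballI indep_setsI)
  fix A J assume J: "J \<noteq> {}" "J \<subseteq> (UNIV :: nat set)" "finite J"
    and A: "\<forall>j\<in>J. A j \<in> {renewal j -` S \<inter> space M |S. S \<in> sets borel}"
  from A have "\<forall>j\<in>J. \<exists>S. S \<in> sets borel \<and> A j = renewal j -` S \<inter> space M" by blast
  then obtain S where S: "\<And>j. j \<in> J \<Longrightarrow> S j \<in> sets borel" "\<And>j. j \<in> J \<Longrightarrow> A j = renewal j -` S j \<inter> space M"
    by metis
  \<comment> \<open>Indices up to \<open>Max J\<close> outside \<open>J\<close> receive the full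
    space, so that \<open>renewal_product\<close> over an initial segment applies.\<close>
  define S' where "S' j = (if j \<in> J then S j else UNIV)" for j
  have JM: "j < Suc (Max J)" if "j \<in> J" for j using that J(3) by (simp add: le_imp_less_Suc)
  have "(\<Inter>j\<in>J. A j) = {\<omega>\<in>space M. \<forall>j<Suc (Max J). renewal j \<omega> \<in> S' j}"
    using J(1) JM S(2) by (auto simp: S'_def)
  then have "prob (\<Inter>j\<in>J. A j) = (\<Prod>j<Suc (Max J). prob {\<omega>\<in>space M. renewal 0 \<omega> \<in> S' j})"
    using renewal_product[OF ex, of S' "Suc (Max J)"] S(1) by (simp add: S'_def)
  also have "\<dots> = (\<Prod>j\<in>J. prob {\<omega>\<in>space M. renewal 0 \<omega> \<in> S' j})"
    using JM by (intro prod.mono_neutral_right) (auto simp: S'_def prob_space)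
  also have "\<dots> = (\<Prod>j\<in>J. prob (A j))"
  proof (intro prod.cong refl)
    fix j assume j: "j \<in> J"
    have "A j = {\<omega>\<in>space M. renewal j \<omega> \<in> S' j}" using S(2)[OF j] j by (auto simp: S'_def)
    then show "prob {\<omega>\<in>space M. renewal 0 \<omega> \<in> S' j} = prob (A j)"
      using renewal_event[OF ex, of "S' j" j] S(1)[OF j] j by (simp add: S'_def)
  qed
  finally show "prob (\<Inter>j\<in>J. A j) = (\<Prod>j\<in>J. prob (A j))" .
next
  show "{renewal i -` A \<inter> space M |A. A \<in> sets borel} \<subseteq> events" for i
    using measurable_sets[OF measurable_renewal[of i]] by auto
qed simp

definition renewal_time :: "nat \<Rightarrow> 'w \<Rightarrow> real" where
  "renewal_time k \<omega> = (\<Sum>i<k. fst (renewal i \<omega>))"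

text \<open>The induction identifies the \<open>k\<close>-th iterate of \<open>post\<close> with the
  path recentred at \<open>renewal_time k\<close>, which is again cadlag and starts at the origin.
  It holds at every point of the space: when a recentred path never leaves the ball, duration and
  displacement are both \<open>0\<close>.\<close>

lemma renewal_path:
  assumes "\<omega> \<in> space M"
  shows "0 \<le> renewal_time k \<omega>"
    and "X (renewal_time k \<omega>) \<omega> = (\<Sum>i<k. snd (renewal i \<omega>))"
    and "0 \<le> fst (renewal k \<omega>)"
    and "0 \<le> s \<Longrightarrow> s < fst (renewal k \<omega>) \<Longrightarrow> norm (X (renewal_time k \<omega> + s) \<omega> - X (renewal_time k \<omega>) \<omega>) \<le> 1"
proof -
  define y where "y k s = X (renewal_time k \<omega> + s) \<omega> - X (renewal_time k \<omega>) \<omega>" for k s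
  have main: "0 \<le> renewal_time k \<omega> \<and> cadlag_path (y k) \<and> (\<forall>s\<ge>0. (post ^^ k) (rpath \<omega>) s = y k s)
     \<and> X (renewal_time k \<omega>) \<omega> = (\<Sum>i<k. snd (renewal i \<omega>))" for k
  proof (induction k)
    case 0
    show ?case using cadlag_path[OF assms] start_origin[OF assms]
      by (auto simp: renewal_time_def y_def rpath_def)
  next
    case (Suc k)
    then interpret yk: cadlag_path "y k" by simp
    have e: "(post ^^ k) (rpath \<omega>) t = y k t" if "0 \<le> t" for t using Suc that by simp
    have ht: "fst (renewal k \<omega>) = hit_time (y k)" unfolding renewal_def using path_cong(4)[OF e] by simp
    have hp: "snd (renewal k \<omega>) = hit_pos (y k)" unfolding renewal_def using path_cong(5)[OF e] by simp
    have rt: "renewal_time (Suc k) \<omega> = renewal_time k \<omega> + hit_time (y k)" by (simp add: renewal_time_def ht)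
    have yS: "y (Suc k) s = y k (hit_time (y k) + s) - y k (hit_time (y k))" for s
      unfolding y_def[of "Suc k"] rt by (simp add: y_def[of k] add.assoc)
    have "(post ^^ Suc k) (rpath \<omega>) s = y (Suc k) s" if "0 \<le> s" for s
      using that path_cong(6)[OF e that] yk.post_path_eq[OF that] by (simp add: post_def yS)
    moreover have "cadlag_path (y (Suc k))"
      unfolding yS[abs_def] by (rule cadlag_path_post[OF yk.cadlag_path_axioms])
    moreover have "X (renewal_time (Suc k) \<omega>) \<omega> = (\<Sum>i<Suc k. snd (renewal i \<omega>))"
      using Suc yk.hit_pos_eq by (simp add: hp rt y_def)
    moreover have "0 \<le> renewal_time (Suc k) \<omega>" using Suc yk.hit_time_nonneg by (simp add: rt)
    ultimately show ?case by blast
  qed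
  show "0 \<le> renewal_time k \<omega>" "X (renewal_time k \<omega>) \<omega> = (\<Sum>i<k. snd (renewal i \<omega>))" using main[of k] by auto
  interpret yk: cadlag_path "y k" using main[of k] by simp
  have ht: "fst (renewal k \<omega>) = hit_time (y k)"
    unfolding renewal_def using path_cong(4)[of "(post ^^ k) (rpath \<omega>)" "y k"] main[of k] by simp
  show "0 \<le> fst (renewal k \<omega>)" unfolding ht by (rule yk.hit_time_nonneg)
  show "0 \<le> s \<Longrightarrow> s < fst (renewal k \<omega>) \<Longrightarrow> norm (X (renewal_time k \<omega> + s) \<omega> - X (renewal_time k \<omega>) \<omega>) \<le> 1"
    unfolding ht using yk.before_hit_time[of s] by (simp add: y_def)
qed

text \<open>Take the last renewal not after \<open>t\<close>. It exists because the search stops at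
  \<open>n\<close>, and it is not \<open>n\<close> itself; until the next renewal the path stays in
  the unit ball around the position reached.\<close>

lemma near_renewal_position:
  assumes \<omega>: "\<omega> \<in> space M" and t: "0 \<le> t" "t < renewal_time n \<omega>"
  obtains k where "k < n" "norm (X t \<omega> - (\<Sum>i<k. snd (renewal i \<omega>))) \<le> 1"
proof -
  define k where "k = (GREATEST k. k \<le> n \<and> renewal_time k \<omega> \<le> t)"
  have ex: "0 \<le> n \<and> renewal_time 0 \<omega> \<le> t" using t by (simp add: renewal_time_def)
  have k: "k \<le> n \<and> renewal_time k \<omega> \<le> t"
    unfolding k_def by (rule GreatestI_nat[of _ 0 n]) (use ex in auto)
  have "k \<noteq> n" using k t by auto
  then have kn: "k < n" using k by simp
  have "t < renewal_time (Suc k) \<omega>"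
  proof (rule ccontr)
    assume "\<not> t < renewal_time (Suc k) \<omega>"
    then have "Suc k \<le> k" unfolding k_def using kn k_def by (intro Greatest_le_nat[of _ _ n]) auto
    then show False by simp
  qed
  then have "t - renewal_time k \<omega> < fst (renewal k \<omega>)" by (simp add: renewal_time_def)
  then have "norm (X t \<omega> - X (renewal_time k \<omega>) \<omega>) \<le> 1"
    using renewal_path(4)[OF \<omega>, of "t - renewal_time k \<omega>" k] k by simp
  then show ?thesis using that[OF kn] renewal_path(2)[OF \<omega>, of k] by simp
qed

text \<open>The conventions for paths without exit agree, as both real-valued exit times default to
  \<open>0\<close>. The identity therefore holds at every point, which lets it be used
  coordinatewise on product spaces.\<close>

lemma renewal_0:
  assumes "\<omega> \<in> space M"
  shows "renewal 0 \<omega> = (enn2real (exit_time X \<omega>), exit_position X \<omega>)"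
    and "exits (path \<omega>) \<Longrightarrow> exit_time X \<omega> = ennreal (hit_time (path \<omega>))"
proof -
  interpret cadlag_path "path \<omega>" using assms by (rule cadlag_path)
  have e: "exit_time X \<omega> = (if exits (path \<omega>) then ennreal (hit_time (path \<omega>)) else \<infinity>)"
    using exit_time_eq[of \<omega>] by (simp add: exit_time_def)
  then have ht: "enn2real (exit_time X \<omega>) = hit_time (path \<omega>)"
    using hit_time_nonneg by (cases "exits (path \<omega>)") (simp_all add: hit_time_def)
  show "exits (path \<omega>) \<Longrightarrow> exit_time X \<omega> = ennreal (hit_time (path \<omega>))" using e by simp
  show "renewal 0 \<omega> = (enn2real (exit_time X \<omega>), exit_position X \<omega>)"
    by (simp add: renewal_def rpath_functionals exit_position_def ht hit_pos_eq)
qed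

end

section \<open>The law of large numbers for renewal times\<close>

lemma (in prob_space) variance_sum_indep:
  fixes V :: "'i \<Rightarrow> 'a \<Rightarrow> real"
  assumes I: "finite I" and ind: "indep_vars (\<lambda>_. borel) V I"
    and sq: "\<And>i. i \<in> I \<Longrightarrow> integrable M (\<lambda>\<omega>. (V i \<omega>)\<^sup>2)"
  shows "integrable M (\<lambda>\<omega>. (\<Sum>i\<in>I. V i \<omega>)\<^sup>2)"
    and "variance (\<lambda>\<omega>. \<Sum>i\<in>I. V i \<omega>) = (\<Sum>i\<in>I. variance (V i))"
proof -
  have m: "V i \<in> borel_measurable M" if "i \<in> I" for i using ind that unfolding indep_vars_def by auto
  have int: "integrable M (V i)" if "i \<in> I" for i
    by (rule square_integrable_imp_integrable[OF m[OF that] sq[OF that]])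
  have pair: "integrable M (\<lambda>\<omega>. V i \<omega> * V j \<omega>)" "i \<noteq> j \<Longrightarrow> expectation (\<lambda>\<omega>. V i \<omega> * V j \<omega>) = expectation (V i) * expectation (V j)"
    if "i \<in> I" "j \<in> I" for i j
  proof -
    have two: "integrable M (\<lambda>\<omega>. \<Prod>k\<in>{i, j}. V k \<omega>)"
      "expectation (\<lambda>\<omega>. \<Prod>k\<in>{i, j}. V k \<omega>) = (\<Prod>k\<in>{i, j}. expectation (V k))"
      using that int indep_vars_subset[OF ind, of "{i, j}"]
      by (auto intro!: indep_vars_integrable indep_vars_lebesgue_integral)
    show "i \<noteq> j \<Longrightarrow> expectation (\<lambda>\<omega>. V i \<omega> * V j \<omega>) = expectation (V i) * expectation (V j)"
      using two(2) by simp
    show "integrable M (\<lambda>\<omega>. V i \<omega> * V j \<omega>)"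
    proof (cases "i = j")
      case True
      then show ?thesis using sq[OF that(1)] by (simp add: power2_eq_square)
    next
      case False
      then show ?thesis using two(1) by simp
    qed
  qed
  have e: "(\<Sum>i\<in>I. V i \<omega>)\<^sup>2 = (\<Sum>i\<in>I. \<Sum>j\<in>I. V i \<omega> * V j \<omega>)" for \<omega>
    by (simp add: power2_eq_square sum_product)
  show i2: "integrable M (\<lambda>\<omega>. (\<Sum>i\<in>I. V i \<omega>)\<^sup>2)"
    unfolding e using pair(1) by (intro Bochner_Integration.integrable_sum)
  have iS: "integrable M (\<lambda>\<omega>. \<Sum>i\<in>I. V i \<omega>)" using int by (intro Bochner_Integration.integrable_sum)
  have "variance (\<lambda>\<omega>. \<Sum>i\<in>I. V i \<omega>) = expectation (\<lambda>\<omega>. (\<Sum>i\<in>I. V i \<omega>)\<^sup>2) - (expectation (\<lambda>\<omega>. \<Sum>i\<in>I. V i \<omega>))\<^sup>2"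
    using iS i2 by (rule variance_eq)
  also have "expectation (\<lambda>\<omega>. (\<Sum>i\<in>I. V i \<omega>)\<^sup>2) = (\<Sum>i\<in>I. \<Sum>j\<in>I. expectation (\<lambda>\<omega>. V i \<omega> * V j \<omega>))"
    unfolding e using pair(1) by (simp add: Bochner_Integration.integral_sum Bochner_Integration.integrable_sum)
  also have "(expectation (\<lambda>\<omega>. \<Sum>i\<in>I. V i \<omega>))\<^sup>2 = (\<Sum>i\<in>I. \<Sum>j\<in>I. expectation (V i) * expectation (V j))"
    using int by (simp add: Bochner_Integration.integral_sum power2_eq_square sum_product)
  also have "(\<Sum>i\<in>I. \<Sum>j\<in>I. expectation (\<lambda>\<omega>. V i \<omega> * V j \<omega>)) - (\<Sum>i\<in>I. \<Sum>j\<in>I. expectation (V i) * expectation (V j))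
     = (\<Sum>i\<in>I. \<Sum>j\<in>I. if i = j then variance (V i) else 0)"
    unfolding sum_subtractf[symmetric]
  proof (intro sum.cong refl)
    fix i j assume "i \<in> I" "j \<in> I"
    then show "expectation (\<lambda>\<omega>. V i \<omega> * V j \<omega>) - expectation (V i) * expectation (V j) = (if i = j then variance (V i) else 0)"
      using pair(2)[of i j] variance_eq[OF int sq, of i] by (auto simp: power2_eq_square)
  qed
  also have "\<dots> = (\<Sum>i\<in>I. variance (V i))" using I by simp
  finally show "variance (\<lambda>\<omega>. \<Sum>i\<in>I. V i \<omega>) = (\<Sum>i\<in>I. variance (V i))" .
qed

lemma (in prob_space) weak_law_square_integrable:
  fixes V :: "nat \<Rightarrow> 'a \<Rightarrow> real"
  assumes ind: "indep_vars (\<lambda>_. borel) V UNIV" and law: "\<And>i. distr M borel (V i) = distr M borel (V 0)"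
    and sq: "integrable M (\<lambda>\<omega>. (V 0 \<omega>)\<^sup>2)" and "0 < e"
  shows "(\<lambda>n. prob {\<omega>\<in>space M. real n * e \<le> \<bar>(\<Sum>i<n. V i \<omega>) - real n * expectation (V 0)\<bar>}) \<longlonglongrightarrow> 0"
proof -
  have m[measurable]: "V i \<in> borel_measurable M" for i using ind unfolding indep_vars_def by auto
  have tr: "expectation (\<lambda>\<omega>. g (V i \<omega>)) = expectation (\<lambda>\<omega>. g (V 0 \<omega>))"
    if [measurable]: "g \<in> borel_measurable borel" for g :: "real \<Rightarrow> real" and i
    using arg_cong[OF law[of i], of "\<lambda>\<mu>. integral\<^sup>L \<mu> g"] by (simp add: integral_distr)
  have sqi: "integrable M (\<lambda>\<omega>. (V i \<omega>)\<^sup>2)" for i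
  proof -
    have "integrable (distr M borel (V i)) (\<lambda>x. x\<^sup>2)" unfolding law[of i] using sq by (subst integrable_distr_eq) auto
    then show ?thesis by (subst (asm) integrable_distr_eq) auto
  qed
  have mean: "expectation (V i) = expectation (V 0)" for i using tr[of "\<lambda>x. x" i] by simp
  have var: "variance (V i) = variance (V 0)" for i
    unfolding mean[of i] by (rule tr[of "\<lambda>x. (x - expectation (V 0))\<^sup>2"]) measurable
  have int: "integrable M (V i)" for i by (rule square_integrable_imp_integrable[OF m sqi])
  have bound: "prob {\<omega>\<in>space M. real n * e \<le> \<bar>(\<Sum>i<n. V i \<omega>) - real n * expectation (V 0)\<bar>} \<le> variance (V 0) / e\<^sup>2 / real n"
    if "0 < n" for n
  proof -
    have indn: "indep_vars (\<lambda>_. borel) V {..<n}" by (rule indep_vars_subset[OF ind]) auto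
    note vs = variance_sum_indep[OF finite_lessThan indn sqi]
    have es: "expectation (\<lambda>\<omega>. \<Sum>i<n. V i \<omega>) = real n * expectation (V 0)"
    proof -
      have "expectation (\<lambda>\<omega>. \<Sum>i<n. V i \<omega>) = (\<Sum>i<n. expectation (V i))"
        by (rule Bochner_Integration.integral_sum) (rule int)
      also have "\<dots> = (\<Sum>i<n. expectation (V 0))" by (intro sum.cong refl mean)
      finally show ?thesis by simp
    qed
    have "prob {\<omega>\<in>space M. real n * e \<le> \<bar>(\<Sum>i<n. V i \<omega>) - expectation (\<lambda>\<omega>. \<Sum>i<n. V i \<omega>)\<bar>}
        \<le> variance (\<lambda>\<omega>. \<Sum>i<n. V i \<omega>) / (real n * e)\<^sup>2"
      using vs(1) that \<open>0 < e\<close> by (intro Chebyshev_inequality) auto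
    also have "variance (\<lambda>\<omega>. \<Sum>i<n. V i \<omega>) = (\<Sum>i<n. variance (V i))" by (rule vs(2))
    also have "\<dots> = (\<Sum>i<n. variance (V 0))" by (intro sum.cong refl var)
    also have "\<dots> = real n * variance (V 0)" by simp
    also have "real n * variance (V 0) / (real n * e)\<^sup>2 = variance (V 0) / e\<^sup>2 / real n"
      using that by (simp add: power2_eq_square)
    finally show ?thesis unfolding es .
  qed
  show ?thesis
  proof (rule tendsto_sandwich[OF _ _ tendsto_const lim_const_over_n])
    show "\<forall>\<^sub>F n in sequentially. prob {\<omega>\<in>space M. real n * e \<le> \<bar>(\<Sum>i<n. V i \<omega>) - real n * expectation (V 0)\<bar>}
        \<le> variance (V 0) / e\<^sup>2 / real n"
      using eventually_gt_at_top[of 0] by eventually_elim (rule bound)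
  qed simp
qed

text \<open>\<open>(n + 1) * (n + 2)\<close> are the coefficients of the twice differentiated
  geometric series, and they dominate the square.\<close>

lemma summable_square_geometric:
  fixes r :: real
  assumes "0 \<le> r" "r < 1"
  shows "summable (\<lambda>k. (real k + 1)\<^sup>2 * r ^ k)"
proof (rule summable_comparison_test)
  obtain K where K: "r < K" "K < 1" using dense[OF assms(2)] by blast
  have geo: "summable (\<lambda>n. 1 * x ^ n)" if "norm x < 1" for x :: real using that by simp
  have "summable (\<lambda>n. diffs (\<lambda>_. 1) n * x ^ n)" if "norm x < K" for x :: real
    by (rule termdiff_converges[OF _ geo, of x 1]) (use that K in auto)
  then have "summable (\<lambda>n. diffs (diffs (\<lambda>_. 1)) n * r ^ n)"
    using K assms(1) by (intro termdiff_converges[of r K]) auto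
  then show "summable (\<lambda>n. ((real n + 1) * (real n + 2)) * r ^ n)" by (simp add: diffs_def algebra_simps)
  show "\<exists>N. \<forall>n\<ge>N. norm ((real n + 1)\<^sup>2 * r ^ n) \<le> (real n + 1) * (real n + 2) * r ^ n"
    using assms(1) by (intro exI[of _ 0]) (auto simp: power2_eq_square abs_mult intro!: mult_right_mono mult_left_mono)
qed

section \<open>Geometric tail and second moment of the exit time\<close>

context levy_process
begin

lemma increments_in_set:
  assumes "0 \<le> t" and S: "S \<in> sets (borel :: 'a measure)"
  shows "prob {\<omega>\<in>space M. \<forall>i<n. X (real (Suc i) * t) \<omega> - X (real i * t) \<omega> \<in> S} = prob {\<omega>\<in>space M. X t \<omega> \<in> S} ^ n"
proof (cases "n = 0")
  case False
  have "incseq (\<lambda>i. real i * t)" using assms by (auto simp: incseq_def mult_right_mono)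
  then have ind: "indep_vars (\<lambda>_. borel) (\<lambda>i \<omega>. X (real (Suc i) * t) \<omega> - X (real i * t) \<omega>) {..<n}"
    by (intro independent_increments) auto
  have "{\<omega>\<in>space M. \<forall>i<n. X (real (Suc i) * t) \<omega> - X (real i * t) \<omega> \<in> S}
     = (\<Inter>i\<in>{..<n}. (\<lambda>\<omega>. X (real (Suc i) * t) \<omega> - X (real i * t) \<omega>) -` S \<inter> space M)"
    using False by auto
  also have "prob \<dots> = (\<Prod>i\<in>{..<n}. prob ((\<lambda>\<omega>. X (real (Suc i) * t) \<omega> - X (real i * t) \<omega>) -` S \<inter> space M))"
    using False S by (intro indep_varsD[OF ind]) auto
  also have "\<dots> = (\<Prod>i\<in>{..<n}. prob {\<omega>\<in>space M. X t \<omega> \<in> S})"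
  proof (intro prod.cong refl)
    fix i
    have [measurable]: "X (real (Suc i) * t) \<in> borel_measurable M" "X (real i * t) \<in> borel_measurable M" "X t \<in> borel_measurable M"
      using assms by (intro measurable_X; simp)+
    have "distr M borel (\<lambda>\<omega>. X (real i * t + t) \<omega> - X (real i * t) \<omega>) = distr M borel (X t)"
      using assms by (intro stationary_increments) auto
    moreover have "real i * t + t = real (Suc i) * t" by (simp add: algebra_simps)
    ultimately have "distr M borel (\<lambda>\<omega>. X (real (Suc i) * t) \<omega> - X (real i * t) \<omega>) = distr M borel (X t)" by simp
    moreover have mD: "(\<lambda>\<omega>. X (real (Suc i) * t) \<omega> - X (real i * t) \<omega>) \<in> borel_measurable M" by measurable
    ultimately show "prob ((\<lambda>\<omega>. X (real (Suc i) * t) \<omega> - X (real i * t) \<omega>) -` S \<inter> space M) = prob {\<omega>\<in>space M. X t \<omega> \<in> S}"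
      using measure_distr[OF mD S] measure_distr[of "X t" M borel S] S
      by (simp add: vimage_def Int_def conj_commute[of _ "_ \<in> S"])
  qed
  finally show ?thesis by simp
qed (simp add: prob_space)

context
  assumes nontrivial: "\<not> (AE \<omega> in M. \<forall>t\<ge>0. X t \<omega> = 0)"
begin

text \<open>If all marginals vanished almost surely, the path would vanish at all dyadic times
  simultaneously, and by right continuity everywhere.\<close>

lemma nontrivial_marginal: "\<exists>t\<ge>0. \<not> (AE \<omega> in M. X t \<omega> = 0)"
proof (rule ccontr)
  assume "\<not> ?thesis"
  then have "AE \<omega> in M. X (real k / 2 ^ n) \<omega> = 0" for k n :: nat by auto
  then have "AE \<omega> in M. \<forall>k n::nat. X (real k / 2 ^ n) \<omega> = 0" by (simp add: AE_all_countable)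
  then have "AE \<omega> in M. \<forall>t\<ge>0. X t \<omega> = 0"
    using AE_space
  proof eventually_elim
    case (elim \<omega>)
    show ?case
    proof (intro allI impI)
      fix t :: real assume "0 \<le> t"
      define r where "r n = real (Suc (nat \<lfloor>t * 2 ^ n\<rfloor>)) / 2 ^ n" for n :: nat
      have r: "t \<le> r n" "r n \<le> t + inverse (2 ^ n)" for n
      proof -
        have "0 \<le> t * 2 ^ n" using \<open>0 \<le> t\<close> by simp
        then have "t * 2 ^ n \<le> real (Suc (nat \<lfloor>t * 2 ^ n\<rfloor>))" "real (Suc (nat \<lfloor>t * 2 ^ n\<rfloor>)) \<le> t * 2 ^ n + 1" by linarith+
        then show "t \<le> r n" "r n \<le> t + inverse (2 ^ n)" by (auto simp: r_def field_simps)
      qed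
      have "(\<lambda>n. t + inverse (2 ^ n)) \<longlonglongrightarrow> t + 0"
        by (intro tendsto_intros LIMSEQ_inverse_realpow_zero) simp
      then have "r \<longlonglongrightarrow> t" using r by (intro tendsto_sandwich[of "\<lambda>_. t" r sequentially "\<lambda>n. t + inverse (2 ^ n)"]) auto
      then have "(\<lambda>n. X (r n) \<omega>) \<longlonglongrightarrow> X t \<omega>"
        using cadlag_paths \<open>\<omega> \<in> space M\<close> \<open>0 \<le> t\<close> r by (intro cadlag_tendsto[where x = "\<lambda>t. X t \<omega>"]) auto
      moreover have "X (r n) \<omega> = 0" for n using elim unfolding r_def by blast
      ultimately show "X t \<omega> = 0" by (simp add: LIMSEQ_const_iff)
    qed
  qed
  with nontrivial show False by simp
qed

text \<open>If no such direction existed, the signed basis directions would give almost surely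
  nonpositive coordinates of both signs, hence a vanishing marginal at a time where it is known not
  to vanish.\<close>

lemma nontrivial_direction:
  obtains t \<delta> b where "0 \<le> t" "0 < \<delta>" "norm b = 1" "0 < prob {\<omega>\<in>space M. \<delta> < b \<bullet> X t \<omega>}"
proof (rule ccontr)
  note obt = that
  assume c: "\<not> thesis"
  obtain t where t: "0 \<le> t" "\<not> (AE \<omega> in M. X t \<omega> = 0)" using nontrivial_marginal by blast
  have [measurable]: "X t \<in> borel_measurable M" using t(1) by (rule measurable_X)
  have le: "AE \<omega> in M. b \<bullet> X t \<omega> \<le> 0" if "norm b = 1" for b
  proof -
    have "AE \<omega> in M. b \<bullet> X t \<omega> \<le> 1 / real (Suc n)" for n
    proof -
      have "prob {\<omega>\<in>space M. 1 / real (Suc n) < b \<bullet> X t \<omega>} = 0"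
      proof (rule ccontr)
        assume "prob {\<omega>\<in>space M. 1 / real (Suc n) < b \<bullet> X t \<omega>} \<noteq> 0"
        then have "0 < prob {\<omega>\<in>space M. 1 / real (Suc n) < b \<bullet> X t \<omega>}" by (simp add: less_le)
        then have thesis by (rule obt[OF t(1) _ \<open>norm b = 1\<close>, rotated]) simp
        with c show False by simp
      qed
      then have "AE \<omega> in M. \<omega> \<notin> {\<omega>\<in>space M. 1 / real (Suc n) < b \<bullet> X t \<omega>}"
        by (subst (asm) prob_eq_0) simp_all
      then show ?thesis using AE_space by eventually_elim (simp add: not_less)
    qed
    then have "AE \<omega> in M. \<forall>n. b \<bullet> X t \<omega> \<le> 1 / real (Suc n)" by (simp add: AE_all_countable)
    then show ?thesis
    proof eventually_elim
      case (elim \<omega>)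
      then show ?case by (intro LIMSEQ_le_const[OF LIMSEQ_Suc[OF lim_1_over_n]]) auto
    qed
  qed
  have "AE \<omega> in M. \<forall>b\<in>Basis. b \<bullet> X t \<omega> \<le> 0 \<and> (- b) \<bullet> X t \<omega> \<le> 0"
    by (intro AE_finite_allI finite_Basis AE_conjI le) auto
  then have "AE \<omega> in M. X t \<omega> = 0"
  proof eventually_elim
    case (elim \<omega>)
    show ?case
    proof (rule euclidean_eqI)
      fix b :: 'a assume "b \<in> Basis"
      with elim have "b \<bullet> X t \<omega> \<le> 0" "(- b) \<bullet> X t \<omega> \<le> 0" by blast+
      then show "X t \<omega> \<bullet> b = 0 \<bullet> b" by (simp add: inner_commute)
    qed
  qed
  with t(2) show False by simp
qed

text \<open>More than \<open>2 / \<delta>\<close> successive increments, each above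
  \<open>\<delta>\<close> in direction \<open>b\<close>, add up to more than 2. By independence this
  happens with positive probability. The number 2 is the diameter of the ball.\<close>

lemma big_increment: obtains s where "0 < s" "0 < prob {\<omega>\<in>space M. 2 < norm (X s \<omega>)}"
proof -
  obtain t \<delta> b where t: "0 \<le> t" "0 < \<delta>" "norm b = 1" "0 < prob {\<omega>\<in>space M. \<delta> < b \<bullet> X t \<omega>}"
    by (rule nontrivial_direction)
  obtain n where n: "2 / \<delta> < real n" using reals_Archimedean2 by blast
  have [measurable]: "X (real n * t) \<in> borel_measurable M" using t(1) by (intro measurable_X) simp
  have "{x. \<delta> < b \<bullet> x} \<in> sets borel" by measurable
  from increments_in_set[OF t(1) this, of n]
  have "0 < prob {\<omega>\<in>space M. \<forall>i<n. \<delta> < b \<bullet> (X (real (Suc i) * t) \<omega> - X (real i * t) \<omega>)}"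
    using t(4) by (simp add: zero_less_power)
  also have "\<dots> \<le> prob {\<omega>\<in>space M. 2 < norm (X (real n * t) \<omega>)}"
  proof (rule finite_measure_mono)
    show "{\<omega>\<in>space M. \<forall>i<n. \<delta> < b \<bullet> (X (real (Suc i) * t) \<omega> - X (real i * t) \<omega>)} \<subseteq> {\<omega>\<in>space M. 2 < norm (X (real n * t) \<omega>)}"
    proof safe
      fix \<omega> assume \<omega>: "\<omega> \<in> space M" and i: "\<forall>i<n. \<delta> < b \<bullet> (X (real (Suc i) * t) \<omega> - X (real i * t) \<omega>)"
      have "real n * \<delta> = (\<Sum>i<n. \<delta>)" by simp
      also have "\<dots> \<le> (\<Sum>i<n. b \<bullet> (X (real (Suc i) * t) \<omega> - X (real i * t) \<omega>))"
        using i by (intro sum_mono) (auto intro: less_imp_le)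
      also have "\<dots> = b \<bullet> X (real n * t) \<omega>"
        using sum_lessThan_telescope[of "\<lambda>i. X (real i * t) \<omega>" n] start_origin[OF \<omega>]
        by (simp only: inner_sum_right[symmetric]) simp
      also have "\<dots> \<le> norm (X (real n * t) \<omega>)" using norm_cauchy_schwarz[of b "X (real n * t) \<omega>"] t(3) by simp
      finally show "2 < norm (X (real n * t) \<omega>)" using n t(2) by (simp add: field_simps)
    qed
  qed measurable
  finally have p: "0 < prob {\<omega>\<in>space M. 2 < norm (X (real n * t) \<omega>)}" .
  moreover have "real n * t \<noteq> 0"
  proof
    assume "real n * t = 0"
    then have "{\<omega>\<in>space M. 2 < norm (X (real n * t) \<omega>)} = {}" using start_origin by auto
    with p show False by simp
  qed
  moreover have "0 \<le> real n * t" using t(1) by simp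
  ultimately have "0 < real n * t" by linarith
  then show ?thesis using p by (rule that)
qed

text \<open>A path found in the unit ball at all times \<open>0, s, ..., k * s\<close> has made
  \<open>k\<close> independent increments of norm at most 2, each of them with probability
  \<open>r < 1\<close>.\<close>

lemma exit_tail:
  obtains s r where "0 < s" "0 \<le> r" "r < 1"
    "\<And>k. prob {\<omega>\<in>space M. \<forall>j\<le>k. norm (X (real j * s) \<omega>) \<le> 1} \<le> r ^ k"
proof -
  obtain s where s: "0 < s" "0 < prob {\<omega>\<in>space M. 2 < norm (X s \<omega>)}" by (rule big_increment)
  have [measurable]: "X t \<in> borel_measurable M" if "0 \<le> t" for t using that by (rule measurable_X)
  define r where "r = prob {\<omega>\<in>space M. X s \<omega> \<in> cball 0 2}"
  have "{\<omega>\<in>space M. X s \<omega> \<in> cball 0 2} = space M - {\<omega>\<in>space M. 2 < norm (X s \<omega>)}" by auto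
  then have "r = 1 - prob {\<omega>\<in>space M. 2 < norm (X s \<omega>)}"
    unfolding r_def using s(1) by (simp add: prob_compl)
  then have r: "0 \<le> r" "r < 1" using s(2) by (auto simp: r_def)
  show ?thesis
  proof (rule that[OF s(1) r])
    fix k
    have "prob {\<omega>\<in>space M. \<forall>j\<le>k. norm (X (real j * s) \<omega>) \<le> 1}
        \<le> prob {\<omega>\<in>space M. \<forall>i<k. X (real (Suc i) * s) \<omega> - X (real i * s) \<omega> \<in> cball 0 2}"
    proof (rule finite_measure_mono)
      show "{\<omega>\<in>space M. \<forall>j\<le>k. norm (X (real j * s) \<omega>) \<le> 1} \<subseteq>
        {\<omega>\<in>space M. \<forall>i<k. X (real (Suc i) * s) \<omega> - X (real i * s) \<omega> \<in> cball 0 2}"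
      proof safe
        fix \<omega> i assume h: "\<forall>j\<le>k. norm (X (real j * s) \<omega>) \<le> 1" "i < k"
        have "norm (X (real (Suc i) * s) \<omega>) \<le> 1" "norm (X (real i * s) \<omega>) \<le> 1" using h by (auto simp del: of_nat_Suc)
        then have "norm (X (real (Suc i) * s) \<omega> - X (real i * s) \<omega>) \<le> 2"
          using norm_triangle_ineq4[of "X (real (Suc i) * s) \<omega>" "X (real i * s) \<omega>"] by linarith
        then show "X (real (Suc i) * s) \<omega> - X (real i * s) \<omega> \<in> cball 0 2" by simp
      qed
      have mD: "(\<lambda>\<omega>. X (real (Suc i) * s) \<omega> - X (real i * s) \<omega>) \<in> borel_measurable M" for i
        using s(1) by (intro borel_measurable_diff measurable_X; simp)
      have "{\<omega>\<in>space M. \<forall>i<k. X (real (Suc i) * s) \<omega> - X (real i * s) \<omega> \<in> cball 0 2}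
        = {\<omega>\<in>space M. \<forall>i\<in>{..<k}. X (real (Suc i) * s) \<omega> - X (real i * s) \<omega> \<in> cball 0 2}" by auto
      also have "\<dots> \<in> events"
      proof (intro sets.sets_Collect_finite_All finite_lessThan)
        fix i
        have "(\<lambda>\<omega>. X (real (Suc i) * s) \<omega> - X (real i * s) \<omega>) -` cball 0 2 \<inter> space M \<in> events"
          by (rule measurable_sets[OF mD]) simp
        then show "{\<omega>\<in>space M. X (real (Suc i) * s) \<omega> - X (real i * s) \<omega> \<in> cball 0 2} \<in> events"
          by (simp only: vimage_def Int_def mem_Collect_eq conj_commute)
      qed
      finally show "{\<omega>\<in>space M. \<forall>i<k. X (real (Suc i) * s) \<omega> - X (real i * s) \<omega> \<in> cball 0 2} \<in> events" .
    qed
    also have "\<dots> = r ^ k" unfolding r_def using s(1) by (intro increments_in_set) auto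
    finally show "prob {\<omega>\<in>space M. \<forall>j\<le>k. norm (X (real j * s) \<omega>) \<le> 1} \<le> r ^ k" .
  qed
qed

text \<open>Both facts follow from the geometric tail: exit is almost sure because the tail tends to
  zero, and the second moment is bounded by a convergent series over the intervals of length
  \<open>s\<close>. Square integrability makes the law of large numbers a matter of Chebyshev's
  inequality.\<close>

lemma exits_AE: "AE \<omega> in M. exits (path \<omega>)"
  and integrable_hit_time_square: "integrable M (\<lambda>\<omega>. (hit_time (path \<omega>))\<^sup>2)"
proof -
  obtain s r where s: "0 < s" and r: "0 \<le> r" "r < 1"
    and tail: "\<And>k. prob {\<omega>\<in>space M. \<forall>j\<le>k. norm (X (real j * s) \<omega>) \<le> 1} \<le> r ^ k"
    by (rule exit_tail) blast
  have X[measurable]: "X t \<in> borel_measurable M" if "0 \<le> t" for t using that by (rule measurable_X)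
  have [measurable]: "X (real j * s) \<in> borel_measurable M" for j :: nat using s by (intro measurable_X) simp
  have ev: "{\<omega>\<in>space M. \<forall>j\<le>k. norm (X (real j * s) \<omega>) \<le> 1} \<in> events" for k :: nat by measurable
  have [measurable]: "Measurable.pred M (\<lambda>\<omega>. exits (path \<omega>))" by (rule measurable_exits[OF X])
  have "prob {\<omega>\<in>space M. \<not> exits (path \<omega>)} \<le> r ^ k" for k
  proof -
    have "{\<omega>\<in>space M. \<not> exits (path \<omega>)} \<subseteq> {\<omega>\<in>space M. \<forall>j\<le>k. norm (X (real j * s) \<omega>) \<le> 1}"
    proof safe
      fix \<omega> j assume \<omega>: "\<omega> \<in> space M" and ne: "\<not> exits (path \<omega>)"
      interpret cadlag_path "path \<omega>" using \<omega> by (rule cadlag_path)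
      have "real j * s \<notin> out" using ne exits_iff by simp
      then show "norm (X (real j * s) \<omega>) \<le> 1" using s by (simp add: out_def)
    qed
    from order_trans[OF finite_measure_mono[OF this ev] tail] show ?thesis .
  qed
  moreover have "(\<lambda>k. r ^ k) \<longlonglongrightarrow> 0" using r by (rule LIMSEQ_realpow_zero)
  ultimately have "prob {\<omega>\<in>space M. \<not> exits (path \<omega>)} \<le> 0"
    by (intro LIMSEQ_le_const) auto
  then have "prob {\<omega>\<in>space M. \<not> exits (path \<omega>)} = 0" using measure_nonneg order_antisym by metis
  then have "AE \<omega> in M. \<omega> \<notin> {\<omega>\<in>space M. \<not> exits (path \<omega>)}"
    by (subst (asm) prob_eq_0) simp_all
  then show "AE \<omega> in M. exits (path \<omega>)" using AE_space by eventually_elim simp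
  have sub: "prob {\<omega>\<in>space M. real k * s < hit_time (path \<omega>)} \<le> r ^ k" for k
  proof -
    have "{\<omega>\<in>space M. real k * s < hit_time (path \<omega>)} \<subseteq> {\<omega>\<in>space M. \<forall>j\<le>k. norm (X (real j * s) \<omega>) \<le> 1}"
    proof safe
      fix \<omega> j assume \<omega>: "\<omega> \<in> space M" and h: "real k * s < hit_time (path \<omega>)" "j \<le> k"
      interpret cadlag_path "path \<omega>" using \<omega> by (rule cadlag_path)
      have le: "real j * s \<le> real k * s" using h(2) s by (intro mult_right_mono) auto
      show "norm (X (real j * s) \<omega>) \<le> 1"
        by (rule before_hit_time[OF _ order_le_less_trans[OF le h(1)]]) (use s in simp)
    qed
    from order_trans[OF finite_measure_mono[OF this ev] tail] show ?thesis .
  qed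
  show "integrable M (\<lambda>\<omega>. (hit_time (path \<omega>))\<^sup>2)"
  proof (rule integrableI_nonneg)
    have "(\<integral>\<^sup>+\<omega>. ennreal ((hit_time (path \<omega>))\<^sup>2) \<partial>M) \<le>
       (\<integral>\<^sup>+\<omega>. (\<Sum>k. ennreal (s\<^sup>2 * (real k + 1)\<^sup>2) * indicator {\<omega>\<in>space M. real k * s < hit_time (path \<omega>)} \<omega>) \<partial>M)"
    proof (rule nn_integral_mono)
      fix \<omega> assume \<omega>: "\<omega> \<in> space M"
      interpret cadlag_path "path \<omega>" using \<omega> by (rule cadlag_path)
      let ?h = "hit_time (path \<omega>)"
      show "ennreal (?h\<^sup>2) \<le> (\<Sum>k. ennreal (s\<^sup>2 * (real k + 1)\<^sup>2) * indicator {\<omega>\<in>space M. real k * s < hit_time (path \<omega>)} \<omega>)"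
      proof (cases "?h = 0")
        case False
        then have hp: "0 < ?h" using hit_time_nonneg by simp
        \<comment> \<open>Rounding up and subtracting one puts the exit time strictly above
          \<open>k * s\<close> and at most at \<open>(k + 1) * s\<close>, matching the strict
          inequality in the indicator.\<close>
        define k where "k = nat (\<lceil>?h / s\<rceil> - 1)"
        have "0 < ?h / s" using hp s by simp
        then have k: "real k < ?h / s" "?h / s \<le> real k + 1" unfolding k_def by linarith+
        have "?h \<le> s * (real k + 1)" using k(2) s by (simp add: field_simps)
        then have "?h\<^sup>2 \<le> (s * (real k + 1))\<^sup>2" using hp by (intro power_mono) auto
        then have "ennreal (?h\<^sup>2) \<le> ennreal (s\<^sup>2 * (real k + 1)\<^sup>2)" by (intro ennreal_leI) (simp add: power_mult_distrib)
        also have "\<dots> = ennreal (s\<^sup>2 * (real k + 1)\<^sup>2) * indicator {\<omega>\<in>space M. real k * s < hit_time (path \<omega>)} \<omega>"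
          using k(1) s \<omega> by (simp add: field_simps)
        also have "\<dots> \<le> (\<Sum>k. ennreal (s\<^sup>2 * (real k + 1)\<^sup>2) * indicator {\<omega>\<in>space M. real k * s < hit_time (path \<omega>)} \<omega>)"
        proof -
          define g where "g j = ennreal (s\<^sup>2 * (real j + 1)\<^sup>2) * indicator {\<omega>\<in>space M. real j * s < hit_time (path \<omega>)} \<omega>" for j
          have "(\<Sum>j\<in>{k}. g j) \<le> suminf g" by (rule sum_le_suminf) auto
          then have "g k \<le> suminf g" by simp
          then show ?thesis unfolding g_def[abs_def] .
        qed
        finally show ?thesis .
      qed simp
    qed
    also have "\<dots> = (\<Sum>k. \<integral>\<^sup>+\<omega>. ennreal (s\<^sup>2 * (real k + 1)\<^sup>2) * indicator {\<omega>\<in>space M. real k * s < hit_time (path \<omega>)} \<omega> \<partial>M)"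
      by (rule nn_integral_suminf) measurable
    also have "\<dots> = (\<Sum>k. ennreal (s\<^sup>2 * (real k + 1)\<^sup>2 * prob {\<omega>\<in>space M. real k * s < hit_time (path \<omega>)}))"
      by (intro suminf_cong, subst nn_integral_cmult_indicator) (auto simp: emeasure_eq_measure ennreal_mult')
    also have "\<dots> \<le> (\<Sum>k. ennreal (s\<^sup>2 * ((real k + 1)\<^sup>2 * r ^ k)))"
      using sub by (intro suminf_le ennreal_leI) (auto simp: mult.assoc intro!: mult_left_mono)
    also have "\<dots> < \<infinity>"
    proof -
      have "summable (\<lambda>k. s\<^sup>2 * ((real k + 1)\<^sup>2 * r ^ k))"
        by (intro summable_mult summable_square_geometric r)
      then have "(\<Sum>k. ennreal (s\<^sup>2 * ((real k + 1)\<^sup>2 * r ^ k))) \<noteq> \<top>"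
        using r(1) by (intro ennreal_suminf_neq_top) auto
      then show ?thesis by (simp add: less_top)
    qed
    finally show "(\<integral>\<^sup>+\<omega>. ennreal ((hit_time (path \<omega>))\<^sup>2) \<partial>M) < \<infinity>" .
  qed auto
qed

lemma mean_exit_time_eq:
  "mean_exit_time M X = expectation (\<lambda>\<omega>. fst (renewal 0 \<omega>))" "0 < mean_exit_time M X"
proof -
  have f0: "fst (renewal 0 \<omega>) = hit_time (path \<omega>)" for \<omega> by (simp add: renewal_def rpath_functionals)
  have int: "integrable M (\<lambda>\<omega>. hit_time (path \<omega>))"
    by (rule square_integrable_imp_integrable[OF _ integrable_hit_time_square]) measurable
  have nn: "AE \<omega> in M. 0 \<le> hit_time (path \<omega>)"
    using AE_space by eventually_elim (rule cadlag_path.hit_time_nonneg[OF cadlag_path])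
  have "(\<integral>\<^sup>+\<omega>. exit_time X \<omega> \<partial>M) = (\<integral>\<^sup>+\<omega>. ennreal (hit_time (path \<omega>)) \<partial>M)"
  proof (rule nn_integral_cong_AE)
    show "AE \<omega> in M. exit_time X \<omega> = ennreal (hit_time (path \<omega>))"
      using exits_AE AE_space by eventually_elim (rule renewal_0(2))
  qed
  also have "\<dots> = ennreal (expectation (\<lambda>\<omega>. hit_time (path \<omega>)))"
    using int nn by (rule nn_integral_eq_integral)
  finally show e: "mean_exit_time M X = expectation (\<lambda>\<omega>. fst (renewal 0 \<omega>))"
    unfolding mean_exit_time_def f0 using nn by (simp add: integral_nonneg_AE)
  have pos: "AE \<omega> in M. 0 < hit_time (path \<omega>)"
    using exits_AE AE_space
  proof eventually_elim
    case (elim \<omega>)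
    then interpret cadlag_path "path \<omega>" by (intro cadlag_path)
    show ?case using tau_pos elim by (simp add: hit_time_eq)
  qed
  have "expectation (\<lambda>\<omega>. hit_time (path \<omega>)) \<noteq> 0"
  proof
    assume "expectation (\<lambda>\<omega>. hit_time (path \<omega>)) = 0"
    then have "AE \<omega> in M. hit_time (path \<omega>) = 0" using integral_nonneg_eq_0_iff_AE[OF int nn] by simp
    with pos have "AE \<omega> in M. False" by eventually_elim simp
    then show False by simp
  qed
  moreover have "0 \<le> expectation (\<lambda>\<omega>. hit_time (path \<omega>))" using nn by (rule integral_nonneg_AE)
  ultimately show "0 < mean_exit_time M X" unfolding e f0 by simp
qed

lemma renewal_time_law_of_large_numbers:
  assumes "0 < e"
  shows "(\<lambda>n. prob {\<omega>\<in>space M. real n * e \<le> \<bar>renewal_time n \<omega> - real n * mean_exit_time M X\<bar>}) \<longlonglongrightarrow> 0"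
proof -
  have fst_borel: "fst \<in> borel_measurable (borel :: (real \<times> 'a) measure)"
    by (rule borel_measurable_continuous_onI[OF continuous_on_fst[OF continuous_on_id]])
  have ind: "indep_vars (\<lambda>_. borel) (\<lambda>k \<omega>. fst (renewal k \<omega>)) UNIV"
    by (rule indep_vars_compose2[OF renewal_indep[OF exits_AE]]) (rule fst_borel)
  have law: "distr M borel (\<lambda>\<omega>. fst (renewal i \<omega>)) = distr M borel (\<lambda>\<omega>. fst (renewal 0 \<omega>))" for i
  proof -
    have "distr (distr M borel (renewal i)) borel fst = distr (distr M borel (renewal 0)) borel fst"
      using renewal_law[OF exits_AE, of i] by simp
    then show ?thesis using fst_borel by (simp add: distr_distr[OF fst_borel measurable_renewal] comp_def)
  qed
  have sq: "integrable M (\<lambda>\<omega>. (fst (renewal 0 \<omega>))\<^sup>2)"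
    using integrable_hit_time_square by (simp add: renewal_def rpath_functionals)
  show ?thesis
    unfolding mean_exit_time_eq(1) renewal_time_def
    by (rule weak_law_square_integrable[OF ind law sq assms])
qed

end

end

section \<open>Random walks in a domain of attraction\<close>

lemma (in prob_space) indep_vars_shift:
  fixes V :: "nat \<Rightarrow> 'a \<Rightarrow> 'b::topological_space"
  assumes "indep_vars (\<lambda>_. borel) V UNIV"
  shows "indep_vars (\<lambda>_. borel) (\<lambda>i. V (a + i)) {..<n::nat}"
proof -
  have "indep_vars (\<lambda>j. PiM {a + j} (\<lambda>_. borel)) (\<lambda>j \<omega>. restrict (\<lambda>i. V i \<omega>) {a + j}) {..<n}"
    by (rule indep_vars_restrict[OF assms]) (auto simp: disjoint_family_on_def)
  then have "indep_vars (\<lambda>_. borel) (\<lambda>j \<omega>. (restrict (\<lambda>i. V i \<omega>) {a + j}) (a + j)) {..<n}"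
    by (rule indep_vars_compose2) (auto intro: measurable_component_singleton)
  then show ?thesis by simp
qed

text \<open>The joint law of independent variables is the product of their laws, and the sum is a
  measurable function of the vector; so the two families may live on different spaces.\<close>

lemma indep_sum_law:
  fixes V :: "nat \<Rightarrow> 'v \<Rightarrow> 'a::euclidean_space" and W :: "nat \<Rightarrow> 'w \<Rightarrow> 'a"
  assumes P: "prob_space P" and Q: "prob_space Q"
    and V: "prob_space.indep_vars P (\<lambda>_. borel) V {..<n}" and W: "prob_space.indep_vars Q (\<lambda>_. borel) W {..<n}"
    and law: "\<And>i. i < n \<Longrightarrow> distr P borel (V i) = distr Q borel (W i)"
  shows "distr P borel (\<lambda>\<omega>. \<Sum>i<n. V i \<omega>) = distr Q borel (\<lambda>\<omega>. \<Sum>i<n. W i \<omega>)"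
proof (cases "n = 0")
  interpret P: prob_space P by fact
  interpret Q: prob_space Q by fact
  {
    case True
    have "distr P borel (\<lambda>_. 0 :: 'a) = return borel 0" "distr Q borel (\<lambda>_. 0 :: 'a) = return borel 0"
      by (simp_all add: P.distr_const Q.distr_const)
    then show ?thesis using True by simp
  next
    case False
    then have ne: "{..<n} \<noteq> {}" by auto
    have mV: "V i \<in> borel_measurable P" and mW: "W i \<in> borel_measurable Q" if "i < n" for i
      using V W that unfolding P.indep_vars_def Q.indep_vars_def by auto
    have s: "(\<lambda>y. \<Sum>i<n. y i) \<in> borel_measurable (PiM {..<n} (\<lambda>_. borel :: 'a measure))"
      by (intro borel_measurable_sum measurable_component_singleton) auto
    have rV: "(\<lambda>\<omega>. \<lambda>i\<in>{..<n}. V i \<omega>) \<in> measurable P (PiM {..<n} (\<lambda>_. borel))"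
      using mV by (intro measurable_restrict) auto
    have rW: "(\<lambda>\<omega>. \<lambda>i\<in>{..<n}. W i \<omega>) \<in> measurable Q (PiM {..<n} (\<lambda>_. borel))"
      using mW by (intro measurable_restrict) auto
    have "distr P (PiM {..<n} (\<lambda>_. borel)) (\<lambda>\<omega>. \<lambda>i\<in>{..<n}. V i \<omega>) = PiM {..<n} (\<lambda>i. distr P borel (V i))"
      using V mV by (subst (asm) P.indep_vars_iff_distr_eq_PiM'[OF ne]) auto
    also have "\<dots> = PiM {..<n} (\<lambda>i. distr Q borel (W i))" using law by (intro PiM_cong) auto
    also have "\<dots> = distr Q (PiM {..<n} (\<lambda>_. borel)) (\<lambda>\<omega>. \<lambda>i\<in>{..<n}. W i \<omega>)"
      using W mW by (subst (asm) Q.indep_vars_iff_distr_eq_PiM'[OF ne]) auto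
    finally have "distr (distr P (PiM {..<n} (\<lambda>_. borel)) (\<lambda>\<omega>. \<lambda>i\<in>{..<n}. V i \<omega>)) borel (\<lambda>y. \<Sum>i<n. y i)
      = distr (distr Q (PiM {..<n} (\<lambda>_. borel)) (\<lambda>\<omega>. \<lambda>i\<in>{..<n}. W i \<omega>)) borel (\<lambda>y. \<Sum>i<n. y i)"
      by simp
    then show ?thesis
      unfolding distr_distr[OF s rV] distr_distr[OF s rW] by (simp add: comp_def)
  }
qed

text \<open>\<open>1 - exp (- U)\<close> is the integral of \<open>exp (- x)\<close> from
  \<open>0\<close> to \<open>U\<close>; exchanging the integrals leaves the tail of
  \<open>U\<close>.\<close>

lemma one_minus_exp_layer_cake:
  assumes "prob_space M" and [measurable]: "U \<in> borel_measurable M" and U: "\<And>\<omega>. \<omega> \<in> space M \<Longrightarrow> 0 \<le> U \<omega>"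
  shows "(\<integral>\<^sup>+\<omega>. ennreal (1 - exp (- U \<omega>)) \<partial>M) =
    (\<integral>\<^sup>+x. ennreal (exp (- x)) * indicator {0..} x * emeasure M {\<omega>\<in>space M. x < U \<omega>} \<partial>lborel)"
proof -
  interpret prob_space M by fact
  interpret pair_sigma_finite M lborel ..
  have "(\<integral>\<^sup>+\<omega>. ennreal (1 - exp (- U \<omega>)) \<partial>M) =
    (\<integral>\<^sup>+\<omega>. (\<integral>\<^sup>+x. ennreal (exp (- x)) * indicator {0..} x * indicator {..<U \<omega>} x \<partial>lborel) \<partial>M)"
  proof (rule nn_integral_cong)
    fix \<omega> assume "\<omega> \<in> space M"
    then have u: "0 \<le> U \<omega>" by (rule U)
    have "(\<integral>\<^sup>+x. ennreal (exp (- x)) * indicator {0..U \<omega>} x \<partial>lborel) = ennreal ((- exp (- U \<omega>)) - (- exp (- 0)))"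
      by (rule nn_integral_FTC_Icc) (auto intro!: derivative_eq_intros simp: u)
    moreover have "(\<integral>\<^sup>+x. ennreal (exp (- x)) * indicator {0..U \<omega>} x \<partial>lborel)
       = (\<integral>\<^sup>+x. ennreal (exp (- x)) * indicator {0..} x * indicator {..<U \<omega>} x \<partial>lborel)"
    proof (rule nn_integral_cong_AE)
      show "AE x in lborel. ennreal (exp (- x)) * indicator {0..U \<omega>} x
         = ennreal (exp (- x)) * indicator {0..} x * indicator {..<U \<omega>} x"
        using AE_lborel_singleton[of "U \<omega>"] by eventually_elim (auto split: split_indicator)
    qed
    ultimately show "ennreal (1 - exp (- U \<omega>)) = (\<integral>\<^sup>+x. ennreal (exp (- x)) * indicator {0..} x * indicator {..<U \<omega>} x \<partial>lborel)"
      by simp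
  qed
  also have "\<dots> = (\<integral>\<^sup>+x. (\<integral>\<^sup>+\<omega>. ennreal (exp (- x)) * indicator {0..} x * indicator {..<U \<omega>} x \<partial>M) \<partial>lborel)"
    by (rule Fubini'[symmetric]) (simp add: indicator_def lessThan_def, measurable)
  also have "\<dots> = (\<integral>\<^sup>+x. ennreal (exp (- x)) * indicator {0..} x * emeasure M {\<omega>\<in>space M. x < U \<omega>} \<partial>lborel)"
  proof (rule nn_integral_cong)
    fix x :: real
    have "(\<integral>\<^sup>+\<omega>. ennreal (exp (- x)) * indicator {0..} x * indicator {..<U \<omega>} x \<partial>M)
      = (\<integral>\<^sup>+\<omega>. ennreal (exp (- x)) * indicator {0..} x * indicator {\<omega>\<in>space M. x < U \<omega>} \<omega> \<partial>M)"
      by (intro nn_integral_cong) (auto split: split_indicator)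
    then show "(\<integral>\<^sup>+\<omega>. ennreal (exp (- x)) * indicator {0..} x * indicator {..<U \<omega>} x \<partial>M)
      = ennreal (exp (- x)) * indicator {0..} x * emeasure M {\<omega>\<in>space M. x < U \<omega>}"
      by (simp add: nn_integral_cmult_indicator)
  qed
  finally show ?thesis .
qed

text \<open>Integrate the tail inequality against \<open>exp (- x)\<close>. This is the passage from
  Ottaviani's inequality, which is multiplicative in tails, to expectations.\<close>

lemma one_minus_exp_tail_comparison:
  assumes "prob_space M" and [measurable]: "U \<in> borel_measurable M" "V \<in> borel_measurable M"
    and U: "\<And>\<omega>. \<omega> \<in> space M \<Longrightarrow> 0 \<le> U \<omega>" and V: "\<And>\<omega>. \<omega> \<in> space M \<Longrightarrow> 0 \<le> V \<omega>"
    and "0 \<le> a" and tail: "\<And>x. 0 \<le> x \<Longrightarrow> a * measure M {\<omega>\<in>space M. x < U \<omega>} \<le> measure M {\<omega>\<in>space M. x < V \<omega>}"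
  shows "a * (\<integral>\<omega>. 1 - exp (- U \<omega>) \<partial>M) \<le> (\<integral>\<omega>. 1 - exp (- V \<omega>) \<partial>M)"
proof -
  interpret prob_space M by fact
  have int: "integrable M (\<lambda>\<omega>. 1 - exp (- Z \<omega>))" "AE \<omega> in M. 0 \<le> 1 - exp (- Z \<omega>)"
    if [measurable]: "Z \<in> borel_measurable M" and Z: "\<And>\<omega>. \<omega> \<in> space M \<Longrightarrow> 0 \<le> Z \<omega>" for Z :: "_ \<Rightarrow> real"
  proof -
    show "integrable M (\<lambda>\<omega>. 1 - exp (- Z \<omega>))"
    proof (rule integrable_const_bound[where B = 1])
      show "AE \<omega> in M. norm (1 - exp (- Z \<omega>)) \<le> 1" using AE_space
      proof eventually_elim
        case (elim \<omega>)
        have "exp (- Z \<omega>) \<le> 1" using Z[OF elim] by simp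
        moreover have "0 < exp (- Z \<omega>)" by simp
        ultimately show ?case unfolding real_norm_def abs_le_iff by linarith
      qed
    qed measurable
    show "AE \<omega> in M. 0 \<le> 1 - exp (- Z \<omega>)" using AE_space by eventually_elim (use Z in simp)
  qed
  have e: "(\<integral>\<^sup>+\<omega>. ennreal (1 - exp (- Z \<omega>)) \<partial>M) = ennreal (\<integral>\<omega>. 1 - exp (- Z \<omega>) \<partial>M)"
    if "Z \<in> borel_measurable M" and "\<And>\<omega>. \<omega> \<in> space M \<Longrightarrow> 0 \<le> Z \<omega>" for Z :: "_ \<Rightarrow> real"
    using int[OF that] by (rule nn_integral_eq_integral)
  have lc: "(\<integral>\<^sup>+\<omega>. ennreal (1 - exp (- U \<omega>)) \<partial>M) =
    (\<integral>\<^sup>+x. ennreal (exp (- x)) * indicator {0..} x * emeasure M {\<omega>\<in>space M. x < U \<omega>} \<partial>lborel)"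
    by (rule one_minus_exp_layer_cake[OF assms(1,2) U])
  have meas: "(\<lambda>x. emeasure M {\<omega>\<in>space M. x < U \<omega>}) \<in> borel_measurable lborel"
  proof -
    have "{p \<in> space (lborel \<Otimes>\<^sub>M M). fst p < U (snd p)} \<in> sets (lborel \<Otimes>\<^sub>M M)" by measurable
    from measurable_emeasure_Pair[OF this]
    show ?thesis by (rule measurable_cong[THEN iffD1, rotated]) (auto intro!: arg_cong[where f = "emeasure M"] simp: space_pair_measure)
  qed
  have "ennreal a * (\<integral>\<^sup>+\<omega>. ennreal (1 - exp (- U \<omega>)) \<partial>M)
     = (\<integral>\<^sup>+x. ennreal a * (ennreal (exp (- x)) * indicator {0..} x * emeasure M {\<omega>\<in>space M. x < U \<omega>}) \<partial>lborel)"
    unfolding lc using meas by (intro nn_integral_cmult[symmetric]) simp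
  also have "\<dots> \<le> (\<integral>\<^sup>+x. ennreal (exp (- x)) * indicator {0..} x * emeasure M {\<omega>\<in>space M. x < V \<omega>} \<partial>lborel)"
  proof (rule nn_integral_mono)
    fix x :: real
    show "ennreal a * (ennreal (exp (- x)) * indicator {0..} x * emeasure M {\<omega>\<in>space M. x < U \<omega>})
       \<le> ennreal (exp (- x)) * indicator {0..} x * emeasure M {\<omega>\<in>space M. x < V \<omega>}"
    proof (cases "0 \<le> x")
      case True
      have "ennreal a * (ennreal (exp (- x)) * emeasure M {\<omega>\<in>space M. x < U \<omega>})
         = ennreal (exp (- x)) * ennreal (a * prob {\<omega>\<in>space M. x < U \<omega>})"
        using \<open>0 \<le> a\<close> by (simp add: emeasure_eq_measure ennreal_mult mult.left_commute)
      also have "\<dots> \<le> ennreal (exp (- x)) * emeasure M {\<omega>\<in>space M. x < V \<omega>}"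
        unfolding emeasure_eq_measure by (intro mult_left_mono ennreal_leI tail True) simp
      finally show ?thesis using True by simp
    qed simp
  qed
  also have "\<dots> = (\<integral>\<^sup>+\<omega>. ennreal (1 - exp (- V \<omega>)) \<partial>M)"
    by (rule one_minus_exp_layer_cake[OF assms(1) assms(3) V, symmetric])
  finally have "ennreal a * ennreal (\<integral>\<omega>. 1 - exp (- U \<omega>) \<partial>M) \<le> ennreal (\<integral>\<omega>. 1 - exp (- V \<omega>) \<partial>M)"
    using e[of U] e[of V] U V by simp
  then have "ennreal (a * (\<integral>\<omega>. 1 - exp (- U \<omega>) \<partial>M)) \<le> ennreal (\<integral>\<omega>. 1 - exp (- V \<omega>) \<partial>M)"
    using \<open>0 \<le> a\<close> by (simp add: ennreal_mult')
  moreover have "0 \<le> (\<integral>\<omega>. 1 - exp (- V \<omega>) \<partial>M)" using V by (intro integral_nonneg_AE int(2)) auto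
  ultimately show ?thesis by (simp add: ennreal_le_iff)
qed

section \<open>Independent identically distributed steps and Ottaviani's inequality\<close>

locale iid_walk = prob_space M for M :: "'w measure" +
  fixes \<xi> :: "nat \<Rightarrow> 'w \<Rightarrow> 'a::euclidean_space"
  assumes indep: "indep_vars (\<lambda>_. borel) \<xi> UNIV"
    and same_law: "distr M borel (\<xi> i) = distr M borel (\<xi> 0)"
begin

definition S :: "nat \<Rightarrow> 'w \<Rightarrow> 'a" where "S k \<omega> = (\<Sum>i<k. \<xi> i \<omega>)"

lemma measurable_step[measurable]: "\<xi> i \<in> borel_measurable M"
  using indep unfolding indep_vars_def by auto

lemma measurable_S[measurable]: "S k \<in> borel_measurable M"
  unfolding S_def[abs_def] by measurable

lemma S_diff: "S (a + n) \<omega> - S a \<omega> = (\<Sum>i<n. \<xi> (a + i) \<omega>)"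
proof -
  have "S (a + n) \<omega> = S a \<omega> + (\<Sum>i<n. \<xi> (a + i) \<omega>)"
    unfolding S_def by (induction n) (auto simp: add.assoc)
  then show ?thesis by simp
qed

lemma block_law: "distr M borel (\<lambda>\<omega>. S (a + n) \<omega> - S a \<omega>) = distr M borel (S n)"
proof -
  have i: "indep_vars (\<lambda>_. borel) (\<lambda>i. \<xi> (0 + i)) {..<n}" by (rule indep_vars_shift[OF indep])
  have "distr M borel (\<lambda>\<omega>. \<Sum>i<n. \<xi> (a + i) \<omega>) = distr M borel (\<lambda>\<omega>. \<Sum>i<n. \<xi> (0 + i) \<omega>)"
  proof (rule indep_sum_law[OF prob_space_axioms prob_space_axioms indep_vars_shift[OF indep] i])
    show "distr M borel (\<xi> (a + i)) = distr M borel (\<xi> (0 + i))" for i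
      using same_law[of "a + i"] same_law[of "0 + i"] by (rule trans[OF _ sym])
  qed
  then show ?thesis unfolding S_diff by (simp add: S_def[abs_def])
qed

lemma indep_blocks: "indep_vars (\<lambda>_. borel) (\<lambda>j \<omega>. S (Suc j * n) \<omega> - S (j * n) \<omega>) {..<m}"
proof -
  define K where "K j = {j * n..<Suc j * n}" for j
  have "disjoint_family_on K {..<m}"
    unfolding disjoint_family_on_def
  proof (intro ballI impI)
    fix i j :: nat assume "i \<noteq> j"
    then consider "i < j" | "j < i" by linarith
    then show "K i \<inter> K j = {}"
    proof cases
      case 1
      then have "Suc i * n \<le> j * n" by (intro mult_le_mono1) simp
      then show ?thesis by (auto simp: K_def)
    next
      case 2
      then have "Suc j * n \<le> i * n" by (intro mult_le_mono1) simp
      then show ?thesis by (auto simp: K_def)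
    qed
  qed
  then have "indep_vars (\<lambda>j. PiM (K j) (\<lambda>_. borel)) (\<lambda>j \<omega>. restrict (\<lambda>i. \<xi> i \<omega>) (K j)) {..<m}"
    by (intro indep_vars_restrict[OF indep]) auto
  then have "indep_vars (\<lambda>_. borel) (\<lambda>j \<omega>. \<Sum>i\<in>K j. restrict (\<lambda>i. \<xi> i \<omega>) (K j) i) {..<m}"
  proof (rule indep_vars_compose2)
    fix j
    show "(\<lambda>y. \<Sum>i\<in>K j. y i) \<in> borel_measurable (PiM (K j) (\<lambda>_. borel :: 'a measure))"
      by (intro borel_measurable_sum measurable_component_singleton)
  qed
  moreover have "(\<Sum>i\<in>K j. restrict (\<lambda>i. \<xi> i \<omega>) (K j) i) = S (Suc j * n) \<omega> - S (j * n) \<omega>" for j \<omega>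
  proof -
    have "(\<Sum>i\<in>K j. restrict (\<lambda>i. \<xi> i \<omega>) (K j) i) = (\<Sum>i\<in>K j. \<xi> i \<omega>)" by (intro sum.cong) auto
    moreover have "S (Suc j * n) \<omega> = S (j * n) \<omega> + (\<Sum>i\<in>K j. \<xi> i \<omega>)"
      unfolding S_def K_def lessThan_atLeast0 by (subst sum.atLeastLessThan_concat) auto
    ultimately show ?thesis by simp
  qed
  ultimately show ?thesis by simp
qed

lemma past_future_indep:
  assumes A: "A \<in> sets (PiM {..<i} (\<lambda>_. borel :: 'a measure))" and B[measurable]: "B \<in> sets (borel :: 'a measure)"
  shows "prob {\<omega>\<in>space M. restrict (\<lambda>k. \<xi> k \<omega>) {..<i} \<in> A \<and> S (i + n) \<omega> - S i \<omega> \<in> B} =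
    prob {\<omega>\<in>space M. restrict (\<lambda>k. \<xi> k \<omega>) {..<i} \<in> A} * prob {\<omega>\<in>space M. S n \<omega> \<in> B}"
proof -
  let ?K = "{i..<i + n}"
  have ind: "indep_var (PiM {..<i} (\<lambda>_. borel)) (\<lambda>\<omega>. restrict (\<lambda>k. \<xi> k \<omega>) {..<i})
      (PiM ?K (\<lambda>_. borel)) (\<lambda>\<omega>. restrict (\<lambda>k. \<xi> k \<omega>) ?K)"
    by (rule indep_var_restrict[OF indep]) auto
  have sm: "(\<lambda>y. \<Sum>k\<in>?K. y k) \<in> borel_measurable (PiM ?K (\<lambda>_. borel :: 'a measure))"
    by (intro borel_measurable_sum measurable_component_singleton)
  define B' where "B' = (\<lambda>y. \<Sum>k\<in>?K. y k) -` B \<inter> space (PiM ?K (\<lambda>_. borel :: 'a measure))"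
  have B': "B' \<in> sets (PiM ?K (\<lambda>_. borel))" unfolding B'_def by (rule measurable_sets[OF sm B])
  have sum: "(\<Sum>k\<in>?K. restrict (\<lambda>k. \<xi> k \<omega>) ?K k) = S (i + n) \<omega> - S i \<omega>" for \<omega>
  proof -
    have "(\<Sum>k\<in>?K. restrict (\<lambda>k. \<xi> k \<omega>) ?K k) = (\<Sum>k\<in>?K. \<xi> k \<omega>)" by (intro sum.cong) auto
    moreover have "S (i + n) \<omega> = S i \<omega> + (\<Sum>k\<in>?K. \<xi> k \<omega>)"
      unfolding S_def lessThan_atLeast0 by (subst sum.atLeastLessThan_concat) auto
    ultimately show ?thesis by simp
  qed
  have mem: "restrict (\<lambda>k. \<xi> k \<omega>) ?K \<in> B' \<longleftrightarrow> S (i + n) \<omega> - S i \<omega> \<in> B" for \<omega>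
    unfolding B'_def using sum[of \<omega>] by (simp add: space_PiM)
  have "prob {\<omega>\<in>space M. restrict (\<lambda>k. \<xi> k \<omega>) {..<i} \<in> A \<and> S (i + n) \<omega> - S i \<omega> \<in> B} =
    prob ((\<lambda>\<omega>. (restrict (\<lambda>k. \<xi> k \<omega>) {..<i}, restrict (\<lambda>k. \<xi> k \<omega>) ?K)) -` (A \<times> B') \<inter> space M)"
    by (intro arg_cong[where f = prob]) (auto simp: mem)
  also have "\<dots> = prob ((\<lambda>\<omega>. restrict (\<lambda>k. \<xi> k \<omega>) {..<i}) -` A \<inter> space M) * prob ((\<lambda>\<omega>. restrict (\<lambda>k. \<xi> k \<omega>) ?K) -` B' \<inter> space M)"
    by (rule indep_varD[OF ind A B'])
  also have "(\<lambda>\<omega>. restrict (\<lambda>k. \<xi> k \<omega>) {..<i}) -` A \<inter> space M = {\<omega>\<in>space M. restrict (\<lambda>k. \<xi> k \<omega>) {..<i} \<in> A}" by auto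
  also have "(\<lambda>\<omega>. restrict (\<lambda>k. \<xi> k \<omega>) ?K) -` B' \<inter> space M = (\<lambda>\<omega>. S (i + n) \<omega> - S i \<omega>) -` B \<inter> space M"
    by (auto simp: mem)
  also have "prob \<dots> = measure (distr M borel (\<lambda>\<omega>. S (i + n) \<omega> - S i \<omega>)) B" by (simp add: measure_distr)
  also have "\<dots> = prob (S n -` B \<inter> space M)" unfolding block_law by (simp add: measure_distr)
  also have "S n -` B \<inter> space M = {\<omega>\<in>space M. S n \<omega> \<in> B}" by auto
  finally show ?thesis .
qed

text \<open>Ottaviani's argument: after the first passage above \<open>x + e\<close> the walk loses at most \<open>e\<close>
  until the next multiple of \<open>n\<close>, up to an event of probability \<open>\<delta>\<close>.\<close>

lemma ottaviani:
  assumes "0 < n" and \<delta>: "\<And>i. i \<le> n \<Longrightarrow> prob {\<omega>\<in>space M. u \<bullet> S i \<omega> < - e} \<le> \<delta>"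
  shows "(1 - \<delta>) * prob {\<omega>\<in>space M. \<exists>i\<le>m * n. x + e < u \<bullet> S i \<omega>} \<le> prob {\<omega>\<in>space M. \<exists>j\<le>m. x < u \<bullet> S (j * n) \<omega>}"
proof -
  define E where "E i = {\<omega>\<in>space M. x + e < u \<bullet> S i \<omega> \<and> (\<forall>k<i. u \<bullet> S k \<omega> \<le> x + e)}" for i
  \<comment> \<open>\<open>i / n\<close> rounded up: \<open>J i * n\<close> is the first multiple of
    \<open>n\<close> not before \<open>i\<close>.\<close>
  define J where "J i = (i + (n - 1)) div n" for i
  have J: "i \<le> J i * n" "J i * n \<le> i + n" for i
  proof -
    have "i + (n - 1) = J i * n + (i + (n - 1)) mod n" unfolding J_def by simp
    moreover have "(i + (n - 1)) mod n < n" using \<open>0 < n\<close> by simp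
    ultimately show "i \<le> J i * n" "J i * n \<le> i + n" by linarith+
  qed
  have Jm: "J i \<le> m" if "i \<le> m * n" for i
  proof -
    have "i + (n - 1) < Suc m * n" using that \<open>0 < n\<close> by simp
    then have "J i < Suc m" unfolding J_def using \<open>0 < n\<close> by (simp add: less_mult_imp_div_less)
    then show ?thesis by simp
  qed
  \<comment> \<open>First passage at \<open>i\<close> without a loss of more than \<open>e\<close>
    until the next block end. The two conditions concern steps before and after \<open>i\<close>, so
    they are independent, and the events inherit disjointness from \<open>E\<close>.\<close>
  define F where "F i = {\<omega>\<in>E i. - e \<le> u \<bullet> (S (J i * n) \<omega> - S i \<omega>)}" for i
  have E_ev[measurable]: "E i \<in> events" for i unfolding E_def by measurable
  have F_ev[measurable]: "F i \<in> events" for i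
  proof -
    have "F i = E i \<inter> {\<omega>\<in>space M. - e \<le> u \<bullet> (S (J i * n) \<omega> - S i \<omega>)}" by (auto simp: F_def E_def)
    also have "\<dots> \<in> events" by measurable
    finally show ?thesis .
  qed
  have disj: "disjoint_family_on E {..m * n}"
    unfolding disjoint_family_on_def
  proof (intro ballI impI)
    fix i j :: nat assume "i \<noteq> j"
    then consider "i < j" | "j < i" by linarith
    then show "E i \<inter> E j = {}" by cases (force simp: E_def)+
  qed
  have EF: "prob (F i) \<ge> (1 - \<delta>) * prob (E i)" for i
  proof -
    define A where "A = {y \<in> space (PiM {..<i} (\<lambda>_. borel :: 'a measure)). x + e < u \<bullet> (\<Sum>l<i. y l) \<and> (\<forall>k\<in>{..<i}. u \<bullet> (\<Sum>l<k. y l) \<le> x + e)}"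
    have sm: "(\<lambda>y. u \<bullet> (\<Sum>l<k. y l)) \<in> borel_measurable (PiM {..<i} (\<lambda>_. borel :: 'a measure))" if "k \<le> i" for k
      using that by (intro borel_measurable_inner borel_measurable_const borel_measurable_sum measurable_component_singleton) auto
    have A: "A \<in> sets (PiM {..<i} (\<lambda>_. borel))"
      unfolding A_def
    proof (intro sets.sets_Collect_conj sets.sets_Collect_finite_All finite_lessThan)
      show "{y \<in> space (PiM {..<i} (\<lambda>_. borel :: 'a measure)). x + e < u \<bullet> (\<Sum>l<i. y l)} \<in> sets (PiM {..<i} (\<lambda>_. borel))"
        by (intro borel_measurable_less borel_measurable_const sm) simp
      show "{y \<in> space (PiM {..<i} (\<lambda>_. borel :: 'a measure)). u \<bullet> (\<Sum>l<k. y l) \<le> x + e} \<in> sets (PiM {..<i} (\<lambda>_. borel))" if "k \<in> {..<i}" for k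
        using that by (intro borel_measurable_le borel_measurable_const sm) simp
    qed
    have memA: "restrict (\<lambda>k. \<xi> k \<omega>) {..<i} \<in> A \<longleftrightarrow> x + e < u \<bullet> S i \<omega> \<and> (\<forall>k<i. u \<bullet> S k \<omega> \<le> x + e)" for \<omega>
    proof -
      have "(\<Sum>l<k. restrict (\<lambda>k. \<xi> k \<omega>) {..<i} l) = S k \<omega>" if "k \<le> i" for k
        using that unfolding S_def by (intro sum.cong) auto
      then show ?thesis unfolding A_def by (auto simp: space_PiM)
    qed
    define d where "d = J i * n - i"
    have d: "J i * n = i + d" "d \<le> n" using J[of i] by (auto simp: d_def)
    have Eeq: "E i = {\<omega>\<in>space M. restrict (\<lambda>k. \<xi> k \<omega>) {..<i} \<in> A}"
      unfolding E_def memA ..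
    have Feq: "F i = {\<omega>\<in>space M. restrict (\<lambda>k. \<xi> k \<omega>) {..<i} \<in> A \<and> S (i + d) \<omega> - S i \<omega> \<in> {z. - e \<le> u \<bullet> z}}"
      unfolding F_def E_def memA d(1) by auto
    have "{z. - e \<le> u \<bullet> z} \<in> sets borel" by measurable
    from past_future_indep[OF A this, of d]
    have "prob (F i) = prob (E i) * prob {\<omega>\<in>space M. S d \<omega> \<in> {z. - e \<le> u \<bullet> z}}"
      unfolding Feq Eeq .
    moreover have "prob {\<omega>\<in>space M. S d \<omega> \<in> {z. - e \<le> u \<bullet> z}} = 1 - prob {\<omega>\<in>space M. u \<bullet> S d \<omega> < - e}"
    proof -
      have "{\<omega>\<in>space M. S d \<omega> \<in> {z. - e \<le> u \<bullet> z}} = space M - {\<omega>\<in>space M. u \<bullet> S d \<omega> < - e}" by auto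
      then show ?thesis by (simp add: prob_compl)
    qed
    ultimately have "prob (F i) = prob (E i) * (1 - prob {\<omega>\<in>space M. u \<bullet> S d \<omega> < - e})" by simp
    also have "\<dots> \<ge> prob (E i) * (1 - \<delta>)" using \<delta>[OF d(2)] by (intro mult_left_mono) auto
    finally show ?thesis by (simp add: mult.commute)
  qed
  have "{\<omega>\<in>space M. \<exists>i\<le>m * n. x + e < u \<bullet> S i \<omega>} \<subseteq> (\<Union>i\<in>{..m * n}. E i)"
  proof
    fix \<omega> assume a: "\<omega> \<in> {\<omega>\<in>space M. \<exists>i\<le>m * n. x + e < u \<bullet> S i \<omega>}"
    then obtain i where i: "i \<le> m * n" "x + e < u \<bullet> S i \<omega>" by blast
    define k where "k = (LEAST i. x + e < u \<bullet> S i \<omega>)"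
    have "x + e < u \<bullet> S k \<omega>" unfolding k_def using i(2) by (rule LeastI)
    moreover have "k \<le> i" unfolding k_def using i(2) by (rule Least_le)
    moreover have "u \<bullet> S j \<omega> \<le> x + e" if "j < k" for j
      using not_less_Least[OF that[unfolded k_def]] by simp
    ultimately show "\<omega> \<in> (\<Union>i\<in>{..m * n}. E i)" using a i(1) by (auto simp: E_def intro!: bexI[of _ k])
  qed
  then have "prob {\<omega>\<in>space M. \<exists>i\<le>m * n. x + e < u \<bullet> S i \<omega>} \<le> prob (\<Union>i\<in>{..m * n}. E i)"
    by (rule finite_measure_mono) measurable
  also have "\<dots> = (\<Sum>i\<in>{..m * n}. prob (E i))"
    using disj by (intro finite_measure_finite_Union) auto
  finally have 1: "prob {\<omega>\<in>space M. \<exists>i\<le>m * n. x + e < u \<bullet> S i \<omega>} \<le> (\<Sum>i\<in>{..m * n}. prob (E i))" .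
  have \<delta>0: "0 \<le> \<delta>" using \<delta>[of 0] measure_nonneg order_trans by blast
  have "(\<Sum>i\<in>{..m * n}. prob (F i)) = prob (\<Union>i\<in>{..m * n}. F i)"
  proof (rule finite_measure_finite_Union[symmetric])
    show "disjoint_family_on F {..m * n}"
      using disj unfolding disjoint_family_on_def F_def by blast
  qed auto
  also have "\<dots> \<le> prob {\<omega>\<in>space M. \<exists>j\<le>m. x < u \<bullet> S (j * n) \<omega>}"
  proof (rule finite_measure_mono)
    show "(\<Union>i\<in>{..m * n}. F i) \<subseteq> {\<omega>\<in>space M. \<exists>j\<le>m. x < u \<bullet> S (j * n) \<omega>}"
    proof
      fix \<omega> assume "\<omega> \<in> (\<Union>i\<in>{..m * n}. F i)"
      then obtain i where i: "i \<le> m * n" "\<omega> \<in> F i" by auto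
      then have "\<omega> \<in> space M" "x + e < u \<bullet> S i \<omega>" "- e \<le> u \<bullet> S (J i * n) \<omega> - u \<bullet> S i \<omega>"
        by (auto simp: F_def E_def inner_diff_right)
      then show "\<omega> \<in> {\<omega>\<in>space M. \<exists>j\<le>m. x < u \<bullet> S (j * n) \<omega>}"
        using Jm[OF i(1)] by (intro CollectI conjI exI[of _ "J i"]) linarith+
    qed
  qed measurable
  finally have 2: "(\<Sum>i\<in>{..m * n}. prob (F i)) \<le> prob {\<omega>\<in>space M. \<exists>j\<le>m. x < u \<bullet> S (j * n) \<omega>}" .
  \<comment> \<open>For \<open>\<delta> > 1\<close> the left-hand side is nonpositive; otherwise the
    estimates \<open>1\<close>, \<open>EF\<close> and \<open>2\<close> are chained.\<close>
  show ?thesis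
  proof (cases "\<delta> \<le> 1")
    case True
    have "(1 - \<delta>) * prob {\<omega>\<in>space M. \<exists>i\<le>m * n. x + e < u \<bullet> S i \<omega>} \<le> (1 - \<delta>) * (\<Sum>i\<in>{..m * n}. prob (E i))"
      using True 1 by (intro mult_left_mono) auto
    also have "\<dots> \<le> (\<Sum>i\<in>{..m * n}. prob (F i))"
      unfolding sum_distrib_left by (intro sum_mono EF)
    finally show ?thesis using 2 by linarith
  next
    case False
    then have "(1 - \<delta>) * prob {\<omega>\<in>space M. \<exists>i\<le>m * n. x + e < u \<bullet> S i \<omega>} \<le> 0"
      by (intro mult_nonpos_nonneg) auto
    then show ?thesis using measure_nonneg order_trans by blast
  qed
qed

end

lemma (in prob_space) prob_norm_gt_le_cutoff:
  assumes [measurable]: "X \<in> borel_measurable M"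
  shows "prob {\<omega>\<in>space M. R + 1 < norm (X \<omega>)} \<le> (\<integral>\<omega>. cutoff R (X \<omega>) \<partial>M)"
proof -
  have "prob {\<omega>\<in>space M. R + 1 < norm (X \<omega>)} = (\<integral>\<omega>. indicator {\<omega>\<in>space M. R + 1 < norm (X \<omega>)} \<omega> \<partial>M)" by simp
  also have "\<dots> \<le> (\<integral>\<omega>. cutoff R (X \<omega>) \<partial>M)"
  proof (rule integral_mono)
    show "integrable M (\<lambda>\<omega>. cutoff R (X \<omega>))"
      by (rule integrable_const_bound[where B = 1]) (auto simp: cutoff_bounds)
    show "indicator {\<omega>\<in>space M. R + 1 < norm (X \<omega>)} \<omega> \<le> cutoff R (X \<omega>)" for \<omega>
      by (auto simp: cutoff_def split: split_indicator)
    show "integrable M (indicat_real {\<omega>\<in>space M. R + 1 < norm (X \<omega>)})"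
      by (rule integrable_const_bound[where B = 1]) auto
  qed
  finally show ?thesis .
qed

text \<open>Slutsky's theorem for a convergent scalar factor. Where the vector is not large,
  \<open>f (a i *\<^sub>R x)\<close> is close to \<open>f (b *\<^sub>R x)\<close> by uniform
  continuity; the remaining mass is controlled by \<open>cutoff\<close> and passes to the limit
  law.\<close>

lemma slutsky_scaling:
  fixes X :: "'i \<Rightarrow> 'w \<Rightarrow> 'a::euclidean_space" and f :: "'a \<Rightarrow> real"
  assumes M: "prob_space M" and N: "prob_space N" and X[measurable]: "\<And>i. X i \<in> borel_measurable M" and \<eta>[measurable]: "\<eta> \<in> borel_measurable N"
    and conv: "\<And>f :: 'a \<Rightarrow> real. continuous_on UNIV f \<Longrightarrow> (\<And>x. \<bar>f x\<bar> \<le> 1) \<Longrightarrow>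
       ((\<lambda>i. \<integral>\<omega>. f (X i \<omega>) \<partial>M) \<longlongrightarrow> (\<integral>\<omega>. f (\<eta> \<omega>) \<partial>N)) F"
    and a: "(a \<longlongrightarrow> b) F" and f: "continuous_on UNIV f" "\<And>x. \<bar>f x\<bar> \<le> 1"
  shows "((\<lambda>i. \<integral>\<omega>. f (a i *\<^sub>R X i \<omega>) \<partial>M) \<longlongrightarrow> (\<integral>\<omega>. f (b *\<^sub>R \<eta> \<omega>) \<partial>N)) F"
proof (rule tendstoI)
  fix e :: real assume "0 < e"
  interpret M: prob_space M by fact
  interpret N: prob_space N by fact
  have [measurable]: "f \<in> borel_measurable borel" using f(1) by (rule borel_measurable_continuous_onI)
  obtain n where n: "(\<Sum>j<1::nat. \<integral>\<omega>. cutoff (real n) (\<eta> \<omega>) \<partial>N) < e / 8"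
    using N.cutoff_integral_small[of 1 "\<lambda>_. \<eta>" "e / 8"] \<open>0 < e\<close> by auto
  \<comment> \<open>Scalars near \<open>b\<close>, and vectors up to the radius at which
    \<open>cutoff (real n)\<close> reaches \<open>1\<close>.\<close>
  have "compact (cball b 1 \<times> cball (0::'a) (real n + 1))" by (intro compact_Times) auto
  moreover have "continuous_on (cball b 1 \<times> cball (0::'a) (real n + 1)) (\<lambda>(s, x). f (s *\<^sub>R x))"
    unfolding case_prod_beta by (rule continuous_on_compose2[OF f(1)]) (auto intro!: continuous_intros)
  ultimately have "uniformly_continuous_on (cball b 1 \<times> cball (0::'a) (real n + 1)) (\<lambda>(s, x). f (s *\<^sub>R x))"
    by (intro compact_uniformly_continuous)
  then obtain d where d: "0 < d" and ud: "\<And>p q. p \<in> cball b 1 \<times> cball (0::'a) (real n + 1) \<Longrightarrow> q \<in> cball b 1 \<times> cball (0::'a) (real n + 1)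
      \<Longrightarrow> dist q p < d \<Longrightarrow> dist (case q of (s, x) \<Rightarrow> f (s *\<^sub>R x)) (case p of (s, x) \<Rightarrow> f (s *\<^sub>R x)) < e / 4"
    unfolding uniformly_continuous_on_def using \<open>0 < e\<close> by (metis divide_pos_pos zero_less_numeral)
  have "continuous_on UNIV (\<lambda>x. f (b *\<^sub>R x))"
    by (rule continuous_on_compose2[OF f(1)]) (auto intro!: continuous_intros)
  from conv[OF this f(2)] have "((\<lambda>i. \<integral>\<omega>. f (b *\<^sub>R X i \<omega>) \<partial>M) \<longlongrightarrow> (\<integral>\<omega>. f (b *\<^sub>R \<eta> \<omega>) \<partial>N)) F" .
  from tendstoD[OF this, of "e / 4"] \<open>0 < e\<close>
  have ev1: "\<forall>\<^sub>F i in F. dist (\<integral>\<omega>. f (b *\<^sub>R X i \<omega>) \<partial>M) (\<integral>\<omega>. f (b *\<^sub>R \<eta> \<omega>) \<partial>N) < e / 4" by simp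
  have "((\<lambda>i. \<integral>\<omega>. cutoff (real n) (X i \<omega>) \<partial>M) \<longlongrightarrow> (\<integral>\<omega>. cutoff (real n) (\<eta> \<omega>) \<partial>N)) F"
    by (rule conv[OF continuous_cutoff]) (simp add: cutoff_bounds)
  from order_tendstoD(2)[OF this, of "e / 8"] n
  have ev2: "\<forall>\<^sub>F i in F. (\<integral>\<omega>. cutoff (real n) (X i \<omega>) \<partial>M) < e / 8" by simp
  have ev3: "\<forall>\<^sub>F i in F. dist (a i) b < min d 1" using tendstoD[OF a, of "min d 1"] d by simp
  show "\<forall>\<^sub>F i in F. dist (\<integral>\<omega>. f (a i *\<^sub>R X i \<omega>) \<partial>M) (\<integral>\<omega>. f (b *\<^sub>R \<eta> \<omega>) \<partial>N) < e"
    using ev1 ev2 ev3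
  proof eventually_elim
    case (elim i)
    have pt: "\<bar>f (a i *\<^sub>R x) - f (b *\<^sub>R x)\<bar> \<le> e / 4 + 2 * cutoff (real n) x" for x
    proof (cases "norm x \<le> real n + 1")
      case True
      then have "dist (case (a i, x) of (s, x) \<Rightarrow> f (s *\<^sub>R x)) (case (b, x) of (s, x) \<Rightarrow> f (s *\<^sub>R x)) < e / 4"
        using elim by (intro ud) (auto simp: dist_Pair_Pair dist_commute)
      then show ?thesis using cutoff_bounds(1)[of "real n" x] by (simp add: dist_real_def)
    next
      case False
      then have "cutoff (real n) x = 1" by (simp add: cutoff_def)
      moreover have "\<bar>f (a i *\<^sub>R x) - f (b *\<^sub>R x)\<bar> \<le> 2"
        using f(2)[of "a i *\<^sub>R x"] f(2)[of "b *\<^sub>R x"] by (simp add: abs_le_iff)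
      ultimately show ?thesis using \<open>0 < e\<close> by simp
    qed
    have i1: "integrable M (\<lambda>\<omega>. f (a i *\<^sub>R X i \<omega>))" "integrable M (\<lambda>\<omega>. f (b *\<^sub>R X i \<omega>))"
      using f(2) by (auto intro!: M.integrable_const_bound[where B = 1])
    have i2: "integrable M (\<lambda>\<omega>. cutoff (real n) (X i \<omega>))"
      by (rule M.integrable_const_bound[where B = 1]) (auto simp: cutoff_bounds)
    have "\<bar>(\<integral>\<omega>. f (a i *\<^sub>R X i \<omega>) \<partial>M) - (\<integral>\<omega>. f (b *\<^sub>R X i \<omega>) \<partial>M)\<bar>
       = \<bar>\<integral>\<omega>. f (a i *\<^sub>R X i \<omega>) - f (b *\<^sub>R X i \<omega>) \<partial>M\<bar>" using i1 by simp
    also have "\<dots> \<le> (\<integral>\<omega>. \<bar>f (a i *\<^sub>R X i \<omega>) - f (b *\<^sub>R X i \<omega>)\<bar> \<partial>M)" by (rule integral_abs_bound)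
    also have "\<dots> \<le> (\<integral>\<omega>. e / 4 + 2 * cutoff (real n) (X i \<omega>) \<partial>M)"
      using i1 i2 pt by (intro integral_mono integrable_abs Bochner_Integration.integrable_diff
        Bochner_Integration.integrable_add integrable_mult_right) auto
    also have "\<dots> = e / 4 + 2 * (\<integral>\<omega>. cutoff (real n) (X i \<omega>) \<partial>M)"
      using i2 by (simp add: M.prob_space)
    finally have "\<bar>(\<integral>\<omega>. f (a i *\<^sub>R X i \<omega>) \<partial>M) - (\<integral>\<omega>. f (b *\<^sub>R X i \<omega>) \<partial>M)\<bar> < e / 2"
      using elim by linarith
    then show ?case using elim(1) unfolding dist_real_def abs_less_iff by linarith
  qed
qed

section \<open>Norming function, tightness and convergence of grid hulls\<close>

locale attracted_walk = iid_walk M \<xi> for M :: "'w measure" and \<xi> :: "nat \<Rightarrow> 'w \<Rightarrow> 'a::euclidean_space" +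
  fixes N :: "'v measure" and \<eta> :: "'v \<Rightarrow> 'a" and p :: real and l :: "real \<Rightarrow> real"
  assumes N: "prob_space N" and \<eta>[measurable]: "\<eta> \<in> borel_measurable N"
    and p: "0 < p" and l: "slowly_varying l"
    and attraction: "\<And>f :: 'a \<Rightarrow> real. continuous_on UNIV f \<Longrightarrow> (\<And>x. \<bar>f x\<bar> \<le> 1) \<Longrightarrow>
      (\<lambda>n. \<integral>\<omega>. f (S n \<omega> /\<^sub>R (real n powr p * l (real n))) \<partial>M) \<longlonglongrightarrow> (\<integral>\<omega>. f (\<eta> \<omega>) \<partial>N)"
begin

definition norming :: "real \<Rightarrow> real" where "norming t = t powr p * l t"

lemma norming_at_top: "filterlim norming at_top at_top"
proof -
  obtain x0 q where g: "0 < x0" "1 < q" "\<And>x. x0 \<le> x \<Longrightarrow> 0 < norming x"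
    "\<And>x t j. x0 \<le> x \<Longrightarrow> 2 ^ j * x \<le> t \<Longrightarrow> norming x * q ^ j \<le> 2 * norming t"
    using regularly_varying_growth[OF l p, folded norming_def] by metis
  show ?thesis
    unfolding filterlim_at_top
  proof
    fix Z
    obtain j where j: "2 * Z / norming x0 < q ^ j" using real_arch_pow[OF g(2)] by blast
    show "\<forall>\<^sub>F t in at_top. Z \<le> norming t"
      using eventually_ge_at_top[of "2 ^ j * x0"]
    proof eventually_elim
      case (elim t)
      have "2 * Z < norming x0 * q ^ j" using j g(3)[of x0] by (simp add: field_simps)
      then show ?case using g(4)[of x0 j t] elim by linarith
    qed
  qed
qed

lemma norming_pos: "\<forall>\<^sub>F t in at_top. 0 < norming t"
  using norming_at_top by (auto simp: filterlim_at_top_dense)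

lemma real_nat_at_top:
  fixes k :: "real \<Rightarrow> nat"
  assumes "((\<lambda>t. real (k t) / t) \<longlongrightarrow> \<rho>) at_top" "0 < \<rho>"
  shows "filterlim k at_top at_top"
proof -
  have "filterlim (\<lambda>t. (real (k t) / t) * t) at_top at_top"
    by (rule filterlim_tendsto_pos_mult_at_top[OF assms filterlim_ident])
  moreover have "\<forall>\<^sub>F t in at_top. (real (k t) / t) * t = real (k t)"
    using eventually_gt_at_top[of 0] by eventually_elim simp
  ultimately have "filterlim (\<lambda>t. real (k t)) at_top at_top" by (rule filterlim_cong[THEN iffD1, OF refl refl, rotated])
  then show ?thesis by (simp add: filterlim_sequentially_iff_filterlim_real)
qed

lemma norming_ratio:
  fixes k :: "real \<Rightarrow> nat"
  assumes k: "((\<lambda>t. real (k t) / t) \<longlongrightarrow> \<rho>) at_top" and "0 < \<rho>"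
  shows "((\<lambda>t. norming (real (k t)) / norming t) \<longlongrightarrow> \<rho> powr p) at_top"
proof -
  have "((\<lambda>t. (real (k t) / t) powr p * (l (real (k t)) / l t)) \<longlongrightarrow> \<rho> powr p * 1) at_top"
    using assms by (intro tendsto_mult tendsto_powr tendsto_const slowly_varying_ratio[OF l]) auto
  moreover have "\<forall>\<^sub>F t in at_top. (real (k t) / t) powr p * (l (real (k t)) / l t) = norming (real (k t)) / norming t"
    using eventually_gt_at_top[of 0] by eventually_elim (simp add: norming_def powr_divide)
  ultimately show ?thesis by (simp add: tendsto_cong)
qed

text \<open>The hypothesis normalises \<open>k t\<close> steps by the norming function at
  \<open>k t\<close>. Its ratio to the value at \<open>t\<close> tends to
  \<open>\<rho> powr p\<close>, so Slutsky's theorem moves this factor into the limit.\<close>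

lemma scaled_attraction:
  fixes k :: "real \<Rightarrow> nat" and f :: "'a \<Rightarrow> real"
  assumes k: "((\<lambda>t. real (k t) / t) \<longlongrightarrow> \<rho>) at_top" and "0 < \<rho>"
    and f: "continuous_on UNIV f" "\<And>x. \<bar>f x\<bar> \<le> 1"
  shows "((\<lambda>t. \<integral>\<omega>. f (S (k t) \<omega> /\<^sub>R norming t) \<partial>M) \<longlongrightarrow> (\<integral>\<omega>. f (\<rho> powr p *\<^sub>R \<eta> \<omega>) \<partial>N)) at_top"
proof -
  have ktop: "filterlim k at_top at_top" by (rule real_nat_at_top[OF k \<open>0 < \<rho>\<close>])
  have "((\<lambda>t. \<integral>\<omega>. f ((norming (real (k t)) / norming t) *\<^sub>R (S (k t) \<omega> /\<^sub>R norming (real (k t)))) \<partial>M)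
    \<longlongrightarrow> (\<integral>\<omega>. f (\<rho> powr p *\<^sub>R \<eta> \<omega>) \<partial>N)) at_top"
  proof (rule slutsky_scaling[OF prob_space_axioms N _ \<eta> _ norming_ratio[OF k \<open>0 < \<rho>\<close>] f])
    fix g :: "'a \<Rightarrow> real" assume g: "continuous_on UNIV g" "\<And>x. \<bar>g x\<bar> \<le> 1"
    show "((\<lambda>t. \<integral>\<omega>. g (S (k t) \<omega> /\<^sub>R norming (real (k t))) \<partial>M) \<longlongrightarrow> (\<integral>\<omega>. g (\<eta> \<omega>) \<partial>N)) at_top"
      using filterlim_compose[OF attraction[OF g] ktop] unfolding norming_def .
  qed measurable
  moreover have "\<forall>\<^sub>F t in at_top. (\<integral>\<omega>. f ((norming (real (k t)) / norming t) *\<^sub>R (S (k t) \<omega> /\<^sub>R norming (real (k t)))) \<partial>M)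
     = (\<integral>\<omega>. f (S (k t) \<omega> /\<^sub>R norming t) \<partial>M)"
  proof -
    have "filterlim (\<lambda>t. real (k t)) at_top at_top" by (rule filterlim_compose[OF filterlim_real_sequentially ktop])
    from eventually_compose_filterlim[OF norming_pos this] show ?thesis
      by eventually_elim (simp add: divide_inverse mult.commute mult.left_commute)
  qed
  ultimately show ?thesis by (simp add: tendsto_cong)
qed

text \<open>Convergence of the \<open>cutoff\<close> integrals carries the tightness of the single
  law of \<open>\<eta>\<close> over to the scaled walk.\<close>

lemma tight:
  assumes "0 < \<gamma>"
  obtains R i0 where "0 < R" "\<And>i. i0 \<le> i \<Longrightarrow> 0 < norming (real i) \<and> prob {\<omega>\<in>space M. R * norming (real i) < norm (S i \<omega>)} \<le> \<gamma>"
proof -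
  interpret N: prob_space N by (rule N)
  obtain n where n: "(\<Sum>j<1::nat. \<integral>\<omega>. cutoff (real n) (\<eta> \<omega>) \<partial>N) < \<gamma>"
    using N.cutoff_integral_small[of 1 "\<lambda>_. \<eta>" \<gamma>] \<open>0 < \<gamma>\<close> by auto
  have "(\<lambda>i. \<integral>\<omega>. cutoff (real n) (S i \<omega> /\<^sub>R norming (real i)) \<partial>M) \<longlonglongrightarrow> (\<integral>\<omega>. cutoff (real n) (\<eta> \<omega>) \<partial>N)"
    unfolding norming_def by (rule attraction[OF continuous_cutoff]) (simp add: cutoff_bounds)
  from order_tendstoD(2)[OF this, of \<gamma>] n
  have "\<forall>\<^sub>F i in sequentially. (\<integral>\<omega>. cutoff (real n) (S i \<omega> /\<^sub>R norming (real i)) \<partial>M) < \<gamma>" by simp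
  moreover have "\<forall>\<^sub>F i in sequentially. 0 < norming (real i)"
    by (rule eventually_compose_filterlim[OF norming_pos filterlim_real_sequentially])
  ultimately have "\<forall>\<^sub>F i in sequentially. 0 < norming (real i) \<and> prob {\<omega>\<in>space M. (real n + 1) * norming (real i) < norm (S i \<omega>)} \<le> \<gamma>"
  proof eventually_elim
    case (elim i)
    have "{\<omega>\<in>space M. (real n + 1) * norming (real i) < norm (S i \<omega>)} = {\<omega>\<in>space M. real n + 1 < norm (S i \<omega> /\<^sub>R norming (real i))}"
      using elim(2) by (auto simp: field_simps)
    then show ?case
      using elim prob_norm_gt_le_cutoff[of "\<lambda>\<omega>. S i \<omega> /\<^sub>R norming (real i)" "real n"] by simp
  qed
  then obtain i0 where "\<And>i. i0 \<le> i \<Longrightarrow> 0 < norming (real i) \<and> prob {\<omega>\<in>space M. (real n + 1) * norming (real i) < norm (S i \<omega>)} \<le> \<gamma>"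
    by (auto simp: eventually_sequentially)
  then show ?thesis by (intro that[of "real n + 1" i0]) auto
qed

text \<open>Provides the smallness that Ottaviani's inequality requires, uniformly in the number
  \<open>i\<close> of steps within a block. For large \<open>i\<close> the walk has the order of the
  norming function at \<open>i\<close>, which by its growth is small against the value at
  \<open>t\<close>; the finitely many remaining \<open>i\<close> are fixed while the norming
  function at \<open>t\<close> diverges.\<close>

lemma small_blocks:
  assumes "0 < e" "0 < \<gamma>" "0 < A"
  shows "\<forall>\<^sub>F m in sequentially. \<forall>\<^sub>F t in at_top. \<forall>i. real i \<le> A * t / real m \<longrightarrow>
     prob {\<omega>\<in>space M. e * norming t < norm (S i \<omega>)} \<le> \<gamma>"
proof -
  obtain R i0 where R: "0 < R" "\<And>i. i0 \<le> i \<Longrightarrow> 0 < norming (real i) \<and> prob {\<omega>\<in>space M. R * norming (real i) < norm (S i \<omega>)} \<le> \<gamma>"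
    using tight[OF \<open>0 < \<gamma>\<close>] by metis
  obtain x0 q where g: "0 < x0" "1 < q" "\<And>x. x0 \<le> x \<Longrightarrow> 0 < norming x"
    "\<And>x t j. x0 \<le> x \<Longrightarrow> 2 ^ j * x \<le> t \<Longrightarrow> norming x * q ^ j \<le> 2 * norming t"
    using regularly_varying_growth[OF l p, folded norming_def] by metis
  \<comment> \<open>After \<open>j\<close> doublings \<open>R\<close> times the norming function at
    \<open>i\<close> has dropped below \<open>e\<close> times its value at \<open>t\<close>; the
    factor 2 is the loss in the growth estimate.\<close>
  obtain j where j: "2 * R / e < q ^ j" using real_arch_pow[OF g(2)] by blast
  obtain i1 where i1: "x0 \<le> real i1" using real_arch_simple by blast
  define i2 where "i2 = max i0 i1"
  have single: "\<exists>Z. prob {\<omega>\<in>space M. Z < norm (S i \<omega>)} \<le> \<gamma>" for i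
  proof -
    obtain n where n: "(\<Sum>j<1::nat. \<integral>\<omega>. cutoff (real n) (S i \<omega>) \<partial>M) < \<gamma>"
      using cutoff_integral_small[of 1 "\<lambda>_. S i" \<gamma>] \<open>0 < \<gamma>\<close> by auto
    then show ?thesis
      using prob_norm_gt_le_cutoff[of "S i" "real n"] by (intro exI[of _ "real n + 1"]) simp
  qed
  then obtain Z where Z: "\<And>i. prob {\<omega>\<in>space M. Z i < norm (S i \<omega>)} \<le> \<gamma>" by metis
  have small: "\<forall>\<^sub>F t in at_top. \<forall>i\<in>{..<i2}. prob {\<omega>\<in>space M. e * norming t < norm (S i \<omega>)} \<le> \<gamma>"
  proof (intro eventually_ball_finite ballI)
    fix i
    have "\<forall>\<^sub>F t in at_top. Z i / e \<le> norming t" using norming_at_top by (simp add: filterlim_at_top)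
    then show "\<forall>\<^sub>F t in at_top. prob {\<omega>\<in>space M. e * norming t < norm (S i \<omega>)} \<le> \<gamma>"
    proof eventually_elim
      case (elim t)
      then have "Z i \<le> e * norming t" using \<open>0 < e\<close> by (simp add: field_simps)
      then have "prob {\<omega>\<in>space M. e * norming t < norm (S i \<omega>)} \<le> prob {\<omega>\<in>space M. Z i < norm (S i \<omega>)}"
        by (intro finite_measure_mono) auto
      with Z[of i] show ?case by linarith
    qed
  qed simp
  \<comment> \<open>For such \<open>m\<close> the bound \<open>real i \<le> A * t / real m\<close>
    implies \<open>2 ^ j * real i \<le> t\<close>, which is \<open>j\<close> doublings of
    room.\<close>
  obtain m0 :: nat where m0: "A * 2 ^ j \<le> real m0" using real_arch_simple by blast
  show ?thesis
    using eventually_ge_at_top[of "max 1 m0"]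
  proof eventually_elim
    case (elim m)
    then have m: "A * 2 ^ j \<le> real m" "0 < real m" using m0 by auto
    show ?case
      using small eventually_gt_at_top[of 0]
    proof eventually_elim
      case (elim t)
      show ?case
      proof (intro allI impI)
        fix i assume i: "real i \<le> A * t / real m"
        show "prob {\<omega>\<in>space M. e * norming t < norm (S i \<omega>)} \<le> \<gamma>"
        proof (cases "i < i2")
          case True
          then show ?thesis using elim(1) by simp
        next
          case False
          then have ii: "i0 \<le> i" "x0 \<le> real i" using i1 by (auto simp: i2_def)
          have "2 ^ j * real i \<le> 2 ^ j * (A * t / real m)" using i by (intro mult_left_mono) auto
          also have "\<dots> = (A * 2 ^ j) * t / real m" by simp
          also have "\<dots> \<le> real m * t / real m"
            using m elim(2) by (intro divide_right_mono mult_right_mono) auto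
          also have "\<dots> = t" using m by simp
          finally have gr: "norming (real i) * q ^ j \<le> 2 * norming t" by (rule g(4)[OF ii(2)])
          have "R * norming (real i) = e / 2 * (2 * R / e * norming (real i))" using \<open>0 < e\<close> by simp
          also have "\<dots> \<le> e / 2 * (q ^ j * norming (real i))"
            using j R(2)[OF ii(1)] \<open>0 < e\<close> by (intro mult_left_mono mult_right_mono) auto
          also have "\<dots> \<le> e / 2 * (2 * norming t)"
            using gr \<open>0 < e\<close> by (intro mult_left_mono) (auto simp: mult.commute)
          finally have "R * norming (real i) \<le> e * norming t" by simp
          then have "prob {\<omega>\<in>space M. e * norming t < norm (S i \<omega>)} \<le> prob {\<omega>\<in>space M. R * norming (real i) < norm (S i \<omega>)}"
            by (intro finite_measure_mono) auto
          with R(2)[OF ii(1)] show ?thesis by linarith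
        qed
      qed
    qed
  qed
qed

text \<open>\<open>m\<close> is the number of blocks and \<open>n\<close> their common length. The
  hull is written through block increments because these are the independent coordinates.\<close>

definition grid_hull :: "nat \<Rightarrow> nat \<Rightarrow> real \<Rightarrow> 'w \<Rightarrow> 'a convex_body" where
  "grid_hull m n t \<omega> = walk_hull m (\<lambda>j. (S (Suc j * n) \<omega> - S (j * n) \<omega>) /\<^sub>R norming t)"

lemma measurable_grid_hull[measurable]: "grid_hull m n t \<in> borel_measurable M"
  unfolding grid_hull_def[abs_def] by measurable

lemma grid_hull_eq: "grid_hull m n t \<omega> = closed_hull ((\<lambda>j. S (j * n) \<omega> /\<^sub>R norming t) ` {..m})"
proof -
  have "(\<Sum>i<j. (S (Suc i * n) \<omega> - S (i * n) \<omega>) /\<^sub>R norming t) = S (j * n) \<omega> /\<^sub>R norming t" for j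
    using sum_lessThan_telescope[of "\<lambda>i. S (i * n) \<omega>" j]
    by (simp only: scaleR_sum_right[symmetric]) (simp add: S_def)
  then show ?thesis by (simp add: grid_hull_def walk_hull_def)
qed

text \<open>For fixed \<open>m\<close> there are \<open>m\<close> independent blocks of the same
  law, each converging by \<open>scaled_attraction\<close>. Since \<open>walk_hull m\<close> is
  Lipschitz in the blocks, joint convergence of independent vectors applies.\<close>

lemma grid_hull_convergence:
  fixes k :: "real \<Rightarrow> nat" and F :: "'a convex_body \<Rightarrow> real" and \<zeta> :: "nat \<Rightarrow> 'u \<Rightarrow> 'a"
  assumes k: "((\<lambda>t. real (k t) / t) \<longlongrightarrow> \<rho>) at_top" and "0 < \<rho>"
    and Q: "prob_space Q" and ind: "prob_space.indep_vars Q (\<lambda>_. borel) \<zeta> {..<m}"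
    and \<zeta>[measurable]: "\<And>j. \<zeta> j \<in> borel_measurable Q"
    and law: "\<And>j. j < m \<Longrightarrow> distr Q borel (\<zeta> j) = distr N borel (\<lambda>v. \<rho> powr p *\<^sub>R \<eta> v)"
    and F: "\<And>K. \<bar>F K\<bar> \<le> B" "\<And>K K'. \<bar>F K - F K'\<bar> \<le> L * dist K K'" "0 \<le> L"
  shows "((\<lambda>t. \<integral>\<omega>. F (grid_hull m (k t) t \<omega>) \<partial>M) \<longlongrightarrow> (\<integral>\<omega>. F (walk_hull m (\<lambda>j. \<zeta> j \<omega>)) \<partial>Q)) at_top"
  unfolding grid_hull_def
proof (rule joint_convergence_independent[where \<Phi> = "\<lambda>x. F (walk_hull m x)" and m = m and B = B and L = L, OF prob_space_axioms Q])
  have [measurable]: "F \<in> borel_measurable borel"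
  proof (rule borel_measurable_continuous_onI)
    have "L-lipschitz_on UNIV F" by (rule lipschitz_onI) (use F in \<open>auto simp: dist_real_def\<close>)
    then show "continuous_on UNIV F" by (rule lipschitz_on_continuous_on)
  qed
  show "indep_vars (\<lambda>_. borel) (\<lambda>j \<omega>. (S (Suc j * k t) \<omega> - S (j * k t) \<omega>) /\<^sub>R norming t) {..<m}" for t
    by (rule indep_vars_compose2[OF indep_blocks]) simp
  show "(\<lambda>\<omega>. F (walk_hull m (\<lambda>j. (S (Suc j * k t) \<omega> - S (j * k t) \<omega>) /\<^sub>R norming t))) \<in> borel_measurable M" for t
    by measurable
  show "(\<lambda>\<omega>. F (walk_hull m (\<lambda>j. \<zeta> j \<omega>))) \<in> borel_measurable Q" by measurable
  show "\<bar>F (walk_hull m x) - F (walk_hull m y)\<bar> \<le> L * (\<Sum>j<m. dist (x j) (y j))" for x y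
    using F(2)[of "walk_hull m x" "walk_hull m y"] mult_left_mono[OF dist_walk_hull_le[of m x y] F(3)] by linarith
  fix j and f :: "'a \<Rightarrow> real" assume j: "j < m" and f: "continuous_on UNIV f" "\<And>x. \<bar>f x\<bar> \<le> 1"
  have [measurable]: "f \<in> borel_measurable borel" using f(1) by (rule borel_measurable_continuous_onI)
  have "(\<integral>\<omega>. f ((S (Suc j * k t) \<omega> - S (j * k t) \<omega>) /\<^sub>R norming t) \<partial>M) = (\<integral>\<omega>. f (S (k t) \<omega> /\<^sub>R norming t) \<partial>M)" for t
  proof -
    have e: "Suc j * k t = j * k t + k t" by simp
    have "(\<integral>\<omega>. f ((S (j * k t + k t) \<omega> - S (j * k t) \<omega>) /\<^sub>R norming t) \<partial>M)
       = (\<integral>x. f (x /\<^sub>R norming t) \<partial>distr M borel (\<lambda>\<omega>. S (j * k t + k t) \<omega> - S (j * k t) \<omega>))"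
      by (subst integral_distr) auto
    also have "\<dots> = (\<integral>\<omega>. f (S (k t) \<omega> /\<^sub>R norming t) \<partial>M)"
      unfolding block_law by (subst integral_distr) auto
    finally show ?thesis unfolding e .
  qed
  moreover have "(\<integral>\<omega>. f (\<zeta> j \<omega>) \<partial>Q) = (\<integral>\<omega>. f (\<rho> powr p *\<^sub>R \<eta> \<omega>) \<partial>N)"
  proof -
    have "(\<integral>\<omega>. f (\<zeta> j \<omega>) \<partial>Q) = (\<integral>x. f x \<partial>distr Q borel (\<zeta> j))" by (subst integral_distr) auto
    also have "\<dots> = (\<integral>\<omega>. f (\<rho> powr p *\<^sub>R \<eta> \<omega>) \<partial>N)" unfolding law[OF j] by (subst integral_distr) auto
    finally show ?thesis .
  qed
  ultimately show "((\<lambda>t. \<integral>\<omega>. f ((S (Suc j * k t) \<omega> - S (j * k t) \<omega>) /\<^sub>R norming t) \<partial>M) \<longlongrightarrow> (\<integral>\<omega>. f (\<zeta> j \<omega>) \<partial>Q)) at_top"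
    using scaled_attraction[OF k \<open>0 < \<rho>\<close> f] by simp
qed (use F ind in auto)

end

section \<open>Limits of the scaled hulls\<close>

text \<open>The limit in \<open>t\<close> for fixed \<open>m\<close>, followed by the limit in
  \<open>m\<close>: the threshold for \<open>t\<close> may depend on \<open>m\<close>. This is
  weaker than the product filter, in which the two thresholds would be independent.\<close>

definition iter_filter :: "(nat \<times> real) filter" where
  "iter_filter = Abs_filter (\<lambda>P. \<forall>\<^sub>F m in sequentially. \<forall>\<^sub>F t in at_top. P (m, t))"

lemma eventually_iter_filter:
  "eventually P iter_filter \<longleftrightarrow> (\<forall>\<^sub>F m in sequentially. \<forall>\<^sub>F t in at_top. P (m, t))"
  unfolding iter_filter_def
proof (rule eventually_Abs_filter, rule is_filter.intro)
  fix P Q :: "nat \<times> real \<Rightarrow> bool"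
  assume "\<forall>\<^sub>F m in sequentially. \<forall>\<^sub>F t in at_top. P (m, t)" "\<forall>\<^sub>F m in sequentially. \<forall>\<^sub>F t in at_top. Q (m, t)"
  then show "\<forall>\<^sub>F m in sequentially. \<forall>\<^sub>F t in at_top. P (m, t) \<and> Q (m, t)"
    by eventually_elim (rule eventually_conj)
next
  fix P Q :: "nat \<times> real \<Rightarrow> bool"
  assume "\<forall>x. P x \<longrightarrow> Q x" and P: "\<forall>\<^sub>F m in sequentially. \<forall>\<^sub>F t in at_top. P (m, t)"
  from P show "\<forall>\<^sub>F m in sequentially. \<forall>\<^sub>F t in at_top. Q (m, t)"
    by eventually_elim (erule eventually_mono, simp add: \<open>\<forall>x. P x \<longrightarrow> Q x\<close>)
qed simp

lemma iter_filter_tendstoI: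
  fixes a :: "nat \<Rightarrow> real \<Rightarrow> real"
  assumes a: "\<forall>\<^sub>F m in sequentially. (a m \<longlongrightarrow> b m) at_top" and b: "b \<longlonglongrightarrow> L"
  shows "((\<lambda>x. a (fst x) (snd x)) \<longlongrightarrow> L) iter_filter"
proof (rule tendstoI)
  fix e :: real assume "0 < e"
  have "\<forall>\<^sub>F m in sequentially. dist (b m) L < e / 2" using b \<open>0 < e\<close> by (intro tendstoD) auto
  with a show "\<forall>\<^sub>F x in iter_filter. dist (a (fst x) (snd x)) L < e"
    unfolding eventually_iter_filter
  proof eventually_elim
    case (elim m)
    have "\<forall>\<^sub>F t in at_top. dist (a m t) (b m) < e / 2" using elim(1) \<open>0 < e\<close> by (intro tendstoD) auto
    then show ?case
    proof eventually_elim
      case (elim t)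
      show ?case using elim \<open>dist (b m) L < e / 2\<close> dist_triangle[of "a m t" L "b m"] by simp
    qed
  qed
qed

text \<open>Removes the auxiliary \<open>m\<close> at the end. For a quantity that does not depend
  on \<open>m\<close>, a single good \<open>m\<close> already gives the statement for all large
  \<open>t\<close>.\<close>

lemma iter_filter_tendsto_snd:
  assumes "((\<lambda>x. a (snd x)) \<longlongrightarrow> L) iter_filter"
  shows "(a \<longlongrightarrow> L) at_top"
proof (rule topological_tendstoI)
  fix S assume "open S" "L \<in> S"
  with assms have "\<forall>\<^sub>F x in iter_filter. a (snd x) \<in> S" by (rule topological_tendstoD)
  then have "\<forall>\<^sub>F m in sequentially. \<forall>\<^sub>F t in at_top. a t \<in> S" unfolding eventually_iter_filter by simp
  then have "\<exists>m::nat. \<forall>\<^sub>F t in at_top. a t \<in> S" using eventually_happens'[OF sequentially_bot] by blast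
  then show "\<forall>\<^sub>F t in at_top. a t \<in> S" by blast
qed

lemma eventually_iter_filter_snd: "eventually P at_top \<Longrightarrow> eventually (\<lambda>x. P (snd x)) iter_filter"
  unfolding eventually_iter_filter by simp

lemma indep_vars_PiM_components:
  assumes "finite I" "I \<noteq> {}" and M: "\<And>i. prob_space (M i)"
  shows "prob_space.indep_vars (PiM I M) M (\<lambda>i \<omega>. \<omega> i) I"
proof -
  interpret P: prob_space "PiM I M" by (rule prob_space_PiM) (rule M)
  have "distr (PiM I M) (PiM I M) (\<lambda>\<omega>. \<lambda>i\<in>I. \<omega> i) = distr (PiM I M) (PiM I M) (\<lambda>\<omega>. \<omega>)"
    by (rule distr_cong) (auto simp: space_PiM)
  also have "\<dots> = PiM I (\<lambda>i. distr (PiM I M) (M i) (\<lambda>\<omega>. \<omega> i))"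
    using M by (simp add: distr_PiM_component cong: PiM_cong)
  finally show ?thesis
    by (subst P.indep_vars_iff_distr_eq_PiM'[OF assms(2)]) (auto intro: measurable_component_singleton)
qed

lemma exp_minus_lipschitz:
  fixes a b :: real
  assumes "0 \<le> a" "0 \<le> b"
  shows "\<bar>exp (- a) - exp (- b)\<bar> \<le> \<bar>a - b\<bar>"
proof -
  have le: "exp (- a) - exp (- b) \<le> b - a" if "0 \<le> a" "a \<le> b" for a b :: real
  proof -
    have "exp (- a) - exp (- b) = exp (- a) * (1 - exp (- (b - a)))" by (simp add: right_diff_distrib exp_add[symmetric])
    also have "\<dots> \<le> 1 * (b - a)"
    proof (rule mult_mono)
      show "1 - exp (- (b - a)) \<le> b - a" using exp_ge_add_one_self[of "- (b - a)"] by linarith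
    qed (use that in auto)
    finally show ?thesis by simp
  qed
  show ?thesis
    using le[of a b] le[of b a] assms by (cases "a \<le> b") (auto simp: abs_if)
qed

lemma nat_floor_ratio:
  assumes "0 < \<rho>" shows "((\<lambda>t. real (nat \<lfloor>\<rho> * t\<rfloor>) / t) \<longlongrightarrow> \<rho>) at_top"
proof (rule tendsto_sandwich)
  show "\<forall>\<^sub>F t in at_top. \<rho> - inverse t \<le> real (nat \<lfloor>\<rho> * t\<rfloor>) / t"
    using eventually_gt_at_top[of 0]
  proof eventually_elim
    case (elim t)
    then have "0 \<le> \<rho> * t" using assms by simp
    then have "\<rho> * t - 1 \<le> real (nat \<lfloor>\<rho> * t\<rfloor>)" by linarith
    then have "(\<rho> * t - 1) / t \<le> real (nat \<lfloor>\<rho> * t\<rfloor>) / t" using elim by (intro divide_right_mono) auto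
    then show ?case using elim by (simp add: diff_divide_distrib inverse_eq_divide)
  qed
  show "\<forall>\<^sub>F t in at_top. real (nat \<lfloor>\<rho> * t\<rfloor>) / t \<le> \<rho>"
    using eventually_gt_at_top[of 0]
  proof eventually_elim
    case (elim t)
    then have "0 \<le> \<rho> * t" using assms by simp
    then have "real (nat \<lfloor>\<rho> * t\<rfloor>) \<le> \<rho> * t" by linarith
    then show ?case using elim by (simp add: field_simps)
  qed
  have "((\<lambda>t. \<rho> - inverse t) \<longlongrightarrow> \<rho> - 0) at_top" by (intro tendsto_intros tendsto_inverse_0_at_top filterlim_ident)
  then show "((\<lambda>t. \<rho> - inverse t) \<longlongrightarrow> \<rho>) at_top" by simp
qed (rule tendsto_const)

lemma nat_ceiling_ratio:
  assumes "0 < \<rho>" shows "((\<lambda>t. real (nat \<lceil>\<rho> * t\<rceil>) / t) \<longlongrightarrow> \<rho>) at_top"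
proof (rule tendsto_sandwich)
  show "\<forall>\<^sub>F t in at_top. \<rho> \<le> real (nat \<lceil>\<rho> * t\<rceil>) / t"
    using eventually_gt_at_top[of 0]
  proof eventually_elim
    case (elim t)
    then have "0 \<le> \<rho> * t" using assms by simp
    then have "\<rho> * t \<le> real (nat \<lceil>\<rho> * t\<rceil>)" by linarith
    then show ?case using elim by (simp add: field_simps)
  qed
  show "\<forall>\<^sub>F t in at_top. real (nat \<lceil>\<rho> * t\<rceil>) / t \<le> \<rho> + inverse t"
    using eventually_gt_at_top[of 0]
  proof eventually_elim
    case (elim t)
    then have "0 \<le> \<rho> * t" using assms by simp
    then have "real (nat \<lceil>\<rho> * t\<rceil>) \<le> \<rho> * t + 1" by linarith
    then have "real (nat \<lceil>\<rho> * t\<rceil>) / t \<le> (\<rho> * t + 1) / t" using elim by (intro divide_right_mono) auto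
    then show ?case using elim by (simp add: add_divide_distrib inverse_eq_divide)
  qed
  have "((\<lambda>t. \<rho> + inverse t) \<longlongrightarrow> \<rho> + 0) at_top" by (intro tendsto_intros tendsto_inverse_0_at_top filterlim_ident)
  then show "((\<lambda>t. \<rho> + inverse t) \<longlongrightarrow> \<rho>) at_top" by simp
qed (rule tendsto_const)

text \<open>The hull involves uncountably many times, but on cadlag paths it is the pointwise limit
  of walk hulls over finite grids.\<close>

lemma measurable_closed_hull_path:
  fixes Z :: "real \<Rightarrow> 'w \<Rightarrow> 'a::euclidean_space"
  assumes m: "\<And>t. 0 \<le> t \<Longrightarrow> Z t \<in> borel_measurable M" and c: "\<And>\<omega>. \<omega> \<in> space M \<Longrightarrow> cadlag (\<lambda>t. Z t \<omega>)"
    and z: "\<And>\<omega>. \<omega> \<in> space M \<Longrightarrow> Z 0 \<omega> = 0" and "0 \<le> t"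
  shows "(\<lambda>\<omega>. closed_hull {Z s \<omega> |s. 0 \<le> s \<and> s \<le> t}) \<in> borel_measurable M"
proof (rule borel_measurable_LIMSEQ_metric)
  fix n
  have "(\<lambda>\<omega>. Z (real (Suc i) * (t / real n)) \<omega> - Z (real i * (t / real n)) \<omega>) \<in> borel_measurable M" for i
    using \<open>0 \<le> t\<close> by (intro borel_measurable_diff m) auto
  then show "(\<lambda>\<omega>. walk_hull n (\<lambda>i. Z (real (Suc i) * (t / real n)) \<omega> - Z (real i * (t / real n)) \<omega>)) \<in> borel_measurable M"
    by (rule measurable_walk_hull)
next
  fix \<omega> assume "\<omega> \<in> space M"
  then show "(\<lambda>n. walk_hull n (\<lambda>i. Z (real (Suc i) * (t / real n)) \<omega> - Z (real i * (t / real n)) \<omega>))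
    \<longlonglongrightarrow> closed_hull {Z s \<omega> |s. 0 \<le> s \<and> s \<le> t}"
    using \<open>0 \<le> t\<close> by (intro walk_hull_grid_tendsto c z)
qed

lemma lipschitz_body_measurable:
  fixes F :: "'a::euclidean_space convex_body \<Rightarrow> real"
  assumes "\<And>K K'. \<bar>F K - F K'\<bar> \<le> L * dist K K'"
  shows "continuous_on UNIV F" "F \<in> borel_measurable borel"
proof -
  have "(max L 0)-lipschitz_on UNIV F"
  proof (rule lipschitz_onI)
    fix K K' :: "'a convex_body"
    show "dist (F K) (F K') \<le> max L 0 * dist K K'"
      using assms[of K K'] mult_right_mono[of L "max L 0" "dist K K'"] by (simp add: dist_real_def)
  qed simp
  then show "continuous_on UNIV F" by (rule lipschitz_on_continuous_on)
  then show "F \<in> borel_measurable borel" by (rule borel_measurable_continuous_onI)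
qed

text \<open>The layer-cake form of the support function. The truncation at \<open>0\<close> keeps it
  bounded, and Lipschitz for unit \<open>u\<close>, on arbitrary bodies, so that it is an admissible
  test function on the whole space.\<close>

definition exp_support :: "'a::euclidean_space \<Rightarrow> 'a convex_body \<Rightarrow> real" where
  "exp_support u K = 1 - exp (- max 0 (support_fun u K))"

lemma exp_support_bounds: "0 \<le> exp_support u K" "exp_support u K \<le> 1" "\<bar>exp_support u K\<bar> \<le> 1"
proof -
  show "0 \<le> exp_support u K" "exp_support u K \<le> 1" by (auto simp: exp_support_def)
  then show "\<bar>exp_support u K\<bar> \<le> 1" by simp
qed

lemma exp_support_lipschitz: "norm u = 1 \<Longrightarrow> \<bar>exp_support u K - exp_support u K'\<bar> \<le> 1 * dist K K'"
proof -
  assume "norm u = 1"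
  have "\<bar>exp_support u K - exp_support u K'\<bar> = \<bar>exp (- max 0 (support_fun u K)) - exp (- max 0 (support_fun u K'))\<bar>"
    by (simp add: exp_support_def abs_minus_commute)
  also have "\<dots> \<le> \<bar>max 0 (support_fun u K) - max 0 (support_fun u K')\<bar>" by (rule exp_minus_lipschitz) auto
  also have "\<dots> \<le> \<bar>support_fun u K - support_fun u K'\<bar>" by (auto simp: max_def abs_if)
  also have "\<dots> \<le> dist K K'" using support_fun_lipschitz[of u K K'] \<open>norm u = 1\<close> by simp
  finally show ?thesis by simp
qed

lemma support_fun_nonneg: "0 \<in> body_set K \<Longrightarrow> 0 \<le> support_fun u K"
  using support_fun_upper[of 0 K u] by simp

lemma measurable_support_fun[measurable]: "support_fun u \<in> borel_measurable borel"
  by (rule lipschitz_body_measurable(2)[OF support_fun_lipschitz])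

lemma measurable_exp_support[measurable]: "exp_support u \<in> borel_measurable borel"
  unfolding exp_support_def[abs_def] by measurable

section \<open>The walk embedded in the Levy process\<close>

locale hull_limit = X: levy_process M X + Y: levy_process M' Y
  for M :: "'w measure" and X :: "real \<Rightarrow> 'w \<Rightarrow> 'a::euclidean_space" and M' :: "'u measure" and Y :: "real \<Rightarrow> 'u \<Rightarrow> 'a" +
  fixes N :: "'v measure" and \<eta> :: "'v \<Rightarrow> 'a" and \<alpha> :: real and l :: "real \<Rightarrow> real"
  assumes nontrivial: "\<not> (AE \<omega> in M. \<forall>t\<ge>0. X t \<omega> = 0)"
    and stable: "strictly_stable \<alpha> N \<eta>"
    and slow: "slowly_varying l"
    and attr: "converges_in_distribution
           (\<lambda>n. \<Pi>\<^sub>M i\<in>{..<n}. M)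
           (\<lambda>n \<omega>. inverse (real n powr (1 / \<alpha>) * l (real n)) *\<^sub>R (\<Sum>i<n. exit_position X (\<omega> i)))
           N \<eta> sequentially"
    and law_Y: "distr M' borel (Y 1) = distr N borel \<eta>"
begin

definition "step i \<omega> = snd (X.renewal i \<omega>)"

lemma snd_borel: "snd \<in> borel_measurable (borel :: (real \<times> 'a) measure)"
  by (rule borel_measurable_continuous_onI[OF continuous_on_snd[OF continuous_on_id]])

lemma fst_borel: "fst \<in> borel_measurable (borel :: (real \<times> 'a) measure)"
  by (rule borel_measurable_continuous_onI[OF continuous_on_fst[OF continuous_on_id]])

lemma iid_walk_step: "iid_walk M step"
proof (unfold_locales)
  show "X.indep_vars (\<lambda>_. borel) step UNIV"
    unfolding step_def[abs_def]
    by (rule X.indep_vars_compose2[OF X.renewal_indep[OF X.exits_AE[OF nontrivial]]]) (rule snd_borel)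
  show "distr M borel (step i) = distr M borel (step 0)" for i
  proof -
    have "distr (distr M borel (X.renewal i)) borel snd = distr (distr M borel (X.renewal 0)) borel snd"
      using X.renewal_law[OF X.exits_AE[OF nontrivial], of i] by simp
    then show ?thesis
      by (simp add: distr_distr[OF snd_borel X.measurable_renewal] comp_def step_def[abs_def])
  qed
qed

text \<open>The attraction hypothesis speaks of independent copies on a product space, while the
  embedded walk reads its steps from a single path. Both sums have independent summands of the same
  law.\<close>

lemma exit_position_sum_law:
  "distr (\<Pi>\<^sub>M i\<in>{..<n}. M) borel (\<lambda>\<omega>. \<Sum>i<n. step 0 (\<omega> i)) = distr M borel (\<lambda>\<omega>. \<Sum>i<n. step i \<omega>)"
proof (cases "n = 0")
  case True
  interpret P: prob_space "\<Pi>\<^sub>M i\<in>{..<n}. M" by (rule prob_space_PiM) unfold_locales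
  show ?thesis using True P.distr_const[of 0 borel] X.distr_const[of 0 borel] by simp
next
  case False
  interpret W: iid_walk M step by (rule iid_walk_step)
  have P: "prob_space (\<Pi>\<^sub>M i\<in>{..<n}. M)" by (rule prob_space_PiM) unfold_locales
  interpret P: prob_space "\<Pi>\<^sub>M i\<in>{..<n}. M" by (rule P)
  have ne: "{..<n} \<noteq> {}" using False by auto
  have c: "P.indep_vars (\<lambda>_. M) (\<lambda>i \<omega>. \<omega> i) {..<n}"
    by (rule indep_vars_PiM_components[OF finite_lessThan ne X.prob_space_axioms])
  have i1: "P.indep_vars (\<lambda>_. borel) (\<lambda>i \<omega>. step 0 (\<omega> i)) {..<n}"
    by (rule P.indep_vars_compose2[OF c W.measurable_step])
  have i2: "X.indep_vars (\<lambda>_. borel) step {..<n}" by (rule X.indep_vars_subset[OF W.indep]) auto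
  show ?thesis
  proof (rule indep_sum_law[OF P X.prob_space_axioms i1 i2])
    fix i assume i: "i < n"
    have "distr (\<Pi>\<^sub>M i\<in>{..<n}. M) borel (\<lambda>\<omega>. step 0 (\<omega> i)) = distr (distr (\<Pi>\<^sub>M i\<in>{..<n}. M) M (\<lambda>\<omega>. \<omega> i)) borel (step 0)"
      using i by (subst distr_distr[OF W.measurable_step]) (auto simp: comp_def intro: measurable_component_singleton)
    also have "\<dots> = distr M borel (step 0)"
      using i distr_PiM_component[of "{..<n}" "\<lambda>_. M" i] X.prob_space_axioms by simp
    also have "\<dots> = distr M borel (step i)" by (rule W.same_law[symmetric])
    finally show "distr (\<Pi>\<^sub>M i\<in>{..<n}. M) borel (\<lambda>\<omega>. step 0 (\<omega> i)) = distr M borel (step i)" .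
  qed
qed

sublocale W: attracted_walk M step N \<eta> "1 / \<alpha>" l
proof -
  interpret W0: iid_walk M step by (rule iid_walk_step)
  have st: "prob_space N" "\<eta> \<in> borel_measurable N" "0 < \<alpha>"
    using stable by (auto simp: strictly_stable_def)
  show "attracted_walk M step N \<eta> (1 / \<alpha>) l"
  proof (intro attracted_walk.intro attracted_walk_axioms.intro W0.iid_walk_axioms st(1))
    show "\<eta> \<in> borel_measurable N" "0 < 1 / \<alpha>" "slowly_varying l" using st slow by simp_all
    fix f :: "'a \<Rightarrow> real" assume f: "continuous_on UNIV f" "\<And>x. \<bar>f x\<bar> \<le> 1"
    have [measurable]: "f \<in> borel_measurable borel" using f(1) by (rule borel_measurable_continuous_onI)
    have "bounded (range f)" using f(2) by (auto simp: bounded_iff)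
    then have lim: "(\<lambda>n. \<integral>\<omega>. f (inverse (real n powr (1 / \<alpha>) * l (real n)) *\<^sub>R (\<Sum>i<n. exit_position X (\<omega> i))) \<partial>(\<Pi>\<^sub>M i\<in>{..<n}. M))
      \<longlonglongrightarrow> (\<integral>\<omega>. f (\<eta> \<omega>) \<partial>N)"
      using attr f(1) unfolding converges_in_distribution_def by blast
    have "(\<integral>\<omega>. f (inverse (real n powr (1 / \<alpha>) * l (real n)) *\<^sub>R (\<Sum>i<n. exit_position X (\<omega> i))) \<partial>(\<Pi>\<^sub>M i\<in>{..<n}. M))
       = (\<integral>\<omega>. f (W0.S n \<omega> /\<^sub>R (real n powr (1 / \<alpha>) * l (real n))) \<partial>M)" for n
    proof -
      define c where "c = inverse (real n powr (1 / \<alpha>) * l (real n))"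
      have [measurable]: "(\<lambda>\<omega>. \<Sum>i<n. step 0 (\<omega> i)) \<in> borel_measurable (\<Pi>\<^sub>M i\<in>{..<n}. M)"
      proof (rule borel_measurable_sum)
        fix i assume "i \<in> {..<n}"
        then have "(\<lambda>\<omega>. \<omega> i) \<in> measurable (\<Pi>\<^sub>M i\<in>{..<n}. M) M" by (rule measurable_component_singleton)
        from measurable_compose[OF this W0.measurable_step]
        show "(\<lambda>\<omega>. step 0 (\<omega> i)) \<in> borel_measurable (\<Pi>\<^sub>M i\<in>{..<n}. M)" .
      qed
      have "(\<integral>\<omega>. f (c *\<^sub>R (\<Sum>i<n. exit_position X (\<omega> i))) \<partial>(\<Pi>\<^sub>M i\<in>{..<n}. M))
         = (\<integral>\<omega>. f (c *\<^sub>R (\<Sum>i<n. step 0 (\<omega> i))) \<partial>(\<Pi>\<^sub>M i\<in>{..<n}. M))"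
      proof (intro Bochner_Integration.integral_cong refl)
        fix \<omega> assume "\<omega> \<in> space (\<Pi>\<^sub>M i\<in>{..<n}. M)"
        then have "\<omega> i \<in> space M" if "i < n" for i using that by (auto simp: space_PiM)
        then have "exit_position X (\<omega> i) = step 0 (\<omega> i)" if "i < n" for i
          using that X.renewal_0(1)[of "\<omega> i"] by (simp add: step_def)
        then show "f (c *\<^sub>R (\<Sum>i<n. exit_position X (\<omega> i))) = f (c *\<^sub>R (\<Sum>i<n. step 0 (\<omega> i)))" by simp
      qed
      also have "\<dots> = (\<integral>x. f (c *\<^sub>R x) \<partial>distr (\<Pi>\<^sub>M i\<in>{..<n}. M) borel (\<lambda>\<omega>. \<Sum>i<n. step 0 (\<omega> i)))"
        by (subst integral_distr) auto
      also have "\<dots> = (\<integral>\<omega>. f (c *\<^sub>R (\<Sum>i<n. step i \<omega>)) \<partial>M)"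
        unfolding exit_position_sum_law by (subst integral_distr) auto
      finally show ?thesis unfolding c_def W0.S_def .
    qed
    with lim show "(\<lambda>n. \<integral>\<omega>. f (W0.S n \<omega> /\<^sub>R (real n powr (1 / \<alpha>) * l (real n))) \<partial>M) \<longlonglongrightarrow> (\<integral>\<omega>. f (\<eta> \<omega>) \<partial>N)"
      by simp
  qed
qed

end

lemma cadlag_scaleR:
  fixes x :: "real \<Rightarrow> 'a::real_normed_vector"
  assumes "cadlag x"
  shows "cadlag (\<lambda>s. d *\<^sub>R x s)"
  unfolding cadlag_def
proof (intro conjI allI impI)
  fix t :: real assume "0 \<le> t"
  then have "(x \<longlongrightarrow> x t) (at_right t)" using assms unfolding cadlag_def by blast
  then show "((\<lambda>s. d *\<^sub>R x s) \<longlongrightarrow> d *\<^sub>R x t) (at_right t)" by (intro tendsto_scaleR tendsto_const)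
next
  fix t :: real assume "0 < t"
  then obtain y where "(x \<longlongrightarrow> y) (at_left t)" using assms unfolding cadlag_def by blast
  then have "((\<lambda>s. d *\<^sub>R x s) \<longlongrightarrow> d *\<^sub>R y) (at_left t)" by (intro tendsto_scaleR tendsto_const)
  then show "\<exists>y. ((\<lambda>s. d *\<^sub>R x s) \<longlongrightarrow> y) (at_left t)" by blast
qed

section \<open>Bounds on the path hull by hulls of the embedded walk\<close>

context hull_limit
begin

abbreviation "\<mu> \<equiv> mean_exit_time M X"
abbreviation "c \<equiv> W.norming"
abbreviation "T \<equiv> X.renewal_time"

definition "scaled_hull t \<omega> = scale_body (inverse (c t)) (path_hull X t \<omega>)"
definition "limit_hull = path_hull Y (inverse \<mu>)"

lemma mu_pos: "0 < \<mu>"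
  by (rule X.mean_exit_time_eq(2)[OF nontrivial])

lemma measurable_T[measurable]: "T n \<in> borel_measurable M"
proof -
  have "(\<lambda>\<omega>. fst (X.renewal i \<omega>)) \<in> borel_measurable M" for i
    by (rule measurable_compose[OF X.measurable_renewal fst_borel])
  then show ?thesis unfolding X.renewal_time_def[abs_def] by (intro borel_measurable_sum)
qed

lemma S_eq: "\<omega> \<in> space M \<Longrightarrow> W.S k \<omega> = X (T k \<omega>) \<omega>"
  unfolding W.S_def step_def by (rule X.renewal_path(2)[symmetric])

lemma T_mono: "\<omega> \<in> space M \<Longrightarrow> i \<le> j \<Longrightarrow> T i \<omega> \<le> T j \<omega>"
  unfolding X.renewal_time_def by (rule sum_mono2) (auto intro: X.renewal_path(3))

lemma hull_eq:
  assumes "\<omega> \<in> space M" "0 \<le> t"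
  shows "scaled_hull t \<omega> = closed_hull ((*\<^sub>R) (inverse (c t)) ` {X s \<omega> |s. 0 \<le> s \<and> s \<le> t})"
  unfolding scaled_hull_def path_hull_def
  using assms X.cadlag_paths[OF assms(1)] by (intro scale_body_closed_hull bounded_cadlag) auto

lemma bounded_scaled_path:
  assumes "\<omega> \<in> space M" "0 \<le> t"
  shows "bounded ((*\<^sub>R) (inverse (c t)) ` {X s \<omega> |s. 0 \<le> s \<and> s \<le> t})"
    "(*\<^sub>R) (inverse (c t)) ` {X s \<omega> |s. 0 \<le> s \<and> s \<le> t} \<noteq> {}"
proof -
  show "bounded ((*\<^sub>R) (inverse (c t)) ` {X s \<omega> |s. 0 \<le> s \<and> s \<le> t})"
    by (rule bounded_scaling[OF bounded_cadlag[OF X.cadlag_paths[OF assms(1)]]])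
  show "(*\<^sub>R) (inverse (c t)) ` {X s \<omega> |s. 0 \<le> s \<and> s \<le> t} \<noteq> {}" using assms(2) by auto
qed

lemma measurable_hull[measurable]: "0 \<le> t \<Longrightarrow> scaled_hull t \<in> borel_measurable M"
proof -
  assume "0 \<le> t"
  define d where "d = inverse (c t)"
  have "(\<lambda>\<omega>. closed_hull {d *\<^sub>R X s \<omega> |s. 0 \<le> s \<and> s \<le> t}) \<in> borel_measurable M"
  proof (rule measurable_closed_hull_path[where Z = "\<lambda>s \<omega>. d *\<^sub>R X s \<omega>"])
    show "(\<lambda>\<omega>. d *\<^sub>R X s \<omega>) \<in> borel_measurable M" if "0 \<le> s" for s
      using X.measurable_X[OF that] by simp
    show "cadlag (\<lambda>s. d *\<^sub>R X s \<omega>)" if "\<omega> \<in> space M" for \<omega>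
      using X.cadlag_paths[OF that] by (rule cadlag_scaleR)
  qed (use X.start_origin \<open>0 \<le> t\<close> in auto)
  moreover have "scaled_hull t \<omega> = closed_hull {d *\<^sub>R X s \<omega> |s. 0 \<le> s \<and> s \<le> t}" if "\<omega> \<in> space M" for \<omega>
  proof -
    have "(*\<^sub>R) d ` {X s \<omega> |s. 0 \<le> s \<and> s \<le> t} = {d *\<^sub>R X s \<omega> |s. 0 \<le> s \<and> s \<le> t}" by auto
    then show ?thesis using hull_eq[OF that \<open>0 \<le> t\<close>] unfolding d_def by simp
  qed
  ultimately show "scaled_hull t \<in> borel_measurable M" by (simp cong: measurable_cong)
qed

lemma measurable_limit_hull[measurable]: "limit_hull \<in> borel_measurable M'"
  unfolding limit_hull_def path_hull_def[abs_def]
  using mu_pos by (intro measurable_closed_hull_path Y.measurable_X Y.cadlag_paths Y.start_origin) auto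

lemma zero_in_grid_hull: "0 \<in> body_set (W.grid_hull m n t \<omega>)"
  using body_set_walk_hull[of 0 m] unfolding W.grid_hull_def by simp

text \<open>The block ends of the walk are values of the path at renewal times, and none of these
  times exceeds \<open>t\<close>.\<close>

lemma grid_hull_subset:
  assumes \<omega>: "\<omega> \<in> space M" and "0 \<le> t" "T (m * n) \<omega> \<le> t"
  shows "body_set (W.grid_hull m n t \<omega>) \<subseteq> body_set (scaled_hull t \<omega>)"
  unfolding W.grid_hull_eq hull_eq[OF \<omega> \<open>0 \<le> t\<close>]
proof (rule closed_hull_mono[OF _ bounded_scaled_path(1)[OF \<omega> \<open>0 \<le> t\<close>]])
  show "(\<lambda>j. W.S (j * n) \<omega> /\<^sub>R c t) ` {..m} \<subseteq> (*\<^sub>R) (inverse (c t)) ` {X s \<omega> |s. 0 \<le> s \<and> s \<le> t}"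
  proof (rule image_subsetI)
    fix j assume "j \<in> {..m}"
    then have "T (j * n) \<omega> \<le> T (m * n) \<omega>" by (intro T_mono \<omega> mult_le_mono1) simp
    then have "0 \<le> T (j * n) \<omega>" "T (j * n) \<omega> \<le> t" using assms(3) X.renewal_path(1)[OF \<omega>] by auto
    then show "W.S (j * n) \<omega> /\<^sub>R c t \<in> (*\<^sub>R) (inverse (c t)) ` {X s \<omega> |s. 0 \<le> s \<and> s \<le> t}"
      unfolding S_eq[OF \<omega>] by blast
  qed
qed auto

text \<open>Up to time \<open>t\<close> the path stays within distance \<open>1\<close> of some walk
  position with index below \<open>n\<close>. The \<open>1\<close> becomes \<open>1 / c t\<close>
  after scaling and vanishes in the limit.\<close>

lemma hull_support_upper:
  assumes \<omega>: "\<omega> \<in> space M" and t: "0 \<le> t" "t < T n \<omega>" and "0 < c t" "norm u = 1"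
  shows "support_fun u (scaled_hull t \<omega>) \<le> (1 + Max ((\<lambda>i. u \<bullet> W.S i \<omega>) ` {..n})) / c t"
  unfolding hull_eq[OF \<omega> t(1)]
proof (rule support_fun_closed_hull_le[OF bounded_scaled_path[OF \<omega> t(1)]])
  fix a assume "a \<in> (*\<^sub>R) (inverse (c t)) ` {X s \<omega> |s. 0 \<le> s \<and> s \<le> t}"
  then obtain s where s: "0 \<le> s" "s \<le> t" "a = inverse (c t) *\<^sub>R X s \<omega>" by blast
  obtain k where k: "k < n" "norm (X s \<omega> - W.S k \<omega>) \<le> 1"
    using X.near_renewal_position[OF \<omega> s(1), of n] s(2) t(2) unfolding W.S_def step_def
    by (metis order_le_less_trans)
  have "u \<bullet> X s \<omega> = u \<bullet> (X s \<omega> - W.S k \<omega>) + u \<bullet> W.S k \<omega>" by (simp add: inner_diff_right)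
  also have "u \<bullet> (X s \<omega> - W.S k \<omega>) \<le> 1"
    using norm_cauchy_schwarz[of u "X s \<omega> - W.S k \<omega>"] k(2) \<open>norm u = 1\<close> by simp
  also have "u \<bullet> W.S k \<omega> \<le> Max ((\<lambda>i. u \<bullet> W.S i \<omega>) ` {..n})" using k(1) by (intro Max_ge) auto
  finally show "u \<bullet> a \<le> (1 + Max ((\<lambda>i. u \<bullet> W.S i \<omega>) ` {..n})) / c t"
    using \<open>0 < c t\<close> unfolding s(3) by (simp add: divide_inverse mult.commute mult_left_mono)
qed

text \<open>Unless \<open>m * n\<close> renewals are completed by time \<open>t\<close>, the support
  function of the path hull is bounded through the maximum over all \<open>m * n\<close> steps.
  Ottaviani's inequality replaces this maximum by the one over block ends, which is the support
  function of the grid hull. The error terms stand for early completion, the distance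
  \<open>1\<close>, the loss \<open>e\<close> inside a block, and the factor
  \<open>1 - \<gamma>\<close>.\<close>

lemma expectation_exp_support_upper:
  assumes u: "norm u = 1" and t: "0 \<le> t" "0 < c t" and "0 < n" "0 < e" and \<gamma>: "0 \<le> \<gamma>" "\<gamma> \<le> 1"
    and small: "\<And>i. i \<le> n \<Longrightarrow> X.prob {\<omega>\<in>space M. e * c t < norm (W.S i \<omega>)} \<le> \<gamma>"
  shows "(\<integral>\<omega>. exp_support u (scaled_hull t \<omega>) \<partial>M) \<le>
    X.prob {\<omega>\<in>space M. T (m * n) \<omega> \<le> t} + 1 / c t + e + \<gamma> + (\<integral>\<omega>. exp_support u (W.grid_hull m n t \<omega>) \<partial>M)"
proof -
  define Mx where "Mx \<omega> = Max ((\<lambda>i. u \<bullet> W.S i \<omega>) ` {..m * n})" for \<omega>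
  have mMx[measurable]: "Mx \<in> borel_measurable M" unfolding Mx_def[abs_def] by (intro borel_measurable_Max) auto
  \<comment> \<open>Subtracting \<open>e\<close> absorbs the loss inside a block:
    \<open>x < U\<close> says that the maximum exceeds the level \<open>c t * x\<close> by more than
    \<open>e * c t\<close>.\<close>
  define U where "U \<omega> = max 0 (Mx \<omega> / c t - e)" for \<omega>
  define V where "V \<omega> = max 0 (support_fun u (W.grid_hull m n t \<omega>))" for \<omega>
  have [measurable]: "U \<in> borel_measurable M" "V \<in> borel_measurable M" unfolding U_def[abs_def] V_def[abs_def] by measurable
  have hm[measurable]: "scaled_hull t \<in> borel_measurable M" using t(1) by (rule measurable_hull)
  have lessMx: "y < Mx \<omega> \<longleftrightarrow> (\<exists>i\<le>m * n. y < u \<bullet> W.S i \<omega>)" for y \<omega>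
    unfolding Mx_def by (subst Max_gr_iff) auto
  have "(1 - \<gamma>) * (\<integral>\<omega>. 1 - exp (- U \<omega>) \<partial>M) \<le> (\<integral>\<omega>. 1 - exp (- V \<omega>) \<partial>M)"
  proof (rule one_minus_exp_tail_comparison[OF X.prob_space_axioms])
    fix x :: real assume "0 \<le> x"
    have "{\<omega>\<in>space M. x < U \<omega>} = {\<omega>\<in>space M. \<exists>i\<le>m * n. c t * x + e * c t < u \<bullet> W.S i \<omega>}"
    proof -
      have "x < U \<omega> \<longleftrightarrow> c t * x + e * c t < Mx \<omega>" for \<omega>
        using t(2) \<open>0 \<le> x\<close> by (auto simp: U_def less_max_iff_disj field_simps)
      then show ?thesis unfolding lessMx by simp
    qed
    moreover have "{\<omega>\<in>space M. x < V \<omega>} = {\<omega>\<in>space M. \<exists>j\<le>m. c t * x < u \<bullet> W.S (j * n) \<omega>}"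
    proof -
      have "x < V \<omega> \<longleftrightarrow> (\<exists>j\<le>m. c t * x < u \<bullet> W.S (j * n) \<omega>)" for \<omega>
      proof -
        have ps: "(\<Sum>i<j. (W.S (Suc i * n) \<omega> - W.S (i * n) \<omega>) /\<^sub>R c t) = W.S (j * n) \<omega> /\<^sub>R c t" for j
          using sum_lessThan_telescope[of "\<lambda>i. W.S (i * n) \<omega>" j]
          by (simp only: scaleR_sum_right[symmetric]) (simp add: W.S_def)
        have "x < V \<omega> \<longleftrightarrow> x < support_fun u (W.grid_hull m n t \<omega>)"
          using \<open>0 \<le> x\<close> by (auto simp: V_def less_max_iff_disj)
        also have "\<dots> \<longleftrightarrow> (\<exists>j\<le>m. x < u \<bullet> (W.S (j * n) \<omega> /\<^sub>R c t))"
          unfolding W.grid_hull_def support_fun_walk_hull ps by (subst Max_gr_iff) auto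
        also have "\<dots> \<longleftrightarrow> (\<exists>j\<le>m. c t * x < u \<bullet> W.S (j * n) \<omega>)"
          using t(2) by (simp add: field_simps)
        finally show ?thesis .
      qed
      then show ?thesis by simp
    qed
    moreover have "(1 - \<gamma>) * X.prob {\<omega>\<in>space M. \<exists>i\<le>m * n. c t * x + e * c t < u \<bullet> W.S i \<omega>}
       \<le> X.prob {\<omega>\<in>space M. \<exists>j\<le>m. c t * x < u \<bullet> W.S (j * n) \<omega>}"
    proof (rule W.ottaviani[OF \<open>0 < n\<close>])
      fix i assume "i \<le> n"
      have "X.prob {\<omega>\<in>space M. u \<bullet> W.S i \<omega> < - (e * c t)} \<le> X.prob {\<omega>\<in>space M. e * c t < norm (W.S i \<omega>)}"
      proof (rule X.finite_measure_mono)
        show "{\<omega>\<in>space M. u \<bullet> W.S i \<omega> < - (e * c t)} \<subseteq> {\<omega>\<in>space M. e * c t < norm (W.S i \<omega>)}"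
        proof safe
          fix \<omega> assume "u \<bullet> W.S i \<omega> < - (e * c t)"
          moreover have "\<bar>u \<bullet> W.S i \<omega>\<bar> \<le> norm (W.S i \<omega>)" using Cauchy_Schwarz_ineq2[of u "W.S i \<omega>"] u by simp
          ultimately show "e * c t < norm (W.S i \<omega>)" by linarith
        qed
      qed measurable
      with small[OF \<open>i \<le> n\<close>] show "X.prob {\<omega>\<in>space M. u \<bullet> W.S i \<omega> < - (e * c t)} \<le> \<gamma>" by linarith
    qed
    ultimately show "(1 - \<gamma>) * X.prob {\<omega>\<in>space M. x < U \<omega>} \<le> X.prob {\<omega>\<in>space M. x < V \<omega>}" by simp
  qed (use \<gamma> in \<open>auto simp: U_def V_def\<close>)
  moreover have "(\<integral>\<omega>. 1 - exp (- V \<omega>) \<partial>M) = (\<integral>\<omega>. exp_support u (W.grid_hull m n t \<omega>) \<partial>M)"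
    by (simp add: V_def exp_support_def)
  moreover have iU: "integrable M (\<lambda>\<omega>. 1 - exp (- U \<omega>))"
  proof (rule X.integrable_const_bound[where B = 1])
    show "AE \<omega> in M. norm (1 - exp (- U \<omega>)) \<le> 1"
    proof (rule AE_I2)
      fix \<omega>
      have "0 \<le> U \<omega>" by (simp add: U_def)
      then have "exp (- U \<omega>) \<le> 1" by simp
      moreover have "0 < exp (- U \<omega>)" by simp
      ultimately show "norm (1 - exp (- U \<omega>)) \<le> 1" unfolding real_norm_def abs_le_iff by linarith
    qed
  qed measurable
  have U1: "(\<integral>\<omega>. 1 - exp (- U \<omega>) \<partial>M) \<le> 1"
  proof -
    have "(\<integral>\<omega>. 1 - exp (- U \<omega>) \<partial>M) \<le> (\<integral>\<omega>. 1 \<partial>M)" using iU by (intro integral_mono) auto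
    then show ?thesis by (simp add: X.prob_space)
  qed
  \<comment> \<open>The expectation is at most \<open>1\<close>, which turns the factor
    \<open>1 - \<gamma>\<close> into the additive error \<open>\<gamma>\<close>.\<close>
  have "\<gamma> * (\<integral>\<omega>. 1 - exp (- U \<omega>) \<partial>M) \<le> \<gamma> * 1" using U1 \<gamma> by (intro mult_left_mono)
  ultimately have EU: "(\<integral>\<omega>. 1 - exp (- U \<omega>) \<partial>M) \<le> \<gamma> + (\<integral>\<omega>. exp_support u (W.grid_hull m n t \<omega>) \<partial>M)"
    by (simp add: left_diff_distrib)
  have bad[measurable]: "{\<omega>\<in>space M. T (m * n) \<omega> \<le> t} \<in> sets M" by measurable
  have "(\<integral>\<omega>. exp_support u (scaled_hull t \<omega>) \<partial>M) \<le>
    (\<integral>\<omega>. indicator {\<omega>\<in>space M. T (m * n) \<omega> \<le> t} \<omega> + (1 / c t + e) + (1 - exp (- U \<omega>)) \<partial>M)"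
  proof (rule integral_mono)
    show "integrable M (\<lambda>\<omega>. exp_support u (scaled_hull t \<omega>))"
      by (rule X.integrable_const_bound[where B = 1]) (auto simp: exp_support_bounds)
    show "integrable M (\<lambda>\<omega>. indicator {\<omega>\<in>space M. T (m * n) \<omega> \<le> t} \<omega> + (1 / c t + e) + (1 - exp (- U \<omega>)))"
      using iU by (intro Bochner_Integration.integrable_add) (auto simp: X.emeasure_eq_measure)
    fix \<omega> assume \<omega>: "\<omega> \<in> space M"
    have U0: "0 \<le> U \<omega>" by (simp add: U_def)
    then have eU: "0 \<le> 1 - exp (- U \<omega>)" by simp
    have ce: "0 \<le> 1 / c t + e" using t(2) \<open>0 < e\<close> by simp
    show "exp_support u (scaled_hull t \<omega>) \<le> indicator {\<omega>\<in>space M. T (m * n) \<omega> \<le> t} \<omega> + (1 / c t + e) + (1 - exp (- U \<omega>))"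
    proof (cases "T (m * n) \<omega> \<le> t")
      case True
      then have "indicator {\<omega>\<in>space M. T (m * n) \<omega> \<le> t} \<omega> = (1 :: real)" using \<omega> by simp
      then show ?thesis using exp_support_bounds(2)[of u "scaled_hull t \<omega>"] eU ce by linarith
    next
      case False
      define h where "h = max 0 (support_fun u (scaled_hull t \<omega>))"
      have "support_fun u (scaled_hull t \<omega>) \<le> (1 + Mx \<omega>) / c t"
        unfolding Mx_def using False \<omega> t u by (intro hull_support_upper) auto
      also have "\<dots> = 1 / c t + Mx \<omega> / c t" by (simp add: add_divide_distrib)
      also have "\<dots> \<le> 1 / c t + e + U \<omega>" by (simp add: U_def)
      finally have h: "h \<le> 1 / c t + e + U \<omega>" unfolding h_def using ce U0 by simp
      have "exp (- U \<omega>) - exp (- h) \<le> 1 / c t + e"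
      proof (cases "h \<le> U \<omega>")
        case True
        then show ?thesis using ce by (simp add: order_trans[of _ 0])
      next
        case False
        then show ?thesis using exp_minus_lipschitz[of "U \<omega>" h] U0 h by (simp add: abs_le_iff h_def)
      qed
      then show ?thesis using \<omega> False by (simp add: exp_support_def h_def)
    qed
  qed
  also have "\<dots> = X.prob {\<omega>\<in>space M. T (m * n) \<omega> \<le> t} + (1 / c t + e) + (\<integral>\<omega>. 1 - exp (- U \<omega>) \<partial>M)"
  proof -
    have i: "integrable M (indicator {\<omega>\<in>space M. T (m * n) \<omega> \<le> t} :: _ \<Rightarrow> real)" by (simp add: X.emeasure_eq_measure)
    have "(\<integral>\<omega>. indicator {\<omega>\<in>space M. T (m * n) \<omega> \<le> t} \<omega> + (1 / c t + e) + (1 - exp (- U \<omega>)) \<partial>M)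
      = (\<integral>\<omega>. indicator {\<omega>\<in>space M. T (m * n) \<omega> \<le> t} \<omega> + (1 / c t + e) \<partial>M) + (\<integral>\<omega>. 1 - exp (- U \<omega>) \<partial>M)"
      using i iU by (intro Bochner_Integration.integral_add Bochner_Integration.integrable_add) auto
    also have "(\<integral>\<omega>. indicator {\<omega>\<in>space M. T (m * n) \<omega> \<le> t} \<omega> + (1 / c t + e) \<partial>M)
      = X.prob {\<omega>\<in>space M. T (m * n) \<omega> \<le> t} + (1 / c t + e)"
      using i by (subst Bochner_Integration.integral_add) (auto simp: X.prob_space)
    finally show ?thesis .
  qed
  finally show ?thesis using EU by linarith
qed

text \<open>The relative perturbation \<open>1 / (m + 2)\<close> vanishes in the limit of \<open>m\<close>, but for fixed \<open>m\<close> it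
  leaves room for the law of large numbers.\<close>

definition "n_low m t = nat \<lfloor>(1 - 1 / real (m + 2)) * (inverse \<mu> / real m) * t\<rfloor>" for m :: nat and t :: real
definition "n_up m t = nat \<lceil>(1 + 1 / real (m + 2)) * (inverse \<mu> / real m) * t\<rceil>" for m :: nat and t :: real

abbreviation "lower \<equiv> (\<lambda>p. W.grid_hull (fst p) (n_low (fst p) (snd p)) (snd p))"
abbreviation "upper \<equiv> (\<lambda>p. W.grid_hull (fst p) (n_up (fst p) (snd p)) (snd p))"

lemma n_low_ratio: "0 < m \<Longrightarrow> ((\<lambda>t. real (n_low m t) / t) \<longlongrightarrow> (1 - 1 / real (m + 2)) * (inverse \<mu> / real m)) at_top"
  unfolding n_low_def by (rule nat_floor_ratio) (use mu_pos in simp)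

lemma n_up_ratio: "0 < m \<Longrightarrow> ((\<lambda>t. real (n_up m t) / t) \<longlongrightarrow> (1 + 1 / real (m + 2)) * (inverse \<mu> / real m)) at_top"
  unfolding n_up_def by (rule nat_ceiling_ratio) (use mu_pos in \<open>simp add: add_pos_pos\<close>)

text \<open>For fixed \<open>m\<close> the blocks converge to independent increments of
  \<open>Y\<close> over time \<open>r / m\<close>, scaled by a power of \<open>\<sigma> m\<close>.
  As \<open>m\<close> grows, the hulls over the grid of \<open>Y\<close> tend to the hull of its
  path up to \<open>r\<close>, and the scaling tends to \<open>1\<close>. Both block lengths, low
  and up, are covered by the choice of \<open>\<sigma>\<close>.\<close>

lemma grid_limit:
  fixes k :: "nat \<Rightarrow> real \<Rightarrow> nat" and F :: "'a convex_body \<Rightarrow> real"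
  assumes \<sigma>: "\<sigma> \<longlonglongrightarrow> 1" "\<And>m. 0 < \<sigma> m"
    and k: "\<And>m. 0 < m \<Longrightarrow> ((\<lambda>t. real (k m t) / t) \<longlongrightarrow> \<sigma> m * (inverse \<mu> / real m)) at_top"
    and F: "\<And>K. \<bar>F K\<bar> \<le> B" "\<And>K K'. \<bar>F K - F K'\<bar> \<le> L * dist K K'" "0 \<le> L"
  shows "((\<lambda>p. \<integral>\<omega>. F (W.grid_hull (fst p) (k (fst p) (snd p)) (snd p) \<omega>) \<partial>M) \<longlongrightarrow> (\<integral>\<omega>. F (limit_hull \<omega>) \<partial>M')) iter_filter"
proof -
  define r where "r = inverse \<mu>"
  have r: "0 < r" using mu_pos by (simp add: r_def)
  define p where "p = 1 / \<alpha>"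
  define D where "D m j \<omega> = Y (real (Suc j) * (r / real m)) \<omega> - Y (real j * (r / real m)) \<omega>" for m j \<omega>
  \<comment> \<open>By stability, perturbing the time step by the factor \<open>\<sigma> m\<close>
    has in law the effect of scaling the increment by \<open>\<sigma> m powr p\<close>. The grid of
    \<open>Y\<close> can thus stay on \<open>{0..r}\<close>, and the perturbation becomes a scaling
    of the body.\<close>
  define \<zeta> where "\<zeta> m j \<omega> = (\<sigma> m powr p) *\<^sub>R D m j \<omega>" for m j \<omega>
  note Fc = lipschitz_body_measurable[OF F(2)]
  have mD[measurable]: "D m j \<in> borel_measurable M'" for m j
    unfolding D_def[abs_def] using r by (intro borel_measurable_diff Y.measurable_X) auto
  have m\<zeta>[measurable]: "\<zeta> m j \<in> borel_measurable M'" for m j unfolding \<zeta>_def[abs_def] by measurable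
  show ?thesis
  proof (rule iter_filter_tendstoI[where a = "\<lambda>m t. \<integral>\<omega>. F (W.grid_hull m (k m t) t \<omega>) \<partial>M"
        and b = "\<lambda>m. \<integral>\<omega>. F (walk_hull m (\<lambda>j. \<zeta> m j \<omega>)) \<partial>M'"])
    show "\<forall>\<^sub>F m in sequentially. ((\<lambda>t. \<integral>\<omega>. F (W.grid_hull m (k m t) t \<omega>) \<partial>M) \<longlongrightarrow>
        (\<integral>\<omega>. F (walk_hull m (\<lambda>j. \<zeta> m j \<omega>)) \<partial>M')) at_top"
      using eventually_gt_at_top[of 0]
    proof eventually_elim
      case (elim m)
      have rm: "0 < r / real m" using r elim by simp
      have \<rho>: "0 < \<sigma> m * (inverse \<mu> / real m)" using mult_pos_pos[OF \<sigma>(2) rm] unfolding r_def by simp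
      have inc: "incseq (\<lambda>j. real j * (r / real m))"
        unfolding incseq_def by (intro allI impI mult_right_mono) (use rm in auto)
      have "Y.indep_vars (\<lambda>_. borel) (D m) {..<m}"
        unfolding D_def[abs_def] by (rule Y.independent_increments[OF _ inc]) simp
      then have ind: "Y.indep_vars (\<lambda>_. borel) (\<zeta> m) {..<m}"
        unfolding \<zeta>_def[abs_def] by (rule Y.indep_vars_compose2) simp
      show ?case
      proof (rule W.grid_hull_convergence[OF k[OF elim] \<rho> Y.prob_space_axioms ind m\<zeta> _ F])
        fix j assume "j < m"
        have [measurable]: "Y (r / real m) \<in> borel_measurable M'" using rm by (intro Y.measurable_X) simp
        have [measurable]: "\<eta> \<in> borel_measurable N" by (rule W.\<eta>)
        have nn: "0 \<le> real j * (r / real m)" using rm by (intro mult_nonneg_nonneg) linarith+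
        have e: "real (Suc j) * (r / real m) = real j * (r / real m) + r / real m" by (simp add: add_divide_distrib distrib_right)
        have "distr M' borel (D m j) = distr M' borel (Y (r / real m))"
          unfolding D_def[abs_def] e using rm nn by (intro Y.stationary_increments) (assumption | linarith)+
        also have "\<dots> = distr N borel (\<lambda>v. (r / real m) powr p *\<^sub>R \<eta> v)"
          unfolding p_def using rm by (intro levy_strictly_stable_marginal[OF Y.levy_process_axioms stable law_Y])
        finally have "distr (distr M' borel (D m j)) borel ((*\<^sub>R) (\<sigma> m powr p))
          = distr (distr N borel (\<lambda>v. (r / real m) powr p *\<^sub>R \<eta> v)) borel ((*\<^sub>R) (\<sigma> m powr p))" by simp
        then have "distr M' borel (\<zeta> m j) = distr N borel (\<lambda>v. (\<sigma> m powr p * (r / real m) powr p) *\<^sub>R \<eta> v)"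
          by (simp add: distr_distr comp_def \<zeta>_def[abs_def])
        then show "distr M' borel (\<zeta> m j) = distr N borel (\<lambda>v. (\<sigma> m * (inverse \<mu> / real m)) powr (1 / \<alpha>) *\<^sub>R \<eta> v)"
          unfolding p_def r_def by (simp only: powr_mult)
      qed
    qed
    have lim: "(\<lambda>m. walk_hull m (\<lambda>j. \<zeta> m j \<omega>)) \<longlonglongrightarrow> limit_hull \<omega>" if \<omega>: "\<omega> \<in> space M'" for \<omega>
    proof -
      have "(\<lambda>m. walk_hull m (\<lambda>j. D m j \<omega>)) \<longlonglongrightarrow> limit_hull \<omega>"
        unfolding D_def limit_hull_def path_hull_def r_def[symmetric]
        using r Y.cadlag_paths[OF \<omega>] Y.start_origin[OF \<omega>] by (intro walk_hull_grid_tendsto[of "\<lambda>s. Y s \<omega>"]) auto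
      moreover have "(\<lambda>m. \<sigma> m powr p) \<longlonglongrightarrow> 1 powr p" using \<sigma>(1) by (intro tendsto_powr tendsto_const) auto
      ultimately have "(\<lambda>m. scale_body (\<sigma> m powr p) (walk_hull m (\<lambda>j. D m j \<omega>))) \<longlonglongrightarrow> limit_hull \<omega>"
        by (intro scale_body_tendsto) simp_all
      then show ?thesis unfolding scale_body_walk_hull \<zeta>_def .
    qed
    show "(\<lambda>m. \<integral>\<omega>. F (walk_hull m (\<lambda>j. \<zeta> m j \<omega>)) \<partial>M') \<longlonglongrightarrow> (\<integral>\<omega>. F (limit_hull \<omega>) \<partial>M')"
    proof (rule integral_dominated_convergence[where w = "\<lambda>_. B"])
      show "(\<lambda>\<omega>. F (limit_hull \<omega>)) \<in> borel_measurable M'"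
        by (rule measurable_compose[OF measurable_limit_hull Fc(2)])
      show "(\<lambda>\<omega>. F (walk_hull m (\<lambda>j. \<zeta> m j \<omega>))) \<in> borel_measurable M'" for m
        by (rule measurable_compose[OF measurable_walk_hull Fc(2)]) (rule m\<zeta>)
      show "AE \<omega> in M'. (\<lambda>m. F (walk_hull m (\<lambda>j. \<zeta> m j \<omega>))) \<longlonglongrightarrow> F (limit_hull \<omega>)"
      proof (rule AE_I2)
        fix \<omega> assume "\<omega> \<in> space M'"
        have "isCont F (limit_hull \<omega>)" using Fc(1) continuous_on_eq_continuous_at[OF open_UNIV, of F] by blast
        then show "(\<lambda>m. F (walk_hull m (\<lambda>j. \<zeta> m j \<omega>))) \<longlonglongrightarrow> F (limit_hull \<omega>)"
          by (rule isCont_tendsto_compose[OF _ lim[OF \<open>\<omega> \<in> space M'\<close>]])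
      qed
    qed (use F(1) in auto)
  qed
qed

lemma perturbation_tendsto: "(\<lambda>m. 1 - 1 / real (m + 2)) \<longlonglongrightarrow> 1" "(\<lambda>m. 1 + 1 / real (m + 2)) \<longlonglongrightarrow> 1"
proof -
  have z: "(\<lambda>m. 1 / real (m + 2)) \<longlonglongrightarrow> 0" by (rule LIMSEQ_ignore_initial_segment[OF lim_1_over_n])
  from tendsto_diff[OF tendsto_const z, of 1] tendsto_add[OF tendsto_const z, of 1]
  show "(\<lambda>m. 1 - 1 / real (m + 2)) \<longlonglongrightarrow> 1" "(\<lambda>m. 1 + 1 / real (m + 2)) \<longlonglongrightarrow> 1" by simp_all
qed

lemma lower_limit:
  assumes "\<And>K. \<bar>F K\<bar> \<le> B" "\<And>K K'. \<bar>F K - F K'\<bar> \<le> L * dist K K'" "0 \<le> L"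
  shows "((\<lambda>p. \<integral>\<omega>. F (lower p \<omega>) \<partial>M) \<longlongrightarrow> (\<integral>\<omega>. F (limit_hull \<omega>) \<partial>M')) iter_filter"
  by (rule grid_limit[OF perturbation_tendsto(1) _ n_low_ratio assms]) simp_all

lemma upper_limit:
  assumes "\<And>K. \<bar>F K\<bar> \<le> B" "\<And>K K'. \<bar>F K - F K'\<bar> \<le> L * dist K K'" "0 \<le> L"
  shows "((\<lambda>p. \<integral>\<omega>. F (upper p \<omega>) \<partial>M) \<longlongrightarrow> (\<integral>\<omega>. F (limit_hull \<omega>) \<partial>M')) iter_filter"
  by (rule grid_limit[OF perturbation_tendsto(2) _ n_up_ratio assms]) (simp_all add: add_pos_pos)

end

lemma (in prob_space) cutoff_integral_tendsto:
  fixes \<zeta> :: "'a \<Rightarrow> 'b::euclidean_space"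
  assumes [measurable]: "\<zeta> \<in> borel_measurable M"
  shows "(\<lambda>n. \<integral>\<omega>. cutoff (real n) (\<zeta> \<omega>) \<partial>M) \<longlonglongrightarrow> 0"
proof -
  have "(\<lambda>n. \<integral>\<omega>. cutoff (real n) (\<zeta> \<omega>) \<partial>M) \<longlonglongrightarrow> (\<integral>\<omega>. 0 \<partial>M)"
    by (rule integral_dominated_convergence[where w = "\<lambda>_. 1"]) (auto simp: cutoff_tendsto cutoff_bounds)
  then show ?thesis by simp
qed

lemma cutoff_support_lipschitz:
  assumes "norm u = 1"
  shows "\<bar>cutoff R (support_fun u K) - cutoff R (support_fun u K')\<bar> \<le> 1 * dist K K'"
proof -
  have "\<bar>cutoff R (a::real) - cutoff R b\<bar> \<le> \<bar>a - b\<bar>" for a b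
    by (auto simp: cutoff_def min_def max_def abs_if)
  from order_trans[OF this[of "support_fun u K" "support_fun u K'"] support_fun_lipschitz] assms show ?thesis by simp
qed

text \<open>A quantitative form of strict monotonicity: below the level \<open>R\<close>, a gap
  larger than \<open>\<theta>\<close> costs an amount that does not depend on \<open>a\<close> and
  \<open>b\<close>.\<close>

lemma one_minus_exp_increment:
  fixes a b R \<theta> :: real
  assumes "a \<le> R" "\<theta> < b - a" "0 < \<theta>"
  shows "exp (- R) * (1 - exp (- \<theta>)) \<le> exp (- a) - exp (- b)"
proof -
  have "exp (- R) * (1 - exp (- \<theta>)) \<le> exp (- a) * (1 - exp (- (b - a)))"
    using assms by (intro mult_mono) auto
  also have "\<dots> = exp (- a) - exp (- b)" by (simp add: right_diff_distrib exp_add[symmetric])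
  finally show ?thesis .
qed

section \<open>Closing the gap between the lower hull and the path hull\<close>

context hull_limit
begin

abbreviation "bad_low p \<equiv> {\<omega>\<in>space M. snd p < T (fst p * n_low (fst p) (snd p)) \<omega>}"
abbreviation "bad_up p \<equiv> {\<omega>\<in>space M. T (fst p * n_up (fst p) (snd p)) \<omega> \<le> snd p}"

lemma mult_at_top:
  fixes k :: "real \<Rightarrow> nat"
  assumes "0 < m" "filterlim k at_top at_top"
  shows "filterlim (\<lambda>t. m * k t) at_top at_top"
  by (rule filterlim_at_top_mono[OF assms(2)]) (use assms(1) in auto)

text \<open>At most \<open>(1 - \<kappa>) * t / \<mu>\<close> renewals are involved. As
  \<open>(1 - \<kappa>) * (1 + \<kappa>) \<le> 1\<close>, they last longer than \<open>t\<close>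
  only if their total duration exceeds its mean by the relative amount \<open>\<kappa>\<close>,
  which the law of large numbers excludes in the limit.\<close>

lemma bad_low_tendsto: "((\<lambda>p. X.prob (bad_low p)) \<longlongrightarrow> 0) iter_filter"
proof (rule iter_filter_tendstoI[where a = "\<lambda>m t. X.prob {\<omega>\<in>space M. t < T (m * n_low m t) \<omega>}", OF _ tendsto_const])
  show "\<forall>\<^sub>F m in sequentially. ((\<lambda>t. X.prob {\<omega>\<in>space M. t < T (m * n_low m t) \<omega>}) \<longlongrightarrow> 0) at_top"
    using eventually_gt_at_top[of 0]
  proof eventually_elim
    case (elim m)
    define \<kappa> where "\<kappa> = 1 / real (m + 2)"
    have \<kappa>: "0 < \<kappa>" "\<kappa> < 1" by (simp_all add: \<kappa>_def)
    have e: "0 < \<mu> * \<kappa>" using mu_pos \<kappa> by simp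
    have top: "filterlim (\<lambda>t. m * n_low m t) at_top at_top"
      using elim mu_pos \<kappa> by (intro mult_at_top W.real_nat_at_top[OF n_low_ratio]) (auto simp: \<kappa>_def)
    note lln = filterlim_compose[OF X.renewal_time_law_of_large_numbers[OF nontrivial e] top]
    show ?case
    proof (rule tendsto_sandwich[OF _ _ tendsto_const lln])
      show "\<forall>\<^sub>F t in at_top. X.prob {\<omega>\<in>space M. t < T (m * n_low m t) \<omega>} \<le>
        X.prob {\<omega>\<in>space M. real (m * n_low m t) * (\<mu> * \<kappa>) \<le> \<bar>T (m * n_low m t) \<omega> - real (m * n_low m t) * \<mu>\<bar>}"
        using eventually_gt_at_top[of 0]
      proof eventually_elim
        case (elim t)
        define n where "n = m * n_low m t"
        have "0 \<le> (1 - \<kappa>) * (inverse \<mu> / real m) * t" using \<kappa> mu_pos elim by simp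
        then have "real (n_low m t) \<le> (1 - \<kappa>) * (inverse \<mu> / real m) * t"
          unfolding n_low_def \<kappa>_def by linarith
        then have "real m * real (n_low m t) \<le> real m * ((1 - \<kappa>) * (inverse \<mu> / real m) * t)"
          by (rule mult_left_mono) simp
        also have "\<dots> = (1 - \<kappa>) * t / \<mu>" using \<open>0 < m\<close> by (simp add: divide_inverse mult_ac)
        finally have "real n * \<mu> \<le> (1 - \<kappa>) * t" using mu_pos by (simp add: n_def field_simps)
        then have "real n * \<mu> * (1 + \<kappa>) \<le> (1 - \<kappa>) * t * (1 + \<kappa>)" using \<kappa> by (intro mult_right_mono) auto
        also have "\<dots> = t - \<kappa>\<^sup>2 * t" by (simp add: algebra_simps power2_eq_square)
        also have "\<dots> \<le> t" using elim by simp
        finally have nt: "real n * \<mu> + real n * (\<mu> * \<kappa>) \<le> t" by (simp add: algebra_simps)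
        show ?case
          unfolding n_def[symmetric]
        proof (rule X.finite_measure_mono)
          show "{\<omega>\<in>space M. t < T n \<omega>} \<subseteq> {\<omega>\<in>space M. real n * (\<mu> * \<kappa>) \<le> \<bar>T n \<omega> - real n * \<mu>\<bar>}"
            using nt by auto
        qed measurable
      qed
    qed simp
  qed
qed

lemma bad_up_tendsto: "((\<lambda>p. X.prob (bad_up p)) \<longlongrightarrow> 0) iter_filter"
proof (rule iter_filter_tendstoI[where a = "\<lambda>m t. X.prob {\<omega>\<in>space M. T (m * n_up m t) \<omega> \<le> t}", OF _ tendsto_const])
  show "\<forall>\<^sub>F m in sequentially. ((\<lambda>t. X.prob {\<omega>\<in>space M. T (m * n_up m t) \<omega> \<le> t}) \<longlongrightarrow> 0) at_top"
    using eventually_gt_at_top[of 0]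
  proof eventually_elim
    case (elim m)
    define \<kappa> where "\<kappa> = 1 / real (m + 2)"
    have \<kappa>: "0 < \<kappa>" by (simp add: \<kappa>_def)
    \<comment> \<open>Chosen so that \<open>real n * \<mu> / (1 + \<kappa>)\<close>, which is at
      least \<open>t\<close>, equals \<open>real n * \<mu> - real n * e\<close>.\<close>
    define e where "e = \<mu> - \<mu> / (1 + \<kappa>)"
    have e: "0 < e" using mu_pos \<kappa> by (simp add: e_def field_simps)
    have top: "filterlim (\<lambda>t. m * n_up m t) at_top at_top"
      using elim mu_pos by (intro mult_at_top W.real_nat_at_top[OF n_up_ratio]) (auto simp: add_pos_pos)
    note lln = filterlim_compose[OF X.renewal_time_law_of_large_numbers[OF nontrivial e] top]
    show ?case
    proof (rule tendsto_sandwich[OF _ _ tendsto_const lln])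
      show "\<forall>\<^sub>F t in at_top. X.prob {\<omega>\<in>space M. T (m * n_up m t) \<omega> \<le> t} \<le>
        X.prob {\<omega>\<in>space M. real (m * n_up m t) * e \<le> \<bar>T (m * n_up m t) \<omega> - real (m * n_up m t) * \<mu>\<bar>}"
        using eventually_gt_at_top[of 0]
      proof eventually_elim
        case (elim t)
        define n where "n = m * n_up m t"
        have "(1 + \<kappa>) * (inverse \<mu> / real m) * t \<le> real (n_up m t)"
          unfolding n_up_def \<kappa>_def by linarith
        then have "real m * ((1 + \<kappa>) * (inverse \<mu> / real m) * t) \<le> real m * real (n_up m t)"
          by (rule mult_left_mono) simp
        moreover have "real m * ((1 + \<kappa>) * (inverse \<mu> / real m) * t) = (1 + \<kappa>) * t / \<mu>"
          using \<open>0 < m\<close> by (simp add: divide_inverse mult_ac)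
        ultimately have "(1 + \<kappa>) * t / \<mu> \<le> real n" by (simp only: n_def of_nat_mult)
        then have "(1 + \<kappa>) * t \<le> real n * \<mu>" using mu_pos by (simp only: pos_divide_le_eq)
        then have "t \<le> real n * \<mu> / (1 + \<kappa>)" using \<kappa> by (simp add: field_simps)
        then have nt: "t \<le> real n * \<mu> - real n * e" by (simp add: e_def right_diff_distrib)
        show ?case
          unfolding n_def[symmetric]
        proof (rule X.finite_measure_mono)
          show "{\<omega>\<in>space M. T n \<omega> \<le> t} \<subseteq> {\<omega>\<in>space M. real n * e \<le> \<bar>T n \<omega> - real n * \<mu>\<bar>}"
            using nt by auto
        qed measurable
      qed
    qed simp
  qed
qed

text \<open>The upper half of the comparison, in expectation only: each of the error terms of
  \<open>expectation_exp_support_upper\<close> and the distance of the upper hull from its limit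
  gets \<open>\<epsilon> / 8\<close>.\<close>

lemma exp_support_hull_le:
  assumes u: "norm u = 1" and "0 < \<epsilon>"
  shows "\<forall>\<^sub>F p in iter_filter. (\<integral>\<omega>. exp_support u (scaled_hull (snd p) \<omega>) \<partial>M) \<le> (\<integral>\<omega>. exp_support u (limit_hull \<omega>) \<partial>M') + \<epsilon>"
proof -
  define e where "e = min (\<epsilon> / 8) 1"
  have e: "0 < e" "e \<le> \<epsilon> / 8" "e \<le> 1" using \<open>0 < \<epsilon>\<close> by (auto simp: e_def)
  \<comment> \<open>With \<open>a = t / (\<mu> * m)\<close>, the block length is at most
    \<open>2 * a\<close> rounded up, hence at most \<open>4 * a\<close> once
    \<open>2 * a > 1\<close>.\<close>
  define A where "A = 4 * inverse \<mu>"
  have A: "0 < A" using mu_pos by (simp add: A_def)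
  have 1: "\<forall>\<^sub>F p in iter_filter. X.prob (bad_up p) < \<epsilon> / 8"
    using bad_up_tendsto \<open>0 < \<epsilon>\<close> by (intro order_tendstoD) auto
  have 2: "\<forall>\<^sub>F p in iter_filter. 8 / \<epsilon> < c (snd p)"
    using W.norming_at_top by (intro eventually_iter_filter_snd) (simp add: filterlim_at_top_dense)
  have 3: "\<forall>\<^sub>F p in iter_filter. \<forall>i. real i \<le> A * snd p / real (fst p) \<longrightarrow>
      X.prob {\<omega>\<in>space M. e * c (snd p) < norm (W.S i \<omega>)} \<le> e"
    using W.small_blocks[OF e(1) e(1) A] unfolding eventually_iter_filter by simp
  have 4: "\<forall>\<^sub>F p in iter_filter. 0 < n_up (fst p) (snd p) \<and> real (n_up (fst p) (snd p)) \<le> A * snd p / real (fst p)"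
    unfolding eventually_iter_filter fst_conv snd_conv
    using eventually_gt_at_top[of 0]
  proof eventually_elim
    case (elim m)
    have r: "0 < inverse \<mu> / real m" using mu_pos elim by simp
    show ?case
      using eventually_gt_at_top[of "1 / (2 * (inverse \<mu> / real m))"] eventually_gt_at_top[of 0]
    proof eventually_elim
      case (elim t)
      define a where "a = (inverse \<mu> / real m) * t"
      have a: "0 < a" "1 < 2 * a" using elim r unfolding a_def by (auto simp: field_simps)
      have "1 / real (m + 2) \<le> 1" by simp
      then have "(1 + 1 / real (m + 2)) * a \<le> 2 * a" using a(1) by (intro mult_right_mono) auto
      moreover have "0 < (1 + 1 / real (m + 2)) * a" using a(1) by (simp add: add_pos_pos)
      moreover have "n_up m t = nat \<lceil>(1 + 1 / real (m + 2)) * a\<rceil>" by (simp add: n_up_def a_def mult.assoc)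
      moreover have "A * t / real m = 4 * a" by (simp add: A_def a_def)
      ultimately show ?case using a(2) by (auto, linarith+)
    qed
  qed
  have "((\<lambda>p. \<integral>\<omega>. exp_support u (upper p \<omega>) \<partial>M) \<longlongrightarrow> (\<integral>\<omega>. exp_support u (limit_hull \<omega>) \<partial>M')) iter_filter"
    by (rule upper_limit[OF exp_support_bounds(3) exp_support_lipschitz[OF u]]) simp
  then have 5: "\<forall>\<^sub>F p in iter_filter. (\<integral>\<omega>. exp_support u (upper p \<omega>) \<partial>M) < (\<integral>\<omega>. exp_support u (limit_hull \<omega>) \<partial>M') + \<epsilon> / 8"
    using \<open>0 < \<epsilon>\<close> by (intro order_tendstoD(2)) auto
  have 6: "\<forall>\<^sub>F p in iter_filter. 0 \<le> snd p"
    by (rule eventually_iter_filter_snd) (rule eventually_ge_at_top)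
  show ?thesis
    using 1 2 3 4 5 6
  proof eventually_elim
    case (elim p)
    have cp: "0 < c (snd p)" using elim(2) \<open>0 < \<epsilon>\<close> by (meson divide_pos_pos order_less_trans zero_less_numeral)
    have "1 / c (snd p) < \<epsilon> / 8" using elim(2) cp \<open>0 < \<epsilon>\<close> by (simp add: field_simps)
    moreover have "(\<integral>\<omega>. exp_support u (scaled_hull (snd p) \<omega>) \<partial>M) \<le>
      X.prob (bad_up p) + 1 / c (snd p) + e + e + (\<integral>\<omega>. exp_support u (upper p \<omega>) \<partial>M)"
    proof (rule expectation_exp_support_upper[OF u elim(6) cp _ e(1) _ e(3)])
      fix i assume "i \<le> n_up (fst p) (snd p)"
      then have "real i \<le> A * snd p / real (fst p)" using elim(4) by linarith
      then show "X.prob {\<omega>\<in>space M. e * c (snd p) < norm (W.S i \<omega>)} \<le> e" using elim(3) by blast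
    qed (use elim(4) e in auto)
    ultimately show ?case using elim(1,5) e by linarith
  qed
qed

text \<open>Off \<open>bad_low\<close> the lower hull is contained in the path hull, so the two
  values of \<open>exp_support\<close> are ordered; their expectations have asymptotically the same
  limit. A gap above \<open>\<theta>\<close> at a moderate level forces a difference of at least
  \<open>\<gamma>\<close>, so Markov's inequality bounds its probability.\<close>

lemma support_gap_tendsto:
  assumes u: "norm u = 1" and \<theta>: "0 < \<theta>"
  shows "((\<lambda>p. X.prob {\<omega>\<in>space M. \<theta> < support_fun u (scaled_hull (snd p) \<omega>) - support_fun u (lower p \<omega>)}) \<longlongrightarrow> 0) iter_filter"
proof (rule order_tendstoI)
  fix a :: real assume "a < 0"
  then show "\<forall>\<^sub>F p in iter_filter. a < X.prob {\<omega>\<in>space M. \<theta> < support_fun u (scaled_hull (snd p) \<omega>) - support_fun u (lower p \<omega>)}"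
    by (intro always_eventually allI) (auto intro: less_le_trans)
next
  fix \<epsilon> :: real assume "0 < \<epsilon>"
  have mlim: "(\<lambda>\<omega>. support_fun u (limit_hull \<omega>)) \<in> borel_measurable M'" by measurable
  have "\<forall>\<^sub>F n in sequentially. (\<integral>\<omega>. cutoff (real n) (support_fun u (limit_hull \<omega>)) \<partial>M') < \<epsilon> / 8"
    using Y.cutoff_integral_tendsto[OF mlim] \<open>0 < \<epsilon>\<close> by (intro order_tendstoD) auto
  then obtain n where n: "(\<integral>\<omega>. cutoff (real n) (support_fun u (limit_hull \<omega>)) \<partial>M') < \<epsilon> / 8"
    using eventually_happens'[OF sequentially_bot] by blast
  \<comment> \<open>The cost of a gap above \<open>\<theta>\<close> when the smaller support value
    is at most \<open>real n + 1\<close>, by \<open>one_minus_exp_increment\<close>.\<close>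
  define \<gamma> where "\<gamma> = exp (- (real n + 1)) * (1 - exp (- \<theta>))"
  have \<gamma>: "0 < \<gamma>" "\<gamma> \<le> 1" using \<theta> unfolding \<gamma>_def by (auto intro!: mult_pos_pos mult_le_one)
  \<comment> \<open>Three errors of size \<open>s\<close> enter the bound on
    \<open>\<gamma> * X.prob G\<close>; dividing by \<open>\<gamma>\<close> leaves
    \<open>3 * (\<epsilon> / 8)\<close>.\<close>
  define s where "s = \<gamma> * (\<epsilon> / 8)"
  have s: "0 < s" using \<gamma> \<open>0 < \<epsilon>\<close> by (simp add: s_def)
  have s_le: "s \<le> \<epsilon> / 8" unfolding s_def using \<gamma> \<open>0 < \<epsilon>\<close> mult_right_mono[of \<gamma> 1 "\<epsilon> / 8"] by simp
  have 1: "\<forall>\<^sub>F p in iter_filter. X.prob (bad_low p) < s"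
    using bad_low_tendsto s by (intro order_tendstoD) auto
  have 2: "\<forall>\<^sub>F p in iter_filter. (\<integral>\<omega>. exp_support u (scaled_hull (snd p) \<omega>) \<partial>M) \<le> (\<integral>\<omega>. exp_support u (limit_hull \<omega>) \<partial>M') + s"
    by (rule exp_support_hull_le[OF u s])
  have "((\<lambda>p. \<integral>\<omega>. exp_support u (lower p \<omega>) \<partial>M) \<longlongrightarrow> (\<integral>\<omega>. exp_support u (limit_hull \<omega>) \<partial>M')) iter_filter"
    by (rule lower_limit[OF exp_support_bounds(3) exp_support_lipschitz[OF u]]) simp
  then have 3: "\<forall>\<^sub>F p in iter_filter. (\<integral>\<omega>. exp_support u (limit_hull \<omega>) \<partial>M') - s < (\<integral>\<omega>. exp_support u (lower p \<omega>) \<partial>M)"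
    using s by (intro order_tendstoD(1)) auto
  have "((\<lambda>p. \<integral>\<omega>. cutoff (real n) (support_fun u (lower p \<omega>)) \<partial>M) \<longlongrightarrow> (\<integral>\<omega>. cutoff (real n) (support_fun u (limit_hull \<omega>)) \<partial>M')) iter_filter"
    by (rule lower_limit[where F = "\<lambda>K. cutoff (real n) (support_fun u K)" and B = 1, OF _ cutoff_support_lipschitz[OF u]])
       (simp_all add: cutoff_bounds)
  then have 4: "\<forall>\<^sub>F p in iter_filter. (\<integral>\<omega>. cutoff (real n) (support_fun u (lower p \<omega>)) \<partial>M) < \<epsilon> / 8"
    using n by (rule order_tendstoD(2))
  have 5: "\<forall>\<^sub>F p in iter_filter. 0 \<le> snd p"
    by (rule eventually_iter_filter_snd) (rule eventually_ge_at_top)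
  show "\<forall>\<^sub>F p in iter_filter. X.prob {\<omega>\<in>space M. \<theta> < support_fun u (scaled_hull (snd p) \<omega>) - support_fun u (lower p \<omega>)} < \<epsilon>"
    using 1 2 3 4 5
  proof eventually_elim
    case (elim p)
    have mh[measurable]: "scaled_hull (snd p) \<in> borel_measurable M" using elim(5) by (rule measurable_hull)
    define a where "a \<omega> = support_fun u (lower p \<omega>)" for \<omega>
    define b where "b \<omega> = support_fun u (scaled_hull (snd p) \<omega>)" for \<omega>
    have [measurable]: "a \<in> borel_measurable M" "b \<in> borel_measurable M"
      unfolding a_def[abs_def] b_def[abs_def] by measurable
    define G where "G = {\<omega>\<in>space M. \<theta> < b \<omega> - a \<omega> \<and> a \<omega> \<le> real n + 1 \<and> \<not> snd p < T (fst p * n_low (fst p) (snd p)) \<omega>}"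
    have [measurable]: "G \<in> sets M" "bad_low p \<in> sets M" unfolding G_def by measurable
    define Tl where "Tl = {\<omega>\<in>space M. real n + 1 < norm (a \<omega>)}"
    have [measurable]: "Tl \<in> sets M" unfolding Tl_def by measurable
    have "\<gamma> * X.prob G \<le> (\<integral>\<omega>. exp_support u (scaled_hull (snd p) \<omega>) \<partial>M) - (\<integral>\<omega>. exp_support u (lower p \<omega>) \<partial>M) + X.prob (bad_low p)"
    proof -
      have i1: "integrable M (\<lambda>\<omega>. exp_support u (scaled_hull (snd p) \<omega>))" "integrable M (\<lambda>\<omega>. exp_support u (lower p \<omega>))"
        by (rule X.integrable_const_bound[where B = 1]; auto simp: exp_support_bounds)+
      have i2: "integrable M (indicator G :: _ \<Rightarrow> real)" "integrable M (indicator (bad_low p) :: _ \<Rightarrow> real)"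
        by (simp_all add: X.emeasure_eq_measure)
      have "\<gamma> * X.prob G = (\<integral>\<omega>. \<gamma> * indicator G \<omega> \<partial>M)" by simp
      also have "\<dots> \<le> (\<integral>\<omega>. (exp_support u (scaled_hull (snd p) \<omega>) - exp_support u (lower p \<omega>)) + indicator (bad_low p) \<omega> \<partial>M)"
      proof (rule integral_mono)
        show "integrable M (\<lambda>\<omega>. \<gamma> * indicator G \<omega>)" using i2(1) by (rule integrable_mult_right)
        show "integrable M (\<lambda>\<omega>. (exp_support u (scaled_hull (snd p) \<omega>) - exp_support u (lower p \<omega>)) + indicator (bad_low p) \<omega>)"
          using i1 i2(2) by (intro Bochner_Integration.integrable_add Bochner_Integration.integrable_diff)
        fix \<omega> assume \<omega>: "\<omega> \<in> space M"
        show "\<gamma> * indicator G \<omega> \<le> (exp_support u (scaled_hull (snd p) \<omega>) - exp_support u (lower p \<omega>)) + indicator (bad_low p) \<omega>"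
        proof (cases "\<omega> \<in> bad_low p")
          case True
          then have "\<omega> \<notin> G" by (simp add: G_def)
          moreover have "indicator (bad_low p) \<omega> = (1::real)" using True by simp
          ultimately show ?thesis
            using exp_support_bounds[of u "scaled_hull (snd p) \<omega>"] exp_support_bounds[of u "lower p \<omega>"] by simp
        next
          case False
          have "body_set (lower p \<omega>) \<subseteq> body_set (scaled_hull (snd p) \<omega>)"
            using False \<omega> elim(5) by (intro grid_hull_subset) auto
          then have ab: "a \<omega> \<le> b \<omega>" unfolding a_def b_def by (rule support_fun_mono)
          have a0: "0 \<le> a \<omega>" unfolding a_def by (rule support_fun_nonneg[OF zero_in_grid_hull])
          have ex: "exp_support u (scaled_hull (snd p) \<omega>) - exp_support u (lower p \<omega>) = exp (- a \<omega>) - exp (- b \<omega>)"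
            using a0 ab unfolding exp_support_def a_def[symmetric] b_def[symmetric] by simp
          show ?thesis
          proof (cases "\<omega> \<in> G")
            case True
            then have "\<gamma> \<le> exp (- a \<omega>) - exp (- b \<omega>)"
              unfolding \<gamma>_def using \<theta> by (intro one_minus_exp_increment) (auto simp: G_def)
            then show ?thesis unfolding ex using True False by simp
          next
            assume "\<omega> \<notin> G"
            then show ?thesis unfolding ex using ab False by simp
          qed
        qed
      qed
      also have "\<dots> = (\<integral>\<omega>. exp_support u (scaled_hull (snd p) \<omega>) \<partial>M) - (\<integral>\<omega>. exp_support u (lower p \<omega>) \<partial>M) + X.prob (bad_low p)"
        using i1 i2(2) by (simp add: Bochner_Integration.integral_add Bochner_Integration.integral_diff)
      finally show ?thesis .
    qed
    also have "\<dots> < \<gamma> * (3 * (\<epsilon> / 8))" using elim(1,2,3) unfolding s_def by (simp add: algebra_simps)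
    finally have G3: "X.prob G < 3 * (\<epsilon> / 8)" using \<gamma>(1) by simp
    have "X.prob {\<omega>\<in>space M. \<theta> < b \<omega> - a \<omega>} \<le> X.prob ((G \<union> bad_low p) \<union> Tl)"
      by (rule X.finite_measure_mono) (auto simp: G_def Tl_def)
    also have "\<dots> \<le> X.prob (G \<union> bad_low p) + X.prob Tl" by (rule measure_Un_le) measurable
    also have "\<dots> \<le> X.prob G + X.prob (bad_low p) + X.prob Tl" by (intro add_right_mono measure_Un_le) measurable
    also have "X.prob Tl < \<epsilon> / 8"
      using X.prob_norm_gt_le_cutoff[of a "real n"] elim(4) unfolding Tl_def a_def by simp
    finally have "X.prob {\<omega>\<in>space M. \<theta> < b \<omega> - a \<omega>} < X.prob G + X.prob (bad_low p) + \<epsilon> / 8" by simp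
    then show ?case using G3 elim(1) s_le \<open>0 < \<epsilon>\<close> unfolding a_def b_def by linarith
  qed
qed

text \<open>The path hull is replaced by the lower hull, whose limit is known. Small support gaps on
  a finite net give a small Hausdorff distance once the path hull is bounded, and its bound comes
  from that of the lower hull in the signed basis directions plus the gap.\<close>

lemma lipschitz_hull_tendsto:
  fixes f :: "'a convex_body \<Rightarrow> real"
  assumes B: "\<And>K. \<bar>f K\<bar> \<le> B" and L: "\<And>K K'. \<bar>f K - f K'\<bar> \<le> L * dist K K'" and "0 \<le> L"
  shows "((\<lambda>p. \<integral>\<omega>. f (scaled_hull (snd p) \<omega>) \<partial>M) \<longlongrightarrow> (\<integral>\<omega>. f (limit_hull \<omega>) \<partial>M')) iter_filter"
proof (rule tendstoI)
  fix \<epsilon> :: real assume "0 < \<epsilon>"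
  have B0: "0 \<le> B" using B[of undefined] by linarith
  have [measurable]: "f \<in> borel_measurable borel" by (rule lipschitz_body_measurable(2)[OF L])
  \<comment> \<open>The Hausdorff distance will be at most \<open>2 * \<theta>\<close>, which
    changes \<open>f\<close> by at most \<open>\<epsilon> / 4\<close>.\<close>
  define \<theta> where "\<theta> = \<epsilon> / (8 * (L + 1))"
  have \<theta>: "0 < \<theta>" using \<open>0 < \<epsilon>\<close> \<open>0 \<le> L\<close> by (simp add: \<theta>_def)
  \<comment> \<open>The exceptional event will have probability at most \<open>2 * q\<close>, and
    \<open>f\<close> varies by at most \<open>2 * B\<close> on it, again
    \<open>\<epsilon> / 4\<close> in total.\<close>
  define q where "q = \<epsilon> / (16 * (B + 1))"
  have q: "0 < q" using \<open>0 < \<epsilon>\<close> B0 by (simp add: q_def)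
  define BB :: "'a set" where "BB = Basis \<union> uminus ` Basis"
  have BB: "finite BB" "\<And>b. b \<in> BB \<Longrightarrow> norm b = 1" by (auto simp: BB_def)
  have mlim: "(\<lambda>\<omega>. support_fun b (limit_hull \<omega>)) \<in> borel_measurable M'" for b by measurable
  have "(\<lambda>n. \<Sum>b\<in>BB. \<integral>\<omega>. cutoff (real n) (support_fun b (limit_hull \<omega>)) \<partial>M') \<longlonglongrightarrow> (\<Sum>b\<in>BB. 0)"
    by (intro tendsto_sum Y.cutoff_integral_tendsto mlim)
  then have "\<forall>\<^sub>F n in sequentially. (\<Sum>b\<in>BB. \<integral>\<omega>. cutoff (real n) (support_fun b (limit_hull \<omega>)) \<partial>M') < q"
    using q by (intro order_tendstoD) auto
  then obtain n where n: "(\<Sum>b\<in>BB. \<integral>\<omega>. cutoff (real n) (support_fun b (limit_hull \<omega>)) \<partial>M') < q"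
    using eventually_happens'[OF sequentially_bot] by blast
  \<comment> \<open>The norm bound of \<open>norm_le_support\<close> for a body whose support
    function is at most \<open>real n + 1 + \<theta>\<close> in all signed basis directions.\<close>
  define R where "R = real DIM('a) * (real n + 1 + \<theta>)"
  have R: "0 < R" using \<theta> by (simp add: R_def DIM_positive)
  \<comment> \<open>Makes the net error \<open>2 * \<delta> * R\<close> in
    \<open>dist_body_le_support\<close> equal to \<open>\<theta>\<close>. The net depends on
    \<open>R\<close>, and hence on the limit law only.\<close>
  define \<delta> where "\<delta> = \<theta> / (2 * R)"
  have \<delta>: "0 < \<delta>" using \<theta> R by (simp add: \<delta>_def)
  obtain D :: "'a set" where D: "finite D" "\<And>b. b \<in> Basis \<Longrightarrow> b \<in> D \<and> - b \<in> D"
    "\<And>u. u \<in> D \<Longrightarrow> norm u = 1" "\<And>v. norm v = 1 \<Longrightarrow> \<exists>u\<in>D. norm (v - u) \<le> \<delta>"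
    using finite_sphere_net[OF \<delta>] by metis
  have BBD: "BB \<subseteq> D" using D(2) by (auto simp: BB_def)
  let ?gap = "\<lambda>u p. {\<omega>\<in>space M. \<theta> < support_fun u (scaled_hull (snd p) \<omega>) - support_fun u (lower p \<omega>)}"
  have "((\<lambda>p. X.prob (bad_low p) + (\<Sum>u\<in>D. X.prob (?gap u p))) \<longlongrightarrow> 0 + (\<Sum>u\<in>D. 0)) iter_filter"
    by (intro tendsto_add tendsto_sum bad_low_tendsto support_gap_tendsto D(3) \<theta>)
  then have 1: "\<forall>\<^sub>F p in iter_filter. X.prob (bad_low p) + (\<Sum>u\<in>D. X.prob (?gap u p)) < q"
    using q by (intro order_tendstoD(2)) auto
  have "((\<lambda>p. \<Sum>b\<in>BB. \<integral>\<omega>. cutoff (real n) (support_fun b (lower p \<omega>)) \<partial>M) \<longlongrightarrow>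
     (\<Sum>b\<in>BB. \<integral>\<omega>. cutoff (real n) (support_fun b (limit_hull \<omega>)) \<partial>M')) iter_filter"
  proof (rule tendsto_sum)
    fix b assume "b \<in> BB"
    then show "((\<lambda>p. \<integral>\<omega>. cutoff (real n) (support_fun b (lower p \<omega>)) \<partial>M) \<longlongrightarrow> (\<integral>\<omega>. cutoff (real n) (support_fun b (limit_hull \<omega>)) \<partial>M')) iter_filter"
      by (intro lower_limit[where F = "\<lambda>K. cutoff (real n) (support_fun b K)" and B = 1, OF _ cutoff_support_lipschitz[OF BB(2)]])
         (simp_all add: cutoff_bounds)
  qed
  then have 2: "\<forall>\<^sub>F p in iter_filter. (\<Sum>b\<in>BB. \<integral>\<omega>. cutoff (real n) (support_fun b (lower p \<omega>)) \<partial>M) < q"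
    using n by (rule order_tendstoD(2))
  have 3: "\<forall>\<^sub>F p in iter_filter. dist (\<integral>\<omega>. f (lower p \<omega>) \<partial>M) (\<integral>\<omega>. f (limit_hull \<omega>) \<partial>M') < \<epsilon> / 2"
    using lower_limit[OF B L \<open>0 \<le> L\<close>] \<open>0 < \<epsilon>\<close> by (intro tendstoD) auto
  have 4: "\<forall>\<^sub>F p in iter_filter. 0 \<le> snd p"
    by (rule eventually_iter_filter_snd) (rule eventually_ge_at_top)
  show "\<forall>\<^sub>F p in iter_filter. dist (\<integral>\<omega>. f (scaled_hull (snd p) \<omega>) \<partial>M) (\<integral>\<omega>. f (limit_hull \<omega>) \<partial>M') < \<epsilon>"
    using 1 2 3 4
  proof eventually_elim
    case (elim p)
    have mh[measurable]: "scaled_hull (snd p) \<in> borel_measurable M" using elim(4) by (rule measurable_hull)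
    define Tl where "Tl b = {\<omega>\<in>space M. real n + 1 < norm (support_fun b (lower p \<omega>))}" for b
    have gap_ev: "?gap u p \<in> sets M" for u by measurable
    have Tl_ev: "Tl b \<in> sets M" for b unfolding Tl_def by measurable
    \<comment> \<open>The exceptional event: the renewals last too long, or the support functions
      differ by more than \<open>\<theta>\<close> in some net direction, or the lower hull is large
      in a signed basis direction.\<close>
    define E where "E = (bad_low p \<union> (\<Union>u\<in>D. ?gap u p)) \<union> (\<Union>b\<in>BB. Tl b)"
    have ev: "bad_low p \<in> sets M" "(\<Union>u\<in>D. ?gap u p) \<in> sets M" "(\<Union>b\<in>BB. Tl b) \<in> sets M"
      using D(1) BB(1) gap_ev Tl_ev by (measurable, auto intro!: sets.finite_UN)
    have E_ev: "E \<in> sets M" unfolding E_def using ev by auto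
    have "X.prob E \<le> X.prob (bad_low p) + X.prob (\<Union>u\<in>D. ?gap u p) + X.prob (\<Union>b\<in>BB. Tl b)"
      unfolding E_def using measure_Un_le[OF sets.Un[OF ev(1,2)] ev(3)] measure_Un_le[OF ev(1,2)] by linarith
    also have "\<dots> \<le> X.prob (bad_low p) + (\<Sum>u\<in>D. X.prob (?gap u p)) + (\<Sum>b\<in>BB. X.prob (Tl b))"
      using D(1) BB(1) gap_ev Tl_ev by (intro add_mono order_refl measure_UNION_le) auto
    also have "(\<Sum>b\<in>BB. X.prob (Tl b)) \<le> (\<Sum>b\<in>BB. \<integral>\<omega>. cutoff (real n) (support_fun b (lower p \<omega>)) \<partial>M)"
      unfolding Tl_def by (intro sum_mono X.prob_norm_gt_le_cutoff) measurable
    finally have PE: "X.prob E \<le> 2 * q" using elim(1,2) by linarith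
    have close: "\<bar>f (scaled_hull (snd p) \<omega>) - f (lower p \<omega>)\<bar> \<le> \<epsilon> / 4 + 2 * B * indicator E \<omega>" if \<omega>: "\<omega> \<in> space M" for \<omega>
    proof (cases "\<omega> \<in> E")
      case True
      then show ?thesis using B[of "scaled_hull (snd p) \<omega>"] B[of "lower p \<omega>"] \<open>0 < \<epsilon>\<close> by (simp add: abs_le_iff)
    next
      case False
      have sub: "body_set (lower p \<omega>) \<subseteq> body_set (scaled_hull (snd p) \<omega>)"
        using False \<omega> elim(4) unfolding E_def by (intro grid_hull_subset) auto
      have g: "support_fun u (scaled_hull (snd p) \<omega>) \<le> support_fun u (lower p \<omega>) + \<theta>" if "u \<in> D" for u
        using False \<omega> that unfolding E_def by (auto simp: not_less)
      have t: "support_fun b (lower p \<omega>) \<le> real n + 1" if "b \<in> BB" for b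
        using False \<omega> that unfolding E_def Tl_def by (auto simp: not_less abs_le_iff)
      have hb: "support_fun b (scaled_hull (snd p) \<omega>) \<le> real n + 1 + \<theta>" if "b \<in> BB" for b
        using g[of b] t[OF that] that BBD by fastforce
      have nr: "norm x \<le> R" if "x \<in> body_set (scaled_hull (snd p) \<omega>)" for x
        unfolding R_def
      proof (rule norm_le_support[OF _ that])
        fix b :: 'a assume "b \<in> Basis"
        then have "b \<in> BB" "- b \<in> BB" by (auto simp: BB_def)
        then show "support_fun b (scaled_hull (snd p) \<omega>) \<le> real n + 1 + \<theta> \<and> support_fun (- b) (scaled_hull (snd p) \<omega>) \<le> real n + 1 + \<theta>"
          using hb by blast
      qed
      have "dist (lower p \<omega>) (scaled_hull (snd p) \<omega>) \<le> \<theta> + 2 * \<delta> * R"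
        by (rule dist_body_le_support[OF sub less_imp_le[OF \<theta>] D(4) g nr less_imp_le[OF \<delta>]])
      also have "\<dots> = 2 * \<theta>" using R by (simp add: \<delta>_def)
      finally have "L * dist (scaled_hull (snd p) \<omega>) (lower p \<omega>) \<le> L * (2 * \<theta>)"
        using \<open>0 \<le> L\<close> by (intro mult_left_mono) (simp_all add: dist_commute)
      also have "\<dots> \<le> (L + 1) * (2 * \<theta>)" using \<theta> by (intro mult_right_mono) auto
      also have "\<dots> = \<epsilon> / 4" using \<open>0 \<le> L\<close> by (simp add: \<theta>_def field_simps)
      finally show ?thesis using L[of "scaled_hull (snd p) \<omega>" "lower p \<omega>"] False by simp
    qed
    have i1: "integrable M (\<lambda>\<omega>. f (scaled_hull (snd p) \<omega>))" "integrable M (\<lambda>\<omega>. f (lower p \<omega>))"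
      using B by (auto intro!: X.integrable_const_bound[where B = B])
    have i2: "integrable M (indicator E :: _ \<Rightarrow> real)" using E_ev by (simp add: X.emeasure_eq_measure)
    have "\<bar>(\<integral>\<omega>. f (scaled_hull (snd p) \<omega>) \<partial>M) - (\<integral>\<omega>. f (lower p \<omega>) \<partial>M)\<bar>
      = \<bar>\<integral>\<omega>. f (scaled_hull (snd p) \<omega>) - f (lower p \<omega>) \<partial>M\<bar>" using i1 by simp
    also have "\<dots> \<le> (\<integral>\<omega>. \<bar>f (scaled_hull (snd p) \<omega>) - f (lower p \<omega>)\<bar> \<partial>M)" by (rule integral_abs_bound)
    also have "\<dots> \<le> (\<integral>\<omega>. \<epsilon> / 4 + 2 * B * indicator E \<omega> \<partial>M)"
    proof (rule integral_mono)
      show "integrable M (\<lambda>\<omega>. \<bar>f (scaled_hull (snd p) \<omega>) - f (lower p \<omega>)\<bar>)"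
        using i1 by (intro integrable_abs Bochner_Integration.integrable_diff)
      show "integrable M (\<lambda>\<omega>. \<epsilon> / 4 + 2 * B * indicator E \<omega>)"
        using i2 by (intro Bochner_Integration.integrable_add integrable_mult_right) auto
    qed (rule close)
    also have "\<dots> = \<epsilon> / 4 + 2 * B * X.prob E"
      using i2 E_ev by (subst Bochner_Integration.integral_add) (auto simp: X.prob_space)
    also have "2 * B * X.prob E \<le> 2 * B * (2 * q)" using PE B0 by (intro mult_left_mono) auto
    also have "2 * B * (2 * q) \<le> 4 * (B + 1) * q" using q by (simp add: algebra_simps)
    also have "4 * (B + 1) * q = \<epsilon> / 4" using B0 by (simp add: q_def field_simps)
    finally have "\<bar>(\<integral>\<omega>. f (scaled_hull (snd p) \<omega>) \<partial>M) - (\<integral>\<omega>. f (lower p \<omega>) \<partial>M)\<bar> \<le> \<epsilon> / 2" by simp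
    then show ?case using elim(3) unfolding dist_real_def abs_le_iff abs_less_iff by linarith
  qed
qed

lemma scaled_hull_converges:
  "converges_in_distribution (\<lambda>_. M) scaled_hull M' limit_hull at_top"
proof (rule converges_in_distributionI_lipschitz)
  show "\<forall>\<^sub>F t in at_top. prob_space M \<and> scaled_hull t \<in> borel_measurable M"
    using eventually_ge_at_top[of 0] by eventually_elim (simp add: X.prob_space_axioms measurable_hull)
  fix f :: "'a convex_body \<Rightarrow> real" and B L
  assume f: "\<And>K. \<bar>f K\<bar> \<le> B" "\<And>K K'. \<bar>f K - f K'\<bar> \<le> L * dist K K'"
  have "\<bar>f K - f K'\<bar> \<le> max L 0 * dist K K'" for K K'
    using f(2)[of K K'] mult_right_mono[of L "max L 0" "dist K K'"] by simp
  from lipschitz_hull_tendsto[OF f(1) this]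
  have "((\<lambda>p. \<integral>\<omega>. f (scaled_hull (snd p) \<omega>) \<partial>M) \<longlongrightarrow> (\<integral>\<omega>. f (limit_hull \<omega>) \<partial>M')) iter_filter" by simp
  then show "((\<lambda>t. \<integral>\<omega>. f (scaled_hull t \<omega>) \<partial>M) \<longlongrightarrow> (\<integral>\<omega>. f (limit_hull \<omega>) \<partial>M')) at_top"
    by (rule iter_filter_tendsto_snd)
qed (simp_all add: Y.prob_space_axioms measurable_limit_hull)

end

theorem theorem5p2:
  fixes M :: "'w measure" and X :: "real \<Rightarrow> 'w \<Rightarrow> 'a::euclidean_space"
    and N :: "'v measure" and \<eta> :: "'v \<Rightarrow> 'a"
    and M' :: "'u measure" and Y :: "real \<Rightarrow> 'u \<Rightarrow> 'a"
    and \<alpha> :: real and l :: "real \<Rightarrow> real"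
  assumes "levy_process M X"
    and "\<not> (AE \<omega> in M. \<forall>t\<ge>0. X t \<omega> = 0)"
    and "strictly_stable \<alpha> N \<eta>"
    and "slowly_varying l"
    and "converges_in_distribution
           (\<lambda>n. \<Pi>\<^sub>M i\<in>{..<n}. M)
           (\<lambda>n \<omega>. inverse (real n powr (1 / \<alpha>) * l (real n)) *\<^sub>R (\<Sum>i<n. exit_position X (\<omega> i)))
           N \<eta> sequentially"
    and "levy_process M' Y"
    and "distr M' borel (Y 1) = distr N borel \<eta>"
  shows "converges_in_distribution
           (\<lambda>_. M)
           (\<lambda>t \<omega>. scale_body (inverse (t powr (1 / \<alpha>) * l t)) (path_hull X t \<omega>))
           M' (path_hull Y (inverse (mean_exit_time M X))) at_top"
proof -
  interpret hull_limit M X M' Y N \<eta> \<alpha> l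
    using assms by (intro hull_limit.intro hull_limit_axioms.intro)
  show ?thesis
    using scaled_hull_converges unfolding scaled_hull_def[abs_def] limit_hull_def W.norming_def .
qed

end
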